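(* Let $\Omega\subset\mathbb R^n$ be a bounded smooth domain. There exists a positive constant $C$, depending only on $\Omega$, such that for every Steklov eigenvalue $\lambda>0$ of $\Omega$ and every Steklov eigenfunction $u$ of $\Omega$ with eigenvalue $\lambda$, the vanishing order of $u$ on $\partial\Omega$ is everywhere less than $C\lambda$. That is, if $x_0\in\partial\Omega$ and $l\ge0$ is an integer such that all derivatives of order at most $l$ of the function $u|_{\partial\Omega}$ (computed in smooth local coordinates of $\partial\Omega$ near $x_0$) vanish at $x_0$, then $l<C\lambda$.
   Context: A Steklov eigenfunction of $\Omega$ with eigenvalue $\lambda$ is a real-valued function $u$, not identically zero, with $\Delta u=0$ in $\Omega$ and $\frac{\partial u}{\partial\nu}=\lambda u$ on $\partial\Omega$, where $\nu$ is the exterior unit normal to $\partial\Omega$; it is smooth up to the boundary. The eigenvalues form a discrete sequence $0=\lambda_0<\lambda_1\le\lambda_2\le\cdots\to\infty$. Here $n\ge2$. The vanishing order of a function $u$ at $x_0$ is $l$ if $D^\alpha u(x_0)=0$ for all $|\alpha|\le l$ in the Taylor expansion at $x_0$ (with $l$ the largest such integer); on $\partial\Omega$ this is applied to the restriction $u|_{\partial\Omega}$ in local coordinates. *)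

theory Defs
  imports "HOL-Analysis.Analysis"
begin

(* Partial derivatives are iterated along a list of basis vectors; on smooth functions the order
   of the list is immaterial, so lists over Basis of length k stand for the multi-indices alpha
   with |alpha| = k. *)
primrec iter_deriv ::
  "'a::euclidean_space list \<Rightarrow> ('a \<Rightarrow> 'b::real_normed_vector) \<Rightarrow> 'a \<Rightarrow> 'b" where
  "iter_deriv [] f = f"
| "iter_deriv (v # vs) f = (\<lambda>x. frechet_derivative (iter_deriv vs f) (at x) v)"

(* Intended for open S only: the derivatives are two-sided. *)
definition smooth_on ::
  "'a::euclidean_space set \<Rightarrow> ('a \<Rightarrow> 'b::real_normed_vector) \<Rightarrow> bool" where
  "smooth_on S f \<longleftrightarrow> (\<forall>vs\<in>lists Basis. \<forall>x\<in>S. iter_deriv vs f differentiable (at x))"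

(* C^infinity up to the boundary: u is smooth in the open set S, continuous on its closure, and
   every partial derivative has a continuous extension from S to the closure. *)
definition smooth_up_to_boundary ::
  "'a::euclidean_space set \<Rightarrow> ('a \<Rightarrow> 'b::real_normed_vector) \<Rightarrow> bool" where
  "smooth_up_to_boundary S u \<longleftrightarrow> smooth_on S u \<and> continuous_on (closure S) u \<and>
     (\<forall>vs\<in>lists Basis. \<exists>g. continuous_on (closure S) g \<and> (\<forall>x\<in>S. g x = iter_deriv vs u x))"

definition laplacian :: "('a::euclidean_space \<Rightarrow> real) \<Rightarrow> 'a \<Rightarrow> real" where
  "laplacian u x = (\<Sum>b\<in>Basis. iter_deriv [b, b] u x)"

(* Since the gradient of \<rho> has no zero in U, the part of the frontier of \<Omega> in U is the zero set
   of \<rho>, and \<Omega> lies locally on one side of it. *)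
definition local_defining_function ::
  "'a::euclidean_space set \<Rightarrow> 'a set \<Rightarrow> ('a \<Rightarrow> real) \<Rightarrow> bool" where
  "local_defining_function \<Omega> U \<rho> \<longleftrightarrow> open U \<and> smooth_on U \<rho> \<and>
     (\<forall>x\<in>U. \<not> (GDERIV \<rho> x :> 0)) \<and> \<Omega> \<inter> U = {x \<in> U. \<rho> x < 0}"

definition bounded_smooth_domain :: "'a::euclidean_space set \<Rightarrow> bool" where
  "bounded_smooth_domain \<Omega> \<longleftrightarrow> open \<Omega> \<and> connected \<Omega> \<and> \<Omega> \<noteq> {} \<and> bounded \<Omega> \<and>
     (\<forall>x\<in>frontier \<Omega>. \<exists>U \<rho>. x \<in> U \<and> local_defining_function \<Omega> U \<rho>)"

(* The normalized gradient of a defining function that is negative inside \<Omega>; it does not depend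
   on the defining function when x lies on the frontier of \<Omega>. *)
definition exterior_unit_normal :: "'a::euclidean_space set \<Rightarrow> 'a \<Rightarrow> 'a \<Rightarrow> bool" where
  "exterior_unit_normal \<Omega> x \<nu> \<longleftrightarrow>
     (\<exists>U \<rho> g. x \<in> U \<and> local_defining_function \<Omega> U \<rho> \<and> (GDERIV \<rho> x :> g) \<and> \<nu> = g /\<^sub>R norm g)"

(* Only the values of u on the closure of \<Omega> matter. The normal derivative is therefore taken
   from inside: x + t \<nu> lies in \<Omega> for small t < 0. *)
definition steklov_eigenfunction ::
  "'a::euclidean_space set \<Rightarrow> real \<Rightarrow> ('a \<Rightarrow> real) \<Rightarrow> bool" where
  "steklov_eigenfunction \<Omega> \<sigma> u \<longleftrightarrow>
     smooth_up_to_boundary \<Omega> u \<and> (\<exists>x\<in>\<Omega>. u x \<noteq> 0) \<and>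
     (\<forall>x\<in>\<Omega>. laplacian u x = 0) \<and>
     (\<forall>x\<in>frontier \<Omega>. \<exists>\<nu>. exterior_unit_normal \<Omega> x \<nu> \<and>
        ((\<lambda>t. u (x + t *\<^sub>R \<nu>)) has_real_derivative \<sigma> * u x) (at_left 0))"

definition steklov_eigenvalue :: "'a::euclidean_space set \<Rightarrow> real \<Rightarrow> bool" where
  "steklov_eigenvalue \<Omega> \<sigma> \<longleftrightarrow> (\<exists>u. steklov_eigenfunction \<Omega> \<sigma> u)"

(* \<phi> is the inverse of a smooth coordinate chart of the hypersurface M, defined on the relatively
   open subset \<phi> ` W of M. The dimension of M is fixed by the type of the parameters. *)
definition local_parametrization ::
  "'a::euclidean_space set \<Rightarrow> 'b::euclidean_space set \<Rightarrow> ('b \<Rightarrow> 'a) \<Rightarrow> bool" where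
  "local_parametrization M W \<phi> \<longleftrightarrow> open W \<and> smooth_on W \<phi> \<and>
     (\<forall>y\<in>W. inj (frechet_derivative \<phi> (at y))) \<and>
     openin (top_of_set M) (\<phi> ` W) \<and> (\<exists>\<psi>. homeomorphism W (\<phi> ` W) \<phi> \<psi>)"

definition vanishes_to_order :: "nat \<Rightarrow> ('a::euclidean_space \<Rightarrow> real) \<Rightarrow> 'a \<Rightarrow> bool" where
  "vanishes_to_order l f y \<longleftrightarrow> (\<forall>vs\<in>lists Basis. length vs \<le> l \<longrightarrow> iter_deriv vs f y = 0)"

end

theory Submission
  imports Defs
begin

text \<open>
  If \<open>u\<close> vanishes to order \<open>l\<close> along the boundary at \<open>x0\<close>, then so does its normal derivative, by the Steklov condition, and
  harmonicity propagates this to the full jet of \<open>u\<close> at \<open>x0\<close>. It remains to bound the vanishing order from inside the domain.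

  This is done with the Carleman weight \<open>- ln q / 2 + 2 * q powr (1/4)\<close>, where \<open>q\<close> is a squared distance to \<open>x0\<close> corrected so
  that its normal derivative vanishes on the boundary. All boundary terms are treated by one inequality: the divergence of a
  field that does not point outwards has nonpositive integral. It follows by cutting the field off near the boundary, so that
  no surface measure is needed. With a Carleman parameter of order \<open>1 + sigma\<close> the inequality yields a shell estimate at
  \<open>x0\<close>. Chains of interior balls, and a collar estimate with a weight that is constant on the boundary, show that every
  interior annulus carries at least the fraction \<open>exp (- C * (1 + sigma))\<close> of the Dirichlet energy. Both facts together
  give \<open>l \<le> C * (1 + sigma)\<close>, and the summand 1 is absorbed since the positive eigenvalues are bounded away from 0.
\<close>

section \<open>Functions of class \<open>C\<^sup>k\<close>\<close>

text \<open>The final bound is linear in \<open>sig\<close> because a Carleman parameter of the size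
  of \<open>1 + sig\<close> suffices; the Robin condition must therefore cost no more than a lower
  order term. When the normal derivative of the weight vanishes on the boundary, the conjugated
  function inherits the Robin condition of \<open>u\<close>, and the flux of the Carleman field is
  exactly \<open>sig\<close> times the flux of an explicit field \<open>Z\<close>. Every summand in
  the divergence of \<open>Z\<close> keeps an undifferentiated factor \<open>v\<close>, so it is
  absorbed once \<open>tau\<close> dominates \<open>sig\<close>. A weight that separates the
  boundary from the interior cannot have this property, which is why the collar requires a different
  cancellation. A second obstacle is regularity. A harmonic function enters through a continuous
  extension of its gradient to the closure, so the divergence of a field quadratic in the gradient
  might fail to be integrable. The divergence inequality therefore works with an integrable
  minorant. All constants are fixed before \<open>u\<close> and \<open>sig\<close>. The order
  \<open>l\<close> enters through \<open>tau = l - 1/2\<close>, for which the contribution of a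
  shell around \<open>x0\<close> disappears as the shell shrinks.\<close>

abbreviation (input) fd :: "('a::real_normed_vector \<Rightarrow> 'b::real_normed_vector) \<Rightarrow> 'a \<Rightarrow> 'a \<Rightarrow> 'b" where
  "fd f x \<equiv> frechet_derivative f (at x)"

text \<open>Smoothness is counted, since the cutoffs and the global defining function built below
  have finitely many derivatives. From level 1 on the derivatives are two-sided, so \<open>S\<close>
  is meant to be open or a subset of an open set.\<close>

primrec ck :: "nat \<Rightarrow> 'a::euclidean_space set \<Rightarrow> ('a \<Rightarrow> 'b::real_normed_vector) \<Rightarrow> bool" where
  "ck 0 S f \<longleftrightarrow> continuous_on S f"
| "ck (Suc k) S f \<longleftrightarrow> (\<forall>x\<in>S. f differentiable (at x)) \<and> (\<forall>b\<in>Basis. ck k S (\<lambda>x. fd f x b))"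

lemma fd_eqI: "(f has_derivative D) (at x) ==> fd f x = D"
  by (metis frechet_derivative_at)

lemma differentiable_fd: "f differentiable (at x) ==> (f has_derivative fd f x) (at x)"
  using frechet_derivative_works by blast

lemma fd_cong_open:
  assumes "open S" "x \<in> S" "\<And>y. y \<in> S ==> f y = g y"
  shows "fd f x = fd g x"
  unfolding frechet_derivative_def
  by (metis (mono_tags, opaque_lifting) assms has_derivative_transform_within_open)

lemma differentiable_cong_open:
  assumes "open S" "x \<in> S" "\<And>y. y \<in> S ==> f y = g y" "f differentiable (at x)"
  shows "g differentiable (at x)"
  using assms unfolding differentiable_def
  by (metis has_derivative_transform_within_open)

lemma ck_cong:
  assumes "open S" "\<And>y. y \<in> S ==> f y = g y" "ck k S f"
  shows "ck k S g"
  using assms(2,3)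
proof (induction k arbitrary: f g)
  case 0
  then show ?case by (auto intro: continuous_on_eq)
next
  case (Suc k)
  have "ck k S (\<lambda>x. fd g x b)" if "b \<in> Basis" for b
    by (rule Suc.IH[of "\<lambda>x. fd f x b"])
       (use Suc.prems that fd_cong_open[OF assms(1)] in \<open>auto, metis\<close>)
  moreover have "g differentiable (at x)" if "x \<in> S" for x
    using differentiable_cong_open[OF assms(1) that, of f g] Suc.prems that by auto
  ultimately show ?case by simp
qed

lemma ck_subset: "ck k S f ==> T \<subseteq> S ==> ck k T f"
  by (induction k arbitrary: f) (auto intro: continuous_on_subset)

lemma ck_Suc_imp: "ck (Suc k) S f ==> ck k S f"
proof (induction k arbitrary: f)
  case 0
  then show ?case
    by (auto intro!: continuous_at_imp_continuous_on differentiable_imp_continuous_within)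
next
  case (Suc k)
  then show ?case by (metis ck.simps(2))
qed

lemma ck_mono: "ck k S f ==> j \<le> k ==> ck j S f"
proof (induction k)
  case 0 then show ?case by simp
next
  case (Suc k) then show ?case by (metis ck_Suc_imp le_Suc_eq)
qed

lemma ck_cont: "ck k S f ==> continuous_on S f"
  using ck_mono[of k S f 0] by simp

lemma ck_diff: "ck (Suc k) S f ==> x \<in> S ==> (f has_derivative fd f x) (at x)"
  using differentiable_fd by auto

lemma ck_local:
  assumes "\<And>x. x \<in> S ==> \<exists>T. open T \<and> x \<in> T \<and> ck k T f"
  shows "ck k S f"
  using assms
proof (induction k arbitrary: f)
  case 0
  show ?case unfolding ck.simps
  proof (rule continuous_at_imp_continuous_on, safe)
    fix x assume "x \<in> S"
    then obtain T where "open T" "x \<in> T" "continuous_on T f" using 0 by auto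
    then show "isCont f x" using continuous_on_eq_continuous_at by blast
  qed
next
  case (Suc k)
  have "f differentiable (at x)" if "x \<in> S" for x using Suc.prems[OF that] by auto
  moreover have "ck k S (\<lambda>x. fd f x b)" if "b \<in> Basis" for b
    by (rule Suc.IH) (use Suc.prems that in force)
  ultimately show ?case by simp
qed

lemma ck_const [simp, intro]: "ck k S (\<lambda>x. c)"
  by (induction k arbitrary: c) (auto simp: frechet_derivative_const)


lemma ck_Suc_openI:
  assumes "open S" "\<And>x. x \<in> S ==> (f has_derivative D x) (at x)"
    "\<And>b. b \<in> Basis ==> ck k S (\<lambda>x. D x b)"
  shows "ck (Suc k) S f"
proof -
  have "ck k S (\<lambda>x. fd f x b)" if "b \<in> Basis" for b
    by (rule ck_cong[OF assms(1) _ assms(3)[OF that]]) (simp add: fd_eqI[OF assms(2)])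
  then show ?thesis using assms(2) by (auto simp: differentiable_def)
qed

lemma ck_bounded_linear:
  assumes "open S" "bounded_linear L" "ck k S f"
  shows "ck k S (\<lambda>x. L (f x))"
  using assms(3)
proof (induction k arbitrary: f)
  case 0 then show ?case
    using bounded_linear.continuous_on[OF assms(2)] by auto
next
  case (Suc k)
  show ?case
    by (rule ck_Suc_openI[OF assms(1) bounded_linear.has_derivative[OF assms(2) ck_diff[OF Suc.prems]]])
       (use Suc in auto)
qed

lemma ck_add:
  assumes "open S" "ck k S f" "ck k S g"
  shows "ck k S (\<lambda>x. f x + g x)"
  using assms(2,3)
proof (induction k arbitrary: f g)
  case 0 then show ?case by (auto intro: continuous_intros)
next
  case (Suc k)
  show ?case
    by (rule ck_Suc_openI[OF assms(1) has_derivative_add[OF ck_diff[OF Suc.prems(1)] ck_diff[OF Suc.prems(2)]]])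
       (use Suc in auto)
qed

lemma ck_bilinear:
  assumes "open S" "bounded_bilinear B" "ck k S f" "ck k S g"
  shows "ck k S (\<lambda>x. B (f x) (g x))"
  using assms(3,4)
proof (induction k arbitrary: f g)
  case 0 then show ?case using bounded_bilinear.continuous_on[OF assms(2)] by auto
next
  case (Suc k)
  show ?case
  proof (rule ck_Suc_openI[OF assms(1) bounded_bilinear.FDERIV[OF assms(2) ck_diff[OF Suc.prems(1)] ck_diff[OF Suc.prems(2)]]])
    fix b :: 'a assume "b \<in> Basis"
    then show "ck k S (\<lambda>x. B (f x) (fd g x b) + B (fd f x b) (g x))"
      by (intro ck_add[OF assms(1)] Suc.IH ck_Suc_imp[OF Suc.prems(1)] ck_Suc_imp[OF Suc.prems(2)])
         (use Suc.prems in auto)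
  qed
qed

lemma ck_minus: "open S ==> ck k S f ==> ck k S (\<lambda>x. - f x)"
  by (rule ck_bounded_linear[where L="\<lambda>x. - x"]) (auto intro: bounded_linear_minus bounded_linear_ident)

lemma ck_diff': "open S ==> ck k S f ==> ck k S g ==> ck k S (\<lambda>x. f x - g x)"
  using ck_add[of S k f "\<lambda>x. - g x"] ck_minus by auto

lemma ck_mult:
  fixes f g :: "'a::euclidean_space \<Rightarrow> real"
  shows "open S ==> ck k S f ==> ck k S g ==> ck k S (\<lambda>x. f x * g x)"
  by (rule ck_bilinear[OF _ bounded_bilinear_mult])

lemma ck_scaleR: "open S ==> ck k S f ==> ck k S g ==> ck k S (\<lambda>x. f x *\<^sub>R g x)"
  by (rule ck_bilinear[OF _ bounded_bilinear_scaleR])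

lemma ck_inner: "open S ==> ck k S f ==> ck k S g ==> ck k S (\<lambda>x. f x \<bullet> g x)"
  by (rule ck_bilinear[OF _ bounded_bilinear_inner])

lemma ck_power:
  fixes f :: "'a::euclidean_space \<Rightarrow> real"
  shows "open S ==> ck k S f ==> ck k S (\<lambda>x. f x ^ m)"
  by (induction m) (auto intro: ck_mult)

lemma ck_sum: "open S ==> (\<And>i. i \<in> I ==> ck k S (f i)) ==> ck k S (\<lambda>x. \<Sum>i\<in>I. f i x)"
  by (induction I rule: infinite_finite_induct) (auto intro: ck_add)

lemma ck_ident: "open S ==> ck k S (\<lambda>x. x)"
proof (cases k)
  case 0 then show ?thesis by simp
next
  case (Suc j)
  assume "open S"
  then show ?thesis unfolding Suc by (rule ck_Suc_openI[where D="\<lambda>x h. h"]) auto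
qed

text \<open>The outer function comes with the sequence \<open>H\<close> of its successive
  derivatives; the induction passes to the shifted sequence.\<close>

lemma ck_compose_real:
  fixes f :: "'a::euclidean_space \<Rightarrow> real" and H :: "nat \<Rightarrow> real \<Rightarrow> real"
  assumes "open S"
    and "\<And>i s. i < k ==> s \<in> T ==> (H i has_real_derivative H (Suc i) s) (at s)"
    and "continuous_on T (H k)" and "ck k S f" and "f ` S \<subseteq> T"
  shows "ck k S (\<lambda>x. H 0 (f x))"
  using assms(2-5)
proof (induction k arbitrary: H)
  case 0 then show ?case
    using continuous_on_compose2 by (fastforce simp del: o_apply)
next
  case (Suc k)
  have d: "((\<lambda>x. H 0 (f x)) has_derivative (\<lambda>h. fd f x h * H 1 (f x))) (at x)" if "x \<in> S" for x
  proof -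
    have "(H 0 has_real_derivative H 1 (f x)) (at (f x))" using Suc.prems(1)[of 0] Suc.prems(4) that by auto
    from DERIV_compose_FDERIV[OF this ck_diff[OF Suc.prems(3) that]] show ?thesis .
  qed
  show ?case
  proof (rule ck_Suc_openI[OF assms(1) d], assumption)
    fix b :: 'a assume b: "b \<in> Basis"
    have "ck k S (\<lambda>x. H (Suc 0) (f x))"
      by (rule Suc.IH[of "\<lambda>i. H (Suc i)", OF Suc.prems(1) Suc.prems(2) ck_Suc_imp[OF Suc.prems(3)] Suc.prems(4)]) simp_all
    then show "ck k S (\<lambda>x. fd f x b * H 1 (f x))" using Suc.prems(3) b by (auto intro!: ck_mult[OF assms(1)])
  qed
qed

lemma linear_Basis_sum:
  fixes L :: "'a::euclidean_space \<Rightarrow> 'b::real_vector"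
  assumes "linear L" shows "L v = (\<Sum>b\<in>Basis. (v \<bullet> b) *\<^sub>R L b)"
  by (subst euclidean_representation[symmetric, of v], simp only: linear_sum[OF assms] linear_scale[OF assms])

lemma fd_linear: "f differentiable (at x) ==> linear (fd f x)"
  by (rule linear_frechet_derivative)

lemma fd_Basis_sum:
  fixes f :: "'a::euclidean_space \<Rightarrow> 'b::real_normed_vector"
  shows "f differentiable (at x) ==> fd f x v = (\<Sum>b\<in>Basis. (v \<bullet> b) *\<^sub>R fd f x b)"
  by (rule linear_Basis_sum[OF fd_linear])

lemma ck_dir:
  assumes "open S" "ck (Suc k) S f" "ck k S Y"
  shows "ck k S (\<lambda>x. fd f x (Y x))"
proof -
  have "ck k S (\<lambda>x. \<Sum>b\<in>Basis. (Y x \<bullet> b) *\<^sub>R fd f x b)"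
    using assms by (auto intro!: ck_sum ck_scaleR ck_inner)
  then show ?thesis
    by (rule ck_cong[OF assms(1), rotated]) (rule fd_Basis_sum[symmetric], use assms(2) in auto)
qed

lemma ck_compose:
  fixes g :: "'b::euclidean_space \<Rightarrow> 'c::real_normed_vector" and phi :: "'a::euclidean_space \<Rightarrow> 'b"
  assumes "open S" "open T" "ck k T g" "ck k S phi" "phi ` S \<subseteq> T"
  shows "ck k S (\<lambda>x. g (phi x))"
  using assms(3,4)
proof (induction k arbitrary: g)
  case 0 then show ?case using assms(5) continuous_on_compose2 by (fastforce simp del: o_apply)
next
  case (Suc k)
  have d: "((\<lambda>x. g (phi x)) has_derivative (\<lambda>h. fd g (phi x) (fd phi x h))) (at x)" if "x \<in> S" for x
    using has_derivative_compose[OF ck_diff[OF Suc.prems(2) that] ck_diff[OF Suc.prems(1)]] assms(5) that by blast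
  show ?case
  proof (rule ck_Suc_openI[OF assms(1) d], assumption)
    fix b :: 'a assume b: "b \<in> Basis"
    have "ck k S (\<lambda>x. \<Sum>e\<in>Basis. (fd phi x b \<bullet> e) *\<^sub>R fd g (phi x) e)"
      using Suc b ck_Suc_imp[OF Suc.prems(2)]
      by (auto intro!: ck_sum ck_scaleR ck_inner assms(1))
    then show "ck k S (\<lambda>x. fd g (phi x) (fd phi x b))"
      by (rule ck_cong[OF assms(1), rotated])
        (rule fd_Basis_sum[symmetric], use assms(5) Suc.prems(1) in auto)
  qed
qed

definition gr :: "('a::euclidean_space \<Rightarrow> real) \<Rightarrow> 'a \<Rightarrow> 'a" where
  "gr f x = (\<Sum>b\<in>Basis. fd f x b *\<^sub>R b)"

lemma gr_inner: "f differentiable (at x) ==> gr f x \<bullet> h = fd f x h"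
  unfolding gr_def by (simp add: fd_Basis_sum[of f x h] inner_sum_left inner_sum_right inner_commute mult.commute)

lemma gr_deriv: "f differentiable (at x) ==> (f has_derivative (\<lambda>h. gr f x \<bullet> h)) (at x)"
  using differentiable_fd gr_inner by (metis (no_types, lifting) ext)

lemma gr_eqI: "(f has_derivative (\<lambda>h. g \<bullet> h)) (at x) ==> gr f x = g"
  unfolding gr_def by (simp add: fd_eqI euclidean_representation)

lemma ck_gr: "open S ==> ck (Suc k) S f ==> ck k S (gr f)"
  unfolding gr_def by (auto intro!: ck_sum ck_scaleR)

text \<open>Both orders of differentiation compute the same second difference, by the mean value theorem applied twice.\<close>

lemma second_difference:
  fixes f :: "'a::euclidean_space \<Rightarrow> real"
  assumes S: "ck 2 S f" and ball: "\<And>s t. 0 \<le> s ==> s \<le> h ==> 0 \<le> t ==> t \<le> h ==> x + s *\<^sub>R a + t *\<^sub>R b \<in> S"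
    and op: "open S" and h: "h > 0"
  shows "\<exists>s t. 0 < s \<and> s < h \<and> 0 < t \<and> t < h \<and>
     f (x + h *\<^sub>R a + h *\<^sub>R b) - f (x + h *\<^sub>R a) - f (x + h *\<^sub>R b) + f x
       = h * h * fd (\<lambda>y. fd f y a) (x + s *\<^sub>R a + t *\<^sub>R b) b"
proof -
  have S2: "ck (Suc (Suc 0)) S f" using S by (simp add: numeral_2_eq_2)
  have S1: "ck (Suc 0) S (\<lambda>y. fd f y a)" by (rule ck_dir[OF op S2]) simp
  define phi where "phi s = f (x + s *\<^sub>R a + h *\<^sub>R b) - f (x + s *\<^sub>R a)" for s
  have d: "(phi has_real_derivative fd f (x + s *\<^sub>R a + h *\<^sub>R b) a - fd f (x + s *\<^sub>R a) a) (at s)"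
    if "0 \<le> s" "s \<le> h" for s
  proof -
    have 1: "((\<lambda>s. f (x + s *\<^sub>R a + h *\<^sub>R b)) has_derivative (\<lambda>t. fd f (x + s *\<^sub>R a + h *\<^sub>R b) (t *\<^sub>R a))) (at s)"
      by (rule has_derivative_compose[where g=f])
         (auto intro!: derivative_eq_intros ck_diff[OF S2] ball that simp: h less_imp_le)
    have 2: "((\<lambda>s. f (x + s *\<^sub>R a)) has_derivative (\<lambda>t. fd f (x + s *\<^sub>R a) (t *\<^sub>R a))) (at s)"
      by (rule has_derivative_compose[where g=f])
         (use ball[OF that, of 0] h in \<open>auto intro!: derivative_eq_intros ck_diff[OF S2]\<close>)
    have dd: "f differentiable (at (x + s *\<^sub>R a + h *\<^sub>R b))" "f differentiable (at (x + s *\<^sub>R a))"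
      using S2 ball[OF that, of h] ball[OF that, of 0] h by auto
    have "(phi has_derivative (\<lambda>t. t * (fd f (x + s *\<^sub>R a + h *\<^sub>R b) a - fd f (x + s *\<^sub>R a) a))) (at s)"
      using has_derivative_diff[OF 1 2]
      by (simp only: phi_def[abs_def] linear_scale[OF fd_linear[OF dd(1)]] linear_scale[OF fd_linear[OF dd(2)]]
         real_scaleR_def right_diff_distrib)
    then show ?thesis by (simp add: has_field_derivative_def mult_commute_abs)
  qed
  obtain s where s: "0 < s" "s < h" "phi h - phi 0 = (h - 0) * (fd f (x + s *\<^sub>R a + h *\<^sub>R b) a - fd f (x + s *\<^sub>R a) a)"
    using MVT2[OF h, of phi "\<lambda>s. fd f (x + s *\<^sub>R a + h *\<^sub>R b) a - fd f (x + s *\<^sub>R a) a"] d by blast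
  define eta where "eta t = fd f (x + s *\<^sub>R a + t *\<^sub>R b) a" for t
  have e: "(eta has_real_derivative fd (\<lambda>y. fd f y a) (x + s *\<^sub>R a + t *\<^sub>R b) b) (at t)" if "0 \<le> t" "t \<le> h" for t
  proof -
    have m: "x + s *\<^sub>R a + t *\<^sub>R b \<in> S" using ball s that by auto
    have 1: "(eta has_derivative (\<lambda>r. fd (\<lambda>y. fd f y a) (x + s *\<^sub>R a + t *\<^sub>R b) (r *\<^sub>R b))) (at t)"
      unfolding eta_def
      by (rule has_derivative_compose[where g="\<lambda>y. fd f y a"])
         (auto intro!: derivative_eq_intros ck_diff[OF S1] m)
    have "(\<lambda>y. fd f y a) differentiable (at (x + s *\<^sub>R a + t *\<^sub>R b))" using S1 m by auto
    then show ?thesis using 1 by (simp add: has_field_derivative_def linear_scale[OF fd_linear] mult_commute_abs)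
  qed
  obtain t where t: "0 < t" "t < h" "eta h - eta 0 = (h - 0) * fd (\<lambda>y. fd f y a) (x + s *\<^sub>R a + t *\<^sub>R b) b"
    using MVT2[OF h, of eta "\<lambda>t. fd (\<lambda>y. fd f y a) (x + s *\<^sub>R a + t *\<^sub>R b) b"] e by blast
  show ?thesis
    by (rule exI[of _ s], rule exI[of _ t]) (use s t in \<open>auto simp: phi_def eta_def algebra_simps\<close>)
qed

text \<open>If the two mixed derivatives differed by \<open>2 * e\<close>, each would stay within
  \<open>e\<close> of its value at \<open>x\<close> on a small parallelogram. But one and the same
  second difference is, up to \<open>h * h\<close>, a value of both.\<close>

lemma fd_commute:
  fixes f :: "'a::euclidean_space \<Rightarrow> real"
  assumes op: "open S" and S: "ck 2 S f" and x: "x \<in> S"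
  shows "fd (\<lambda>y. fd f y a) x b = fd (\<lambda>y. fd f y b) x a"
proof (rule ccontr)
  have S2: "ck (Suc (Suc 0)) S f" using S by (simp add: numeral_2_eq_2)
  define F where "F a b y = fd (\<lambda>y. fd f y a) y b" for a b y
  define e where "e = \<bar>F a b x - F b a x\<bar> / 2"
  assume "fd (\<lambda>y. fd f y a) x b \<noteq> fd (\<lambda>y. fd f y b) x a"
  then have e: "e > 0" by (simp add: e_def F_def)
  have c: "(F a b \<longlongrightarrow> F a b x) (nhds x)" for a b
  proof -
    have "ck (Suc 0) S (\<lambda>y. fd f y a)" by (rule ck_dir[OF op S2]) simp
    then have "continuous_on S (F a b)" using ck_dir[OF op, of 0 "\<lambda>y. fd f y a" "\<lambda>_. b"] by (simp add: F_def[abs_def])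
    then show ?thesis using op x by (simp add: continuous_on_eq_continuous_at continuous_at tendsto_nhds_iff)
  qed
  have "\<forall>\<^sub>F y in nhds x. y \<in> S \<and> dist (F a b y) (F a b x) < e \<and> dist (F b a y) (F b a x) < e"
    by (intro eventually_conj eventually_nhds_in_open op x tendstoD[OF c] e)
  then obtain d where d: "d > 0" "\<And>y. dist y x < d ==> y \<in> S \<and> dist (F a b y) (F a b x) < e \<and> dist (F b a y) (F b a x) < e"
    unfolding eventually_nhds_metric by blast
  define M where "M = norm a + norm b + 1"
  have M: "M > 0" by (simp add: M_def add_pos_nonneg add_nonneg_pos)
  define h where "h = d / M"
  have h: "h > 0" using d M by (simp add: h_def)
  have near: "dist (x + s *\<^sub>R a + t *\<^sub>R b) x < d" if "0 \<le> s" "s \<le> h" "0 \<le> t" "t \<le> h" for s t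
  proof -
    have "dist (x + s *\<^sub>R a + t *\<^sub>R b) x \<le> s * norm a + t * norm b"
      using norm_triangle_ineq[of "s *\<^sub>R a" "t *\<^sub>R b"] that by (simp add: dist_norm add.assoc)
    also have "... \<le> h * norm a + h * norm b" using that by (intro add_mono mult_right_mono) auto
    also have "... < h * M" using h by (simp add: M_def algebra_simps)
    finally show ?thesis using M by (simp add: h_def)
  qed
  have near': "dist (x + s *\<^sub>R b + t *\<^sub>R a) x < d" if "0 \<le> s" "s \<le> h" "0 \<le> t" "t \<le> h" for s t
    using near[of t s] that by (simp add: add_ac)
  have "\<exists>s t. 0 < s \<and> s < h \<and> 0 < t \<and> t < h \<and> f (x + h *\<^sub>R a + h *\<^sub>R b) - f (x + h *\<^sub>R a) - f (x + h *\<^sub>R b) + f x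
       = h * h * fd (\<lambda>y. fd f y a) (x + s *\<^sub>R a + t *\<^sub>R b) b"
    by (rule second_difference[OF S _ op h]) (use d(2) near in blast)
  then obtain p where p: "dist p x < d" "f (x + h *\<^sub>R a + h *\<^sub>R b) - f (x + h *\<^sub>R a) - f (x + h *\<^sub>R b) + f x = h * h * F a b p"
    unfolding F_def using near by (meson less_imp_le)
  have "\<exists>s t. 0 < s \<and> s < h \<and> 0 < t \<and> t < h \<and> f (x + h *\<^sub>R b + h *\<^sub>R a) - f (x + h *\<^sub>R b) - f (x + h *\<^sub>R a) + f x
       = h * h * fd (\<lambda>y. fd f y b) (x + s *\<^sub>R b + t *\<^sub>R a) a"
    by (rule second_difference[OF S _ op h]) (use d(2) near' in blast)
  then obtain q where q: "dist q x < d" "f (x + h *\<^sub>R b + h *\<^sub>R a) - f (x + h *\<^sub>R b) - f (x + h *\<^sub>R a) + f x = h * h * F b a q"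
    unfolding F_def using near' by (meson less_imp_le)
  have "x + h *\<^sub>R b + h *\<^sub>R a = x + h *\<^sub>R a + h *\<^sub>R b" by (simp add: add_ac)
  from q(2)[unfolded this] have "h * h * F a b p = h * h * F b a q" using p(2) by linarith
  then have "F a b p = F b a q" using h by simp
  then show False using d(2)[OF p(1)] d(2)[OF q(1)] unfolding e_def dist_real_def by argo
qed

section \<open>A twice continuously differentiable step function\<close>

definition pos2 :: "real \<Rightarrow> real" where "pos2 s = (max 0 s)^2"

lemma pos2_deriv: "(pos2 has_real_derivative 2 * max 0 s) (at s)"
  unfolding has_field_derivative_def
proof (rule has_derivativeI_sandwich[where e=1 and H="\<lambda>y. \<bar>y - s\<bar>"])
  fix y :: real assume "y \<noteq> s"
  have "\<bar>(max 0 y)^2 - (max 0 s)^2 - 2 * max 0 s * (y - s)\<bar> \<le> (y - s)^2"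
  proof -
    have sq: "(y - s)^2 = y^2 - 2 * (s * y) + s^2" by (simp add: power2_eq_square algebra_simps)
    have nn: "0 \<le> (y - s)^2" "0 \<le> y^2" "0 \<le> s^2" by simp_all
    have xy: "2 * s * (y - s) = 2 * (s * y) - 2 * s^2" by (simp add: power2_eq_square algebra_simps)
    show ?thesis
    proof (cases "0 \<le> s")
      case True
      moreover have "\<bar>s^2 - 2 * (s * y)\<bar> \<le> y^2 - 2 * (s * y) + s^2" if "\<not> 0 \<le> y"
        using nn mult_nonneg_nonpos[of s y] True that by arith
      ultimately show ?thesis unfolding max_def using nn xy unfolding sq by (cases "0 \<le> y") auto
    next
      case False
      moreover have "2 * (s * y) \<le> s^2" if "0 \<le> y" using nn mult_nonpos_nonneg[of s y] False that by arith
      ultimately show ?thesis unfolding max_def using nn unfolding sq by (cases "0 \<le> y") auto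
    qed
  qed
  then show "norm (pos2 y - pos2 s - 2 * max 0 s * (y - s)) / norm (y - s) \<le> \<bar>y - s\<bar>"
    using \<open>y \<noteq> s\<close> by (simp add: pos2_def pos_divide_le_eq power2_eq_square)
next
  show "((\<lambda>y. \<bar>y - s\<bar>) \<longlongrightarrow> 0) (at s within UNIV)" by (rule tendsto_eq_intros refl | simp)+
qed (simp_all add: bounded_linear_mult_right)

text \<open>The quintic \<open>10 * m^3 - 15 * m^4 + 6 * m^5\<close> in \<open>m = s - 1\<close>,
  which rises from 0 at \<open>s = 1\<close> to 1 at \<open>s = 2\<close>. Truncated powers glue it
  to the constants: for \<open>s > 2\<close> the second term removes the excess of the quintic over
  1.\<close>

definition step :: "real \<Rightarrow> real" where
  "step s = (10 * (s - 1) - 15 * (s - 1)^2 + 6 * (s - 1)^3) * pos2 (s - 1)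
     - (10 * (s - 2) + 15 * (s - 2)^2 + 6 * (s - 2)^3) * pos2 (s - 2)"
definition step' :: "real \<Rightarrow> real" where
  "step' s = 30 * ((s - 2)^2 * pos2 (s - 1) - (s - 1)^2 * pos2 (s - 2))"
definition step'' :: "real \<Rightarrow> real" where
  "step'' s = 60 * ((s - 2) * pos2 (s - 1) + (s - 2)^2 * max 0 (s - 1) - (s - 1) * pos2 (s - 2) - (s - 1)^2 * max 0 (s - 2))"

lemma pos2_shift: "((\<lambda>s. pos2 (s - c)) has_real_derivative 2 * max 0 (s - c)) (at s)"
  using DERIV_chain2[OF pos2_deriv, of "\<lambda>s. s - c" 1 s] by (simp add: DERIV_diff[where E=0, simplified])

lemma pos2_max: "s * max 0 s = pos2 s" by (simp add: pos2_def max_def power2_eq_square)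

lemma step_deriv: "(step has_real_derivative step' s) (at s)"
proof -
  have "(step has_real_derivative
     (10 - 30 * (s - 1) + 18 * (s - 1)^2) * pos2 (s - 1) + (20 - 30 * (s - 1) + 12 * (s - 1)^2) * ((s - 1) * max 0 (s - 1))
     - (10 + 30 * (s - 2) + 18 * (s - 2)^2) * pos2 (s - 2) - (20 + 30 * (s - 2) + 12 * (s - 2)^2) * ((s - 2) * max 0 (s - 2))) (at s)"
    unfolding step_def[abs_def]
    by (rule derivative_eq_intros pos2_shift refl)+ (simp add: eval_nat_numeral algebra_simps)
  then show ?thesis unfolding pos2_max step'_def by (simp add: power2_eq_square algebra_simps)
qed

lemma step'_deriv: "(step' has_real_derivative step'' s) (at s)"
  unfolding step'_def[abs_def] step''_def
  by (rule derivative_eq_intros pos2_shift refl)+ (simp add: power2_eq_square algebra_simps)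

lemma step''_cont: "continuous_on UNIV step''"
  unfolding step''_def[abs_def] pos2_def by (intro continuous_intros)

lemma step_low: "s \<le> 1 ==> step s = 0 \<and> step' s = 0 \<and> step'' s = 0"
  by (simp add: step_def step'_def step''_def pos2_def)

lemma step_high: "s \<ge> 2 ==> step s = 1 \<and> step' s = 0 \<and> step'' s = 0"
  by (simp add: step_def step'_def step''_def pos2_def eval_nat_numeral algebra_simps)

lemma step_range: "0 \<le> step s" "step s \<le> 1" "0 \<le> step' s" "\<bar>step' s\<bar> \<le> 60" "\<bar>step'' s\<bar> \<le> 60"
proof -
  define m where "m = s - 1"
  have "0 \<le> step s \<and> step s \<le> 1 \<and> 0 \<le> step' s \<and> \<bar>step' s\<bar> \<le> 60 \<and> \<bar>step'' s\<bar> \<le> 60"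
  proof (cases "1 < s \<and> s < 2")
    case True
    then have m: "0 \<le> m" "0 \<le> 1 - m" "\<bar>1 - 2 * m\<bar> \<le> 1" "m * (1 - m) \<le> 1"
      using mult_mono[of m 1 "1 - m" 1] by (auto simp: m_def)
    \<comment> \<open>Completing the square in the quadratic factors of \<open>step\<close> and of
      \<open>1 - step\<close> exhibits both as nonnegative.\<close>
    have s: "step s = m^3 * (6 * (m - 5/4)^2 + 5/8)" "1 - step s = (1 - m)^3 * (6 * (m + 1/4)^2 + 5/8)"
      "step' s = 30 * (m * (1 - m))^2" "step'' s = 60 * (m * (1 - m) * (1 - 2 * m))"
      using True by (simp_all add: step_def step'_def step''_def pos2_def m_def eval_nat_numeral algebra_simps)
    have "\<bar>m * (1 - m)\<bar> * \<bar>1 - 2 * m\<bar> \<le> 1 * 1" "(m * (1 - m))^2 \<le> 1"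
      using m by (intro mult_mono power_le_one; simp)+
    moreover have "0 \<le> step s" unfolding s(1) using m by simp
    moreover have "0 \<le> 1 - step s" unfolding s(2) using m by simp
    ultimately show ?thesis using s(3,4) by (simp add: abs_mult)
  qed (use step_low[of s] step_high[of s] in auto)
  then show "0 \<le> step s" "step s \<le> 1" "0 \<le> step' s" "\<bar>step' s\<bar> \<le> 60" "\<bar>step'' s\<bar> \<le> 60" by auto
qed

section \<open>Integrals of compactly supported divergences\<close>

lemma lborel_integral_affine:
  fixes g :: "'a::euclidean_space \<Rightarrow> real"
  assumes "g \<in> borel_measurable borel" "R > 0"
  shows "integral\<^sup>L lborel g = R ^ DIM('a) * integral\<^sup>L lborel (\<lambda>x. g (z + R *\<^sub>R x))"
    and "integrable lborel g ==> integrable lborel (\<lambda>x. g (z + R *\<^sub>R x))"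
proof -
  have l: "lborel = density (distr lborel borel (\<lambda>x. z + R *\<^sub>R x)) (\<lambda>_. ennreal (R ^ DIM('a)))"
    using lborel_affine[of R z] assms(2) by simp
  show "integral\<^sup>L lborel g = R ^ DIM('a) * integral\<^sup>L lborel (\<lambda>x. g (z + R *\<^sub>R x))"
    by (subst l) (use assms in \<open>simp add: integral_density integral_distr\<close>)
  show "integrable lborel (\<lambda>x. g (z + R *\<^sub>R x))" if "integrable lborel g"
    using that assms by (subst (asm) l) (simp add: integrable_density integrable_distr_eq)
qed

lemma integrable_cont_compact_support:
  fixes g :: "'a::euclidean_space \<Rightarrow> real"
  assumes "continuous_on UNIV g" "compact K" "\<And>x. x \<notin> K ==> g x = 0"
  shows "integrable lborel g"
proof -
  have "integrable lborel (\<lambda>x. indicator K x *\<^sub>R g x)"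
    by (rule borel_integrable_compact) (use assms in \<open>auto intro: continuous_on_subset\<close>)
  moreover have "(\<lambda>x. indicator K x *\<^sub>R g x) = g" using assms(3) by (auto simp: fun_eq_iff indicator_def)
  ultimately show ?thesis by simp
qed

text \<open>Translation invariance of Lebesgue measure, differentiated.\<close>

lemma integral_fd_zero:
  fixes g :: "'a::euclidean_space \<Rightarrow> real"
  assumes g: "ck 1 UNIV g" and K: "compact K" and z: "\<And>x. x \<notin> K ==> g x = 0" and b: "b \<in> Basis"
  shows "integrable lborel (\<lambda>x. fd g x b)" "integral\<^sup>L lborel (\<lambda>x. fd g x b) = 0"
proof -
  have c: "continuous_on UNIV (\<lambda>x. fd g x b)" using g b by (simp)
  have dg: "(g has_derivative fd g x) (at x)" for x using ck_diff[of 0 UNIV g x] g by simp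
  have gc: "continuous_on UNIV g" using ck_cont[OF g] .
  have zd: "fd g x b = 0" if "x \<notin> K" for x
  proof -
    have "fd g x = fd (\<lambda>x. 0) x"
      by (rule fd_cong_open[of "-K"]) (use K compact_imp_closed that z in auto)
    then show ?thesis by (simp add: frechet_derivative_const)
  qed
  show "integrable lborel (\<lambda>x. fd g x b)" by (rule integrable_cont_compact_support[OF c K zd])
  obtain R where R: "R > 0" "K \<subseteq> cball 0 R"
    using compact_imp_bounded[OF K] unfolding bounded_pos by (auto simp: subset_eq)
  have "bounded ((\<lambda>x. fd g x b) ` K)"
    by (intro compact_imp_bounded compact_continuous_image K continuous_on_subset[OF c]) auto
  then obtain M where M: "\<And>x. x \<in> K ==> \<bar>fd g x b\<bar> \<le> M" "M > 0"
    unfolding bounded_pos by auto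
  then have M': "\<bar>fd g x b\<bar> \<le> M" for x using zd[of x] by (cases "x \<in> K") auto
  define h where "h n = 1 / (real n + 1)" for n
  have h: "0 < h n" "h n \<le> 1" for n by (auto simp: h_def)
  have line: "((\<lambda>t. g (x + t *\<^sub>R b)) has_real_derivative fd g (x + t *\<^sub>R b) b) (at t)" for x t
  proof -
    have "((\<lambda>t. g (x + t *\<^sub>R b)) has_derivative (\<lambda>s. fd g (x + t *\<^sub>R b) (s *\<^sub>R b))) (at t)"
      by (rule has_derivative_compose[OF _ dg]) (auto intro!: derivative_eq_intros)
    moreover have "linear (fd g (x + t *\<^sub>R b))" using dg has_derivative_linear by blast
    ultimately show ?thesis by (simp add: has_field_derivative_def linear_scale mult_commute_abs)
  qed
  define f where "f n x = (g (x + h n *\<^sub>R b) - g x) / h n" for n x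
  have lim: "(\<lambda>n. f n x) \<longlonglongrightarrow> fd g x b" for x
  proof -
    have "((\<lambda>t. (g (x + t *\<^sub>R b) - g x) / t) \<longlongrightarrow> fd g x b) (at 0)"
      using line[of x 0] by (simp add: DERIV_def)
    moreover have "filterlim h (at 0) sequentially"
      unfolding filterlim_at using h LIMSEQ_ignore_initial_segment[OF lim_const_over_n[of 1], of 1]
      by (simp add: h_def[abs_def] add.commute less_imp_neq[symmetric])
    ultimately show ?thesis unfolding f_def by (rule filterlim_compose)
  qed
  \<comment> \<open>A shift of length \<open>h n \<le> 1\<close> moves the support by at most 1,
    hence the radius \<open>R + 1\<close> of the dominating function.\<close>
  have bound: "\<bar>f n x\<bar> \<le> indicator (cball 0 (R + 1)) x *\<^sub>R M" for n x
  proof (cases "x \<in> cball 0 (R + 1)")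
    case True
    obtain t where "g (x + h n *\<^sub>R b) - g (x + 0 *\<^sub>R b) = (h n - 0) * fd g (x + t *\<^sub>R b) b"
      using MVT2[OF h(1)[of n], of "\<lambda>t. g (x + t *\<^sub>R b)" "\<lambda>t. fd g (x + t *\<^sub>R b) b"] line by blast
    then have "f n x = fd g (x + t *\<^sub>R b) b" using h(1)[of n] by (simp add: f_def)
    then show ?thesis using True M' by simp
  next
    case False
    then have "norm x > R + 1" by simp
    moreover have "norm x \<le> norm (x + h n *\<^sub>R b) + 1"
      using norm_triangle_ineq4[of "x + h n *\<^sub>R b" "h n *\<^sub>R b"] h[of n] b by simp
    ultimately have "x \<notin> K" "x + h n *\<^sub>R b \<notin> K" using R by (auto simp: subset_eq)
    then show ?thesis using z False by (simp add: f_def)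
  qed
  have i0: "integrable lborel g" by (rule integrable_cont_compact_support[OF gc K z])
  have gm: "g \<in> borel_measurable borel" using gc by (rule borel_measurable_continuous_onI)
  have ish: "integrable lborel (\<lambda>x. g (x + c))" for c
  proof (rule integrable_cont_compact_support[where K="(\<lambda>x. x - c) ` K"])
    show "continuous_on UNIV (\<lambda>x. g (x + c))"
      by (rule continuous_on_compose2[OF gc]) (auto intro!: continuous_intros)
    show "compact ((\<lambda>x. x - c) ` K)" by (rule compact_continuous_image[OF _ K]) (auto intro!: continuous_intros)
    show "g (x + c) = 0" if "x \<notin> (\<lambda>x. x - c) ` K" for x
      using that z[of "x + c"] by force
  qed
  have If: "integral\<^sup>L lborel (f n) = 0" for n
    unfolding f_def using i0 ish[of "h n *\<^sub>R b"] lborel_integral_affine(1)[OF gm zero_less_one, of "h n *\<^sub>R b"]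
    by (simp add: Bochner_Integration.integral_diff add.commute)
  have "(\<lambda>n. integral\<^sup>L lborel (f n)) \<longlonglongrightarrow> integral\<^sup>L lborel (\<lambda>x. fd g x b)"
  proof (rule integral_dominated_convergence)
    show "(\<lambda>x. fd g x b) \<in> borel_measurable lborel"
      using borel_measurable_continuous_onI[OF c] by simp
    show "f n \<in> borel_measurable lborel" for n
      unfolding f_def using i0 ish by (intro borel_measurable_divide borel_measurable_diff) auto
    show "integrable lborel (\<lambda>x. indicator (cball 0 (R + 1)) x *\<^sub>R M)"
      by (rule borel_integrable_compact) auto
  qed (use lim bound in auto)
  then show "integral\<^sup>L lborel (\<lambda>x. fd g x b) = 0" using If LIMSEQ_unique[OF tendsto_const] by fastforce
qed

definition dv :: "('a::euclidean_space \<Rightarrow> 'a) \<Rightarrow> 'a \<Rightarrow> real" where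
  "dv F x = (\<Sum>b\<in>Basis. fd F x b \<bullet> b)"

lemma dv_eqI: "(F has_derivative D) (at x) ==> dv F x = (\<Sum>b\<in>Basis. D b \<bullet> b)"
  by (simp add: dv_def fd_eqI)

lemma dv_cong_open:
  "open S ==> x \<in> S ==> (\<And>y. y \<in> S ==> F y = G y) ==> dv F x = dv G x"
  unfolding dv_def using fd_cong_open[of S x F G] by simp

lemma ck_dv: "open S ==> ck (Suc k) S F ==> ck k S (dv F)"
  unfolding dv_def by (auto intro!: ck_sum ck_inner)

text \<open>Extension by zero turns \<open>F\<close> into a C^1 field on the whole space, and the
  divergence becomes a sum of directional derivatives of compactly supported functions.\<close>

lemma integral_dv_zero:
  fixes F :: "'a::euclidean_space \<Rightarrow> 'a"
  assumes S: "open S" and F: "ck 1 S F" and K: "compact K" "K \<subseteq> S" and z: "\<And>x. x \<in> S - K ==> F x = 0"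
  shows "set_integrable lborel S (dv F)" "(LINT x:S|lborel. dv F x) = 0"
proof -
  define G where "G x = (if x \<in> S then F x else 0)" for x
  have clK: "open (- K)" using K compact_imp_closed by auto
  have Gz: "G x = 0" if "x \<notin> K" for x using z[of x] that by (auto simp: G_def)
  have G: "ck 1 UNIV G"
  proof (rule ck_local)
    fix x :: 'a
    show "\<exists>T. open T \<and> x \<in> T \<and> ck 1 T G"
    proof (cases "x \<in> S")
      case True
      have "ck 1 S G" by (rule ck_cong[OF S _ F]) (simp add: G_def)
      then show ?thesis using S True by blast
    next
      case False
      have "ck 1 (- K) G" by (rule ck_cong[OF clK _ ck_const[of _ _ 0]]) (simp add: Gz)
      then show ?thesis using clK False K by blast
    qed
  qed
  have Gb: "ck 1 UNIV (\<lambda>x. G x \<bullet> b)" for b by (rule ck_inner) (use G in auto)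
  have fdG: "fd (\<lambda>x. G x \<bullet> b) x b = fd G x b \<bullet> b" for x b
  proof -
    have "(G has_derivative fd G x) (at x)" using ck_diff[of 0 UNIV G x] G by simp
    from has_derivative_inner_left[OF this, of b] show ?thesis by (simp add: fd_eqI)
  qed
  have e: "indicator S x *\<^sub>R dv F x = (\<Sum>b\<in>Basis. fd (\<lambda>x. G x \<bullet> b) x b)" for x
  proof (cases "x \<in> S")
    case True
    have "dv F x = dv G x" by (rule dv_cong_open[OF S True]) (simp add: G_def)
    then show ?thesis using True by (simp add: dv_def fdG)
  next
    case False
    then have "x \<in> - K" using K by auto
    have "dv G x = dv (\<lambda>x. 0) x" by (rule dv_cong_open[OF clK \<open>x \<in> - K\<close>]) (simp add: Gz)
    then show ?thesis using False by (simp add: dv_def fdG frechet_derivative_const)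
  qed
  have *: "integrable lborel (\<lambda>x. fd (\<lambda>x. G x \<bullet> b) x b)" "integral\<^sup>L lborel (\<lambda>x. fd (\<lambda>x. G x \<bullet> b) x b) = 0"
    if "b \<in> Basis" for b
    using integral_fd_zero[OF Gb K(1) _ that, of b] Gz by auto
  show "set_integrable lborel S (dv F)" unfolding set_integrable_def e using * by auto
  show "(LINT x:S|lborel. dv F x) = 0" unfolding set_lebesgue_integral_def e using * by simp
qed

section \<open>The divergence theorem as an inequality\<close>

lemma dv_scaleR:
  assumes "f differentiable (at x)" "F differentiable (at x)"
  shows "dv (\<lambda>x. f x *\<^sub>R F x) x = gr f x \<bullet> F x + f x * dv F x"
proof -
  have "((\<lambda>x. f x *\<^sub>R F x) has_derivative (\<lambda>h. f x *\<^sub>R fd F x h + fd f x h *\<^sub>R F x)) (at x)"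
    using has_derivative_scaleR[OF differentiable_fd[OF assms(1)] differentiable_fd[OF assms(2)]] .
  then have "dv (\<lambda>x. f x *\<^sub>R F x) x = (\<Sum>b\<in>Basis. (f x *\<^sub>R fd F x b + fd f x b *\<^sub>R F x) \<bullet> b)" by (rule dv_eqI)
  also have "... = f x * dv F x + gr f x \<bullet> F x"
    by (simp add: dv_def gr_def inner_add_left sum.distrib sum_distrib_left inner_sum_left inner_commute[of "F x"])
  finally show ?thesis by simp
qed

lemma dv_add:
  assumes "F differentiable (at x)" "G differentiable (at x)"
  shows "dv (\<lambda>x. F x + G x) x = dv F x + dv G x"
  using dv_eqI[OF has_derivative_add[OF differentiable_fd[OF assms(1)] differentiable_fd[OF assms(2)]]]
  by (simp add: dv_def inner_add_left sum.distrib)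

lemma dv_diff:
  assumes "F differentiable (at x)" "G differentiable (at x)"
  shows "dv (\<lambda>x. F x - G x) x = dv F x - dv G x"
  using dv_eqI[OF has_derivative_diff[OF differentiable_fd[OF assms(1)] differentiable_fd[OF assms(2)]]]
  by (simp add: dv_def inner_diff_left sum_subtractf)

lemma dv_cmul: "F differentiable (at x) ==> dv (\<lambda>x. c *\<^sub>R F x) x = c * dv F x"
  using dv_eqI[OF has_derivative_scaleR_right[OF differentiable_fd], of F x c] by (simp add: dv_def sum_distrib_left)

lemma gr_cmul: "f differentiable (at x) ==> gr (\<lambda>x. c * f x) x = c *\<^sub>R gr f x"
  using has_derivative_mult_right[OF gr_deriv, of f x c] by (intro gr_eqI) simp

lemma gr_mult:
  assumes "f differentiable (at x)" "k differentiable (at x)"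
  shows "gr (\<lambda>x. f x * k x) x = f x *\<^sub>R gr k x + k x *\<^sub>R gr f x"
  by (rule gr_eqI, rule has_derivative_eq_rhs[OF has_derivative_mult[OF gr_deriv[OF assms(1)] gr_deriv[OF assms(2)]]])
     (auto simp: fun_eq_iff inner_add_left algebra_simps)

lemma gr_compose:
  assumes "(f has_real_derivative f') (at (s x))" "s differentiable (at x)"
  shows "gr (\<lambda>x. f (s x)) x = f' *\<^sub>R gr s x"
  by (rule gr_eqI, rule has_derivative_eq_rhs[OF DERIV_compose_FDERIV[OF assms(1) gr_deriv[OF assms(2)]]])
     (auto simp: fun_eq_iff algebra_simps)

lemma set_integrable_bounded_cont:
  fixes f :: "'a::euclidean_space \<Rightarrow> real"
  assumes "open S" "bounded S" "continuous_on S f" "\<And>x. x \<in> S ==> \<bar>f x\<bar> \<le> M"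
  shows "set_integrable lborel S f"
proof -
  have 1: "set_borel_measurable lborel S f"
    using borel_measurable_continuous_on_indicator[OF _ assms(3)] assms(1) by (simp add: set_borel_measurable_def)
  obtain R where R: "S \<subseteq> cball 0 R" using assms(2) unfolding bounded_pos by (auto simp: subset_eq)
  have 2: "integrable lborel (\<lambda>x. indicator (cball 0 R) x *\<^sub>R M)" by (rule borel_integrable_compact) auto
  show ?thesis unfolding set_integrable_def
  proof (rule Bochner_Integration.integrable_bound[OF 2])
    show "(\<lambda>x. indicat_real S x *\<^sub>R f x) \<in> borel_measurable lborel"
      using 1 by (simp add: set_borel_measurable_def)
    have "norm (indicat_real S x *\<^sub>R f x) \<le> norm (indicat_real (cball 0 R) x *\<^sub>R M)" for x
    proof (cases "x \<in> S")
      case True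
      then show ?thesis using assms(4)[OF True] subsetD[OF R True] by simp
    qed simp
    then show "AE x in lborel. norm (indicat_real S x *\<^sub>R f x) \<le> norm (indicat_real (cball 0 R) x *\<^sub>R M)" by simp
  qed
qed

text \<open>Near the frontier \<open>rho\<close> plays the role of a signed distance: its gradient
  there is the exterior unit normal. Class 3 is dictated by the corrected squared distances, which
  contain \<open>gr rho\<close> and must be of class 2.\<close>

locale defined_domain =
  fixes Om D :: "'a::euclidean_space set" and rho :: "'a \<Rightarrow> real"
  assumes op: "open Om" and bd: "bounded Om" and conn: "connected Om" and ne: "Om \<noteq> {}"
    and opD: "open D" and clD: "closure Om \<subseteq> D" and ckr: "ck 3 D rho"
    and neg: "\<And>x. x \<in> Om ==> rho x < 0" and zer: "\<And>x. x \<in> frontier Om ==> rho x = 0"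
    and unit: "\<And>x. x \<in> frontier Om ==> norm (gr rho x) = 1"
begin

lemma subD: "Om \<subseteq> D" using closure_subset clD by blast

lemma compact_cl: "compact (closure Om)" using bd by (simp add: compact_closure)

lemma closure_cases: "x \<in> closure Om ==> x \<notin> Om ==> x \<in> frontier Om"
  using op by (simp add: frontier_def interior_open)

lemma frontier_notin: "x \<in> frontier Om ==> x \<notin> Om"
  using op by (simp add: frontier_def interior_open)

lemma frontier_cl: "x \<in> frontier Om ==> x \<in> closure Om" by (simp add: frontier_def)

lemma compact_le: "continuous_on (closure Om) f ==> compact {x \<in> closure Om. f x \<le> (c::real)}"
proof -
  assume "continuous_on (closure Om) f"
  then have "closed {x \<in> closure Om. f x \<le> c}"
    using continuous_closed_preimage[of "closure Om" f "{..c}"] by (simp add: vimage_def Int_def)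
  from compact_Int_closed[OF compact_cl this] show ?thesis by (simp add: Int_absorb1)
qed

lemma bounded_cl:
  fixes f :: "'a \<Rightarrow> 'b::real_normed_vector"
  assumes "continuous_on (closure Om) f"
  obtains K where "K > 0" "\<And>x. x \<in> closure Om ==> norm (f x) \<le> K"
proof -
  have "bounded (f ` closure Om)" by (intro compact_imp_bounded compact_continuous_image compact_cl assms)
  then show ?thesis using that unfolding bounded_pos by auto
qed

lemma si_closure:
  fixes f :: "'a \<Rightarrow> real"
  assumes "continuous_on (closure Om) f" "U \<in> sets borel" "U \<subseteq> Om" shows "set_integrable lborel U f"
proof -
  obtain M where M: "\<And>x. x \<in> closure Om ==> norm (f x) \<le> M" using bounded_cl[OF assms(1)] by blast
  have "set_integrable lborel Om f"
    by (rule set_integrable_bounded_cont[OF op bd continuous_on_subset[OF assms(1) closure_subset], where M=M])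
       (use M closure_subset in force)
  then show ?thesis by (rule set_integrable_subset) (use assms in auto)
qed

lemma cont_rho: "continuous_on (closure Om) rho"
  using ck_cont[OF ckr] clD continuous_on_subset by blast

lemma ck_rho: "k \<le> 3 ==> ck k D rho" using ck_mono[OF ckr] .

lemma ck_grho: "k \<le> 2 ==> ck k D (gr rho)"
  by (rule ck_gr[OF opD]) (use ck_rho[of "Suc k"] in auto)

lemma cont_grho: "continuous_on (closure Om) (gr rho)"
  using ck_cont[OF ck_grho[of 0]] clD continuous_on_subset by blast

lemma rho_diff: "x \<in> D ==> rho differentiable (at x)"
  using ck_rho[of 1] by simp

lemma inner_set: "dl > 0 ==> compact {x \<in> closure Om. rho x \<le> - dl}" "dl > 0 ==> {x \<in> closure Om. rho x \<le> - dl} \<subseteq> Om"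
  using compact_le[OF cont_rho] closure_cases zer by force+

text \<open>On a nonempty \<open>K\<close> the function \<open>rho\<close> attains its maximum, at a
  point of \<open>Om\<close>, so the maximum is negative.\<close>

lemma away_from_frontier:
  assumes "compact K" "K \<subseteq> closure Om" "K \<inter> frontier Om = {}"
  obtains dl where "dl > 0" "\<And>x. x \<in> K ==> rho x \<le> - dl"
proof (cases "K = {}")
  case True then show ?thesis using that[of 1] by auto
next
  case False
  obtain x where x: "x \<in> K" "\<And>y. y \<in> K ==> rho y \<le> rho x"
    using continuous_attains_sup[OF assms(1) False continuous_on_subset[OF cont_rho assms(2)]] by blast
  have "rho x < 0" using x assms(2,3) closure_cases neg by blast
  show ?thesis
  proof (rule that[of "- rho x"])
    show "- rho x > 0" using \<open>rho x < 0\<close> by simp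
    show "rho y \<le> - (- rho x)" if "y \<in> K" for y using x(2)[OF that] by simp
  qed
qed

text \<open>The set where the bound fails is compact and misses the frontier, so it lies at positive
  depth.\<close>

lemma collar_ge:
  assumes "continuous_on (closure Om) f" "\<And>x. x \<in> frontier Om ==> f x > (c::real)"
  obtains dl where "dl > 0" "\<And>x. x \<in> closure Om ==> rho x > - dl ==> f x > c"
proof -
  note compact_le[OF assms(1), of c]
  moreover have "{x \<in> closure Om. f x \<le> c} \<inter> frontier Om = {}" by (auto dest: assms(2))
  ultimately obtain dl where "dl > 0" "\<And>x. x \<in> {x \<in> closure Om. f x \<le> c} ==> rho x \<le> - dl"
    using away_from_frontier[of "{x \<in> closure Om. f x \<le> c}"] by blast
  then show ?thesis using that[of dl] by (metis (mono_tags, lifting) mem_Collect_eq not_le)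
qed

text \<open>A cutoff by depth: 0 where \<open>rho \<ge> - e\<close> and 1 where
  \<open>rho \<le> - (2 * e)\<close>. \<open>th'\<close> is its derivative with respect to the depth
  \<open>- rho\<close>.\<close>

definition "th e x = step (- rho x / e)"
definition "th' e x = step' (- rho x / e) / e"

lemma ck_th: "e > 0 ==> ck 1 D (th e)"
proof -
  assume e: "e > 0"
  have "ck 1 D (\<lambda>x. - rho x / e)" unfolding divide_inverse by (intro ck_mult ck_minus ck_const opD ck_rho) simp
  then have "ck 1 D (\<lambda>x. (if (0::nat) = 0 then step else step') (- rho x / e))"
    by (intro ck_compose_real[where T=UNIV and H="\<lambda>i. if i = 0 then step else step'"])
       (auto simp: opD step_deriv DERIV_continuous_on[OF step'_deriv])
  then show ?thesis by (simp add: th_def[abs_def])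
qed

lemma gr_th: "e > 0 ==> x \<in> D ==> gr (th e) x = - th' e x *\<^sub>R gr rho x"
proof -
  assume x: "e > 0" "x \<in> D"
  have "((\<lambda>s. step (- s / e)) has_real_derivative - step' (- rho x / e) / e) (at (rho x))"
    by (rule DERIV_cong[OF DERIV_chain2[OF step_deriv]]) (use x in \<open>auto intro!: derivative_eq_intros\<close>)
  from gr_compose[OF this rho_diff[OF x(2)]] show ?thesis by (simp add: th_def[abs_def] th'_def)
qed

lemma cont_th': "e > 0 ==> continuous_on (closure Om) (th' e)"
proof -
  assume "e > 0"
  then have 1: "continuous_on (closure Om) (\<lambda>x. - rho x / e)" by (intro continuous_intros cont_rho) auto
  have "continuous_on UNIV step'" using step'_deriv by (auto intro!: DERIV_continuous_on)
  from continuous_on_compose2[OF this 1] show ?thesis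
    unfolding th'_def[abs_def] by (intro continuous_intros) (use \<open>e > 0\<close> in auto)
qed

lemma th_range: "0 \<le> th e x" "th e x \<le> 1" "e > 0 ==> 0 \<le> th' e x"
  using step_range by (auto simp: th_def th'_def)

lemma th_low: "e > 0 ==> rho x \<ge> - e ==> th e x = 0 \<and> th' e x = 0"
  using step_low[of "- rho x / e"] by (simp add: th_def th'_def field_simps)

lemma th_high: "e > 0 ==> rho x \<le> - (2 * e) ==> th e x = 1 \<and> th' e x = 0"
  using step_high[of "- rho x / e"] by (simp add: th_def th'_def field_simps)

text \<open>Integrating the divergence of a field cut off at depth \<open>e\<close> turns the boundary integral into an
  average over the layer \<open>- 2 * e \<le> rho \<le> - e\<close>.\<close>

lemma cutoff_divergence:
  assumes A: "open A" and C: "closed C" "C \<subseteq> A" and F: "ck 1 (Om \<inter> A) F"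
    and z: "\<And>x. x \<in> Om \<inter> A - C ==> F x = 0" and e: "e > 0"
  shows "set_integrable lborel (Om \<inter> A) (\<lambda>x. th e x * dv F x)"
    and "set_integrable lborel (Om \<inter> A) (\<lambda>x. th' e x * (gr rho x \<bullet> F x))"
    and "(LINT x:Om \<inter> A|lborel. th e x * dv F x) = (LINT x:Om \<inter> A|lborel. th' e x * (gr rho x \<bullet> F x))"
proof -
  define S where "S = Om \<inter> A"
  have S: "open S" unfolding S_def by (rule open_Int[OF op A])
  have SD: "S \<subseteq> D" "S \<subseteq> closure Om" using subD closure_subset by (auto simp: S_def)
  \<comment> \<open>The cut-off field lives on this compact subset of the open set \<open>S\<close>,
    so the integral of its divergence is zero.\<close>
  define K where "K = {x \<in> closure Om. rho x \<le> - e} \<inter> C"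
  have K: "compact K" unfolding K_def by (rule compact_Int_closed[OF compact_le[OF cont_rho] C(1)])
  have KS: "K \<subseteq> S"
  proof
    fix x assume x: "x \<in> K"
    then have "x \<notin> frontier Om" using zer e by (force simp: K_def)
    then show "x \<in> S" using x closure_cases C(2) by (auto simp: K_def S_def)
  qed
  have off: "F x = 0 \<or> th e x = 0 \<and> th' e x = 0" if "x \<in> S - K" for x
    using that SD z[of x] th_low[OF e, of x] by (cases "x \<in> C") (auto simp: K_def S_def)
  have F1: "ck 1 S F" using F by (simp add: S_def)
  have th1: "ck 1 S (th e)" by (rule ck_subset[OF ck_th[OF e] SD(1)])
  define G where "G x = th e x *\<^sub>R F x" for x
  define J where "J x = th' e x * (gr rho x \<bullet> F x)" for x
  have G: "ck 1 S G" unfolding G_def by (rule ck_scaleR[OF S th1 F1])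
  have dG: "dv G x = th e x * dv F x - J x" if "x \<in> S" for x
    unfolding G_def using dv_scaleR[of "th e" x F] th1 F1 that gr_th[OF e, of x] SD by (simp add: J_def subset_eq)
  have "continuous_on S J" unfolding J_def
    by (intro continuous_intros ck_cont[OF F1] continuous_on_subset[OF _ SD(2)] cont_th' cont_grho e)
  then have "integrable lborel (\<lambda>x. indicator K x *\<^sub>R J x)"
    by (intro borel_integrable_compact[OF K]) (rule continuous_on_subset[OF _ KS])
  moreover have "(\<lambda>x. indicator K x *\<^sub>R J x) = (\<lambda>x. indicator S x *\<^sub>R J x)"
    using KS off by (fastforce simp: fun_eq_iff indicator_def J_def)
  ultimately have Ji: "set_integrable lborel S J" by (simp add: set_integrable_def)
  have I: "set_integrable lborel S (dv G)" "(LINT x:S|lborel. dv G x) = 0"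
    by (rule integral_dv_zero[OF S G K KS]; use off in \<open>force simp: G_def\<close>)+
  have e1: "indicator S x *\<^sub>R (th e x * dv F x) = indicator S x *\<^sub>R (dv G x + J x)" for x
    by (simp add: dG indicator_def)
  show "set_integrable lborel (Om \<inter> A) (\<lambda>x. th e x * dv F x)"
    using set_integral_add(1)[OF I(1) Ji] unfolding set_integrable_def S_def[symmetric] e1 .
  show "set_integrable lborel (Om \<inter> A) (\<lambda>x. th' e x * (gr rho x \<bullet> F x))"
    using Ji unfolding S_def J_def .
  show "(LINT x:Om \<inter> A|lborel. th e x * dv F x) = (LINT x:Om \<inter> A|lborel. th' e x * (gr rho x \<bullet> F x))"
    using set_integral_add(2)[OF I(1) Ji] I(2)
    unfolding set_lebesgue_integral_def S_def[symmetric] e1 by (simp add: J_def)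
qed

text \<open>Near the boundary \<open>F \<bullet> gr rho\<close> is at most \<open>eta\<close> times \<open>gr rho \<bullet> gr rho\<close>, and the layer average of the
  latter is controlled by the divergence of the field \<open>gr rho\<close>.\<close>

theorem divergence_bound:
  fixes F :: "'a \<Rightarrow> 'a" and m :: "'a \<Rightarrow> real"
  assumes A: "open A" and C: "closed C" "C \<subseteq> A"
    and F: "ck 1 (Om \<inter> A) F" and Fc: "continuous_on (closure Om \<inter> A) F"
    and z: "\<And>x. x \<in> closure Om \<inter> A - C ==> F x = 0"
    and bc: "\<And>x. x \<in> frontier Om \<inter> A ==> F x \<bullet> gr rho x \<le> 0"
    and mi: "set_integrable lborel (Om \<inter> A) m" and le: "\<And>x. x \<in> Om \<inter> A ==> m x \<le> dv F x"
  shows "(LINT x:Om \<inter> A|lborel. m x) \<le> 0"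
proof -
  have N1: "ck 1 (Om \<inter> UNIV) (gr rho)" using ck_subset[OF ck_grho[of 1] subD] by simp
  have "continuous_on (closure Om) (dv (gr rho))"
    using ck_cont[OF ck_dv[OF opD, of 0 "gr rho"]] ck_grho[of 1] clD continuous_on_subset by auto
  then obtain M where M: "M > 0" "\<And>x. x \<in> closure Om ==> \<bar>dv (gr rho) x\<bar> \<le> M"
    by (rule bounded_cl) (use that in auto)
  have Mi: "set_integrable lborel Om (\<lambda>x. M)" by (rule set_integrable_bounded_cont[OF op bd]) auto
  define V where "V = (LINT x:Om|lborel. M) + 1"
  have "(LINT x:Om|lborel. M) \<ge> 0" unfolding set_lebesgue_integral_def
    by (rule Bochner_Integration.integral_nonneg) (use M in auto)
  then have V: "V > 0" by (simp add: V_def)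
  have thi: "set_integrable lborel (Om \<inter> A) (\<lambda>x. th e x * m x)" if e: "e > 0" for e
  proof (rule set_integrable_bound[OF mi])
    have "continuous_on (Om \<inter> A) (th e)"
      using continuous_on_subset[OF ck_cont[OF ck_th[OF e]], of "Om \<inter> A"] subD by auto
    then have 1: "(\<lambda>x. indicat_real (Om \<inter> A) x *\<^sub>R th e x) \<in> borel_measurable borel"
      using A op by (intro borel_measurable_continuous_on_indicator) auto
    have "(\<lambda>x. indicat_real (Om \<inter> A) x *\<^sub>R m x) \<in> borel_measurable borel"
      using mi by (auto simp: set_integrable_def)
    from borel_measurable_times[OF 1 this] show "set_borel_measurable lborel (Om \<inter> A) (\<lambda>x. th e x * m x)"
      by (auto simp: set_borel_measurable_def indicator_def elim!: measurable_cong[THEN iffD1, rotated])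
    show "AE x in lborel. x \<in> Om \<inter> A \<longrightarrow> norm (th e x * m x) \<le> norm (m x)"
      using th_range[of e] by (auto simp: abs_mult mult_left_le_one_le)
  qed
  have key: "\<exists>d>0. \<forall>e. 0 < e \<longrightarrow> e < d \<longrightarrow> (LINT x:Om \<inter> A|lborel. th e x * m x) \<le> eta * V" if eta: "eta > 0" for eta
  proof -
    \<comment> \<open>The points of \<open>C\<close> at which the flux exceeds the allowed
      \<open>eta\<close>-fraction. They form a compact set away from the frontier, hence at depth
      \<open>d\<close> or more, and the layer of depth between \<open>e\<close> and
      \<open>2 * e\<close> avoids them as soon as \<open>e < d / 2\<close>.\<close>
    define K where "K = {x \<in> closure Om \<inter> C. gr rho x \<bullet> F x - eta * (gr rho x \<bullet> gr rho x) \<in> {0..}}"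
    have cc: "continuous_on (closure Om \<inter> C) (\<lambda>x. gr rho x \<bullet> F x - eta * (gr rho x \<bullet> gr rho x))"
      by (intro continuous_intros continuous_on_subset[OF cont_grho] continuous_on_subset[OF Fc]) (use C in auto)
    have "closed K" unfolding K_def
      using continuous_closed_preimage[OF cc closed_Int[OF closed_closure C(1)] closed_atLeast[of 0]]
      by (simp add: vimage_def Int_def conj_assoc)
    then have K: "compact K" using compact_Int_closed[OF compact_cl, of K] by (simp add: K_def Int_absorb1 subset_eq)
    obtain d where d: "d > 0" "\<And>x. x \<in> K ==> rho x \<le> - d"
    proof (rule away_from_frontier[OF K])
      show "K \<inter> frontier Om = {}"
      proof safe
        fix x assume x: "x \<in> K" "x \<in> frontier Om"
        then have "gr rho x \<bullet> F x \<le> 0" "gr rho x \<bullet> gr rho x = 1"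
          using bc[of x] C unit[of x] by (auto simp: K_def inner_commute dot_square_norm)
        then show "x \<in> {}" using x eta by (auto simp: K_def)
      qed
    qed (auto simp: K_def)
    have "(LINT x:Om \<inter> A|lborel. th e x * m x) \<le> eta * V" if e: "0 < e" "e < d / 2" for e
    proof -
      have z': "F x = 0" if "x \<in> Om \<inter> A - C" for x using z[of x] that closure_subset by auto
      note E = cutoff_divergence[OF A C F z' e(1)]
      note N = cutoff_divergence[OF open_UNIV closed_UNIV subset_UNIV N1 _ e(1), simplified]
      have "(LINT x:Om \<inter> A|lborel. th e x * m x) \<le> (LINT x:Om \<inter> A|lborel. th e x * dv F x)"
        by (rule set_integral_mono[OF thi[OF e(1)] E(1)]) (use le th_range in \<open>auto intro!: mult_left_mono\<close>)
      also have "... = (LINT x:Om \<inter> A|lborel. th' e x * (gr rho x \<bullet> F x))" by (rule E(3))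
      also have "... \<le> (LINT x:Om|lborel. eta * (th' e x * (gr rho x \<bullet> gr rho x)))"
        unfolding set_lebesgue_integral_def
      proof (rule integral_mono)
        show "integrable lborel (\<lambda>x. indicat_real (Om \<inter> A) x *\<^sub>R (th' e x * (gr rho x \<bullet> F x)))"
          using E(2) by (simp add: set_integrable_def)
        show "integrable lborel (\<lambda>x. indicat_real Om x *\<^sub>R (eta * (th' e x * (gr rho x \<bullet> gr rho x))))"
          using set_integrable_mult_right[of eta, OF N(2)] by (simp add: set_integrable_def)
        fix x
        have nn: "0 \<le> eta * (th' e x * (gr rho x \<bullet> gr rho x))" using eta th_range(3)[OF e(1)] by simp
        have "th' e x * (gr rho x \<bullet> F x) \<le> eta * (th' e x * (gr rho x \<bullet> gr rho x))" if x: "x \<in> Om \<inter> A"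
        proof (cases "x \<in> C \<and> rho x > - (2 * e)")
          case True
          then have "x \<notin> K" using d(2)[of x] e by auto
          then have "gr rho x \<bullet> F x \<le> eta * (gr rho x \<bullet> gr rho x)" using x True closure_subset by (auto simp: K_def)
          from mult_left_mono[OF this th_range(3)[OF e(1)]] show ?thesis by (simp add: mult.left_commute)
        next
          case False
          then have "F x = 0 \<or> th' e x = 0" using z'[of x] x th_high[OF e(1), of x] by auto
          then show ?thesis using nn by auto
        qed
        then show "indicat_real (Om \<inter> A) x *\<^sub>R (th' e x * (gr rho x \<bullet> F x)) \<le> indicat_real Om x *\<^sub>R (eta * (th' e x * (gr rho x \<bullet> gr rho x)))"
          using nn by (auto simp: indicator_def)
      qed
      also have "... = eta * (LINT x:Om|lborel. th e x * dv (gr rho) x)" using N(3) by simp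
      also have "... \<le> eta * (LINT x:Om|lborel. M)"
      proof (intro mult_left_mono set_integral_mono[OF N(1) Mi])
        fix x assume "x \<in> Om"
        then have "\<bar>dv (gr rho) x\<bar> \<le> M" using M closure_subset by blast
        then have "th e x * dv (gr rho) x \<le> 1 * M" using th_range[of e x] M(1) abs_le_D1
          by (intro order_trans[OF mult_left_mono mult_right_mono]) auto
        then show "th e x * dv (gr rho) x \<le> M" by simp
      qed (use eta in simp)
      also have "... \<le> eta * V" using eta by (simp add: V_def)
      finally show ?thesis .
    qed
    then show ?thesis using d(1) by (intro exI[of _ "d / 2"]) auto
  qed
  define h where "h n = 1 / (real n + 1)" for n
  have h: "h n > 0" for n by (simp add: h_def)
  have h0: "h \<longlonglongrightarrow> 0" using LIMSEQ_ignore_initial_segment[OF lim_const_over_n[of 1], of 1]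
    by (simp add: h_def[abs_def] add.commute)
  \<comment> \<open>Letting the cutoff depth tend to 0 takes a dominating function. The integrable
    minorant \<open>m\<close> provides it; about the integrability of \<open>dv F\<close> up to the
    boundary nothing is known.\<close>
  have lim: "(\<lambda>n. LINT x:Om \<inter> A|lborel. th (h n) x * m x) \<longlonglongrightarrow> (LINT x:Om \<inter> A|lborel. m x)"
    unfolding set_lebesgue_integral_def
  proof (rule integral_dominated_convergence[where w="\<lambda>x. indicat_real (Om \<inter> A) x *\<^sub>R \<bar>m x\<bar>"])
    show "(\<lambda>x. indicat_real (Om \<inter> A) x *\<^sub>R m x) \<in> borel_measurable lborel"
      using mi by (auto simp: set_integrable_def)
    show "(\<lambda>x. indicat_real (Om \<inter> A) x *\<^sub>R (th (h n) x * m x)) \<in> borel_measurable lborel" for n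
      using thi[OF h[of n]] by (auto simp: set_integrable_def)
    show "integrable lborel (\<lambda>x. indicat_real (Om \<inter> A) x *\<^sub>R \<bar>m x\<bar>)"
      using set_integrable_abs[OF mi] by (simp add: set_integrable_def)
    have "(\<lambda>n. th (h n) x * m x) \<longlonglongrightarrow> m x" if x: "x \<in> Om" for x
    proof -
      have "\<forall>\<^sub>F n in sequentially. h n < - rho x / 2"
        using order_tendstoD(2)[OF h0, of "- rho x / 2"] neg[OF x] by simp
      then have "\<forall>\<^sub>F n in sequentially. th (h n) x * m x = m x"
        by eventually_elim (use th_high[OF h, of x] in simp)
      then show ?thesis by (rule tendsto_eventually)
    qed
    then show "AE x in lborel. (\<lambda>n. indicat_real (Om \<inter> A) x *\<^sub>R (th (h n) x * m x)) \<longlonglongrightarrow> indicat_real (Om \<inter> A) x *\<^sub>R m x"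
      by (auto simp: indicator_def)
    show "AE x in lborel. norm (indicat_real (Om \<inter> A) x *\<^sub>R (th (h n) x * m x)) \<le> indicat_real (Om \<inter> A) x *\<^sub>R \<bar>m x\<bar>" for n
      using th_range[of "h n"] by (intro AE_I2) (auto simp: indicator_def abs_mult intro!: mult_left_le_one_le)
  qed
  show ?thesis
  proof (rule field_le_epsilon)
    fix eta :: real assume "eta > 0"
    then obtain d where d: "d > 0" "\<And>e. 0 < e ==> e < d ==> (LINT x:Om \<inter> A|lborel. th e x * m x) \<le> eta / V * V"
      using key[of "eta / V"] V by auto
    have "\<forall>\<^sub>F n in sequentially. h n < d" using order_tendstoD(2)[OF h0 d(1)] .
    then have "\<forall>\<^sub>F n in sequentially. (LINT x:Om \<inter> A|lborel. th (h n) x * m x) \<le> eta"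
      by eventually_elim (use d(2)[OF h] V in simp)
    then show "(LINT x:Om \<inter> A|lborel. m x) \<le> 0 + eta" using tendsto_upperbound[OF lim] by simp
  qed
qed

end

section \<open>Carleman inequalities\<close>

lemma gr_inner_fields:
  assumes "X differentiable (at x)" "Y differentiable (at x)"
  shows "gr (\<lambda>x. X x \<bullet> Y x) x \<bullet> h = fd X x h \<bullet> Y x + X x \<bullet> fd Y x h"
proof -
  have d: "((\<lambda>x. X x \<bullet> Y x) has_derivative (\<lambda>h. X x \<bullet> fd Y x h + fd X x h \<bullet> Y x)) (at x)"
    using has_derivative_inner[OF differentiable_fd[OF assms(1)] differentiable_fd[OF assms(2)]] .
  then have "(\<lambda>x. X x \<bullet> Y x) differentiable (at x)" by (auto simp: differentiable_def)
  from gr_inner[OF this, of h] show ?thesis by (simp add: fd_eqI[OF d])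
qed

lemma hess_sym:
  fixes v :: "'a::euclidean_space \<Rightarrow> real"
  assumes S: "open S" "ck 2 S v" "x \<in> S"
  shows "fd (gr v) x h \<bullet> k = h \<bullet> fd (gr v) x k"
proof -
  have S2: "ck (Suc (Suc 0)) S v" using S by (simp add: numeral_2_eq_2)
  have *: "fd (gr v) x a \<bullet> b = fd (\<lambda>y. fd v y b) x a" for a b
  proof -
    have d: "((\<lambda>y. gr v y \<bullet> b) has_derivative (\<lambda>h. fd (gr v) x h \<bullet> b)) (at x)"
      by (rule has_derivative_inner_left[OF ck_diff[OF ck_gr[OF S(1) S2] S(3)]])
    have "fd (\<lambda>y. gr v y \<bullet> b) x = fd (\<lambda>y. fd v y b) x"
      by (rule fd_cong_open[OF S(1,3)], rule gr_inner) (use S2 in auto)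
    then show ?thesis using fd_eqI[OF d] by metis
  qed
  show ?thesis unfolding inner_commute[of h] * by (rule fd_commute[OF S])
qed

abbreviation lap :: "('a::euclidean_space \<Rightarrow> real) \<Rightarrow> 'a \<Rightarrow> real" where
  "lap v \<equiv> dv (gr v)"

lemma inner_diff_self_le:
  fixes a b :: "'a::real_inner"
  shows "(a - b) \<bullet> (a - b) \<le> 2 * (a \<bullet> a) + 2 * (b \<bullet> b)"
  using inner_ge_zero[of "a + b"]
  by (simp add: inner_diff_left inner_diff_right inner_add_left inner_add_right inner_commute)

lemma lap_mult:
  fixes f u :: "'a::euclidean_space \<Rightarrow> real"
  assumes S: "open S" and f: "ck 2 S f" and u: "ck 2 S u" and x: "x \<in> S"
  shows "lap (\<lambda>x. f x * u x) x = f x * lap u x + u x * lap f x + 2 * (gr f x \<bullet> gr u x)"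
proof -
  have c: "ck 1 S f" "ck 1 S u" "ck 1 S (gr f)" "ck 1 S (gr u)"
    using ck_mono[OF f, of 1] ck_mono[OF u, of 1] ck_gr[OF S, of 1] f u by (simp_all add: numeral_2_eq_2)
  have df: "ck 1 S h ==> y \<in> S ==> h differentiable (at y)" for h :: "'a \<Rightarrow> 'c::real_normed_vector" and y by simp
  have "lap (\<lambda>x. f x * u x) x = dv (\<lambda>x. f x *\<^sub>R gr u x + u x *\<^sub>R gr f x) x"
    by (rule dv_cong_open[OF S x gr_mult[OF df[OF c(1)] df[OF c(2)]]])
  also have "... = dv (\<lambda>x. f x *\<^sub>R gr u x) x + dv (\<lambda>x. u x *\<^sub>R gr f x) x"
    by (rule dv_add; rule df[OF ck_scaleR[OF S] x]; fact c)
  finally show ?thesis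
    unfolding dv_scaleR[OF df[OF c(1) x] df[OF c(4) x]] dv_scaleR[OF df[OF c(2) x] df[OF c(3) x]]
    by (simp add: inner_commute)
qed

text \<open>The setting of a Rellich-Pohozaev identity: the expression \<open>lap v + E * v\<close>
  is tested with the multiplier \<open>2 * (X \<bullet> gr v) + B * v\<close>.\<close>

locale multiplier =
  fixes S :: "'a::euclidean_space set" and v B E :: "'a \<Rightarrow> real" and X :: "'a \<Rightarrow> 'a"
  assumes S: "open S" and v: "ck 2 S v" and B: "ck 2 S B" and E: "ck 1 S E" and X: "ck 1 S X"
begin

text \<open>The flux of the multiplier identity \<open>dv_W\<close>; the quadratic terms left over
  are collected in \<open>Q\<close>.\<close>

definition "W x = ((2 * (X x \<bullet> gr v x) + B x * v x) *\<^sub>R gr v x - (v x * v x / 2) *\<^sub>R gr B x)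
   + (E x * (v x * v x) - gr v x \<bullet> gr v x) *\<^sub>R X x"

definition "Q x = 2 * (fd X x (gr v x) \<bullet> gr v x) + (B x - dv X x) * (gr v x \<bullet> gr v x)
   + v x * v x * (gr E x \<bullet> X x + E x * (dv X x - B x) - lap B x / 2)"

text \<open>Where \<open>N\<close> is a unit normal orthogonal to \<open>X\<close>, the normal
  component of \<open>Z N\<close> is \<open>v\<close> times the multiplier. A Robin condition makes
  the flux of \<open>W\<close> a multiple of exactly this quantity.\<close>

definition "Z N x = (2 * v x * (X x \<bullet> gr v x) + B x * (v x * v x)) *\<^sub>R N x - (2 * v x * (N x \<bullet> gr v x)) *\<^sub>R X x"

lemma ckg: "ck 1 S (gr v)" "ck 1 S (gr B)"
  using ck_gr[OF S, of 1] v B by (simp_all add: numeral_2_eq_2)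

lemma ck1: "ck 1 S v" "ck 1 S B" using ck_mono[OF v, of 1] ck_mono[OF B, of 1] by simp_all

lemma W_ck: "ck 1 S W"
  unfolding W_def by (intro ck_add ck_diff' ck_scaleR ck_inner ck_mult S ckg ck1 E X ck_const | subst divide_inverse)+

lemma Z_ck: "ck 1 S N ==> ck 1 S (Z N)"
  unfolding Z_def by (intro ck_add ck_diff' ck_scaleR ck_inner ck_mult S ckg ck1 E X ck_const)

lemma df: "ck 1 S f ==> x \<in> S ==> f differentiable (at x)" by simp

text \<open>Apart from \<open>lap v\<close>, second derivatives arise from differentiating
  \<open>X \<bullet> gr v\<close> along \<open>gr v\<close> and \<open>gr v \<bullet> gr v\<close>
  along \<open>X\<close>. The two contributions cancel because the Hessian is symmetric.\<close>

lemma dv_W: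
  assumes x: "x \<in> S"
  shows "dv W x = (lap v x + E x * v x) * (2 * (X x \<bullet> gr v x) + B x * v x) + Q x"
proof -
  note c = ck_add ck_diff' ck_scaleR ck_inner ck_mult S ckg ck1 E X ck_const
  define a where "a x = 2 * (X x \<bullet> gr v x) + B x * v x" for x
  define b where "b x = v x * v x / 2" for x
  define d where "d x = E x * (v x * v x) - gr v x \<bullet> gr v x" for x
  have Xv: "ck 1 S (\<lambda>x. X x \<bullet> gr v x)" and vv: "ck 1 S (\<lambda>x. gr v x \<bullet> gr v x)" and v2: "ck 1 S (\<lambda>x. v x * v x)"
    and Bv: "ck 1 S (\<lambda>x. B x * v x)" and Ev: "ck 1 S (\<lambda>x. E x * (v x * v x))" by (intro c)+
  have a: "ck 1 S a" unfolding a_def by (intro c Xv)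
  have b: "ck 1 S b" unfolding b_def divide_inverse by (intro c)
  have d: "ck 1 S d" unfolding d_def by (intro c)
  have ga: "gr a x \<bullet> h = 2 * (fd X x h \<bullet> gr v x + X x \<bullet> fd (gr v) x h) + B x * (gr v x \<bullet> h) + v x * (gr B x \<bullet> h)" for h
  proof -
    have "(a has_derivative (\<lambda>h. 2 * (gr (\<lambda>x. X x \<bullet> gr v x) x \<bullet> h) + gr (\<lambda>x. B x * v x) x \<bullet> h)) (at x)"
      unfolding a_def
      by (intro has_derivative_add has_derivative_mult_right gr_deriv df[OF Xv x] df[OF Bv x])
    then have "gr a x = 2 *\<^sub>R gr (\<lambda>x. X x \<bullet> gr v x) x + gr (\<lambda>x. B x * v x) x"
      by (intro gr_eqI) (simp add: inner_add_left)
    then show ?thesis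
      using gr_inner_fields[OF df[OF X x] df[OF ckg(1) x], of h] gr_mult[OF df[OF ck1(2) x] df[OF ck1(1) x]]
      by (simp add: inner_add_left algebra_simps)
  qed
  have gb: "gr b x = v x *\<^sub>R gr v x"
  proof -
    have "(b has_derivative (\<lambda>h. (gr (\<lambda>x. v x * v x) x \<bullet> h) / 2)) (at x)"
      unfolding b_def using has_derivative_mult_right[OF gr_deriv[OF df[OF v2 x]], of "1/2"] by simp
    then have "gr b x = (1/2) *\<^sub>R gr (\<lambda>x. v x * v x) x" by (intro gr_eqI) (simp add: inner_add_left)
    also have "... = (1/2) *\<^sub>R (v x *\<^sub>R gr v x + v x *\<^sub>R gr v x)"
      by (simp only: gr_mult[OF df[OF ck1(1) x] df[OF ck1(1) x]])
    finally show ?thesis by (simp add: scaleR_add_right[symmetric] scaleR_2[symmetric])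
  qed
  have g2: "gr (\<lambda>x. v x * v x) x = (2 * v x) *\<^sub>R gr v x"
    using gr_mult[OF df[OF ck1(1) x] df[OF ck1(1) x]] by (simp add: scaleR_2[symmetric])
  have gd: "gr d x \<bullet> h = v x * v x * (gr E x \<bullet> h) + E x * (2 * v x * (gr v x \<bullet> h)) - 2 * (fd (gr v) x h \<bullet> gr v x)" for h
  proof -
    have "(d has_derivative (\<lambda>h. (gr (\<lambda>x. E x * (v x * v x)) x \<bullet> h) - gr (\<lambda>x. gr v x \<bullet> gr v x) x \<bullet> h)) (at x)"
      unfolding d_def by (intro has_derivative_diff gr_deriv df[OF Ev x] df[OF vv x])
    then have e: "gr d x = gr (\<lambda>x. E x * (v x * v x)) x - gr (\<lambda>x. gr v x \<bullet> gr v x) x"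
      by (intro gr_eqI) (simp add: inner_diff_left)
    show ?thesis
      using gr_inner_fields[OF df[OF ckg(1) x] df[OF ckg(1) x], of h]
      unfolding e inner_diff_left gr_mult[OF df[OF E x] df[OF v2 x]] g2
      by (simp add: inner_add_left inner_commute algebra_simps)
  qed
  have 1: "dv (\<lambda>x. a x *\<^sub>R gr v x) x = gr a x \<bullet> gr v x + a x * lap v x" by (rule dv_scaleR[OF df[OF a x] df[OF ckg(1) x]])
  have 2: "dv (\<lambda>x. b x *\<^sub>R gr B x) x = gr b x \<bullet> gr B x + b x * lap B x" by (rule dv_scaleR[OF df[OF b x] df[OF ckg(2) x]])
  have 3: "dv (\<lambda>x. d x *\<^sub>R X x) x = gr d x \<bullet> X x + d x * dv X x" by (rule dv_scaleR[OF df[OF d x] df[OF X x]])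
  have k1: "ck 1 S (\<lambda>x. a x *\<^sub>R gr v x)" "ck 1 S (\<lambda>x. b x *\<^sub>R gr B x)" "ck 1 S (\<lambda>x. d x *\<^sub>R X x)"
    by (intro c a b d)+
  have W: "W = (\<lambda>x. (a x *\<^sub>R gr v x - b x *\<^sub>R gr B x) + d x *\<^sub>R X x)"
    by (simp add: W_def a_def b_def d_def fun_eq_iff)
  have "dv W x = dv (\<lambda>x. a x *\<^sub>R gr v x - b x *\<^sub>R gr B x) x + dv (\<lambda>x. d x *\<^sub>R X x) x"
    unfolding W by (rule dv_add[OF df[OF ck_diff'[OF S k1(1,2)] x] df[OF k1(3) x]])
  also have "dv (\<lambda>x. a x *\<^sub>R gr v x - b x *\<^sub>R gr B x) x = dv (\<lambda>x. a x *\<^sub>R gr v x) x - dv (\<lambda>x. b x *\<^sub>R gr B x) x"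
    by (rule dv_diff[OF df[OF k1(1) x] df[OF k1(2) x]])
  finally have "dv W x = gr a x \<bullet> gr v x + a x * lap v x - (gr b x \<bullet> gr B x + b x * lap B x) + (gr d x \<bullet> X x + d x * dv X x)"
    by (simp only: 1 2 3)
  moreover have "fd (gr v) x (X x) \<bullet> gr v x = X x \<bullet> fd (gr v) x (gr v x)" by (rule hess_sym[OF S v x])
  ultimately show ?thesis unfolding ga gb gd
    by (simp add: a_def b_def d_def Q_def inner_commute algebra_simps)
qed

text \<open>Symmetry of the Hessian removes the second derivatives, and the two products
  \<open>(X \<bullet> gr v) * (N \<bullet> gr v)\<close> cancel as well. Every remaining summand has
  a factor \<open>v\<close>: compared with \<open>W\<close> the field is of lower order.\<close>

lemma dv_Z:
  assumes x: "x \<in> S" and N: "ck 1 S N"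
  shows "dv (Z N) x = 2 * v x * (fd X x (N x) \<bullet> gr v x - fd N x (X x) \<bullet> gr v x + (X x \<bullet> gr v x) * dv N x - (N x \<bullet> gr v x) * dv X x)
     + v x * v x * (gr B x \<bullet> N x) + 2 * B x * v x * (gr v x \<bullet> N x) + B x * (v x * v x) * dv N x"
proof -
  note c = ck_add ck_diff' ck_scaleR ck_inner ck_mult S ckg ck1 E X N ck_const
  define a where "a x = v x * (2 * (X x \<bullet> gr v x) + B x * v x)" for x
  define d where "d x = v x * (2 * (N x \<bullet> gr v x))" for x
  have Xv: "ck 1 S (\<lambda>x. X x \<bullet> gr v x)" and Nv: "ck 1 S (\<lambda>x. N x \<bullet> gr v x)" 
    and Bv: "ck 1 S (\<lambda>x. B x * v x)" and s: "ck 1 S (\<lambda>x. 2 * (X x \<bullet> gr v x) + B x * v x)" 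
    and Nv2: "ck 1 S (\<lambda>x. 2 * (N x \<bullet> gr v x))" by (intro c)+
  have a: "ck 1 S a" unfolding a_def by (intro c)
  have d: "ck 1 S d" unfolding d_def by (intro c)
  have gs: "gr (\<lambda>x. 2 * (X x \<bullet> gr v x) + B x * v x) x = 2 *\<^sub>R gr (\<lambda>x. X x \<bullet> gr v x) x + gr (\<lambda>x. B x * v x) x"
  proof -
    have "((\<lambda>x. 2 * (X x \<bullet> gr v x) + B x * v x) has_derivative (\<lambda>h. 2 * (gr (\<lambda>x. X x \<bullet> gr v x) x \<bullet> h) + gr (\<lambda>x. B x * v x) x \<bullet> h)) (at x)"
      by (intro has_derivative_add has_derivative_mult_right gr_deriv df[OF Xv x] df[OF Bv x])
    then show ?thesis by (intro gr_eqI) (simp add: inner_add_left)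
  qed
  have ga: "gr a x \<bullet> h = v x * (2 * (fd X x h \<bullet> gr v x + X x \<bullet> fd (gr v) x h) + B x * (gr v x \<bullet> h) + v x * (gr B x \<bullet> h))
      + (2 * (X x \<bullet> gr v x) + B x * v x) * (gr v x \<bullet> h)" for h
    unfolding a_def gr_mult[OF df[OF ck1(1) x] df[OF s x]] gs gr_mult[OF df[OF ck1(2) x] df[OF ck1(1) x]]
    using gr_inner_fields[OF df[OF X x] df[OF ckg(1) x], of h]
    by (simp add: inner_add_left algebra_simps)
  have gs2: "gr (\<lambda>x. 2 * (N x \<bullet> gr v x)) x = 2 *\<^sub>R gr (\<lambda>x. N x \<bullet> gr v x) x"
  proof -
    have "((\<lambda>x. 2 * (N x \<bullet> gr v x)) has_derivative (\<lambda>h. 2 * (gr (\<lambda>x. N x \<bullet> gr v x) x \<bullet> h))) (at x)"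
      by (intro has_derivative_mult_right gr_deriv df[OF Nv x])
    then show ?thesis by (intro gr_eqI) simp
  qed
  have gd: "gr d x \<bullet> h = v x * (2 * (fd N x h \<bullet> gr v x + N x \<bullet> fd (gr v) x h)) + 2 * (N x \<bullet> gr v x) * (gr v x \<bullet> h)" for h
    unfolding d_def gr_mult[OF df[OF ck1(1) x] df[OF Nv2 x]] gs2
    using gr_inner_fields[OF df[OF N x] df[OF ckg(1) x], of h]
    by (simp add: inner_add_left algebra_simps)
  have 1: "dv (\<lambda>x. a x *\<^sub>R N x) x = gr a x \<bullet> N x + a x * dv N x" by (rule dv_scaleR[OF df[OF a x] df[OF N x]])
  have 3: "dv (\<lambda>x. d x *\<^sub>R X x) x = gr d x \<bullet> X x + d x * dv X x" by (rule dv_scaleR[OF df[OF d x] df[OF X x]])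
  have k1: "ck 1 S (\<lambda>x. a x *\<^sub>R N x)" "ck 1 S (\<lambda>x. d x *\<^sub>R X x)" by (intro c a d)+
  have Z: "Z N = (\<lambda>x. a x *\<^sub>R N x - d x *\<^sub>R X x)"
    by (simp add: Z_def a_def d_def fun_eq_iff algebra_simps)
  have "dv (Z N) x = dv (\<lambda>x. a x *\<^sub>R N x) x - dv (\<lambda>x. d x *\<^sub>R X x) x"
    unfolding Z by (rule dv_diff[OF df[OF k1(1) x] df[OF k1(2) x]])
  moreover have "fd (gr v) x (X x) \<bullet> N x = X x \<bullet> fd (gr v) x (N x)" by (rule hess_sym[OF S v x])
  ultimately show ?thesis unfolding 1 3 ga gd
    by (simp add: a_def d_def inner_commute algebra_simps)
qed

end

text \<open>In the second formula \<open>lap v\<close> and the square of \<open>gr Ps\<close> form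
  the symmetric part of the conjugated operator, the other two terms its antisymmetric part.\<close>

lemma conjugated_laplacian:
  fixes w Ps :: "'a::euclidean_space \<Rightarrow> real"
  assumes S: "open S" and w: "ck 2 S w" and P: "ck 2 S Ps" and x: "x \<in> S"
    and v: "\<And>x. v x = exp (Ps x) * w x"
  shows "gr v x = exp (Ps x) *\<^sub>R (gr w x + w x *\<^sub>R gr Ps x)"
    and "lap v x + (gr Ps x \<bullet> gr Ps x) * v x - 2 * (gr Ps x \<bullet> gr v x) - v x * lap Ps x = exp (Ps x) * lap w x"
proof -
  have w1: "ck 1 S w" "ck 1 S (gr w)" and P1: "ck 1 S Ps" "ck 1 S (gr Ps)"
    using ck_mono[OF w, of 1] ck_mono[OF P, of 1] ck_gr[OF S, of 1] w P by (simp_all add: numeral_2_eq_2)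
  have df: "ck 1 S f ==> x \<in> S ==> f differentiable (at x)" for f :: "'a \<Rightarrow> 'c::real_normed_vector" and x by simp
  define e where "e x = exp (Ps x)" for x
  have ge: "(e has_derivative (\<lambda>h. (e y *\<^sub>R gr Ps y) \<bullet> h)) (at y)" if "y \<in> S" for y
    unfolding e_def
    by (rule has_derivative_eq_rhs[OF DERIV_compose_FDERIV[OF DERIV_exp gr_deriv[OF df[OF P1(1) that]]]])
       (auto simp: fun_eq_iff)
  have ed: "e differentiable (at y)" if "y \<in> S" for y using ge[OF that] by (auto simp: differentiable_def)
  have gre: "gr e y = e y *\<^sub>R gr Ps y" if "y \<in> S" for y by (rule gr_eqI[OF ge[OF that]])
  define F where "F x = gr w x + w x *\<^sub>R gr Ps x" for x
  have F: "ck 1 S F" unfolding F_def by (intro ck_add ck_scaleR S w1 P1)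
  have gv: "gr v y = e y *\<^sub>R F y" if "y \<in> S" for y
  proof -
    have "v = (\<lambda>x. e x * w x)" using v by (simp add: e_def fun_eq_iff)
    then show ?thesis using gr_mult[OF ed[OF that] df[OF w1(1) that]] gre[OF that]
      by (simp add: F_def scaleR_add_right mult.commute)
  qed
  show g: "gr v x = exp (Ps x) *\<^sub>R (gr w x + w x *\<^sub>R gr Ps x)" using gv[OF x] by (simp add: e_def F_def)
  have "dv (gr v) x = dv (\<lambda>x. e x *\<^sub>R F x) x" by (rule dv_cong_open[OF S x gv])
  also have "... = gr e x \<bullet> F x + e x * dv F x" by (rule dv_scaleR[OF ed[OF x] df[OF F x]])
  also have "dv F x = lap w x + (gr w x \<bullet> gr Ps x + w x * lap Ps x)"
  proof -
    have k: "ck 1 S (\<lambda>x. w x *\<^sub>R gr Ps x)" by (intro ck_scaleR S w1 P1)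
    show ?thesis unfolding F_def dv_add[OF df[OF w1(2) x] df[OF k x]] dv_scaleR[OF df[OF w1(1) x] df[OF P1(2) x]] ..
  qed
  finally have l: "lap v x = e x * (gr Ps x \<bullet> F x) + e x * (lap w x + (gr w x \<bullet> gr Ps x + w x * lap Ps x))"
    by (simp add: gre[OF x])
  show "lap v x + (gr Ps x \<bullet> gr Ps x) * v x - 2 * (gr Ps x \<bullet> gr v x) - v x * lap Ps x = exp (Ps x) * lap w x"
    unfolding l gv[OF x] v e_def F_def by (simp add: inner_add_right inner_commute algebra_simps)
qed

text \<open>With this \<open>X\<close> the multiplier is, up to sign, \<open>kap\<close> times the
  antisymmetric part of the conjugated operator, except that \<open>B / kap\<close> may differ from
  \<open>lap Ps\<close>. This freedom is used to share the positivity between gradient and zero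
  order terms.\<close>

locale carleman = multiplier +
  fixes w Ps kap :: "'a \<Rightarrow> real"
  assumes w: "ck 2 S w" and P: "ck 2 S Ps" and vw: "\<And>x. v x = exp (Ps x) * w x"
    and kp: "\<And>x. x \<in> S ==> kap x > 0" and XP: "\<And>x. x \<in> S ==> X x = kap x *\<^sub>R gr Ps x"
    and EP: "\<And>x. x \<in> S ==> E x = gr Ps x \<bullet> gr Ps x"
begin

text \<open>The squared conjugated operator dominates four times the product of its symmetric and
  antisymmetric parts, up to the zero order remainder.\<close>

lemma pointwise:
  assumes x: "x \<in> S"
  shows "4 * Q x \<le> 4 * dv W x + 2 * kap x * (exp (Ps x) * lap w x)\<^sup>2
     + 2 * kap x * (B x / kap x - lap Ps x)\<^sup>2 * (v x)\<^sup>2"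
proof -
  define p where "p = lap v x + E x * v x"
  define m where "m = 2 * (X x \<bullet> gr v x) + B x * v x"
  define r where "r = (B x / kap x - lap Ps x) * v x"
  define f where "f = exp (Ps x) * lap w x"
  have k: "kap x > 0" using kp[OF x] .
  have f: "f = p - m / kap x + r"
    using conjugated_laplacian(2)[OF S w P x vw] k
    by (simp add: p_def m_def r_def f_def EP[OF x] XP[OF x] field_simps)
  \<comment> \<open>Here \<open>f - r\<close> is \<open>p - m / kap x\<close>. Reversing the sign of
    \<open>m\<close> costs \<open>4 * p * m\<close> and leaves a square.\<close>
  have "kap x * (f - r)\<^sup>2 - (- 4 * p * m) = kap x * (p + m / kap x)\<^sup>2"
    using k by (simp add: f power2_eq_square field_simps)
  moreover have "kap x * (p + m / kap x)\<^sup>2 \<ge> 0" using k by simp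
  ultimately have 1: "- 4 * p * m \<le> kap x * (f - r)\<^sup>2" by linarith
  have "(f - r)\<^sup>2 \<le> 2 * f\<^sup>2 + 2 * r\<^sup>2" using zero_le_power2[of "f + r"] by (simp add: power2_sum power2_diff)
  then have "kap x * (f - r)\<^sup>2 \<le> kap x * (2 * f\<^sup>2 + 2 * r\<^sup>2)" using k by (intro mult_left_mono) auto
  with 1 have "- 4 * p * m \<le> 2 * kap x * f\<^sup>2 + 2 * kap x * r\<^sup>2" by (simp add: algebra_simps)
  moreover have "dv W x = p * m + Q x" using dv_W[OF x] by (simp add: p_def m_def)
  moreover have "2 * kap x * r\<^sup>2 = 2 * kap x * (B x / kap x - lap Ps x)\<^sup>2 * (v x)\<^sup>2"
    by (simp only: r_def power_mult_distrib mult.assoc)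
  ultimately show ?thesis unfolding f_def by linarith
qed

end

lemma ck_exp:
  fixes f :: "'a::euclidean_space \<Rightarrow> real"
  assumes "open S" "ck k S f" shows "ck k S (\<lambda>x. exp (f x))"
  using assms(2)
proof (induction k)
  case 0 then show ?case by (auto intro!: continuous_intros)
next
  case (Suc k)
  show ?case
  proof (rule ck_Suc_openI[OF assms(1) DERIV_compose_FDERIV[OF DERIV_exp ck_diff[OF Suc.prems]]], assumption)
    fix b :: 'a assume "b \<in> Basis"
    then show "ck k S (\<lambda>x. fd f x b * exp (f x))"
      using Suc ck_Suc_imp[OF Suc.prems] by (auto intro!: ck_mult[OF assms(1)])
  qed
qed

lemma ck_powr:
  fixes f :: "'a::euclidean_space \<Rightarrow> real"
  assumes "open S" "ck k S f" "\<And>x. x \<in> S ==> f x > 0" shows "ck k S (\<lambda>x. f x powr a)"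
  using assms(2)
proof (induction k arbitrary: a)
  case 0 then show ?case using assms(3) by (auto intro!: continuous_intros) (metis less_irrefl)
next
  case (Suc k)
  show ?case
  proof (rule ck_Suc_openI[OF assms(1)])
    fix x assume x: "x \<in> S"
    show "((\<lambda>x. f x powr a) has_derivative (\<lambda>h. fd f x h * (a * f x powr (a - 1)))) (at x)"
      by (rule DERIV_compose_FDERIV[OF has_real_derivative_powr ck_diff[OF Suc.prems]]) (use x assms(3) in auto)
  next
    fix b :: 'a assume "b \<in> Basis"
    then show "ck k S (\<lambda>x. fd f x b * (a * f x powr (a - 1)))"
      using Suc ck_Suc_imp[OF Suc.prems] by (auto intro!: ck_mult[OF assms(1)])
  qed
qed

lemma ck_inverse:
  fixes f :: "'a::euclidean_space \<Rightarrow> real"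
  assumes "open S" "ck k S f" "\<And>x. x \<in> S ==> f x > 0" shows "ck k S (\<lambda>x. inverse (f x))"
  by (rule ck_cong[OF assms(1) _ ck_powr[OF assms, of "-1"]]) (auto simp: powr_minus assms(3) less_imp_le)

lemma ck_ln:
  fixes f :: "'a::euclidean_space \<Rightarrow> real"
  assumes "open S" "ck k S f" "\<And>x. x \<in> S ==> f x > 0" shows "ck k S (\<lambda>x. ln (f x))"
proof (cases k)
  case 0 then show ?thesis using assms by (auto intro!: continuous_intros) (metis less_irrefl)
next
  case (Suc j)
  show ?thesis unfolding Suc
  proof (rule ck_Suc_openI[OF assms(1)])
    fix x assume x: "x \<in> S"
    show "((\<lambda>x. ln (f x)) has_derivative (\<lambda>h. fd f x h * inverse (f x))) (at x)"
      by (rule DERIV_compose_FDERIV[OF DERIV_ln ck_diff]) (use x assms Suc in auto)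
  next
    fix b :: 'a assume "b \<in> Basis"
    then show "ck j S (\<lambda>x. fd f x b * inverse (f x))"
      using assms Suc ck_Suc_imp[of j S f] by (auto intro!: ck_mult ck_inverse)
  qed
qed

lemma dv_near_identity:
  fixes F :: "'a::euclidean_space \<Rightarrow> 'a"
  assumes "\<And>h. norm (fd F x h - c *\<^sub>R h) \<le> e * norm h"
  shows "\<bar>dv F x - c * real DIM('a)\<bar> \<le> real DIM('a) * e"
proof -
  have "dv F x - c * real DIM('a) = (\<Sum>b\<in>Basis. (fd F x b - c *\<^sub>R b) \<bullet> b)"
    by (simp add: dv_def inner_diff_left sum_subtractf inner_Basis)
  also have "\<bar>...\<bar> \<le> (\<Sum>b\<in>(Basis::'a set). e)"
  proof (rule order_trans[OF sum_abs sum_mono])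
    fix b :: 'a assume b: "b \<in> Basis"
    have "\<bar>(fd F x b - c *\<^sub>R b) \<bullet> b\<bar> \<le> norm (fd F x b - c *\<^sub>R b) * norm b" by (rule Cauchy_Schwarz_ineq2)
    also have "... \<le> e" using assms[of b] b by simp
    finally show "\<bar>(fd F x b - c *\<^sub>R b) \<bullet> b\<bar> \<le> e" .
  qed
  finally show ?thesis by simp
qed

text \<open>The weight \<open>- ln q / 2 + 2 * q powr (1/4)\<close> for a function \<open>q\<close> close to the square of a distance.
  The fourth root \<open>t\<close> of \<open>q\<close> measures all errors: they are of size \<open>M * t\<^sup>2\<close>, and the convexity gained from
  the term \<open>2 * q powr (1/4)\<close> is of size \<open>t\<close>.\<close>

locale radial_weight =
  fixes S :: "'a::euclidean_space set" and q :: "'a \<Rightarrow> real" and M tau n :: real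
  assumes n: "n = real DIM('a)" and S: "open S" and q: "ck 2 S q" and qp: "\<And>x. x \<in> S ==> q x > 0"
    and M: "M \<ge> 1" and small: "\<And>x. x \<in> S ==> 100 * (n + 1) * M * q x powr (1/4) \<le> 1"
    and h1: "\<And>x. x \<in> S ==> \<bar>gr q x \<bullet> gr q x - 4 * q x\<bar> \<le> 4 * M * (q x powr (1/4))^2 * q x"
    and h2: "\<And>x h. x \<in> S ==> norm (fd (gr q) x h - 2 *\<^sub>R h) \<le> M * (q x powr (1/4))^2 * norm h"
    and tau: "tau \<ge> 16 * n"
begin

definition "t x = q x powr (1/4)"
definition "Ps x = - (tau / 2) * (ln (q x) - 4 * t x)"
definition "X x = (- (tau / 2) * (1 - t x)) *\<^sub>R gr q x"
text \<open>For the exact squared distance, \<open>q * lap Ps\<close> is this expression with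
  \<open>n - 3/2\<close> in place of \<open>n - 1\<close>. That value would yield nothing for
  gradients orthogonal to \<open>gr q\<close>, and \<open>n - 1/2\<close> would yield nothing for
  the zero order term. The midpoint gives half of the gain to each.\<close>

definition "B x = - tau * (n - 2) + tau * (n - 1) * t x"
definition "fE x = ((1 - t x) / q x)^2"
definition "E x = (tau^2 / 4) * (fE x * (gr q x \<bullet> gr q x))"

lemma n1: "n \<ge> 1" unfolding n by (simp add: Suc_leI)

lemma tau0: "tau \<ge> 16" using tau n1 by linarith

lemma tp: "x \<in> S ==> t x > 0" using qp[of x] by (simp add: t_def)

lemma t4: "x \<in> S ==> t x ^ 4 = q x" using qp[of x] by (simp add: t_def powr_power)

lemma q1: "ck 1 S q" "ck 1 S (gr q)" using ck_mono[OF q, of 1] ck_gr[OF S, of 1 q] q by (simp_all add: numeral_2_eq_2)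

lemma t2: "ck 2 S t" unfolding t_def by (rule ck_powr[OF S q qp])
lemma t1: "ck 1 S t" using ck_mono[OF t2, of 1] by simp

lemma df: "ck 1 S f ==> x \<in> S ==> f differentiable (at x)" by simp

lemma dt: "x \<in> S ==> ((\<lambda>s. s powr (1/4)) has_real_derivative t x / (4 * q x)) (at (q x))"
  using has_real_derivative_powr[OF qp, of x "1/4"] qp[of x] powr_diff[of "q x" "1/4" 1]
  by (simp add: t_def mult.commute)

lemma gt: "x \<in> S ==> gr t x = (t x / (4 * q x)) *\<^sub>R gr q x"
  unfolding t_def[abs_def] using gr_compose[of "\<lambda>s. s powr (1/4)" _ q x, OF dt df[OF q1(1)]]
  by (simp add: t_def)

lemma gPsi: assumes x: "x \<in> S" shows "gr Ps x = (- (tau / 2) * ((1 - t x) / q x)) *\<^sub>R gr q x"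
proof -
  have "((\<lambda>s. - (tau / 2) * (ln s - 4 * s powr (1/4))) has_real_derivative - (tau / 2) * (inverse (q x) - 4 * (t x / (4 * q x)))) (at (q x))"
    by (intro DERIV_cmult DERIV_diff DERIV_ln dt x qp)
  from gr_compose[OF this df[OF q1(1) x]] show ?thesis
    unfolding Ps_def[abs_def] t_def[symmetric] using qp[OF x]
    by (simp add: t_def[symmetric] field_simps)
qed

lemma Psi2: "ck 2 S Ps"
  unfolding Ps_def[abs_def] by (intro ck_mult ck_diff' ck_ln ck_const S q qp t2)

lemma X1: "ck 1 S X"
  unfolding X_def[abs_def] by (intro ck_mult ck_scaleR ck_diff' ck_const S q1 t1)

lemma B2: "ck 2 S B"
  unfolding B_def[abs_def] by (intro ck_mult ck_add ck_const S t2)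

lemma fE1: "ck 1 S fE"
  unfolding fE_def[abs_def] divide_inverse by (intro ck_power ck_mult ck_diff' ck_const ck_inverse S q1 t1 qp)

lemma E1: "ck 1 S E"
  unfolding E_def[abs_def] by (intro ck_mult ck_inner ck_const fE1 S q1)

lemma EPsi: "x \<in> S ==> E x = gr Ps x \<bullet> gr Ps x"
  by (simp add: E_def fE_def gPsi power2_eq_square)

lemma XPsi: "x \<in> S ==> X x = q x *\<^sub>R gr Ps x"
  using qp[of x] by (simp add: X_def gPsi)

text \<open>For the exact squared distance \<open>al\<close> is 1 and \<open>l\<close> is 0; all
  errors are expressed through these two quantities and the Hessian.\<close>

definition "al x = (gr q x \<bullet> gr q x) / (4 * q x)"
definition "l x = lap q x - 2 * n"

lemma a_eq: "x \<in> S ==> gr q x \<bullet> gr q x = 4 * q x * al x" using qp[of x] by (simp add: al_def)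

text \<open>The smallness assumption turns each error \<open>M * t^2\<close>, even multiplied by the
  dimension, into at most \<open>t / 100\<close>, a small fraction of the convexity gain.\<close>

lemma bounds:
  assumes x: "x \<in> S"
  shows "0 < t x" "t x \<le> 1/100" "M * (t x)^2 \<le> t x / 100" "\<bar>al x - 1\<bar> \<le> t x / 100" "\<bar>l x\<bar> \<le> t x / 100"
    "0 < q x" "q x \<le> 1"
proof -
  show tx: "0 < t x" by (rule tp[OF x])
  show qx: "0 < q x" by (rule qp[OF x])
  have s: "100 * (n + 1) * M * t x \<le> 1" using small[OF x] by (simp add: t_def)
  have "100 * 2 * 1 * t x \<le> 100 * (n + 1) * M * t x"
    using n1 M tx by (intro mult_right_mono mult_mono) auto
  with s show t100: "t x \<le> 1/100" by simp
  have nM: "n * (M * (t x)^2) \<le> t x / 100"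
  proof -
    have "100 * n * M * t x \<le> 100 * (n + 1) * M * t x" using M tx by (intro mult_right_mono) auto
    then have "(100 * n * M * t x) * t x \<le> 1 * t x" using s tx by (intro mult_right_mono) auto
    then show ?thesis by (simp add: power2_eq_square algebra_simps)
  qed
  have "1 * (M * (t x)^2) \<le> n * (M * (t x)^2)" using n1 M by (intro mult_right_mono) auto
  with nM show M2: "M * (t x)^2 \<le> t x / 100" by simp
  have "\<bar>4 * q x * (al x - 1)\<bar> \<le> 4 * q x * (M * (t x)^2)"
    using h1[OF x] by (simp add: a_eq[OF x] t_def[symmetric] algebra_simps)
  then have "\<bar>al x - 1\<bar> \<le> M * (t x)^2" using qx by (simp add: abs_mult)
  with M2 show "\<bar>al x - 1\<bar> \<le> t x / 100" by simp
  have "\<bar>lap q x - 2 * n\<bar> \<le> n * (M * (t x)^2)" 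
    using dv_near_identity[of "gr q" x 2 "M * (t x)^2"] h2[OF x] by (simp add: t_def n mult.commute)
  with nM show "\<bar>l x\<bar> \<le> t x / 100" by (simp add: l_def)
  have "t x ^ 4 \<le> 1 ^ 4" using tx t100 by (intro power_mono) auto
  then show "q x \<le> 1" using t4[OF x] by simp
qed

lemma fdX:
  assumes x: "x \<in> S"
  shows "fd X x h = (- (tau / 2)) *\<^sub>R ((1 - t x) *\<^sub>R fd (gr q) x h - (t x / (4 * q x) * (gr q x \<bullet> h)) *\<^sub>R gr q x)"
proof -
  have "((\<lambda>x. - (tau / 2) * (1 - t x)) has_derivative (\<lambda>h. - (tau / 2) * (0 - gr t x \<bullet> h))) (at x)"
    by (intro has_derivative_mult_right has_derivative_diff has_derivative_const gr_deriv df[OF t1 x])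
  from has_derivative_scaleR[OF this differentiable_fd[OF df[OF q1(2) x]]]
  show ?thesis unfolding X_def[abs_def]
    by (subst fd_eqI, assumption) (simp add: gt[OF x] scaleR_diff_right scaleR_right_diff_distrib)
qed

lemma dv_radial:
  assumes x: "x \<in> S" and k: "(k has_real_derivative k') (at (q x))" and F: "\<And>y. y \<in> S ==> F y = k (q y) *\<^sub>R gr q y"
  shows "dv F x = k (q x) * (2 * n + l x) + k' * (4 * q x * al x)"
proof -
  have "((\<lambda>x. k (q x)) has_derivative (\<lambda>h. (gr q x \<bullet> h) * k')) (at x)"
    by (rule DERIV_compose_FDERIV[OF k gr_deriv[OF df[OF q1(1) x]]])
  then have dd: "(\<lambda>x. k (q x)) differentiable (at x)" by (auto simp: differentiable_def)
  have gk: "gr (\<lambda>x. k (q x)) x = k' *\<^sub>R gr q x" by (rule gr_compose[OF k df[OF q1(1) x]])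
  have "dv F x = dv (\<lambda>x. k (q x) *\<^sub>R gr q x) x" by (rule dv_cong_open[OF S x F])
  also have "... = k' * (gr q x \<bullet> gr q x) + k (q x) * lap q x"
    using dv_scaleR[OF dd df[OF q1(2) x]] by (simp add: gk)
  finally show ?thesis by (simp add: a_eq[OF x] l_def)
qed

lemma dvX:
  assumes x: "x \<in> S"
  shows "dv X x = - (tau / 2) * ((1 - t x) * (2 * n + l x) - t x * al x)"
proof -
  have "((\<lambda>s. - (tau / 2) * (1 - s powr (1/4))) has_real_derivative - (tau / 2) * (0 - t x / (4 * q x))) (at (q x))"
    by (intro DERIV_cmult DERIV_diff DERIV_const dt x)
  from dv_radial[OF x this, of X] show ?thesis
    using qp[OF x] by (simp add: X_def t_def[symmetric] field_simps)
qed

lemma hess_upper: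
  assumes x: "x \<in> S"
  shows "fd (gr q) x h \<bullet> h \<le> (2 + t x / 100) * (h \<bullet> h)" and "norm (fd (gr q) x h) \<le> 3 * norm h"
proof -
  have 1: "norm (fd (gr q) x h - 2 *\<^sub>R h) \<le> (t x / 100) * norm h"
    using h2[OF x, of h] bounds(3)[OF x] mult_right_mono[OF bounds(3)[OF x], of "norm h"]
    by (simp add: t_def)
  have "(fd (gr q) x h - 2 *\<^sub>R h) \<bullet> h \<le> norm (fd (gr q) x h - 2 *\<^sub>R h) * norm h" by (rule norm_cauchy_schwarz)
  also have "... \<le> (t x / 100) * norm h * norm h" using 1 by (intro mult_right_mono) auto
  finally show "fd (gr q) x h \<bullet> h \<le> (2 + t x / 100) * (h \<bullet> h)"
    by (simp add: inner_diff_left dot_square_norm power2_eq_square algebra_simps)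
  have "norm (fd (gr q) x h) \<le> norm (fd (gr q) x h - 2 *\<^sub>R h) + norm (2 *\<^sub>R h)" by norm
  also have "... \<le> (t x / 100 + 2) * norm h" using 1 by (simp add: algebra_simps)
  also have "... \<le> 3 * norm h" using bounds(2)[OF x] by (intro mult_right_mono) auto
  finally show "norm (fd (gr q) x h) \<le> 3 * norm h" .
qed

text \<open>For the exact squared distance the form is at least \<open>tau * t / 2\<close> times
  \<open>g \<bullet> g\<close>, the radial square being dropped; the errors use up less than half of
  this.\<close>

lemma gradient_part:
  assumes x: "x \<in> S"
  shows "2 * (fd X x g \<bullet> g) + (B x - dv X x) * (g \<bullet> g) \<ge> tau * (t x / 4) * (g \<bullet> g)"
proof -
  note b = bounds[OF x]
  have "2 * (fd X x g \<bullet> g) = - tau * ((1 - t x) * (fd (gr q) x g \<bullet> g)) + tau * (t x / (4 * q x) * (gr q x \<bullet> g)^2)"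
    unfolding fdX[OF x] by (simp add: inner_diff_left power2_eq_square algebra_simps)
  moreover have "tau * (t x / (4 * q x) * (gr q x \<bullet> g)^2) \<ge> 0" using tau0 b by (intro mult_nonneg_nonneg) auto
  moreover have "tau * ((1 - t x) * (fd (gr q) x g \<bullet> g)) \<le> tau * ((1 - t x) * ((2 + t x / 100) * (g \<bullet> g)))"
    using tau0 b hess_upper(1)[OF x, of g] by (intro mult_left_mono) auto
  ultimately have 1: "2 * (fd X x g \<bullet> g) \<ge> - tau * ((1 - t x) * ((2 + t x / 100) * (g \<bullet> g)))" by linarith
  have e: "B x - dv X x = tau * (2 - t x + (1 - t x) * l x / 2 - t x * al x / 2)"
    unfolding B_def dvX[OF x] by (simp add: field_simps)
  have c: "- ((1 - t x) * (2 + t x / 100)) + (2 - t x + (1 - t x) * l x / 2 - t x * al x / 2) \<ge> t x / 4"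
  proof -
    have "(1 - t x) * l x \<ge> (1 - t x) * (- (t x / 100))" using b(1,2,5) by (intro mult_left_mono) (auto simp: abs_le_iff)
    moreover have "(1 - t x) * (- (t x / 100)) \<ge> - (t x / 100)" using b by (simp add: algebra_simps)
    moreover have "t x * al x \<le> t x * (1 + 1/100)" 
    proof (rule mult_left_mono)
      show "al x \<le> 1 + 1/100" using b(2,4) by linarith
    qed (use b in auto)
    moreover have "(1 - t x) * (2 + t x / 100) \<le> 2 - 2 * t x + t x / 100" using b by (simp add: algebra_simps)
    ultimately show ?thesis using b(1,2) by argo
  qed
  have "tau * (g \<bullet> g) * (t x / 4) \<le> tau * (g \<bullet> g) * (- ((1 - t x) * (2 + t x / 100)) + (2 - t x + (1 - t x) * l x / 2 - t x * al x / 2))"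
    using c tau0 by (intro mult_left_mono) auto
  also have "... = - tau * ((1 - t x) * ((2 + t x / 100) * (g \<bullet> g))) + tau * (2 - t x + (1 - t x) * l x / 2 - t x * al x / 2) * (g \<bullet> g)"
    by (simp add: field_simps)
  moreover have "tau * (t x / 4) * (g \<bullet> g) = tau * (g \<bullet> g) * (t x / 4)" by simp
  ultimately show ?thesis using 1 unfolding e by linarith
qed


lemma dk: "x \<in> S ==> ((\<lambda>s. (1 - s powr (1/4)) / s) has_real_derivative - (1 - 3/4 * t x) / (q x)^2) (at (q x))"
  by (rule DERIV_cong[OF DERIV_divide[OF DERIV_diff[OF DERIV_const dt] DERIV_ident]])
     (use qp[of x] in \<open>auto simp: t_def[symmetric] power2_eq_square field_simps\<close>)

lemma gfE:
  assumes x: "x \<in> S"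
  shows "gr fE x = (- 2 * (1 - t x) * (1 - 3/4 * t x) / q x ^ 3) *\<^sub>R gr q x"
proof -
  have "gr fE x = (2 * (- (1 - 3/4 * t x) / (q x)^2 * ((1 - t x) / q x))) *\<^sub>R gr q x"
    using gr_compose[OF DERIV_power[OF dk[OF x], of 2] df[OF q1(1) x]] by (simp add: fE_def[abs_def] t_def)
  also have "2 * (- (1 - 3/4 * t x) / (q x)^2 * ((1 - t x) / q x)) = - 2 * (1 - t x) * (1 - 3/4 * t x) / q x ^ 3"
    using qp[OF x] by (simp add: field_simps power2_eq_square power3_eq_cube)
  finally show ?thesis .
qed

lemma gE:
  assumes x: "x \<in> S"
  shows "gr E x \<bullet> h = (tau^2 / 4) * ((gr fE x \<bullet> h) * (gr q x \<bullet> gr q x) + fE x * (2 * (fd (gr q) x h \<bullet> gr q x)))"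
proof -
  have k: "ck 1 S (\<lambda>x. gr q x \<bullet> gr q x)" by (intro ck_inner S q1)
  have k2: "ck 1 S (\<lambda>x. fE x * (gr q x \<bullet> gr q x))" by (intro ck_mult S fE1 k)
  have "(E has_derivative (\<lambda>h. (tau^2 / 4) * (gr (\<lambda>x. fE x * (gr q x \<bullet> gr q x)) x \<bullet> h))) (at x)"
    unfolding E_def[abs_def] by (intro has_derivative_mult_right gr_deriv df[OF k2 x])
  then have "gr E x = (tau^2 / 4) *\<^sub>R gr (\<lambda>x. fE x * (gr q x \<bullet> gr q x)) x" by (intro gr_eqI) simp
  then show ?thesis
    using gr_inner_fields[OF df[OF q1(2) x] df[OF q1(2) x], of h]
    by (simp add: gr_mult[OF df[OF fE1 x] df[OF k x]] inner_add_left inner_commute algebra_simps)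
qed

lemma gB: "x \<in> S ==> gr B x = (tau * (n - 1) * (t x / (4 * q x))) *\<^sub>R gr q x"
proof -
  assume x: "x \<in> S"
  have "(B has_derivative (\<lambda>h. 0 + tau * (n - 1) * (gr t x \<bullet> h))) (at x)"
    unfolding B_def[abs_def]
    by (intro has_derivative_add has_derivative_const has_derivative_mult_right gr_deriv df[OF t1 x])
  then have "gr B x = (tau * (n - 1)) *\<^sub>R gr t x" by (intro gr_eqI) simp
  then show ?thesis by (simp add: gt[OF x])
qed

lemma lapB:
  assumes x: "x \<in> S"
  shows "lap B x = tau * (n - 1) * (t x / (4 * q x)) * (2 * n + l x - 3 * al x)"
proof -
  have "((\<lambda>s. s powr (1/4) / (4 * s)) has_real_derivative (- 3 * t x / (16 * (q x)^2))) (at (q x))"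
    by (rule DERIV_cong[OF DERIV_divide[OF dt[OF x] DERIV_cmult[OF DERIV_ident, of 4]]])
       (use qp[OF x] in \<open>auto simp: t_def[symmetric] field_simps power2_eq_square\<close>)
  from dv_radial[OF x DERIV_cmult[OF this, of "tau * (n - 1)"], of "gr B"]
  have "lap B x = tau * (n - 1) * (t x / (4 * q x)) * (2 * n + l x) + tau * (n - 1) * (- 3 * t x / (16 * (q x)^2)) * (4 * q x * al x)"
    by (simp add: gB t_def)
  also have "... = tau * (n - 1) * (t x / (4 * q x)) * (2 * n + l x - 3 * al x)"
    using qp[OF x] by (simp add: field_simps power2_eq_square)
  finally show ?thesis .
qed

lemma lapPsi:
  assumes x: "x \<in> S"
  shows "q x * lap Ps x = - (tau / 2) * ((1 - t x) * (2 * n + l x) - (1 - 3/4 * t x) * (4 * al x))"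
proof -
  have "lap Ps x = - (tau / 2) * ((1 - t x) / q x) * (2 * n + l x) + - (tau / 2) * (- (1 - 3/4 * t x) / (q x)^2) * (4 * q x * al x)"
    using dv_radial[OF x DERIV_cmult[OF dk[OF x], of "- (tau / 2)"], of "gr Ps"] by (simp add: gPsi t_def)
  then show ?thesis using qp[OF x] by (simp only:) (simp add: field_simps power2_eq_square)
qed

text \<open>\<open>B - q * lap Ps\<close> has size \<open>tau * t\<close>, so the remainder is of
  order \<open>tau^2\<close> and the zero order gain of order \<open>tau^3\<close> can absorb
  it.\<close>

lemma remainder_part:
  assumes x: "x \<in> S"
  shows "q x * (B x / q x - lap Ps x)\<^sup>2 \<le> tau\<^sup>2 * (t x / q x)"
proof -
  note b = bounds[OF x]
  have "q x * (B x / q x - lap Ps x) = B x - q x * lap Ps x" using b by (simp add: field_simps)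
  also have "... = tau * (2 - t x + (1 - t x) * l x / 2 - 2 * (1 - 3/4 * t x) * al x)"
    unfolding lapPsi[OF x] B_def by (simp add: field_simps)
  finally have e: "q x * (B x / q x - lap Ps x) = tau * (2 - t x + (1 - t x) * l x / 2 - 2 * (1 - 3/4 * t x) * al x)" .
  have "\<bar>2 - t x + (1 - t x) * l x / 2 - 2 * (1 - 3/4 * t x) * al x\<bar> \<le> 2 * t x"
  proof -
    have 1: "\<bar>(1 - t x) * l x\<bar> \<le> 1 * (t x / 100)" unfolding abs_mult using b by (intro mult_mono) auto
    have 2: "\<bar>(1 - 3/4 * t x) * (al x - 1)\<bar> \<le> 1 * (t x / 100)" unfolding abs_mult using b by (intro mult_mono) auto
    have "2 - t x + (1 - t x) * l x / 2 - 2 * (1 - 3/4 * t x) * al x = 1/2 * t x + (1 - t x) * l x / 2 - 2 * ((1 - 3/4 * t x) * (al x - 1))"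
      by (simp add: field_simps)
    with 1 2 b(1) show ?thesis by linarith
  qed
  then have "\<bar>q x * (B x / q x - lap Ps x)\<bar> \<le> tau * (2 * t x)" unfolding e abs_mult using tau0 by (simp add: mult_left_mono)
  then have "\<bar>q x * (B x / q x - lap Ps x)\<bar>\<^sup>2 \<le> (tau * (2 * t x))\<^sup>2" by (rule power_mono) simp
  then have "(q x * (B x / q x - lap Ps x))\<^sup>2 \<le> tau\<^sup>2 * (4 * (t x)\<^sup>2)" by (simp add: power_mult_distrib)
  also have "... \<le> tau\<^sup>2 * t x" using b(1,2) by (intro mult_left_mono) (auto simp: power2_eq_square)
  finally have "(q x * (B x / q x - lap Ps x))\<^sup>2 / q x \<le> tau\<^sup>2 * t x / q x" using b by (simp add: divide_right_mono)
  moreover have "(q x * y)\<^sup>2 / q x = q x * y\<^sup>2" for y using b by (simp add: power2_eq_square)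
  ultimately show ?thesis by (simp only: times_divide_eq_right)
qed

text \<open>The terms of order \<open>tau^3\<close> have the common factor \<open>K * p\<close>, and
  in \<open>U + V\<close> the constants 2 and -2 cancel, which leaves \<open>t / 2\<close> up to
  errors. \<open>lap B\<close> is linear in \<open>tau\<close> and is absorbed by
  \<open>tau \<ge> 16 * n\<close>.\<close>

lemma zero_order_part:
  assumes x: "x \<in> S"
  shows "gr E x \<bullet> X x + E x * (dv X x - B x) - lap B x / 2 \<ge> tau^3 * (t x / (16 * q x))"
proof -
  note b = bounds[OF x]
  define p where "p = gr q x \<bullet> gr q x"
  define A where "A = fd (gr q) x (gr q x) \<bullet> gr q x"
  have p: "p = 4 * q x * al x" using a_eq[OF x] by (simp add: p_def)
  have al: "al x > 0" "al x \<ge> 99/100" using b(2,4) by linarith+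
  have p0: "p > 0" using p b al by simp
  have A: "A \<le> (2 + t x / 100) * p" using hess_upper(1)[OF x] by (simp add: A_def p_def)
  have fX: "fd (gr q) x (X x) = (- (tau / 2) * (1 - t x)) *\<^sub>R fd (gr q) x (gr q x)"
    unfolding X_def by (rule linear_scale[OF fd_linear[OF df[OF q1(2) x]]])
  have "gr E x \<bullet> X x = (tau^2 / 4) * ((gr fE x \<bullet> X x) * p + fE x * (2 * (- (tau / 2) * (1 - t x) * A)))"
    unfolding gE[OF x] fX by (simp add: p_def A_def)
  also have "gr fE x \<bullet> X x = (- 2 * (1 - t x) * (1 - 3/4 * t x) / q x ^ 3) * (- (tau / 2) * (1 - t x)) * p"
    unfolding gfE[OF x] X_def by (simp only: inner_scaleR_left inner_scaleR_right p_def mult_ac)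
  also have "(tau^2 / 4) * ((- 2 * (1 - t x) * (1 - 3/4 * t x) / q x ^ 3) * (- (tau / 2) * (1 - t x)) * p * p + fE x * (2 * (- (tau / 2) * (1 - t x) * A))) = (tau^3 / 4) * fE x * ((1 - 3/4 * t x) * p * (p / q x) - (1 - t x) * A)"
    using b(6) by (simp add: fE_def power2_eq_square power3_eq_cube field_simps)
  also have "p / q x = 4 * al x" using p b(6) by simp
  finally have g: "gr E x \<bullet> X x = (tau^3 / 4) * fE x * ((1 - 3/4 * t x) * p * (4 * al x) - (1 - t x) * A)" .
  have "(1 - t x) * A \<le> (1 - t x) * ((2 + t x / 100) * p)" using A b by (intro mult_left_mono) auto
  then have "(1 - 3/4 * t x) * p * (4 * al x) - (1 - t x) * A \<ge> p * (4 * al x * (1 - 3/4 * t x) - (1 - t x) * (2 + t x / 100))"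
    by (simp add: algebra_simps)
  then have g': "gr E x \<bullet> X x \<ge> (tau^3 / 4) * fE x * (p * (4 * al x * (1 - 3/4 * t x) - (1 - t x) * (2 + t x / 100)))"
    unfolding g using tau0 by (intro mult_left_mono) (auto simp: fE_def)
  have e2: "E x * (dv X x - B x) = (tau^3 / 4) * fE x * (p * (- (1 - t x) * (2 * n + l x) / 2 + t x * al x / 2 + (n - 2) - (n - 1) * t x))"
    unfolding E_def dvX[OF x] B_def p_def[symmetric] by (simp add: power2_eq_square power3_eq_cube field_simps)
  define U where "U = 4 * al x * (1 - 3/4 * t x) - (1 - t x) * (2 + t x / 100)"
  define V where "V = - (1 - t x) * (2 * n + l x) / 2 + t x * al x / 2 + (n - 2) - (n - 1) * t x"
  define K where "K = (tau^3 / 4) * fE x"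
  have K0: "K \<ge> 0" using tau0 by (simp add: K_def fE_def)
  have c: "(4 * al x * (1 - 3/4 * t x) - (1 - t x) * (2 + t x / 100)) + (- (1 - t x) * (2 * n + l x) / 2 + t x * al x / 2 + (n - 2) - (n - 1) * t x) \<ge> t x / 4"
  proof -
    have 1: "\<bar>(1 - t x) * l x\<bar> \<le> 1 * (t x / 100)" unfolding abs_mult using b by (intro mult_mono) auto
    have 2: "\<bar>(4 - 5/2 * t x) * (al x - 1)\<bar> \<le> 4 * (t x / 100)" unfolding abs_mult using b by (intro mult_mono) auto
    have "(4 * al x * (1 - 3/4 * t x) - (1 - t x) * (2 + t x / 100)) + (- (1 - t x) * (2 * n + l x) / 2 + t x * al x / 2 + (n - 2) - (n - 1) * t x)
       = t x / 2 + (4 - 5/2 * t x) * (al x - 1) - (1 - t x) * l x / 2 - (1 - t x) * (t x / 100)"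
      by (simp add: field_simps)
    moreover have "(1 - t x) * (t x / 100) \<le> t x / 100" using b(1) by (simp add: algebra_simps)
    ultimately show ?thesis using 1 2 b(1) by linarith
  qed
  have "K * (p * (t x / 4)) \<le> K * (p * (U + V))"
    using c p0 K0 unfolding U_def V_def by (intro mult_left_mono) auto
  also have "... = K * (p * U) + K * (p * V)" by (simp only: distrib_left)
  also have "... \<le> gr E x \<bullet> X x + E x * (dv X x - B x)" using g' e2 unfolding U_def V_def K_def by linarith
  finally have s1: "gr E x \<bullet> X x + E x * (dv X x - B x) \<ge> (tau^3 / 4) * fE x * (p * (t x / 4))" by (simp only: K_def)
  have y: "(1 - t x)^2 * al x \<ge> 1/2"
  proof -
    have "(99/100)^2 * (99/100) \<le> (1 - t x)^2 * al x" using b(1,2) al by (intro mult_mono power_mono) auto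
    then show ?thesis by (simp add: power2_eq_square)
  qed
  have "tau^3 * (t x / q x) / 8 = tau^3 * (t x / (4 * q x)) * (1/2)" by simp
  also have "... \<le> tau^3 * (t x / (4 * q x)) * ((1 - t x)^2 * al x)"
    using b tau0 y by (intro mult_left_mono) auto
  also have "... = (tau^3 / 4) * fE x * (p * (t x / 4))"
    using b(6) by (simp add: fE_def p power2_eq_square field_simps)
  also note s1
  finally have s2: "tau^3 * (t x / q x) / 8 \<le> gr E x \<bullet> X x + E x * (dv X x - B x)" .
  have s3: "lap B x / 2 \<le> tau^3 * (t x / q x) / 16"
  proof -
    have "lap B x \<le> tau * (n - 1) * (t x / (4 * q x)) * (3 * n)"
      unfolding lapB[OF x]
    proof (rule mult_left_mono)
      show "2 * n + l x - 3 * al x \<le> 3 * n" using b(2,5) al n1 by linarith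
    qed (use b tau0 n1 in auto)
    also have "... \<le> tau * n * (t x / (4 * q x)) * (3 * n)"
      using b tau0 n1 by (intro mult_right_mono mult_left_mono) auto
    finally have "lap B x / 2 \<le> tau * n * (t x / (4 * q x)) * (3 * n) / 2" by (rule divide_right_mono) simp
    also have "... = tau * (t x / q x) * (3/8 * n^2)" by (simp add: power2_eq_square mult_ac)
    also have "... \<le> tau * (t x / q x) * (tau^2 / 16)"
    proof (rule mult_left_mono)
      have "(16 * n)^2 \<le> tau^2" using tau n1 by (intro power_mono) auto
      then have "256 * n^2 \<le> tau^2" by (simp add: power_mult_distrib)
      then show "3/8 * n^2 \<le> tau^2 / 16" using zero_le_power2[of n] by linarith
    qed (use b tau0 in auto)
    finally show ?thesis by (simp add: power2_eq_square power3_eq_cube)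
  qed
  define z where "z = tau^3 * (t x / q x)"
  have "tau^3 * (t x / (16 * q x)) = z / 16" by (simp add: z_def)
  then show ?thesis using s2 s3 unfolding z_def[symmetric] by linarith
qed

end

text \<open>The field \<open>Z\<close> carries the part of the boundary term that is proportional to \<open>sig\<close>; its divergence contains
  no second derivatives.\<close>

locale radial_carleman = radial_weight S q M tau n
  for S :: "'a::euclidean_space set" and q M tau n +
  fixes w :: "'a \<Rightarrow> real" and N :: "'a \<Rightarrow> 'a" and sig K :: real
  assumes w: "ck 2 S w" and N: "ck 1 S N" and K: "K \<ge> 1" and sigma: "sig \<ge> 0"
    and N1: "\<And>x. x \<in> S ==> norm (N x) \<le> K" and N2: "\<And>x h. x \<in> S ==> norm (fd N x h) \<le> K * norm h"
    and tau_sigma: "tau \<ge> 640 * n^2 * K * (1 + sig)"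
begin

definition "v x = exp (Ps x) * w x"

lemma v2: "ck 2 S v" unfolding v_def by (intro ck_mult ck_exp S w Psi2)

sublocale carleman S v B E X w Ps q
  by unfold_locales (use S v2 B2 E1 X1 w Psi2 qp XPsi EPsi in \<open>auto simp: v_def\<close>)

lemma dvN: assumes x: "x \<in> S" shows "\<bar>dv N x\<bar> \<le> n * K"
  using dv_near_identity[of N x 0 K] N2[OF x] by (simp add: n mult.commute)

lemma sizes:
  assumes x: "x \<in> S"
  shows "norm (gr q x) \<le> 3 * (t x)^2" "norm (X x) \<le> 2 * tau" "norm (fd X x h) \<le> 2 * tau * norm h" "\<bar>dv X x\<bar> \<le> 2 * n * tau"
    "\<bar>B x\<bar> \<le> 2 * n * tau" "norm (gr B x) \<le> n * tau / t x"
proof -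
  note b = bounds[OF x]
  have al: "al x \<le> 2" and al0: "0 \<le> al x" using b(2,4) by linarith+
  have "(norm (gr q x))^2 = 4 * q x * al x" using a_eq[OF x] by (simp add: dot_square_norm)
  also have "... \<le> 9 * q x" using al b(6) mult_left_mono[of "al x" 2 "4 * q x"] by simp
  also have "... = (3 * (t x)^2)^2" using t4[OF x] by (simp add: power_mult_distrib power_mult[symmetric])
  finally show g: "norm (gr q x) \<le> 3 * (t x)^2" by (rule power2_le_imp_le) simp
  have tt: "(t x)^2 \<le> 1 / 10000" using power_mono[OF b(2), of 2] b(1) by (simp add: power2_eq_square)
  then have g1: "norm (gr q x) \<le> 1" using g by simp
  have c: "\<bar>tau / 2 * (1 - t x)\<bar> \<le> tau / 2" using b tau0 by (simp add: abs_mult mult_left_le)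
  have "norm (X x) = \<bar>tau / 2 * (1 - t x)\<bar> * norm (gr q x)" by (simp add: X_def abs_mult)
  also have "... \<le> tau / 2 * 1" using c g1 tau0 by (intro mult_mono) auto
  finally show "norm (X x) \<le> 2 * tau" using tau0 by simp
  have "norm ((1 - t x) *\<^sub>R fd (gr q) x h - (t x / (4 * q x) * (gr q x \<bullet> h)) *\<^sub>R gr q x) \<le>
     norm ((1 - t x) *\<^sub>R fd (gr q) x h) + norm ((t x / (4 * q x) * (gr q x \<bullet> h)) *\<^sub>R gr q x)" by (rule norm_triangle_ineq4)
  also have "norm ((1 - t x) *\<^sub>R fd (gr q) x h) \<le> 1 * (3 * norm h)"
    unfolding norm_scaleR using b hess_upper(2)[OF x, of h] by (intro mult_mono) auto
  also have "norm ((t x / (4 * q x) * (gr q x \<bullet> h)) *\<^sub>R gr q x) \<le> 1 * norm h"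
  proof -
    have "norm ((t x / (4 * q x) * (gr q x \<bullet> h)) *\<^sub>R gr q x) = t x / (4 * q x) * \<bar>gr q x \<bullet> h\<bar> * norm (gr q x)"
      using b by (simp add: abs_mult)
    also have "... \<le> t x / (4 * q x) * (norm (gr q x) * norm h) * norm (gr q x)"
      using b Cauchy_Schwarz_ineq2[of "gr q x" h] by (intro mult_right_mono mult_left_mono) auto
    also have "... = t x / (4 * q x) * (norm (gr q x))^2 * norm h" by (simp add: power2_eq_square)
    also have "... = t x * al x * norm h" using b by (simp add: a_eq[OF x] dot_square_norm[symmetric])
    also have "... \<le> (1/100 * 2) * norm h" using b al al0 by (intro mult_right_mono mult_mono) auto
    also have "... \<le> 1 * norm h" by (intro mult_right_mono) auto
    finally show ?thesis .
  qed
  finally have "norm ((1 - t x) *\<^sub>R fd (gr q) x h - (t x / (4 * q x) * (gr q x \<bullet> h)) *\<^sub>R gr q x) \<le> 4 * norm h" by simp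
  then have "tau / 2 * norm ((1 - t x) *\<^sub>R fd (gr q) x h - (t x / (4 * q x) * (gr q x \<bullet> h)) *\<^sub>R gr q x) \<le> tau / 2 * (4 * norm h)"
    using tau0 by (intro mult_left_mono) auto
  then show "norm (fd X x h) \<le> 2 * tau * norm h" unfolding fdX[OF x] norm_scaleR using tau0 by simp
  have 1: "\<bar>(1 - t x) * (2 * n + l x)\<bar> \<le> 1 * (2 * n + 1)" unfolding abs_mult
    using b n1 by (intro mult_mono) (auto simp: abs_le_iff)
  have 2: "\<bar>t x * al x\<bar> \<le> 1/100 * 2" unfolding abs_mult using b(1,2) al al0 by (intro mult_mono) auto
  have "\<bar>dv X x\<bar> = tau / 2 * \<bar>(1 - t x) * (2 * n + l x) - t x * al x\<bar>" unfolding dvX[OF x] using tau0 by (simp add: abs_mult)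
  also have "... \<le> tau / 2 * (4 * n)" using 1 2 n1 tau0 by (intro mult_left_mono) auto
  finally show "\<bar>dv X x\<bar> \<le> 2 * n * tau" by (simp add: mult_ac)
  have "\<bar>(n - 1) * t x\<bar> \<le> n * 1" unfolding abs_mult using b n1 by (intro mult_mono) auto
  then have "\<bar>- (n - 2) + (n - 1) * t x\<bar> \<le> 2 * n" using n1 by linarith
  then have "tau * \<bar>- (n - 2) + (n - 1) * t x\<bar> \<le> tau * (2 * n)" using tau0 by (intro mult_left_mono) auto
  moreover have "B x = tau * (- (n - 2) + (n - 1) * t x)" by (simp add: B_def algebra_simps)
  ultimately show "\<bar>B x\<bar> \<le> 2 * n * tau" using tau0 by (simp add: abs_mult)
  have "norm (gr B x) = tau * (n - 1) * (t x / (4 * q x)) * norm (gr q x)"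
    using b tau0 n1 by (simp add: gB[OF x] abs_mult)
  also have "... \<le> tau * n * (t x / (4 * q x)) * (3 * (t x)^2)"
    using b tau0 n1 g by (intro mult_mono) auto
  also have "... = tau * n * (3 / 4) / t x" using b t4[OF x, symmetric] by (simp add: field_simps eval_nat_numeral)
  also have "... \<le> n * tau / t x" using b tau0 n1 by (intro divide_right_mono) auto
  finally show "norm (gr B x) \<le> n * tau / t x" .
qed

text \<open>The division by \<open>t\<close> comes from \<open>gr B\<close>: since
  \<open>t^4 = q\<close>, the gradient of \<open>t\<close> has size \<open>1 / t\<close>.\<close>

lemma dvZ_bound:
  assumes x: "x \<in> S"
  shows "\<bar>dv (Z N) x\<bar> \<le> 20 * n^2 * K * tau * (\<bar>v x\<bar> * norm (gr v x) + (v x)^2 / t x)"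
proof -
  note b = bounds[OF x]
  define g where "g = gr v x"
  have cs: "\<bar>a \<bullet> c\<bar> \<le> A * C" if "norm a \<le> A" "norm c \<le> C" for a c :: 'a and A C
  proof -
    have "0 \<le> A" using that(1) norm_ge_zero order_trans by blast
    then show ?thesis using Cauchy_Schwarz_ineq2[of a c] mult_mono[OF that _ norm_ge_zero] by linarith
  qed
  have nK: "K \<le> n * K" using n1 K mult_right_mono[of 1 n K] by simp
  have 1: "\<bar>fd X x (N x) \<bullet> g\<bar> \<le> (2 * tau * K) * norm g"
  proof (rule cs)
    have "norm (fd X x (N x)) \<le> 2 * tau * norm (N x)" by (rule sizes(3)[OF x])
    also have "... \<le> 2 * tau * K" using N1[OF x] tau0 by (intro mult_left_mono) auto
    finally show "norm (fd X x (N x)) \<le> 2 * tau * K" .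
  qed simp
  have 2: "\<bar>fd N x (X x) \<bullet> g\<bar> \<le> (2 * tau * K) * norm g"
  proof (rule cs)
    have "norm (fd N x (X x)) \<le> K * norm (X x)" by (rule N2[OF x])
    also have "... \<le> K * (2 * tau)" using sizes(2)[OF x] K by (intro mult_left_mono) auto
    finally show "norm (fd N x (X x)) \<le> 2 * tau * K" by (simp add: mult_ac)
  qed simp
  have 3: "\<bar>(X x \<bullet> g) * dv N x\<bar> \<le> ((2 * tau) * norm g) * (n * K)"
    unfolding abs_mult using cs[OF sizes(2)[OF x], of g "norm g"] dvN[OF x] tau0 by (intro mult_mono) auto
  have 4: "\<bar>(N x \<bullet> g) * dv X x\<bar> \<le> (K * norm g) * (2 * n * tau)"
    unfolding abs_mult using cs[OF N1[OF x], of g "norm g"] sizes(4)[OF x] K by (intro mult_mono) auto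
  have 5: "\<bar>gr B x \<bullet> N x\<bar> \<le> (n * tau / t x) * K" by (rule cs[OF sizes(6)[OF x] N1[OF x]])
  have 6: "\<bar>B x * (g \<bullet> N x)\<bar> \<le> (2 * n * tau) * (norm g * K)"
    unfolding abs_mult using sizes(5)[OF x] cs[of g "norm g", OF _ N1[OF x]] tau0 n1 by (intro mult_mono) auto
  have 7: "\<bar>B x * dv N x\<bar> \<le> (2 * n * tau) * (n * K)"
    unfolding abs_mult using sizes(5)[OF x] dvN[OF x] tau0 n1 by (intro mult_mono) auto
  define D where "D = fd X x (N x) \<bullet> g - fd N x (X x) \<bullet> g + (X x \<bullet> g) * dv N x - (N x \<bullet> g) * dv X x"
  have D: "\<bar>D\<bar> \<le> 8 * (n * K * tau * norm g)"
  proof -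
    have "K * tau * norm g \<le> n * K * tau * norm g" using nK tau0 by (intro mult_right_mono) auto
    then have "(2 * tau * K) * norm g \<le> 2 * (n * K * tau * norm g)" by (simp add: mult_ac)
    then show ?thesis using 1 2 3 4 by (simp add: D_def mult_ac)
  qed
  have e: "dv (Z N) x = v x * (2 * D + 2 * (B x * (g \<bullet> N x))) + v x * v x * (gr B x \<bullet> N x + B x * dv N x)"
    unfolding dv_Z[OF x N] D_def g_def by (simp add: algebra_simps)
  have 8: "\<bar>2 * D + 2 * (B x * (g \<bullet> N x))\<bar> \<le> 20 * (n * K * tau * norm g)" using D 6 by (simp add: mult_ac)
  have n2: "n * K * tau \<le> n^2 * K * tau" using n1 K tau0 by (simp add: power2_eq_square)
  have 9: "\<bar>gr B x \<bullet> N x + B x * dv N x\<bar> \<le> 3 * (n^2 * K * tau) / t x"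
  proof -
    have a: "(n * tau / t x) * K \<le> (n^2 * K * tau) / t x"
      using divide_right_mono[OF n2, of "t x"] b(1) by (simp add: mult_ac)
    have "(n^2 * K * tau) * 1 \<le> (n^2 * K * tau) * (1 / t x)" using b(1,2) K tau0 n1 by (intro mult_left_mono) auto
    then have "2 * (n^2 * K * tau) \<le> 2 * ((n^2 * K * tau) / t x)" by simp
    then have "(2 * n * tau) * (n * K) \<le> 2 * ((n^2 * K * tau) / t x)" by (simp only: power2_eq_square mult_ac)
    with 5 7 a show ?thesis by linarith
  qed
  have "\<bar>dv (Z N) x\<bar> \<le> \<bar>v x\<bar> * (20 * (n * K * tau * norm g)) + (v x)^2 * (3 * (n^2 * K * tau) / t x)"
  proof -
    have "\<bar>dv (Z N) x\<bar> \<le> \<bar>v x * (2 * D + 2 * (B x * (g \<bullet> N x)))\<bar> + \<bar>(v x)^2 * (gr B x \<bullet> N x + B x * dv N x)\<bar>"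
      unfolding e by (simp add: power2_eq_square)
    also have "\<bar>v x * (2 * D + 2 * (B x * (g \<bullet> N x)))\<bar> \<le> \<bar>v x\<bar> * (20 * (n * K * tau * norm g))"
      unfolding abs_mult[of "v x"] using 8 by (intro mult_left_mono) auto
    also have "\<bar>(v x)^2 * (gr B x \<bullet> N x + B x * dv N x)\<bar> \<le> (v x)^2 * (3 * (n^2 * K * tau) / t x)"
      unfolding abs_mult abs_power2 by (rule mult_left_mono[OF 9]) simp
    finally show ?thesis by simp
  qed
  also have "\<bar>v x\<bar> * (20 * (n * K * tau * norm g)) \<le> \<bar>v x\<bar> * (20 * (n^2 * K * tau * norm g))"
    using mult_right_mono[OF n2, of "norm g"] by (intro mult_left_mono) auto
  also have "(v x)^2 * (3 * (n^2 * K * tau) / t x) \<le> (v x)^2 * (20 * (n^2 * K * tau) / t x)"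
    using b(1) K tau0 n1 by (intro mult_left_mono divide_right_mono) auto
  finally show ?thesis by (simp add: g_def algebra_simps)
qed

text \<open>The field \<open>Z\<close> is absorbed by Young's inequality with weight
  \<open>t\<close>: one part goes into the gradient term, the other has the coefficient
  \<open>C^2 / 2 + C\<close> with \<open>C\<close> proportional to \<open>sig\<close>. This is where
  \<open>tau\<close> has to be of the size of \<open>1 + sig\<close>.\<close>

lemma main_pointwise:
  assumes x: "x \<in> S"
  shows "tau * t x / 2 * (gr v x \<bullet> gr v x) + tau^3 * (t x / (16 * q x)) * (v x)^2 - 2 * q x * (exp (Ps x) * lap w x)\<^sup>2
     \<le> 4 * dv (\<lambda>x. W x - sig *\<^sub>R Z N x) x"
proof -
  note b = bounds[OF x]
  define g where "g = gr v x"
  define y where "y = t x / q x"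
  have y0: "y \<ge> 0" using b by (simp add: y_def)
  have Q: "Q x \<ge> tau * (t x / 4) * (g \<bullet> g) + tau^3 * (y / 16) * (v x)^2"
  proof -
    define D' where "D' = gr E x \<bullet> X x + E x * (dv X x - B x) - lap B x / 2"
    have "tau^3 * (y / 16) \<le> D'" using zero_order_part[OF x] by (simp add: D'_def y_def)
    then have "tau^3 * (y / 16) * (v x)^2 \<le> D' * (v x)^2" by (rule mult_right_mono) simp
    moreover have "Q x = 2 * (fd X x g \<bullet> g) + (B x - dv X x) * (g \<bullet> g) + D' * (v x)^2"
      by (simp add: Q_def g_def D'_def power2_eq_square)
    ultimately show ?thesis using gradient_part[OF x, of g] by linarith
  qed
  have R: "2 * q x * (B x / q x - lap Ps x)\<^sup>2 * (v x)\<^sup>2 \<le> tau^3 * (y / 8) * (v x)^2"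
  proof -
    have "2 * (q x * (B x / q x - lap Ps x)\<^sup>2) \<le> 2 * (tau\<^sup>2 * y)" using remainder_part[OF x] by (simp add: y_def)
    also have "... \<le> tau / 8 * (tau\<^sup>2 * y)" using tau0 y0 by (intro mult_right_mono) auto
    finally have "2 * (q x * (B x / q x - lap Ps x)\<^sup>2) * (v x)\<^sup>2 \<le> tau / 8 * (tau\<^sup>2 * y) * (v x)\<^sup>2" by (intro mult_right_mono) auto
    then show ?thesis by (simp add: power2_eq_square power3_eq_cube mult_ac)
  qed
  have dW: "W differentiable (at x)" "Z N differentiable (at x)" using W_ck Z_ck[OF N] x by auto
  have dsc: "dv (\<lambda>x. sig *\<^sub>R Z N x) x = sig * dv (Z N) x"
    using dv_eqI[OF has_derivative_scaleR_right[OF differentiable_fd[OF dW(2)], of sig]] by (simp add: dv_def sum_distrib_left)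
  have ds: "dv (\<lambda>x. W x - sig *\<^sub>R Z N x) x = dv W x - sig * dv (Z N) x"
    using dv_diff[OF dW(1), of "\<lambda>x. sig *\<^sub>R Z N x"] dW(2) dsc by simp
  define C where "C = 80 * n^2 * K * sig"
  have C0: "C \<ge> 0" using K sigma by (simp add: C_def)
  have "\<bar>sig * dv (Z N) x\<bar> \<le> sig * (20 * n^2 * K * tau * (\<bar>v x\<bar> * norm g + (v x)^2 / t x))"
    unfolding abs_mult using dvZ_bound[OF x] sigma by (simp add: g_def mult_left_mono)
  then have "4 * \<bar>sig * dv (Z N) x\<bar> \<le> 4 * (sig * (20 * n^2 * K * tau * (\<bar>v x\<bar> * norm g + (v x)^2 / t x)))"
    by (rule mult_left_mono) simp
  also have "... = C * tau * (\<bar>v x\<bar> * norm g) + C * tau * ((v x)^2 / t x)" by (simp add: C_def algebra_simps)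
  finally have z: "4 * \<bar>sig * dv (Z N) x\<bar> \<le> C * tau * (\<bar>v x\<bar> * norm g) + C * tau * ((v x)^2 / t x)" .
  have am: "C * (\<bar>v x\<bar> * norm g) \<le> t x / 2 * (norm g)^2 + C^2 * (v x)^2 / (2 * t x)"
  proof -
    have "0 \<le> (t x * norm g - C * \<bar>v x\<bar>)^2 / (2 * t x)" using b by simp
    also have "... = t x / 2 * (norm g)^2 + C^2 * (v x)^2 / (2 * t x) - C * (\<bar>v x\<bar> * norm g)"
      using b by (simp add: power2_diff power_mult_distrib field_simps power2_eq_square)
    finally show ?thesis by simp
  qed
  \<comment> \<open>The constant 640 is \<open>8 * 80\<close>: the hypothesis on \<open>tau\<close>
    gives \<open>8 * (C + 1) \<le> tau\<close>.\<close>
  have CT: "C^2 / 2 + C \<le> tau^2 / 16"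
  proof -
    have "n^2 * K \<ge> 1" using mult_mono[of 1 "n^2" 1 K] n1 K by simp
    then have c8: "8 * C + 8 * 80 * 1 \<le> 8 * C + 8 * (80 * (n^2 * K))" by simp
    also have "... = 640 * n^2 * K * (1 + sig)" by (simp add: C_def algebra_simps)
    also have "... \<le> tau" by (rule tau_sigma)
    finally have "(8 * (C + 1))^2 \<le> tau^2" using C0 by (intro power_mono) auto
    then have "64 * C^2 + 128 * C + 64 \<le> tau^2" by (simp add: power2_eq_square algebra_simps)
    then show ?thesis using C0 zero_le_power2[of C] by linarith
  qed
  have yt: "1 / t x \<le> y"
  proof -
    have "q x = (t x)^2 * (t x)^2" using t4[OF x] by (simp add: eval_nat_numeral)
    also have "... \<le> (t x)^2 * 1" using b by (intro mult_left_mono) (auto simp: power_le_one)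
    finally show ?thesis using b by (simp add: y_def field_simps power2_eq_square)
  qed
  define V2 where "V2 = (v x)^2 / t x"
  define G2 where "G2 = (norm g)^2"
  define a where "a = \<bar>v x\<bar> * norm g"
  define p1 where "p1 = tau * t x * (g \<bullet> g)"
  define p2 where "p2 = tau^3 * y * (v x)^2"
  have m1: "tau * ((C^2 / 2 + C) * V2) \<le> tau * ((tau^2 / 16) * ((v x)^2 * y))"
    using CT C0 tau0 mult_left_mono[OF yt, of "(v x)^2"] b unfolding V2_def by (intro mult_left_mono mult_mono) auto
  have m2: "tau * (C * a) \<le> tau * (t x / 2 * G2 + C^2 / 2 * V2)"
    using am tau0 unfolding a_def G2_def V2_def by (intro mult_left_mono) auto
  have "C * tau * a + C * tau * V2 = tau * (C * a) + C * tau * V2" by simp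
  also have "... \<le> tau * (t x / 2 * G2 + C^2 / 2 * V2) + C * tau * V2" using m2 by (rule add_right_mono)
  also have "... = tau * (t x / 2 * G2) + tau * ((C^2 / 2 + C) * V2)" by (simp add: algebra_simps)
  also have "... \<le> tau * (t x / 2 * G2) + tau * ((tau^2 / 16) * ((v x)^2 * y))" using m1 by (rule add_left_mono)
  also have "... = p1 / 2 + p2 / 16"
    by (simp add: p1_def p2_def G2_def dot_square_norm power2_eq_square power3_eq_cube mult_ac)
  finally have zz: "4 * \<bar>sig * dv (Z N) x\<bar> \<le> p1 / 2 + p2 / 16" using z unfolding a_def V2_def by linarith
  have Q': "Q x \<ge> p1 / 4 + p2 / 16" using Q by (simp add: p1_def p2_def)
  define f where "f = 2 * q x * (exp (Ps x) * lap w x)\<^sup>2"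
  define r where "r = 2 * q x * (B x / q x - lap Ps x)\<^sup>2 * (v x)\<^sup>2"
  define z0 where "z0 = sig * dv (Z N) x"
  define Qx where "Qx = Q x"
  define Wx where "Wx = dv W x"
  have r1: "r \<le> p2 / 8" using R by (simp add: p2_def r_def)
  have r2: "4 * Qx \<le> 4 * Wx + f + r" using pointwise[OF x] by (simp only: f_def r_def Qx_def Wx_def)
  have r3: "4 * Qx \<ge> p1 + p2 / 4" using Q' by (simp add: Qx_def)
  have r4: "4 * z0 \<le> p1 / 2 + p2 / 16" using zz by (simp add: z0_def abs_le_iff)
  have r5: "p1 / 2 + p2 / 16 - f \<le> 4 * (Wx - z0)" using r1 r2 r3 r4 by argo
  have e: "tau * t x / 2 * (gr v x \<bullet> gr v x) = p1 / 2" "tau^3 * (t x / (16 * q x)) * (v x)^2 = p2 / 16"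
    by (simp_all add: p1_def p2_def g_def y_def)
  show ?thesis unfolding ds e using r5 by (simp only: f_def z0_def Wx_def)
qed

end

section \<open>Radial cutoffs and the three-shell inequality\<close>

definition Mb :: real where "Mb = 60"

lemma Mb1: "Mb \<ge> 1" and bM: "\<bar>step' s\<bar> \<le> Mb" "\<bar>step'' s\<bar> \<le> Mb" using step_range by (auto simp: Mb_def)

text \<open>The profile is 1 between \<open>2 * a\<close> and \<open>b\<close> and 0 below
  \<open>a\<close> and above \<open>2 * b\<close>; \<open>cf1\<close> and \<open>cf2\<close> are its
  first two derivatives.\<close>

definition cf :: "real \<Rightarrow> real \<Rightarrow> real \<Rightarrow> real" where "cf a b s = step (s / a) * step (3 - s / b)"
definition cf1 :: "real \<Rightarrow> real \<Rightarrow> real \<Rightarrow> real" where "cf1 a b s = step' (s / a) / a * step (3 - s / b) - step (s / a) * step' (3 - s / b) / b"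
definition cf2 :: "real \<Rightarrow> real \<Rightarrow> real \<Rightarrow> real" where "cf2 a b s = step'' (s / a) / a^2 * step (3 - s / b) - 2 * (step' (s / a) / a) * (step' (3 - s / b) / b) + step (s / a) * step'' (3 - s / b) / b^2"

lemma cf_deriv:
  assumes "a > 0" "b > 0"
  shows "(cf a b has_real_derivative cf1 a b s) (at s)" "(cf1 a b has_real_derivative cf2 a b s) (at s)"
    "continuous_on UNIV (cf2 a b)"
proof -
  have 1: "((\<lambda>s. s / a) has_real_derivative 1 / a) (at s)" for s using assms by (auto intro!: derivative_eq_intros)
  have 2: "((\<lambda>s. 3 - s / b) has_real_derivative - 1 / b) (at s)" for s using assms by (auto intro!: derivative_eq_intros)
  note d = DERIV_chain2[OF step_deriv 1] DERIV_chain2[OF step'_deriv 1] DERIV_chain2[OF step_deriv 2] DERIV_chain2[OF step'_deriv 2]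
  show "(cf a b has_real_derivative cf1 a b s) (at s)" unfolding cf_def[abs_def] cf1_def
    by (rule DERIV_cong[OF DERIV_mult[OF d(1,3)]]) simp
  show "(cf1 a b has_real_derivative cf2 a b s) (at s)" unfolding cf1_def[abs_def] cf2_def
    by (rule DERIV_cong[OF DERIV_diff[OF DERIV_mult[OF DERIV_cdivide[OF d(2), of a] d(3)] DERIV_cdivide[OF DERIV_mult[OF d(1) d(4)], of b]]])
       (simp add: power2_eq_square add_divide_distrib diff_divide_distrib algebra_simps)
  have c: "continuous_on UNIV step" "continuous_on UNIV step'" using step_deriv step'_deriv by (auto intro!: DERIV_continuous_on)
  have i: "continuous_on UNIV (\<lambda>s. s / a)" "continuous_on UNIV (\<lambda>s. 3 - s / b)"
    using assms by (auto intro!: continuous_intros)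
  have cc: "continuous_on UNIV (\<lambda>s. f (s / a))" "continuous_on UNIV (\<lambda>s. f (3 - s / b))" if "continuous_on UNIV f" for f :: "real \<Rightarrow> real"
    using continuous_on_compose2[OF that i(1)] continuous_on_compose2[OF that i(2)] by auto
  show "continuous_on UNIV (cf2 a b)" unfolding cf2_def[abs_def]
    by (intro continuous_intros cc c step''_cont) (use assms in auto)
qed

lemma cf_cases:
  assumes "a > 0" "2 * a \<le> b"
  shows "s < a \<or> 2 * b < s ==> cf a b s = 0 \<and> cf1 a b s = 0 \<and> cf2 a b s = 0"
    and "2 * a \<le> s ==> s \<le> b ==> cf a b s = 1 \<and> cf1 a b s = 0 \<and> cf2 a b s = 0"
    and "a \<le> s ==> s \<le> 2 * a ==> \<bar>cf1 a b s\<bar> \<le> Mb / a \<and> \<bar>cf2 a b s\<bar> \<le> Mb / a^2"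
    and "b \<le> s ==> s \<le> 2 * b ==> \<bar>cf1 a b s\<bar> \<le> Mb / b \<and> \<bar>cf2 a b s\<bar> \<le> Mb / b^2"
proof -
  have b0: "b > 0" using assms by simp
  show "cf a b s = 0 \<and> cf1 a b s = 0 \<and> cf2 a b s = 0" if "s < a \<or> 2 * b < s"
  proof -
    have "s / a \<le> 1 \<or> 3 - s / b \<le> 1" using that assms(1) b0 by (auto simp: field_simps)
    then show ?thesis using step_low[of "s / a"] step_low[of "3 - s / b"] by (auto simp: cf_def cf1_def cf2_def)
  qed
  have hi: "s / a \<ge> 2" if "2 * a \<le> s" using that assms(1) by (simp add: field_simps)
  have hj: "3 - s / b \<ge> 2" if "s \<le> b" using that b0 by (simp add: field_simps)
  show "cf a b s = 1 \<and> cf1 a b s = 0 \<and> cf2 a b s = 0" if "2 * a \<le> s" "s \<le> b"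
    using step_high[OF hi[OF that(1)]] step_high[OF hj[OF that(2)]] by (simp add: cf_def cf1_def cf2_def)
  show "\<bar>cf1 a b s\<bar> \<le> Mb / a \<and> \<bar>cf2 a b s\<bar> \<le> Mb / a^2" if "a \<le> s" "s \<le> 2 * a"
    using step_high[OF hj] that assms bM[of "s / a"] by (simp add: cf1_def cf2_def abs_divide divide_right_mono)
  show "\<bar>cf1 a b s\<bar> \<le> Mb / b \<and> \<bar>cf2 a b s\<bar> \<le> Mb / b^2" if "b \<le> s" "s \<le> 2 * b"
    using step_high[OF hi] that assms b0 bM[of "3 - s / b"] by (simp add: cf1_def cf2_def abs_divide divide_right_mono)
qed

text \<open>The weight per unit of \<open>tau\<close>, as a function of the squared distance:
  \<open>Ps = tau * wt q\<close>.\<close>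

definition wt :: "real \<Rightarrow> real" where "wt s = - (1/2) * (ln s - 4 * s powr (1/4))"

lemma wt_strict: "0 < s ==> s < s' ==> s' \<le> 1 ==> wt s' < wt s"
proof (rule DERIV_neg_imp_decreasing_open[of s s' wt])
  assume a: "0 < s" "s' \<le> 1"
  have d: "(wt has_real_derivative - (1/2) * (inverse x - 4 * (1/4 * x powr (1/4 - 1)))) (at x)" if "0 < x" for x
    unfolding wt_def[abs_def]
    by (intro DERIV_cmult DERIV_diff DERIV_ln has_real_derivative_powr) (use that in auto)
  show "continuous_on {s..s'} wt"
    by (rule DERIV_continuous_on[OF has_field_derivative_at_within[OF d]]) (use a in auto)
  fix x assume x: "s < x" "x < s'"
  have "x powr (1/4 - 1) < x powr (-1)" using a x by (intro powr_less_mono') auto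
  then have "- (1/2) * (inverse x - 4 * (1/4 * x powr (1/4 - 1))) < 0" using a x by (simp add: powr_minus)
  then show "\<exists>y. (wt has_real_derivative y) (at x) \<and> y < 0" using d[of x] a x by auto
qed simp

lemma wt_antimono: "0 < s ==> s \<le> s' ==> s' \<le> 1 ==> wt s' \<le> wt s"
  using wt_strict[of s s'] by (cases "s = s'") auto

text \<open>An eigenfunction enters the analysis as a harmonic function whose gradient has the
  continuous extension \<open>G\<close>. The boundary condition is stated separately, because
  interior estimates are shared by all \<open>sig\<close>.\<close>

locale harmonic_data = defined_domain Om D rho for Om D :: "'a::euclidean_space set" and rho +
  fixes u :: "'a \<Rightarrow> real" and G :: "'a \<Rightarrow> 'a"
  assumes u2: "ck 2 Om u" and uc: "continuous_on (closure Om) u" and Gc: "continuous_on (closure Om) G"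
    and GG: "\<And>x. x \<in> Om ==> gr u x = G x" and harm: "\<And>x. x \<in> Om ==> lap u x = 0"
begin

definition "en x = G x \<bullet> G x + (u x)^2"

lemma en_nonneg: "en x \<ge> 0" by (simp add: en_def)

lemma en_cont: "continuous_on (closure Om) en" unfolding en_def[abs_def] by (intro continuous_intros uc Gc)

definition "En U = (LINT x:Om \<inter> U|lborel. en x)"

lemma En_nonneg: "En U \<ge> 0"
  unfolding En_def set_lebesgue_integral_def by (rule Bochner_Integration.integral_nonneg) (simp add: en_nonneg)

lemma En_mono: "U \<in> sets borel ==> V \<in> sets borel ==> Om \<inter> U \<subseteq> V ==> En U \<le> En V"
  unfolding En_def set_lebesgue_integral_def
  by (rule Bochner_Integration.integral_mono)
     (use si_closure[OF en_cont, of "Om \<inter> U"] si_closure[OF en_cont, of "Om \<inter> V"] op en_nonneg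
      in \<open>auto simp: set_integrable_def indicator_def\<close>)

end

abbreviation (in defined_domain) "data \<equiv> harmonic_data Om D rho"

abbreviation (in defined_domain) "energy \<equiv> harmonic_data.En Om"

abbreviation (in defined_domain) "robin u G sig \<equiv> \<forall>x\<in>frontier Om. G x \<bullet> gr rho x = sig * u x"

text \<open>\<open>A\<close> is meant as a ball without its centre and \<open>C\<close> as a closed
  annulus in it, so that the cutoff stays away from the singularity of the weight. For an interior
  centre \<open>A\<close> misses the frontier and the conditions there are void.\<close>

locale centred = harmonic_data Om D rho u G
  for Om D :: "'a::euclidean_space set" and rho u G +
  fixes A C :: "'a set" and q :: "'a \<Rightarrow> real" and M tau n sig K a b :: real
  assumes A: "open A" "A \<subseteq> D" and C: "closed C" "C \<subseteq> A"
    and rw: "radial_weight A q M tau n"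
    and K: "K \<ge> 1" and sigma: "sig \<ge> 0"
    and N1: "\<And>x. x \<in> Om \<inter> A ==> norm (gr rho x) \<le> K"
    and N2: "\<And>x h. x \<in> Om \<inter> A ==> norm (fd (gr rho) x h) \<le> K * norm h"
    and tau_sigma: "tau \<ge> 640 * n^2 * K * (1 + sig)"
    and bc: "\<And>x. x \<in> frontier Om \<inter> A ==> G x \<bullet> gr rho x = sig * u x"
    and qbc: "\<And>x. x \<in> frontier Om \<inter> A ==> gr q x \<bullet> gr rho x = 0"
    and ab: "0 < a" "2 * a \<le> b"
    and supp: "\<And>x. x \<in> A - C ==> q x < a \<or> 2 * b < q x"
begin

interpretation radial_weight A q M tau n by (rule rw)

definition "chi x = cf a b (q x)"
definition "w x = chi x * u x"
text \<open>The Laplacian of \<open>chi * u\<close> for harmonic \<open>u\<close>, that is, the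
  commutator with the cutoff. It lives where \<open>chi\<close> is not locally constant.\<close>

definition "L x = u x * lap chi x + 2 * (gr chi x \<bullet> G x)"
text \<open>\<open>gw\<close> and \<open>gg\<close> are the gradients of \<open>w\<close> and of the
  conjugated function with \<open>G\<close> in place of \<open>gr u\<close>, which gives them a
  meaning on the frontier.\<close>

definition "gw x = chi x *\<^sub>R G x + u x *\<^sub>R gr chi x"
definition "vv x = exp (Ps x) * w x"
definition "gg x = exp (Ps x) *\<^sub>R (gw x + w x *\<^sub>R gr Ps x)"

lemma b0: "b > 0" using ab by simp

lemma oA: "open (Om \<inter> A)" by (rule open_Int[OF op A(1)])

lemma ckA: "ck k A f ==> ck k (Om \<inter> A) f" using ck_subset by blast

lemma u12: "ck 2 (Om \<inter> A) u" "ck 1 (Om \<inter> A) u"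
  using ck_subset[OF u2, of "Om \<inter> A"] ck_mono[of 2 "Om \<inter> A" u 1] by auto

lemma chi2: "ck 2 A chi"
proof -
  define H where "H i = (if i = 0 then cf a b else if i = 1 then cf1 a b else cf2 a b)" for i :: nat
  have "ck 2 A (\<lambda>x. H 0 (q x))"
    by (rule ck_compose_real[where T=UNIV, OF S])
       (use cf_deriv[OF ab(1) b0] q in \<open>auto simp: H_def numeral_2_eq_2 less_Suc_eq\<close>)
  then show ?thesis by (simp add: H_def chi_def[abs_def])
qed

lemma chi1: "ck 1 A chi" using ck_mono[OF chi2, of 1] by simp

lemma w2: "ck 2 (Om \<inter> A) w" unfolding w_def[abs_def] by (intro ck_mult oA ckA[OF chi2] u12)

lemma gchi: "x \<in> A ==> gr chi x = cf1 a b (q x) *\<^sub>R gr q x"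
  unfolding chi_def[abs_def] by (rule gr_compose[OF cf_deriv(1)[OF ab(1) b0] df[OF q1(1)]])

lemma lchi: "x \<in> A ==> lap chi x = cf1 a b (q x) * lap q x + cf2 a b (q x) * (gr q x \<bullet> gr q x)"
  using dv_radial[OF _ cf_deriv(2)[OF ab(1) b0] gchi] by (simp add: l_def a_eq)

lemma gw: assumes "x \<in> Om \<inter> A" shows "gr w x = gw x"
  unfolding w_def[abs_def] gw_def using gr_mult[of chi x u] assms ckA[OF chi1] u12 GG by simp

lemma lap_w: assumes x: "x \<in> Om \<inter> A" shows "lap w x = L x"
  unfolding w_def[abs_def] L_def using lap_mult[OF oA ckA[OF chi2] u12(1) x] harm x GG by simp

lemma rc: "radial_carleman (Om \<inter> A) q M tau n w (gr rho) sig K"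
proof -
  have c: "ck 2 (Om \<inter> A) q" using ckA[OF q] .
  have "radial_weight (Om \<inter> A) q M tau n"
    by unfold_locales (use n oA c qp M small h1 h2 tau in auto)
  moreover have "ck 1 (Om \<inter> A) (gr rho)" using ck_subset[OF ck_grho[of 1], of "Om \<inter> A"] A by auto
  ultimately show ?thesis
    by (intro radial_carleman.intro radial_carleman_axioms.intro)
       (use w2 K sigma N1 N2 tau_sigma in auto)
qed

interpretation R: radial_carleman "Om \<inter> A" q M tau n w "gr rho" sig K by (rule rc)

lemma vv: "R.v x = vv x" by (simp add: R.v_def vv_def)

lemma gg: assumes "x \<in> Om \<inter> A" shows "gr R.v x = gg x"
  using conjugated_laplacian(1)[OF oA w2 ckA[OF Psi2] assms, of R.v] gw[OF assms] by (simp add: gg_def R.v_def)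

text \<open>Inside \<open>Om\<close> this is the field \<open>W - sig *\<^sub>R Z (gr rho)\<close>.
  Written with \<open>vv\<close> and \<open>gg\<close> it is continuous up to the frontier, as the
  divergence inequality demands.\<close>

definition "F x = (((2 * (X x \<bullet> gg x) + B x * vv x) *\<^sub>R gg x - (vv x * vv x / 2) *\<^sub>R gr B x)
   + (E x * (vv x * vv x) - gg x \<bullet> gg x) *\<^sub>R X x)
  - sig *\<^sub>R ((2 * vv x * (X x \<bullet> gg x) + B x * (vv x * vv x)) *\<^sub>R gr rho x - (2 * vv x * (gr rho x \<bullet> gg x)) *\<^sub>R X x)"

definition "m x = tau * t x / 2 * (gg x \<bullet> gg x) + tau^3 * (t x / (16 * q x)) * (vv x)^2 - 2 * q x * (exp (Ps x) * L x)\<^sup>2"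

lemma F_eq: "x \<in> Om \<inter> A ==> F x = R.W x - sig *\<^sub>R R.Z (gr rho) x"
  by (simp add: F_def R.W_def R.Z_def gg vv)

lemma m_le: "x \<in> Om \<inter> A ==> m x / 4 \<le> dv F x"
proof -
  assume x: "x \<in> Om \<inter> A"
  have "dv F x = dv (\<lambda>x. R.W x - sig *\<^sub>R R.Z (gr rho) x) x" by (rule dv_cong_open[OF oA x F_eq])
  then show ?thesis using R.main_pointwise[OF x] by (simp add: m_def gg[OF x] vv lap_w[OF x])
qed

lemma off: assumes "x \<in> A" "q x < a \<or> 2 * b < q x" shows "vv x = 0" "gg x = 0" "L x = 0"
  using cf_cases(1)[OF ab assms(2)] assms(1) by (auto simp: vv_def gg_def w_def gw_def L_def chi_def gchi lchi)

lemma zero_off: assumes "x \<in> A - C" shows "vv x = 0" "gg x = 0"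
  using off[OF _ supp[OF assms]] assms by auto

lemma integral_m:
  assumes k: "set_integrable lborel (Om \<inter> A) k" "\<And>x. x \<in> Om \<inter> A ==> k x \<le> m x"
  shows "(LINT x:Om \<inter> A|lborel. k x) \<le> 0"
proof -
  have c: "continuous_on (closure Om \<inter> A) f" if "continuous_on A f" for f :: "'a \<Rightarrow> 'z::real_normed_vector"
    using that continuous_on_subset by blast
  have c': "continuous_on (closure Om \<inter> A) f" if "continuous_on (closure Om) f" for f :: "'a \<Rightarrow> 'z::real_normed_vector"
    using that continuous_on_subset by blast
  have g: "ck 2 A f ==> continuous_on A (gr f)" for f using ck_cont[OF ck_gr[OF S, of 1 f]] by (simp add: numeral_2_eq_2)
  note q0 = ck_cont[OF chi2, THEN c] g[OF chi2, THEN c] ck_cont[OF Psi2, THEN c] g[OF Psi2, THEN c] uc[THEN c'] Gc[THEN c']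
    ck_cont[OF X1, THEN c] ck_cont[OF B2, THEN c] ck_cont[OF E1, THEN c] g[OF B2, THEN c] cont_grho[THEN c']
  have W: "continuous_on (closure Om \<inter> A) w" unfolding w_def[abs_def] by (intro continuous_intros q0)
  have gW: "continuous_on (closure Om \<inter> A) gw" unfolding gw_def[abs_def] by (intro continuous_intros q0)
  have V: "continuous_on (closure Om \<inter> A) vv" unfolding vv_def[abs_def] by (intro continuous_intros W q0)
  have gV: "continuous_on (closure Om \<inter> A) gg" unfolding gg_def[abs_def] by (intro continuous_intros W gW q0)
  have "(LINT x:Om \<inter> A|lborel. k x / 4) \<le> 0"
  proof (rule divergence_bound[OF A(1) C])
    have "ck 1 (Om \<inter> A) (\<lambda>x. R.W x - sig *\<^sub>R R.Z (gr rho) x)"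
      by (intro ck_diff' ck_scaleR ck_const R.W_ck R.Z_ck[OF R.N] oA)
    then show "ck 1 (Om \<inter> A) F" by (rule ck_cong[OF oA, rotated]) (simp add: F_eq)
    show "continuous_on (closure Om \<inter> A) F" unfolding F_def[abs_def]
      by (intro continuous_intros V gV q0) simp
    show "F x = 0" if "x \<in> closure Om \<inter> A - C" for x
      using zero_off[of x] that by (simp add: F_def)
    \<comment> \<open>On the frontier \<open>X\<close>, \<open>gr B\<close>, \<open>gr Ps\<close>
      and \<open>gr chi\<close> are multiples of \<open>gr q\<close> and hence tangential. Cutoff
      and conjugation therefore preserve the Robin condition, and the fluxes of \<open>W\<close> and
      of \<open>sig *\<^sub>R Z\<close> cancel.\<close>
    show "F x \<bullet> gr rho x \<le> 0" if x: "x \<in> frontier Om \<inter> A" for x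
    proof -
      have z: "X x \<bullet> gr rho x = 0" "gr B x \<bullet> gr rho x = 0" "gr Ps x \<bullet> gr rho x = 0" "gr chi x \<bullet> gr rho x = 0"
        using x qbc[OF x] by (simp_all add: X_def gB gPsi gchi)
      have g: "gg x \<bullet> gr rho x = sig * vv x"
        using bc[OF x] z by (simp add: gg_def gw_def vv_def w_def inner_add_left)
      have N: "gr rho x \<bullet> gr rho x = 1" using unit x by (simp add: dot_square_norm)
      show ?thesis unfolding F_def by (simp add: inner_diff_left inner_add_left z g N algebra_simps)
    qed
    show "set_integrable lborel (Om \<inter> A) (\<lambda>x. k x / 4)" using k(1) by simp
    show "k x / 4 \<le> dv F x" if "x \<in> Om \<inter> A" for x using m_le[OF that] k(2)[OF that] by linarith
  qed
  then show ?thesis by simp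
qed

end

context centred begin

interpretation radial_weight A q M tau n by (rule rw)

definition "shell s1 s2 = {x \<in> Om \<inter> A. s1 \<le> q x \<and> q x \<le> s2}"

lemma shell_meas: "shell s1 s2 \<in> sets borel"
proof -
  have "continuous_on (Om \<inter> A) q" using ck_cont[OF q1(1)] continuous_on_subset by blast
  from continuous_closedin_preimage[OF this, of "{s1..s2}"]
  have "closedin (top_of_set (Om \<inter> A)) (shell s1 s2)" by (simp add: shell_def vimage_def Int_def)
  then obtain T where "closed T" "shell s1 s2 = T \<inter> (Om \<inter> A)" by (auto simp: closedin_closed Int_commute)
  then show ?thesis using oA by auto
qed

lemma Psi_wt: "Ps x = tau * wt (q x)" by (simp add: Ps_def wt_def t_def)

text \<open>Undoing the conjugation replaces \<open>G\<close> by
  \<open>h - u *\<^sub>R gr Ps\<close>, where \<open>gr Ps\<close> has square at most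
  \<open>2 * tau^2 / q\<close>. The zero order term of \<open>m\<close> has precisely this
  strength.\<close>

lemma m_middle:
  assumes x: "x \<in> A" "2 * a \<le> q x" "q x \<le> b"
  shows "m x \<ge> tau * t x / 128 * exp (2 * Ps x) * en x"
proof -
  note bb = bounds[OF x(1)]
  have al: "al x \<le> 2" "0 \<le> al x" using bb(2,4) by linarith+
  have "chi x = 1" "gr chi x = 0" "lap chi x = 0"
    using cf_cases(2)[OF ab x(2,3)] x(1) by (simp_all add: chi_def gchi lchi)
  then have L0: "L x = 0" and v: "vv x = exp (Ps x) * u x"
    and g: "gg x = exp (Ps x) *\<^sub>R (G x + u x *\<^sub>R gr Ps x)"
    by (simp_all add: L_def vv_def gg_def gw_def w_def)
  define h where "h = G x + u x *\<^sub>R gr Ps x"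
  define e2 where "e2 = exp (2 * Ps x)"
  have ee: "exp (Ps x) * exp (Ps x) = e2" by (simp add: e2_def mult_exp_exp)
  have e0: "e2 > 0" by (simp add: e2_def)
  have E: "gr Ps x \<bullet> gr Ps x \<le> 2 * tau\<^sup>2 / q x"
  proof -
    have "gr Ps x \<bullet> gr Ps x = tau\<^sup>2 / q x * ((1 - t x)\<^sup>2 * al x)"
      using bb(6) unfolding EPsi[OF x(1), symmetric] E_def fE_def a_eq[OF x(1)] by (simp add: field_simps power2_eq_square)
    also have "(1 - t x)\<^sup>2 * al x \<le> 1 * 2" using bb(1,2) al by (intro mult_mono power_le_one) auto
    then have "tau\<^sup>2 / q x * ((1 - t x)\<^sup>2 * al x) \<le> tau\<^sup>2 / q x * 2" using bb(6) by (intro mult_left_mono) auto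
    finally show ?thesis by (simp add: mult.commute)
  qed
  define z where "z = tau\<^sup>2 / q x * (u x)\<^sup>2"
  have GG2: "G x \<bullet> G x \<le> 2 * (h \<bullet> h) + 4 * z"
  proof -
    have "G x \<bullet> G x \<le> 2 * (h \<bullet> h) + 2 * ((u x *\<^sub>R gr Ps x) \<bullet> (u x *\<^sub>R gr Ps x))"
      using inner_diff_self_le[of h "u x *\<^sub>R gr Ps x"] by (simp add: h_def)
    also have "(u x *\<^sub>R gr Ps x) \<bullet> (u x *\<^sub>R gr Ps x) = (u x)\<^sup>2 * (gr Ps x \<bullet> gr Ps x)" by (simp add: power2_eq_square)
    also have "... \<le> (u x)\<^sup>2 * (2 * tau\<^sup>2 / q x)" using E by (intro mult_left_mono) auto
    finally show ?thesis by (simp add: z_def mult_ac)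
  qed
  have u1: "(u x)\<^sup>2 \<le> 2 * z"
  proof -
    have "1 \<le> tau\<^sup>2" using tau0 by (simp add: power2_eq_square) (metis mult_mono' mult_1 order_trans one_le_numeral zero_le_one)
    then have "1 \<le> 2 * tau\<^sup>2 / q x" using bb(6,7) by (simp add: field_simps)
    then have "1 * (u x)\<^sup>2 \<le> 2 * tau\<^sup>2 / q x * (u x)\<^sup>2" by (rule mult_right_mono) simp
    then show ?thesis by (simp add: z_def mult_ac)
  qed
  have "en x \<le> 2 * (h \<bullet> h) + 6 * (tau\<^sup>2 / q x * (u x)\<^sup>2)" using GG2 u1 unfolding en_def z_def[symmetric] by linarith
  also have "... \<le> 64 * (h \<bullet> h) + 8 * (tau\<^sup>2 / q x * (u x)\<^sup>2)" using bb(6) by (intro add_mono mult_right_mono) auto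
  finally have "tau * t x / 128 * e2 * en x \<le> tau * t x / 128 * e2 * (64 * (h \<bullet> h) + 8 * (tau\<^sup>2 / q x * (u x)\<^sup>2))"
    using bb(1) tau0 e0 by (intro mult_left_mono) auto
  also have "... = tau * t x / 2 * (e2 * (h \<bullet> h)) + tau^3 * (t x / (16 * q x)) * (e2 * (u x)\<^sup>2)"
    using bb(6) by (simp add: field_simps power2_eq_square power3_eq_cube)
  also have "e2 * (h \<bullet> h) = gg x \<bullet> gg x" by (simp add: g h_def[symmetric] ee[symmetric] mult_ac)
  also have "e2 * (u x)\<^sup>2 = (vv x)\<^sup>2" by (simp add: v power_mult_distrib ee[symmetric] power2_eq_square mult_ac)
  finally show ?thesis by (simp add: m_def L0 e2_def)
qed

text \<open>Where \<open>q\<close> is comparable to \<open>s\<close>, \<open>gr chi\<close> has size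
  \<open>1 / sqrt s\<close> and \<open>lap chi\<close> size \<open>1 / s\<close>; the factor
  \<open>q\<close> removes one power of \<open>s\<close>. The constant is
  \<open>4 * 144 * 2\<close>.\<close>

lemma L_transition:
  assumes x: "x \<in> A" and s: "s > 0" "s \<le> q x" "q x \<le> 2 * s"
    and c1: "\<bar>cf1 a b (q x)\<bar> \<le> Mb / s" and c2: "\<bar>cf2 a b (q x)\<bar> \<le> Mb / s^2"
  shows "2 * q x * (L x)\<^sup>2 \<le> 1152 * n\<^sup>2 * Mb\<^sup>2 * (G x \<bullet> G x + (u x)\<^sup>2 / s)"
proof -
  note bb = bounds[OF x(1)]
  have al: "al x \<le> 101/100" "0 \<le> al x" using bb(2,4) by linarith+
  define r where "r = sqrt s"
  have r: "r > 0" "r^2 = s" using s by (simp_all add: r_def)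
  have "gr q x \<bullet> gr q x = 4 * q x * al x" by (rule a_eq[OF x])
  also have "... \<le> 4 * (2 * s) * (101/100)" using bb(6) al s by (intro mult_mono) auto
  also have "... \<le> 9 * s" using s by simp
  finally have g: "gr q x \<bullet> gr q x \<le> 9 * s" .
  then have "(norm (gr q x))\<^sup>2 \<le> (3 * r)\<^sup>2" using r by (simp add: dot_square_norm power_mult_distrib)
  then have g3: "norm (gr q x) \<le> 3 * r" by (rule power2_le_imp_le) (use r in simp)
  have lq: "\<bar>lap q x\<bar> \<le> 3 * n" 
  proof -
    have "lap q x = 2 * n + l x" by (simp add: l_def)
    then show ?thesis using bb(2,5) n1 by linarith
  qed
  have i1: "\<bar>2 * (gr chi x \<bullet> G x)\<bar> \<le> 12 * n * Mb * (norm (G x) / r)"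
  proof -
    have "\<bar>gr q x \<bullet> G x\<bar> \<le> (3 * r) * norm (G x)"
      using Cauchy_Schwarz_ineq2[of "gr q x" "G x"] mult_right_mono[OF g3, of "norm (G x)"] by simp
    then have "\<bar>cf1 a b (q x)\<bar> * \<bar>gr q x \<bullet> G x\<bar> \<le> (Mb / s) * ((3 * r) * norm (G x))"
      using c1 Mb1 s by (intro mult_mono) auto
    also have "... = 3 * Mb * (norm (G x) / r)" using r by (simp add: r(2)[symmetric] power2_eq_square)
    also have "... \<le> 6 * n * Mb * (norm (G x) / r)" using n1 Mb1 r by (intro mult_right_mono) auto
    finally show ?thesis using x by (simp add: gchi abs_mult)
  qed
  have i2: "\<bar>u x * lap chi x\<bar> \<le> 12 * n * Mb * (\<bar>u x\<bar> / s)"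
  proof -
    have "\<bar>cf2 a b (q x) * (gr q x \<bullet> gr q x)\<bar> \<le> (Mb / s^2) * (9 * s)"
      unfolding abs_mult using c2 g s Mb1 by (intro mult_mono) auto
    moreover have "\<bar>cf1 a b (q x) * lap q x\<bar> \<le> (Mb / s) * (3 * n)"
      unfolding abs_mult using c1 lq s Mb1 by (intro mult_mono) auto
    moreover have "(Mb / s^2) * (9 * s) + (Mb / s) * (3 * n) = (9 + 3 * n) * (Mb / s)"
      using s by (simp add: power2_eq_square field_simps)
    moreover have "(9 + 3 * n) * (Mb / s) \<le> 12 * n * (Mb / s)" using n1 Mb1 s by (intro mult_right_mono) auto
    ultimately have "\<bar>lap chi x\<bar> \<le> 12 * n * (Mb / s)" using x unfolding lchi[OF x] by linarith
    from mult_left_mono[OF this abs_ge_zero] show ?thesis by (simp add: abs_mult mult_ac)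
  qed
  define p where "p = norm (G x) / r"
  define z where "z = \<bar>u x\<bar> / s"
  have "\<bar>L x\<bar> \<le> 12 * n * Mb * (p + z)" using i1 i2 unfolding L_def p_def z_def distrib_left by linarith
  then have "\<bar>L x\<bar>\<^sup>2 \<le> (12 * n * Mb * (p + z))\<^sup>2" by (rule power_mono) simp
  then have "(L x)\<^sup>2 \<le> 144 * n\<^sup>2 * Mb\<^sup>2 * (p + z)\<^sup>2" by (simp add: power_mult_distrib)
  also have "... \<le> 144 * n\<^sup>2 * Mb\<^sup>2 * (2 * p\<^sup>2 + 2 * z\<^sup>2)"
    using zero_le_power2[of "p - z"] by (intro mult_left_mono) (auto simp: power2_sum power2_diff)
  finally have "2 * q x * (L x)\<^sup>2 \<le> 2 * (2 * s) * (144 * n\<^sup>2 * Mb\<^sup>2 * (2 * p\<^sup>2 + 2 * z\<^sup>2))"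
    using s by (intro mult_mono) auto
  also have "... = 1152 * n\<^sup>2 * Mb\<^sup>2 * (s * p\<^sup>2 + s * z\<^sup>2)" by (simp add: algebra_simps)
  also have "s * p\<^sup>2 = G x \<bullet> G x" using r s by (simp add: p_def power_divide dot_square_norm)
  also have "s * z\<^sup>2 = (u x)\<^sup>2 / s" using s by (simp add: z_def power2_eq_square)
  finally show ?thesis .
qed

lemma m_lower: "x \<in> A ==> m x \<ge> - (exp (2 * Ps x) * (2 * q x * (L x)\<^sup>2))"
proof -
  assume x: "x \<in> A"
  note bb = bounds[OF x]
  have "tau * t x / 2 * (gg x \<bullet> gg x) \<ge> 0" "tau^3 * (t x / (16 * q x)) * (vv x)^2 \<ge> 0" using bb tau0 by auto
  moreover have "(exp (Ps x))\<^sup>2 = exp (2 * Ps x)" by (simp add: exp_double)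
  then have "2 * q x * (exp (Ps x) * L x)\<^sup>2 = exp (2 * Ps x) * (2 * q x * (L x)\<^sup>2)" by (simp add: power_mult_distrib)
  ultimately show ?thesis unfolding m_def by linarith
qed

definition "C1 = 1152 * n\<^sup>2 * Mb\<^sup>2"

text \<open>The weight decreases in \<open>q\<close>, so the gain on the middle shell is at least
  its value at the outer edge, and each loss at most its value at the inner edge of the transition
  shell.\<close>

theorem shell_estimate:
  assumes th: "2 * a \<le> tht1" "tht1 \<le> tht2" "tht2 \<le> b" and b1: "b \<le> 1"
  shows "tau * tht1 powr (1/4) / 128 * exp (2 * tau * wt tht2) * (LINT x:shell tht1 tht2|lborel. en x)
     \<le> C1 * exp (2 * tau * wt a) * (LINT x:shell a (2 * a)|lborel. G x \<bullet> G x + (u x)\<^sup>2 / a)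
      + C1 * exp (2 * tau * wt b) * (LINT x:shell b (2 * b)|lborel. G x \<bullet> G x + (u x)\<^sup>2 / b)"
proof -
  define kap where "kap = tau * tht1 powr (1/4) / 128 * exp (2 * tau * wt tht2)"
  define f where "f s x = G x \<bullet> G x + (u x)\<^sup>2 / s" for s x
  have C10: "C1 \<ge> 0" by (simp add: C1_def)
  have sub: "shell s1 s2 \<subseteq> Om" for s1 s2 by (auto simp: shell_def)
  have fc: "continuous_on (closure Om) (f s)" if "s > 0" for s
    unfolding f_def[abs_def] using that by (intro continuous_intros uc Gc) auto
  have f0: "f s x \<ge> 0" if "s > 0" for s x using that by (simp add: f_def)
  have i1: "integrable lborel (\<lambda>x. indicat_real (shell tht1 tht2) x *\<^sub>R en x)"
    using si_closure[OF en_cont shell_meas sub] by (simp add: set_integrable_def)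
  have i2: "integrable lborel (\<lambda>x. indicat_real (shell a (2 * a)) x *\<^sub>R f a x)"
    using si_closure[OF fc[OF ab(1)] shell_meas sub] by (simp add: set_integrable_def)
  have i3: "integrable lborel (\<lambda>x. indicat_real (shell b (2 * b)) x *\<^sub>R f b x)"
    using si_closure[OF fc[OF b0] shell_meas sub] by (simp add: set_integrable_def)
  \<comment> \<open>The integrable minorant of \<open>m\<close>: gain on the middle shell, losses on
    the two transition shells, and 0 elsewhere.\<close>
  define k where "k x = kap * (indicat_real (shell tht1 tht2) x *\<^sub>R en x)
     - C1 * exp (2 * tau * wt a) * (indicat_real (shell a (2 * a)) x *\<^sub>R f a x)
     - C1 * exp (2 * tau * wt b) * (indicat_real (shell b (2 * b)) x *\<^sub>R f b x)" for x
  have ik: "indicat_real (Om \<inter> A) x *\<^sub>R k x = k x" for x by (auto simp: k_def indicator_def shell_def)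
  have trans: "m x \<ge> - (C1 * exp (2 * tau * wt s) * f s x)"
    if x: "x \<in> A" and s: "s = a \<or> s = b" "s \<le> q x" "q x \<le> 2 * s" for x s
  proof -
    have s0: "s > 0" "s \<le> 1" using s(1) ab b0 b1 by auto
    have "\<bar>cf1 a b (q x)\<bar> \<le> Mb / s \<and> \<bar>cf2 a b (q x)\<bar> \<le> Mb / s^2"
      using cf_cases(3,4)[OF ab] s by auto
    then have "2 * q x * (L x)\<^sup>2 \<le> C1 * f s x"
      using L_transition[OF x s0(1) s(2,3)] by (simp add: C1_def f_def)
    moreover have "exp (2 * Ps x) \<le> exp (2 * tau * wt s)"
      using wt_antimono[OF s0(1) s(2)] bounds(7)[OF x] tau0 by (simp add: Psi_wt)
    ultimately have "exp (2 * Ps x) * (2 * q x * (L x)\<^sup>2) \<le> exp (2 * tau * wt s) * (C1 * f s x)"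
      by - (rule mult_mono, use bounds(6)[OF x] in auto)
    then show ?thesis using m_lower[OF x] by (simp add: mult_ac)
  qed
  have pt: "k x \<le> m x" if True: "x \<in> Om \<inter> A" for x
  proof -
    have xA: "x \<in> A" using True by simp
    have neg: "C1 * exp (2 * tau * wt a) * (indicat_real (shell a (2 * a)) x *\<^sub>R f a x) \<ge> 0"
       "C1 * exp (2 * tau * wt b) * (indicat_real (shell b (2 * b)) x *\<^sub>R f b x) \<ge> 0"
      using C10 f0 ab b0 by (auto simp: indicator_def)
    consider "2 * a \<le> q x" "q x \<le> b" | "a \<le> q x" "q x < 2 * a" | "b < q x" "q x \<le> 2 * b" | "q x < a \<or> 2 * b < q x"
      by linarith
    then show ?thesis
    proof cases
      case 1
      have k: "kap * (indicat_real (shell tht1 tht2) x *\<^sub>R en x) \<le> m x"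
      proof (cases "x \<in> shell tht1 tht2")
        case True
        then have tq: "tht1 \<le> q x" "q x \<le> tht2" by (auto simp: shell_def)
        have "tht1 > 0" using th ab by simp
        have "tht1 powr (1/4) \<le> t x" unfolding t_def using tq \<open>tht1 > 0\<close> by (intro powr_mono2) auto
        moreover have "exp (2 * tau * wt tht2) \<le> exp (2 * Ps x)"
          using wt_antimono[of "q x" tht2] bounds(6)[OF xA] tq th b1 tau0 by (simp add: Psi_wt)
        ultimately have "kap \<le> tau * t x / 128 * exp (2 * Ps x)"
          unfolding kap_def using tau0 bounds(1)[OF xA] by (intro mult_mono divide_right_mono mult_left_mono) auto
        then have "kap * en x \<le> tau * t x / 128 * exp (2 * Ps x) * en x" using en_nonneg by (intro mult_right_mono) auto
        also have "... \<le> m x" by (rule m_middle[OF xA 1])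
        finally show ?thesis using True by simp
      next
        case False
        have "0 \<le> tau * t x / 128 * exp (2 * Ps x) * en x" using bounds(1)[OF xA] tau0 en_nonneg by auto
        also have "... \<le> m x" by (rule m_middle[OF xA 1])
        finally show ?thesis using False by simp
      qed
      then show ?thesis using neg True by (simp add: k_def)
    next
      case 2
      then have "x \<notin> shell tht1 tht2" "x \<in> shell a (2 * a)" using th True by (auto simp: shell_def)
      then show ?thesis using trans[of x a] xA 2 neg True by (simp add: k_def)
    next
      case 3
      then have "x \<notin> shell tht1 tht2" "x \<in> shell b (2 * b)" using th True by (auto simp: shell_def)
      then show ?thesis using trans[of x b] xA 3 neg True by (simp add: k_def)
    next
      case 4
      then have "x \<notin> shell tht1 tht2" using th ab by (auto simp: shell_def)
      then show ?thesis using m_lower[OF xA] neg True off(3)[OF xA 4] by (simp add: k_def)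
    qed
  qed
  have "(LINT x:Om \<inter> A|lborel. k x) \<le> 0"
    by (rule integral_m[OF _ pt]) (unfold set_integrable_def ik, unfold k_def,
      intro Bochner_Integration.integrable_diff integrable_mult_right i1 i2 i3)
  also have "(LINT x:Om \<inter> A|lborel. k x) = kap * (LINT x:shell tht1 tht2|lborel. en x)
     - C1 * exp (2 * tau * wt a) * (LINT x:shell a (2 * a)|lborel. f a x)
     - C1 * exp (2 * tau * wt b) * (LINT x:shell b (2 * b)|lborel. f b x)"
    unfolding set_lebesgue_integral_def ik unfolding k_def
    by (subst Bochner_Integration.integral_diff;
        (intro Bochner_Integration.integrable_diff integrable_mult_right i1 i2 i3)?)
       (subst Bochner_Integration.integral_diff;
        (intro integrable_mult_right i1 i2 i3)?; simp)
  finally show ?thesis unfolding kap_def f_def by linarith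
qed

end

section \<open>Propagation of smallness to the boundary\<close>

text \<open>Propagation of smallness from the interior to the boundary. The tangential gradient enters the boundary
  term of the Carleman field with the bad sign; since the weight is constant on the boundary, it is cancelled by a
  multiple of the Rellich field.\<close>

locale collar = harmonic_data Om D rho u G
  for Om D :: "'a::euclidean_space set" and rho u G +
  fixes dl K P mu tau sig :: real
  assumes K: "K \<ge> 1" and mu: "mu \<ge> 200 * K" and delta: "mu * dl \<le> 1" and sigma: "sig \<ge> 0"
    and tau: "tau \<ge> 20 * (1 + sig)"
    and H: "\<And>x h. x \<in> Om ==> norm (fd (gr rho) x h) \<le> K * norm h" and lr: "\<And>x. x \<in> Om ==> \<bar>lap rho x\<bar> \<le> K"
    and grK: "\<And>x. x \<in> Om ==> norm (gr rho x) \<le> K" and P: "\<And>x. x \<in> Om ==> exp (- mu * rho x) \<le> P"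
    and gam: "\<And>x. x \<in> Om ==> rho x \<ge> - dl ==> \<bar>gr rho x \<bullet> gr rho x - 1\<bar> \<le> 1/10"
    and bc: "\<And>x. x \<in> frontier Om ==> G x \<bullet> gr rho x = sig * u x"
begin

text \<open>Constant on the frontier and growing inwards. The exponential with large
  \<open>mu\<close> supplies convexity across the level sets that outweighs the curvature bound
  \<open>K\<close>.\<close>

definition "psi x = exp (- mu * rho x)"
definition "Ps x = tau * psi x"
definition "X x = (- tau * mu * psi x) *\<^sub>R gr rho x"
text \<open>Where \<open>gam\<close> is 1, half of this value is the leading part of
  \<open>lap Ps\<close>. With that half, tangential gradients would gain nothing; with three halves
  of the value, the zero order term would gain nothing.\<close>

definition "B x = (2 * tau * mu^2) * psi x"
definition "E x = X x \<bullet> X x"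
definition "v x = exp (Ps x) * u x"
definition "gg x = exp (Ps x) *\<^sub>R (G x + u x *\<^sub>R X x)"

lemma mu0: "mu > 0" "mu \<ge> 200" "K \<le> mu / 200" using mu K by linarith+
lemma tau0: "tau \<ge> 20" "sig \<le> tau / 4" "tau > 0"
proof -
  have "tau \<ge> 20 + 20 * sig" using tau by (simp add: algebra_simps)
  then show "tau \<ge> 20" "sig \<le> tau / 4" "tau > 0" using sigma by simp_all
qed

lemma r3: "ck 2 D rho" "ck 1 D rho" "ck 1 D (gr rho)"
  using ck_rho[of 2] ck_rho[of 1] ck_grho[of 1] by auto

lemma df: "ck 1 D f ==> x \<in> D ==> f differentiable (at x)" by simp

lemma psi2: "ck 2 D psi" "ck 1 D psi"
  unfolding psi_def[abs_def] by (intro ck_exp ck_mult ck_const opD r3)+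

lemma gpsi: "x \<in> D ==> gr psi x = (- mu * psi x) *\<^sub>R gr rho x"
proof -
  assume x: "x \<in> D"
  have "((\<lambda>s. exp (- mu * s)) has_real_derivative - mu * exp (- mu * rho x)) (at (rho x))"
    by (auto intro!: derivative_eq_intros)
  from gr_compose[OF this df[OF r3(2) x]] show ?thesis by (simp add: psi_def[abs_def])
qed

lemma gPsi: "x \<in> D ==> gr Ps x = X x"
  unfolding Ps_def[abs_def] by (simp add: gr_cmul[OF df[OF psi2(2)]] gpsi X_def)

lemma gB: "x \<in> D ==> gr B x = (2 * tau * mu^2) *\<^sub>R gr psi x"
  unfolding B_def[abs_def] by (rule gr_cmul[OF df[OF psi2(2)]])

lemma ckD: "ck 2 D Ps" "ck 2 D B" "ck 1 D X" "ck 1 D E"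
  unfolding Ps_def[abs_def] B_def[abs_def] E_def[abs_def] X_def[abs_def]
  by (intro ck_mult ck_scaleR ck_inner ck_const opD psi2 r3)+

lemma ckO: "ck k D f ==> ck k Om f" using ck_subset subD by blast

lemma v2: "ck 2 Om v" unfolding v_def[abs_def] by (intro ck_mult ck_exp op u2 ckO[OF ckD(1)])

sublocale CM: carleman Om v B E X u Ps "\<lambda>_. 1"
proof (unfold_locales)
  show "E x = gr Ps x \<bullet> gr Ps x" "X x = 1 *\<^sub>R gr Ps x" if "x \<in> Om" for x
    using gPsi[of x] that subD by (auto simp: E_def)
qed (use op v2 ckO[OF ckD(1)] ckO[OF ckD(2)] ckO[OF ckD(3)] ckO[OF ckD(4)] u2 in \<open>auto simp: v_def\<close>)

sublocale RM: multiplier Om u "\<lambda>_. 0" "\<lambda>_. 0" "gr rho"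
  by unfold_locales (use op u2 ckO[OF r3(3)] in auto)

lemma gg: assumes "x \<in> Om" shows "gr v x = gg x"
  using conjugated_laplacian(1)[OF op u2 ckO[OF ckD(1)] assms, of v] GG[OF assms] gPsi[of x] assms subD
  by (auto simp: gg_def v_def)

lemma fdX:
  assumes x: "x \<in> D"
  shows "fd X x h = (- tau * mu * psi x) *\<^sub>R (fd (gr rho) x h - (mu * (gr rho x \<bullet> h)) *\<^sub>R gr rho x)"
proof -
  have "((\<lambda>x. - tau * mu * psi x) has_derivative (\<lambda>h. - tau * mu * (gr psi x \<bullet> h))) (at x)"
    by (intro has_derivative_mult_right gr_deriv df[OF psi2(2) x])
  from has_derivative_scaleR[OF this differentiable_fd[OF df[OF r3(3) x]]]
  show ?thesis unfolding X_def[abs_def]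
    by (subst fd_eqI, assumption) (simp add: gpsi[OF x] scaleR_diff_right)
qed

lemma lap_psi:
  assumes x: "x \<in> Om"
  shows "lap psi x = mu * psi x * (mu * (gr rho x \<bullet> gr rho x) - lap rho x)"
proof -
  have xD: "x \<in> D" using x subD by auto
  have "lap psi x = dv (\<lambda>x. (- mu * psi x) *\<^sub>R gr rho x) x" by (rule dv_cong_open[OF opD xD gpsi])
  also have "... = gr (\<lambda>x. - mu * psi x) x \<bullet> gr rho x + - mu * psi x * lap rho x"
    by (rule dv_scaleR) (use psi2(2) r3(3) xD opD in \<open>auto intro: df ck_mult\<close>)
  finally show ?thesis by (simp only: gr_cmul[OF df[OF psi2(2) xD]] gpsi[OF xD]) (simp add: algebra_simps)
qed

lemma ck_gpsi: "ck 1 D (gr psi)" using ck_gr[OF opD, of 1 psi] psi2 by (simp add: numeral_2_eq_2)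

lemma dvX: "x \<in> Om ==> dv X x = tau * lap psi x"
  using dv_cong_open[OF op, of x X "\<lambda>x. tau *\<^sub>R gr psi x"] dv_cmul[OF df[OF ck_gpsi], of x tau] subD
  by (auto simp: X_def gpsi subset_eq)

lemma lapB: "x \<in> Om ==> lap B x = (2 * tau * mu^2) * lap psi x"
  using dv_cong_open[OF op, of x "gr B" "\<lambda>x. (2 * tau * mu^2) *\<^sub>R gr psi x"] dv_cmul[OF df[OF ck_gpsi], of x "2 * tau * mu^2"] gB subD
  by (auto simp: subset_eq)

lemma lapPsi: "x \<in> Om ==> lap Ps x = dv X x"
  by (rule dv_cong_open[OF op]) (use gPsi subD in auto)

text \<open>\<open>T\<close> is the length of \<open>gr Ps\<close> wherever \<open>gr rho\<close> is
  a unit vector; it acts as the local Carleman parameter.\<close>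

definition "T x = tau * mu * psi x"
definition "gam x = gr rho x \<bullet> gr rho x"

lemma T_bounds: assumes "x \<in> Om" shows "1 \<le> psi x" "tau * mu \<le> T x" "20 * mu \<le> T x" "1 \<le> T x" "0 < T x"
proof -
  have "0 \<le> - mu * rho x" using neg[OF assms] mu0 by (simp add: mult_nonneg_nonpos)
  then show p: "1 \<le> psi x" by (simp add: psi_def)
  then show 1: "tau * mu \<le> T x" using tau0 mu0 by (simp add: T_def)
  have "20 * mu \<le> tau * mu" using tau0 mu0 by simp
  with 1 show "20 * mu \<le> T x" by linarith
  with mu0 show "1 \<le> T x" "0 < T x" by linarith+
qed

lemma hess_le: "x \<in> Om ==> \<bar>fd (gr rho) x h \<bullet> h\<bar> \<le> K * (h \<bullet> h)"
  using Cauchy_Schwarz_ineq2[of "fd (gr rho) x h" h] mult_right_mono[OF H[of x h], of "norm h"]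
  by (simp add: dot_square_norm power2_eq_square)

text \<open>The coefficients \<open>c\<close>, \<open>c1\<close>, \<open>c2\<close> and
  \<open>c3\<close> are left open because the computation serves twice: in the collar, where
  \<open>gam\<close> is close to 1 and the signs are favourable, and in all of \<open>Om\<close>,
  where rough bounds are enough.\<close>

lemma collar_pointwise:
  assumes x: "x \<in> Om" and c: "2 * mu - mu * gam x + lap rho x - 2 * K \<ge> c" "mu * gam x - lap rho x \<le> c1"
    "(2 * mu - mu * gam x + lap rho x)^2 \<le> c2" "3 * mu * (gam x)^2 - 2 * mu * gam x - gam x * lap rho x - 2 * K * gam x \<ge> c3"
  shows "4 * (T x * c * (gg x \<bullet> gg x)) + (4 * ((T x)^3 * c3) - 4 * (T x * mu^2 * c1) - 2 * (T x)^2 * c2) * (v x)^2 \<le> 4 * dv CM.W x"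
proof -
  have xD: "x \<in> D" using x subD by auto
  define g t y l N where "g = gg x" and "t = T x" and "y = gam x" and "l = lap rho x" and "N = gr rho x"
  note T0 = T_bounds(5)[OF x, folded t_def]
  have Xx: "X x = (- t) *\<^sub>R N" by (simp add: X_def t_def T_def N_def)
  have dX: "dv X x = t * (mu * y - l)" and lB: "lap B x / 2 = t * mu^2 * (mu * y - l)" and Bx: "B x = t * (2 * mu)"
    unfolding dvX[OF x] lapB[OF x] lap_psi[OF x] B_def
    by (simp_all add: t_def T_def y_def gam_def l_def power2_eq_square)
  have fX: "fd X x h \<bullet> h = t * (mu * (N \<bullet> h)^2 - fd (gr rho) x h \<bullet> h)" for h
    unfolding fdX[OF xD] by (simp add: t_def T_def N_def inner_diff_left power2_eq_square algebra_simps)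
  have "gr E x \<bullet> X x = 2 * (fd X x (X x) \<bullet> X x)"
    unfolding E_def[abs_def] using gr_inner_fields[OF df[OF ckD(3) xD] df[OF ckD(3) xD]] by (simp add: inner_commute)
  also have "... = t^3 * (2 * mu * y^2 - 2 * (fd (gr rho) x N \<bullet> N))"
    unfolding fX Xx linear_scale[OF fd_linear[OF df[OF r3(3) xD]]]
    by (simp add: y_def gam_def N_def[symmetric] power2_eq_square power3_eq_cube algebra_simps)
  finally have gE: "gr E x \<bullet> X x = t^3 * (2 * mu * y^2 - 2 * (fd (gr rho) x N \<bullet> N))" .
  have Ex: "E x = t^2 * y" by (simp add: E_def Xx y_def gam_def N_def power2_eq_square)
  define Z where "Z = gr E x \<bullet> X x + E x * (dv X x - B x) - lap B x / 2"
  have "t^3 * c3 \<le> t^3 * (3 * mu * y^2 - 2 * mu * y - y * l - 2 * (fd (gr rho) x N \<bullet> N))"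
    using c(4) hess_le[OF x, of N] T0
    by (intro mult_left_mono) (auto simp: y_def l_def gam_def N_def[symmetric])
  moreover have "t * mu^2 * (mu * y - l) \<le> t * mu^2 * c1"
    using c(2) T0 by (intro mult_left_mono) (auto simp: y_def l_def)
  moreover have "Z = t^3 * (3 * mu * y^2 - 2 * mu * y - y * l - 2 * (fd (gr rho) x N \<bullet> N)) - t * mu^2 * (mu * y - l)"
    unfolding Z_def gE lB Ex dX Bx by (simp add: power2_eq_square power3_eq_cube algebra_simps)
  ultimately have Z: "t^3 * c3 - t * mu^2 * c1 \<le> Z" by linarith
  have "t * c * (g \<bullet> g) \<le> t * (2 * mu - mu * y + l - 2 * K) * (g \<bullet> g)"
    using c(1) T0 by (intro mult_right_mono mult_left_mono) (auto simp: y_def l_def)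
  also have "... \<le> 2 * (t * (mu * (N \<bullet> g)^2 - fd (gr rho) x g \<bullet> g)) + t * (2 * mu - (mu * y - l)) * (g \<bullet> g)"
  proof -
    have "0 \<le> mu * (N \<bullet> g)^2" using mu0 by simp
    then have "- K * (g \<bullet> g) \<le> mu * (N \<bullet> g)^2 - fd (gr rho) x g \<bullet> g" using hess_le[OF x, of g] by linarith
    then have "t * (- K * (g \<bullet> g)) \<le> t * (mu * (N \<bullet> g)^2 - fd (gr rho) x g \<bullet> g)" using T0 by (intro mult_left_mono) auto
    then show ?thesis by (simp add: algebra_simps)
  qed
  finally have 1: "t * c * (g \<bullet> g) \<le> 2 * (fd X x g \<bullet> g) + (B x - dv X x) * (g \<bullet> g)"
    unfolding fX dX Bx by (simp add: right_diff_distrib)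
  have Qx: "CM.Q x = 2 * (fd X x g \<bullet> g) + (B x - dv X x) * (g \<bullet> g) + Z * (v x)^2"
    by (simp add: CM.Q_def gg[OF x] g_def Z_def power2_eq_square)
  have R: "2 * (B x - dv X x)^2 * (v x)^2 \<le> 2 * t^2 * c2 * (v x)^2"
  proof (rule mult_right_mono)
    have "B x - dv X x = t * (2 * mu - mu * y + l)" unfolding dX Bx by (simp add: algebra_simps)
    then show "2 * (B x - dv X x)^2 \<le> 2 * t^2 * c2"
      using c(3) T0 by (simp add: power_mult_distrib y_def l_def)
  qed simp
  have "4 * CM.Q x \<le> 4 * dv CM.W x + 2 * (B x - dv X x)^2 * (v x)^2"
    using CM.pointwise[OF x] harm[OF x] by (simp add: lapPsi[OF x])
  moreover have "(t^3 * c3 - t * mu^2 * c1) * (v x)^2 \<le> Z * (v x)^2" using Z by (rule mult_right_mono) simp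
  ultimately show ?thesis using 1 R Qx unfolding g_def[symmetric] t_def[symmetric]
    by (simp add: algebra_simps)
qed

lemma gg_le:
  assumes x: "x \<in> Om" shows "G x \<bullet> G x \<le> 2 * ((G x + u x *\<^sub>R X x) \<bullet> (G x + u x *\<^sub>R X x)) + 2 * ((T x)^2 * gam x * (u x)^2)"
    "(G x + u x *\<^sub>R X x) \<bullet> (G x + u x *\<^sub>R X x) \<le> 2 * (G x \<bullet> G x) + 2 * ((T x)^2 * gam x * (u x)^2)"
proof -
  have "(u x *\<^sub>R X x) \<bullet> (u x *\<^sub>R X x) = (T x)^2 * gam x * (u x)^2"
    by (simp add: X_def T_def gam_def power2_eq_square)
  then show "G x \<bullet> G x \<le> 2 * ((G x + u x *\<^sub>R X x) \<bullet> (G x + u x *\<^sub>R X x)) + 2 * ((T x)^2 * gam x * (u x)^2)"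
    "(G x + u x *\<^sub>R X x) \<bullet> (G x + u x *\<^sub>R X x) \<le> 2 * (G x \<bullet> G x) + 2 * ((T x)^2 * gam x * (u x)^2)"
    using inner_diff_self_le[of "G x + u x *\<^sub>R X x" "u x *\<^sub>R X x"] inner_diff_self_le[of "G x" "- (u x *\<^sub>R X x)"]
    by simp_all
qed

text \<open>The Rellich field of \<open>u\<close>, whose flux on the frontier is
  \<open>2 * (sig * u x)^2 - G x \<bullet> G x\<close>. The factor
  \<open>tau * mu * exp (2 * tau)\<close> in \<open>F\<close> is the coefficient of
  \<open>G x \<bullet> G x\<close> in the Carleman flux.\<close>

definition "RF x = (2 * (gr rho x \<bullet> G x)) *\<^sub>R G x - (G x \<bullet> G x) *\<^sub>R gr rho x"
definition "WF x = ((2 * (X x \<bullet> gg x) + B x * v x) *\<^sub>R gg x - (v x * v x / 2) *\<^sub>R gr B x)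
   + (E x * (v x * v x) - gg x \<bullet> gg x) *\<^sub>R X x"
definition "F x = WF x + (tau * mu * exp (2 * tau)) *\<^sub>R RF x"

lemma gr_zero: "gr (\<lambda>_::'a. 0::real) = (\<lambda>_. 0)" "dv (\<lambda>_::'a. 0::'a) x = 0"
  by (simp_all add: gr_def dv_def frechet_derivative_const fun_eq_iff)

lemma F_eq: "x \<in> Om ==> F x = CM.W x + (tau * mu * exp (2 * tau)) *\<^sub>R RM.W x" using GG[of x]
  by (simp add: F_def RF_def RM.W_def gr_zero WF_def CM.W_def gg)

lemma dv_F:
  assumes x: "x \<in> Om"
  shows "4 * dv CM.W x - 12 * (tau * mu * exp (2 * tau) * K * (G x \<bullet> G x)) \<le> 4 * dv F x"
proof -
  define c where "c = tau * mu * exp (2 * tau)"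
  have c0: "c \<ge> 0" using tau0 mu0 by (simp add: c_def)
  have d: "CM.W differentiable (at x)" "RM.W differentiable (at x)" using CM.W_ck RM.W_ck x by auto
  have "dv F x = dv (\<lambda>x. CM.W x + c *\<^sub>R RM.W x) x"
    by (rule dv_cong_open[OF op x]) (simp add: F_eq c_def)
  also have "... = dv CM.W x + c * dv RM.W x" using dv_add[OF d(1), of "\<lambda>x. c *\<^sub>R RM.W x"] dv_cmul[OF d(2)] d(2) by simp
  finally have e: "dv F x = dv CM.W x + c * dv RM.W x" .
  have "lap rho x * (G x \<bullet> G x) \<le> K * (G x \<bullet> G x)" using lr[OF x] by (intro mult_right_mono) auto
  moreover have "dv RM.W x = 2 * (fd (gr rho) x (G x) \<bullet> G x) - lap rho x * (G x \<bullet> G x)"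
    unfolding RM.dv_W[OF x] RM.Q_def using harm[OF x] GG[OF x] by (simp add: gr_zero)
  ultimately have "- (3 * (K * (G x \<bullet> G x))) \<le> dv RM.W x" using hess_le[OF x, of "G x"] by linarith
  from mult_left_mono[OF this c0] show ?thesis unfolding e c_def[symmetric] by (simp add: algebra_simps)
qed

text \<open>The gradient gain has size \<open>tau * mu^2\<close>, whereas the divergence of the
  Rellich field costs \<open>12 * tau * mu * K\<close>; the condition
  \<open>mu \<ge> 200 * K\<close> lets the gain win.\<close>

lemma near:
  assumes x: "x \<in> Om" and r: "rho x \<ge> - dl"
  shows "exp (2 * tau) * en x \<le> 4 * dv F x"
proof -
  define t h e2 where "t = T x" and "h = (G x + u x *\<^sub>R X x) \<bullet> (G x + u x *\<^sub>R X x)" and "e2 = exp (2 * Ps x)"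
  define U Q where "U = (u x)^2" and "Q = G x \<bullet> G x"
  note T0 = T_bounds[OF x, folded t_def]
  have nn: "h \<ge> 0" "U \<ge> 0" "Q \<ge> 0" by (simp_all add: h_def U_def Q_def)
  have y: "9/10 \<le> gam x" "gam x \<le> 11/10" using gam[OF x r] unfolding gam_def by linarith+
  note l = lr[OF x] mu0
  have my: "mu * (9/10) \<le> mu * gam x" "mu * gam x \<le> mu * (11/10)" using y mu0 by auto
  have "4 * (t * (mu / 2) * (gg x \<bullet> gg x)) + (4 * (t^3 * (mu / 2)) - 4 * (t * mu^2 * (2 * mu)) - 2 * t^2 * (4 * mu^2)) * (v x)^2 \<le> 4 * dv CM.W x"
    unfolding t_def
  proof (rule collar_pointwise[OF x])
    show "2 * mu - mu * gam x + lap rho x - 2 * K \<ge> mu / 2" "mu * gam x - lap rho x \<le> 2 * mu" using my l by linarith+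
    have "\<bar>2 * mu - mu * gam x + lap rho x\<bar> \<le> \<bar>2 * mu\<bar>" using my l by linarith
    then show "(2 * mu - mu * gam x + lap rho x)^2 \<le> 4 * mu^2" by (simp add: abs_le_square_iff power_mult_distrib)
    have "gam x * lap rho x \<le> gam x * K" using y l by (intro mult_left_mono) auto
    then have "gam x * lap rho x \<le> K * gam x" "K * gam x \<le> K * (11/10)" using y K by (auto simp: mult.commute)
    moreover have "mu * (9/10 * (7/10)) \<le> mu * (gam x * (3 * gam x - 2))" using y mu0 by (intro mult_left_mono mult_mono) auto
    moreover have "mu * (gam x * (3 * gam x - 2)) = 3 * mu * (gam x)^2 - 2 * mu * gam x" by (simp add: power2_eq_square algebra_simps)
    ultimately show "3 * mu * (gam x)^2 - 2 * mu * gam x - gam x * lap rho x - 2 * K * gam x \<ge> mu / 2" using l unfolding mult.assoc by linarith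
  qed
  moreover have "gg x \<bullet> gg x = e2 * h" "(v x)^2 = e2 * U"
    by (simp_all add: gg_def v_def h_def e2_def U_def power_mult_distrib exp_double power2_eq_square)
  moreover have "t^3 * mu \<le> 4 * (t^3 * (mu / 2)) - 4 * (t * mu^2 * (2 * mu)) - 2 * t^2 * (4 * mu^2)"
  proof -
    have "t * mu * (20 * mu)^2 \<le> t * mu * t^2" using T0 mu0 by (intro mult_left_mono power_mono) auto
    moreover have "t^2 * mu * (20 * mu) \<le> t^2 * mu * t" using T0 mu0 by (intro mult_left_mono) auto
    moreover have "0 \<le> t^3 * mu" using T0 mu0 by simp
    ultimately show ?thesis by (simp add: power2_eq_square power3_eq_cube algebra_simps)
  qed
  then have "t^3 * mu * (v x)^2 \<le> (4 * (t^3 * (mu / 2)) - 4 * (t * mu^2 * (2 * mu)) - 2 * t^2 * (4 * mu^2)) * (v x)^2"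
    by (rule mult_right_mono) simp
  ultimately have W: "e2 * (2 * (t * mu) * h + t^3 * mu * U) \<le> 4 * dv CM.W x" by (simp add: algebra_simps)
  have "tau * 1 \<le> tau * psi x" using T0 tau0 by (intro mult_left_mono) auto
  then have ee: "exp (2 * tau) \<le> e2" "exp (2 * tau) > 0" by (simp_all add: e2_def Ps_def)
  have "Q \<le> 2 * h + 2 * (t^2 * gam x * U)" using gg_le(1)[OF x] by (simp add: Q_def h_def U_def t_def)
  moreover have "t^2 * U * gam x \<le> t^2 * U * (11/10)" using y nn by (intro mult_left_mono) auto
  ultimately have "Q \<le> 2 * h + 11/5 * (t^2 * U)" by (simp add: mult_ac)
  from mult_left_mono[OF this, of "t * mu / 8"] have 1: "t * mu / 8 * Q \<le> t * mu * h / 4 + 11/40 * (t^3 * mu * U)"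
    using T0 mu0 by (simp add: power2_eq_square power3_eq_cube algebra_simps)
  have "1 * 200 \<le> t^3 * mu" using T0 mu0 by (intro mult_mono) (auto simp: one_le_power)
  then have "200 * U \<le> t^3 * mu * U" using nn by (intro mult_right_mono) auto
  moreover have "0 \<le> t * mu * h" using T0 mu0 nn by simp
  ultimately have Y: "t * mu / 8 * Q + U \<le> 2 * (t * mu) * h + t^3 * mu * U" using 1 nn by linarith
  have "1 + 12 * (tau * mu * K) \<le> t * mu / 8"
  proof -
    have "tau * mu * (12 * K + 1) \<le> tau * mu * (mu / 8)" using l tau0 by (intro mult_left_mono) auto
    moreover have "tau * mu * mu \<le> t * mu" "1 \<le> tau * mu" using T0 mu0 tau0 mult_mono[of 1 tau 1 mu] by (auto intro!: mult_right_mono)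
    ultimately show ?thesis by (simp add: algebra_simps)
  qed
  from mult_right_mono[OF this nn(3)] have "Q + U + 12 * (tau * mu * K * Q) \<le> t * mu / 8 * Q + U" by (simp add: algebra_simps)
  also note Y
  finally have "exp (2 * tau) * (Q + U + 12 * (tau * mu * K * Q)) \<le> e2 * (2 * (t * mu) * h + t^3 * mu * U)"
    using ee nn tau0 mu0 K by (intro mult_mono) (auto simp: e2_def)
  with W dv_F[OF x] show ?thesis by (simp add: en_def Q_def[symmetric] U_def[symmetric] algebra_simps)
qed

definition "C2 = 68 * mu^4 * K^4 * P^3 + 12 * (mu * K)"

text \<open>Away from the frontier any loss that is exponential in \<open>tau\<close> is affordable.
  The cube of \<open>T\<close> is estimated through \<open>tau \<le> exp tau\<close>, which produces
  the 3 in the exponent.\<close>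

lemma far:
  assumes x: "x \<in> Om"
  shows "- (C2 * exp ((2 * P + 3) * tau) * en x) \<le> 4 * dv F x"
proof -
  define t h e2 where "t = T x" and "h = (G x + u x *\<^sub>R X x) \<bullet> (G x + u x *\<^sub>R X x)" and "e2 = exp (2 * Ps x)"
  define U Q where "U = (u x)^2" and "Q = G x \<bullet> G x"
  note T0 = T_bounds[OF x, folded t_def]
  have nn: "h \<ge> 0" "U \<ge> 0" "Q \<ge> 0" by (simp_all add: h_def U_def Q_def)
  have K2: "1 \<le> K^2" "K \<le> K^2" using K mult_left_mono[of 1 K K] by (auto simp: power2_eq_square[of K] intro: order_trans)
  have y: "0 \<le> gam x" "gam x \<le> K^2"
    using power_mono[OF grK[OF x], of 2] by (simp_all add: gam_def dot_square_norm)
  note l = lr[OF x] mu0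
  define k where "k = mu * K^2"
  have k: "mu * gam x \<le> k" "mu \<le> k" "0 \<le> mu * gam x" "0 < k"
    using y mu0 K2 by (auto simp: k_def intro!: mult_pos_pos)
  have "4 * (t * (- (2 * k)) * (gg x \<bullet> gg x)) + (4 * (t^3 * (- (3 * k))) - 4 * (t * mu^2 * (2 * k)) - 2 * t^2 * (4 * k)^2) * (v x)^2 \<le> 4 * dv CM.W x"
    unfolding t_def
  proof (rule collar_pointwise[OF x])
    show "2 * mu - mu * gam x + lap rho x - 2 * K \<ge> - (2 * k)" "mu * gam x - lap rho x \<le> 2 * k" using k l by linarith+
    have "\<bar>2 * mu - mu * gam x + lap rho x\<bar> \<le> \<bar>4 * k\<bar>" using k l by linarith
    then show "(2 * mu - mu * gam x + lap rho x)^2 \<le> (4 * k)^2" by (simp only: abs_le_square_iff)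
    have "gam x * (2 * mu + lap rho x + 2 * K) \<le> K^2 * (3 * mu)" using y l K by (intro mult_mono) auto
    then have "gam x * (2 * mu + lap rho x + 2 * K) \<le> 3 * k" by (simp add: k_def mult_ac)
    moreover have "0 \<le> 3 * mu * (gam x)^2" using mu0 by simp
    ultimately show "3 * mu * (gam x)^2 - 2 * mu * gam x - gam x * lap rho x - 2 * K * gam x \<ge> - (3 * k)" by (simp add: algebra_simps)
  qed
  moreover have "gg x \<bullet> gg x = e2 * h" "(v x)^2 = e2 * U"
    by (simp_all add: gg_def v_def h_def e2_def U_def power_mult_distrib exp_double power2_eq_square)
  moreover have S: "4 * (t^3 * (3 * k)) + 4 * (t * mu^2 * (2 * k)) + 2 * t^2 * (4 * k)^2 \<le> 52 * (k * K^2) * t^3"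
  proof -
    have m: "mu \<le> t" using T0 mu0 by linarith
    have "t * k * mu^2 \<le> t * k * t^2" using T0 mu0 m k by (intro mult_left_mono power_mono) auto
    moreover have "t^2 * (k * K^2) * mu \<le> t^2 * (k * K^2) * t" using k m by (intro mult_left_mono) auto
    moreover have "t^3 * k * 1 \<le> t^3 * k * K^2" using k T0 K2 by (intro mult_left_mono) auto
    ultimately show ?thesis by (simp add: k_def power2_eq_square power3_eq_cube algebra_simps)
  qed
  ultimately have "- (e2 * (8 * (k * t) * h + (4 * (t^3 * (3 * k)) + 4 * (t * mu^2 * (2 * k)) + 2 * t^2 * (4 * k)^2) * U)) \<le> 4 * dv CM.W x"
    by (simp add: algebra_simps)
  moreover have "8 * (k * t) * h + (4 * (t^3 * (3 * k)) + 4 * (t * mu^2 * (2 * k)) + 2 * t^2 * (4 * k)^2) * U \<le> 68 * (k * K^2 * t^3) * en x"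
  proof -
    have "t^2 * U * gam x \<le> t^2 * U * K^2" using y nn by (intro mult_left_mono) auto
    then have "h \<le> 2 * Q + 2 * (t^2 * K^2 * U)" using gg_le(2)[OF x] by (simp add: Q_def h_def U_def t_def mult_ac)
    then have "k * t * h \<le> k * t * (2 * Q + 2 * (t^2 * K^2 * U))" using k T0 by (intro mult_left_mono) auto
    also have "... = 2 * (k * t * 1 * Q) + 2 * (k * K^2 * t^3 * U)" by (simp add: power2_eq_square power3_eq_cube algebra_simps)
    also have "k * t * 1 * Q \<le> k * t * (K^2 * t^2) * Q"
      using k T0 K2 nn mult_mono[of 1 "K^2" 1 "t^2"] by (intro mult_right_mono mult_left_mono) auto
    finally have "k * t * h \<le> 2 * (k * K^2 * t^3 * (Q + U))" by (simp add: power2_eq_square power3_eq_cube algebra_simps)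
    moreover have "0 \<le> k * K^2 * t^3 * Q" using k T0 nn by simp
    ultimately show ?thesis using mult_right_mono[OF S nn(2)] by (simp add: en_def U_def Q_def algebra_simps)
  qed
  then have "e2 * (8 * (k * t) * h + (4 * (t^3 * (3 * k)) + 4 * (t * mu^2 * (2 * k)) + 2 * t^2 * (4 * k)^2) * U) \<le> e2 * (68 * (k * K^2 * t^3) * en x)"
    by (rule mult_left_mono) (simp add: e2_def)
  ultimately have W: "- (e2 * (68 * (k * K^2 * t^3) * en x)) \<le> 4 * dv CM.W x" by linarith
  have p: "psi x \<le> P" "0 \<le> P" using P[OF x] order_trans[OF exp_ge_zero P[OF x]] by (auto simp: psi_def)
  have et: "tau \<le> exp tau" using exp_ge_add_one_self[of tau] by linarith
  have "t \<le> exp tau * mu * P" unfolding t_def T_def using et p mu0 tau0 T0 by (intro mult_mono) auto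
  then have "t^3 \<le> (exp tau * mu * P)^3" using T0 by (intro power_mono) auto
  also have "... = exp (3 * tau) * (mu^3 * P^3)" by (simp add: power_mult_distrib exp_of_nat_mult[symmetric])
  finally have t3: "t^3 \<le> exp (3 * tau) * (mu^3 * P^3)" .
  have "e2 \<le> exp (2 * P * tau)" unfolding e2_def Ps_def using p tau0 mult_left_mono[of "psi x" P "2 * tau"] by (simp add: mult_ac)
  then have "e2 * (68 * (k * K^2 * t^3) * en x) \<le> exp (2 * P * tau) * (68 * (k * K^2 * (exp (3 * tau) * (mu^3 * P^3))) * en x)"
    using t3 k T0 en_nonneg[of x] by (intro mult_mono mult_right_mono mult_left_mono) auto
  also have "... = 68 * mu^4 * K^4 * P^3 * (exp (2 * P * tau) * exp (3 * tau)) * en x"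
    by (simp add: k_def eval_nat_numeral mult_ac)
  also have "exp (2 * P * tau) * exp (3 * tau) = exp ((2 * P + 3) * tau)" by (simp add: mult_exp_exp distrib_right)
  finally have 1: "e2 * (68 * (k * K^2 * t^3) * en x) \<le> 68 * mu^4 * K^4 * P^3 * exp ((2 * P + 3) * tau) * en x" .
  have "tau * exp (2 * tau) \<le> exp tau * exp (2 * tau)" using et by (intro mult_right_mono) auto
  also have "... \<le> exp ((2 * P + 3) * tau)" using p tau0 by (simp add: mult_exp_exp distrib_right)
  finally have "mu * K * (tau * exp (2 * tau)) * Q \<le> mu * K * exp ((2 * P + 3) * tau) * en x"
    using nn mu0 K by (intro mult_mono mult_left_mono) (auto simp: en_def Q_def)
  with W 1 dv_F[OF x] show ?thesis by (simp add: C2_def Q_def algebra_simps)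
qed

lemma F_boundary: assumes x: "x \<in> frontier Om" shows "F x \<bullet> gr rho x \<le> 0"
proof -
  have xD: "x \<in> D" using x frontier_cl clD by auto
  have N: "gr rho x \<bullet> gr rho x = 1" using unit[OF x] by (simp add: dot_square_norm)
  have r0: "rho x = 0" by (rule zer[OF x])
  define T where "T = tau * mu"
  define e where "e = exp tau"
  have ps: "psi x = 1" using r0 by (simp add: psi_def)
  have Xx: "X x = (- T) *\<^sub>R gr rho x" by (simp add: X_def ps T_def)
  have vx: "v x = e * u x" by (simp add: v_def Ps_def ps e_def)
  have gx: "gg x = e *\<^sub>R (G x - (T * u x) *\<^sub>R gr rho x)"
    by (simp add: gg_def Ps_def ps e_def Xx)
  have GN: "G x \<bullet> gr rho x = sig * u x" "gr rho x \<bullet> G x = sig * u x" using bc[OF x] by (simp_all add: inner_commute)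
  have gN: "gg x \<bullet> gr rho x = e * (sig - T) * u x" "gr rho x \<bullet> gg x = e * (sig - T) * u x"
    unfolding gx by (simp_all add: inner_diff_left inner_diff_right GN N algebra_simps)
  have g2: "gg x \<bullet> gg x = e^2 * (G x \<bullet> G x) + e^2 * (u x)^2 * (T^2 - 2 * T * sig)"
    unfolding gx by (simp add: inner_diff_left inner_diff_right GN N power2_eq_square algebra_simps)
  have ee: "exp (2 * tau) = e^2" by (simp add: e_def exp_double)
  have Bx: "B x = 2 * T * mu" "gr B x = (- 2 * T * mu^2) *\<^sub>R gr rho x" "E x = T^2"
    using gB[OF xD] by (simp_all add: gpsi[OF xD] B_def E_def Xx ps T_def N power2_eq_square power3_eq_cube)
  define c where "c = e * (sig - T) * u x"
  have W: "WF x \<bullet> gr rho x = (2 * (- T * c) + 2 * T * mu * (e * u x)) * c + e * u x * (e * u x) / 2 * (2 * T * mu^2)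
     - (T^2 * (e * u x * (e * u x)) - gg x \<bullet> gg x) * T"
    unfolding WF_def Bx Xx vx by (simp add: inner_add_left inner_diff_left gN N c_def)
  have R: "RF x \<bullet> gr rho x = 2 * (sig * u x) * (sig * u x) - G x \<bullet> G x"
    unfolding RF_def by (simp add: inner_diff_left GN N)
  have "F x \<bullet> gr rho x = WF x \<bullet> gr rho x + T * e^2 * (RF x \<bullet> gr rho x)"
    by (simp add: F_def inner_add_left ee T_def)
  also have "... = e^2 * (u x)^2 * (T * (- 2 * T^2 + 2 * sig * T + 2 * mu * sig - 2 * mu * T + mu^2))"
    unfolding W R g2 c_def by (simp add: field_simps power2_eq_square)
  finally have "F x \<bullet> gr rho x = e^2 * (u x)^2 * (T * (- 2 * T^2 + 2 * sig * T + 2 * mu * sig - 2 * mu * T + mu^2))" .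
  \<comment> \<open>The terms with \<open>G x \<bullet> G x\<close> have cancelled. In the remaining
    polynomial \<open>- 2 * T^2\<close> wins, because \<open>sig \<le> T / 4\<close> and
    \<open>T \<ge> 20 * mu\<close>.\<close>
  moreover have "- 2 * T^2 + 2 * sig * T + 2 * mu * sig - 2 * mu * T + mu^2 \<le> 0"
  proof -
    have T: "T \<ge> 20 * mu" "T > 0" using tau0 mu0 by (simp_all add: T_def)
    have s: "sig \<le> T / 4"
    proof -
      have "tau * 1 \<le> tau * mu" using tau0 mu0 by (intro mult_left_mono) auto
      then have "tau \<le> T" by (simp only: T_def mult_1_right)
      then show ?thesis using tau0 by linarith
    qed
    have 1: "sig * T \<le> T / 4 * T" using s T by (intro mult_right_mono) auto
    have 2: "mu * sig \<le> mu * (T / 4)" using s mu0 by (intro mult_left_mono) auto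
    have 3: "mu * mu \<le> T * T" using T mu0 by (intro mult_mono) auto
    have 4: "0 \<le> mu * T" "0 \<le> T * T" using T mu0 by auto
    have "T / 4 * T = T * T / 4" "mu * (T / 4) = mu * T / 4" by simp_all
    then show ?thesis using 1 2 3 4 unfolding power2_eq_square mult.assoc by linarith
  qed
  then have tt: "T * (- 2 * T^2 + 2 * sig * T + 2 * mu * sig - 2 * mu * T + mu^2) \<le> 0"
    using tau0 mu0 by (intro mult_nonneg_nonpos) (auto simp: T_def)
  have h0: "e^2 * (u x)^2 * (T * (- 2 * T^2 + 2 * sig * T + 2 * mu * sig - 2 * mu * T + mu^2)) \<le> 0"
    by (rule mult_nonneg_nonpos[OF _ tt]) simp
  ultimately show ?thesis by (simp only: h0)
qed

end

lemma fd_bound_compact: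
  fixes F :: "'a::euclidean_space \<Rightarrow> 'b::real_normed_vector"
  assumes F: "ck 1 D F" and T: "compact T" "T \<subseteq> D"
  shows "\<exists>K\<ge>1. \<forall>x\<in>T. \<forall>h. norm (fd F x h) \<le> K * norm h"
proof -
  have "\<exists>k. \<forall>b\<in>Basis. \<forall>x\<in>T. norm (fd F x b) \<le> k b"
  proof (rule bchoice, safe)
    fix b :: 'a assume b: "b \<in> Basis"
    have "continuous_on T (\<lambda>x. fd F x b)" by (rule continuous_on_subset[OF _ T(2)]) (use F b in simp)
    then have "bounded ((\<lambda>x. fd F x b) ` T)" by (intro compact_imp_bounded compact_continuous_image T(1))
    then show "\<exists>k. \<forall>x\<in>T. norm (fd F x b) \<le> k" unfolding bounded_iff by auto
  qed
  then obtain k where k: "\<And>b x. b \<in> Basis ==> x \<in> T ==> norm (fd F x b) \<le> k b" by blast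
  define K where "K = 1 + (\<Sum>b\<in>(Basis::'a set). \<bar>k b\<bar>)"
  have "norm (fd F x h) \<le> K * norm h" if x: "x \<in> T" for x h
  proof -
    have "F differentiable (at x)" using F x T by auto
    then have "norm (fd F x h) = norm (\<Sum>b\<in>Basis. (h \<bullet> b) *\<^sub>R fd F x b)" by (subst fd_Basis_sum) auto
    also have "... \<le> (\<Sum>b\<in>Basis. norm ((h \<bullet> b) *\<^sub>R fd F x b))" by (rule norm_sum)
    also have "... \<le> (\<Sum>b\<in>(Basis::'a set). norm h * \<bar>k b\<bar>)"
    proof (rule sum_mono)
      fix b :: 'a assume b: "b \<in> Basis"
      have "norm (fd F x b) \<le> \<bar>k b\<bar>" using k[OF b x] by linarith
      then show "norm ((h \<bullet> b) *\<^sub>R fd F x b) \<le> norm h * \<bar>k b\<bar>"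
        unfolding norm_scaleR using Basis_le_norm[OF b, of h] by (intro mult_mono) auto
    qed
    also have "... = (\<Sum>b\<in>(Basis::'a set). \<bar>k b\<bar>) * norm h" by (simp add: sum_distrib_left mult.commute)
    also have "... \<le> K * norm h" by (intro mult_right_mono) (auto simp: K_def)
    finally show ?thesis .
  qed
  moreover have "K \<ge> 1" by (simp add: K_def sum_nonneg)
  ultimately show ?thesis by blast
qed

lemma (in defined_domain) rho_bounds:
  obtains K where "K \<ge> 1" "\<And>x. x \<in> closure Om ==> norm (gr rho x) \<le> K"
    "\<And>x h. x \<in> closure Om ==> norm (fd (gr rho) x h) \<le> K * norm h"
    "\<And>x. x \<in> closure Om ==> \<bar>lap rho x\<bar> \<le> K" "\<And>x. x \<in> closure Om ==> \<bar>rho x\<bar> \<le> K"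
proof -
  obtain K1 where K1: "K1 \<ge> 1" "\<And>x h. x \<in> closure Om ==> norm (fd (gr rho) x h) \<le> K1 * norm h"
    using fd_bound_compact[OF ck_grho[of 1] compact_cl clD] by auto
  have "continuous_on (closure Om) (lap rho)"
    by (rule continuous_on_subset[OF _ clD], rule ck_cont[OF ck_dv[OF opD, of 0]]) (use ck_grho[of 1] in simp)
  then obtain K2 where K2: "K2 > 0" "\<And>x. x \<in> closure Om ==> norm (lap rho x) \<le> K2" using bounded_cl by blast
  obtain K3 where K3: "K3 > 0" "\<And>x. x \<in> closure Om ==> norm (gr rho x) \<le> K3" using bounded_cl[OF cont_grho] by blast
  obtain K4 where K4: "K4 > 0" "\<And>x. x \<in> closure Om ==> norm (rho x) \<le> K4" using bounded_cl[OF cont_rho] by blast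
  show ?thesis
  proof (rule that[of "K1 + K2 + K3 + K4"])
    show "norm (fd (gr rho) x h) \<le> (K1 + K2 + K3 + K4) * norm h" if "x \<in> closure Om" for x h
      using K1(2)[OF that, of h] mult_right_mono[of K1 "K1 + K2 + K3 + K4" "norm h"] K2(1) K3(1) K4(1) by simp
  qed (use K1(1) K2 K3 K4 in force)+
qed

text \<open>The minorant is taken from \<open>near\<close> outside \<open>U\<close> and from
  \<open>far\<close> on \<open>U\<close>. The quotient of the two exponentials leaves the exponent
  \<open>2 * P + 1\<close>.\<close>

lemma (in collar) En_split:
  defines "U \<equiv> {x \<in> closure Om. rho x \<le> - dl}"
  shows "En UNIV \<le> (1 + C2) * exp ((2 * P + 1) * tau) * En U"
proof -
  have Um: "Om \<inter> U \<in> sets borel" "Om - U \<in> sets borel"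
    using compact_imp_closed[OF compact_le[OF cont_rho]] op by (auto simp: U_def)
  define c where "c = C2 * exp ((2 * P + 3) * tau)"
  define i j k where "i x = indicat_real (Om - U) x *\<^sub>R en x" and "j x = indicat_real (Om \<inter> U) x *\<^sub>R en x"
    and "k x = exp (2 * tau) * i x - c * j x" for x
  have int: "integrable lborel i" "integrable lborel j"
    using si_closure[OF en_cont Um(1)] si_closure[OF en_cont Um(2)] by (simp_all add: set_integrable_def i_def[abs_def] j_def[abs_def])
  have ik: "indicat_real (Om \<inter> UNIV) x *\<^sub>R (k x / 4) = k x / 4" for x by (auto simp: k_def i_def j_def indicator_def)
  have ki: "integrable lborel k"
    unfolding k_def[abs_def] by (intro Bochner_Integration.integrable_diff integrable_mult_right int)
  have c: "continuous_on (closure Om) f" if "continuous_on D f" for f :: "'a \<Rightarrow> 'z::real_normed_vector"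
    by (rule continuous_on_subset[OF that clD])
  have "continuous_on D (gr B)"
    using ck_cont[OF ck_gr[OF opD, of 1]] ckD(2) by (simp add: numeral_2_eq_2)
  note q0 = this[THEN c] ck_cont[OF r3(3), THEN c] ck_cont[OF ckD(1), THEN c] ck_cont[OF ckD(2), THEN c] ck_cont[OF ckD(3), THEN c]
    ck_cont[OF ckD(4), THEN c] uc Gc
  have v: "continuous_on (closure Om) v" "continuous_on (closure Om) gg"
    unfolding v_def[abs_def] gg_def[abs_def] by (intro continuous_intros q0)+
  have "(LINT x:Om \<inter> UNIV|lborel. k x / 4) \<le> 0"
  proof (rule divergence_bound[OF open_UNIV closed_UNIV subset_UNIV])
    have "ck 1 Om (\<lambda>x. CM.W x + (tau * mu * exp (2 * tau)) *\<^sub>R RM.W x)"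
      by (intro ck_add ck_scaleR ck_const CM.W_ck RM.W_ck op)
    then show "ck 1 (Om \<inter> UNIV) F" unfolding Int_UNIV_right by (rule ck_cong[OF op, rotated]) (simp only: F_eq)
    show "continuous_on (closure Om \<inter> UNIV) F"
      unfolding Int_UNIV_right F_def[abs_def] WF_def[abs_def] RF_def[abs_def] by (intro continuous_intros v q0) simp
    show "F x \<bullet> gr rho x \<le> 0" if x: "x \<in> frontier Om \<inter> UNIV" for x using F_boundary x by blast
    show "set_integrable lborel (Om \<inter> UNIV) (\<lambda>x. k x / 4)" unfolding set_integrable_def ik using ki by simp
    show "k x / 4 \<le> dv F x" if "x \<in> Om \<inter> UNIV" for x
    proof -
      have x: "x \<in> Om" "x \<in> closure Om" using that closure_subset by auto
      have "k x \<le> 4 * dv F x"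
      proof (cases "rho x \<le> - dl")
        case True
        then have "k x = - (c * en x)" using x by (simp add: k_def i_def j_def U_def)
        then show ?thesis using far[OF x(1)] by (simp only: c_def)
      next
        case False
        then have "k x = exp (2 * tau) * en x" using x by (simp add: k_def i_def j_def U_def)
        then show ?thesis using near[OF x(1)] False by simp
      qed
      then show ?thesis by linarith
    qed
  qed simp
  then have "(\<integral>x. k x \<partial>lborel) \<le> 0" unfolding set_lebesgue_integral_def ik by simp
  then have 1: "exp (2 * tau) * (\<integral>x. i x \<partial>lborel) \<le> c * (\<integral>x. j x \<partial>lborel)"
    unfolding k_def[abs_def] by (subst (asm) Bochner_Integration.integral_diff; (intro integrable_mult_right int)?) simp
  have "c = exp (2 * tau) * (C2 * exp ((2 * P + 1) * tau))" by (simp add: c_def mult_exp_exp distrib_right)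
  with 1 have "exp (2 * tau) * (\<integral>x. i x \<partial>lborel) \<le> exp (2 * tau) * (C2 * exp ((2 * P + 1) * tau) * (\<integral>x. j x \<partial>lborel))"
    by (simp only: mult.assoc)
  then have 2: "(\<integral>x. i x \<partial>lborel) \<le> C2 * exp ((2 * P + 1) * tau) * (\<integral>x. j x \<partial>lborel)" by simp
  have J: "En U = (\<integral>x. j x \<partial>lborel)" by (simp add: En_def set_lebesgue_integral_def j_def)
  have "En UNIV = (\<integral>x. (i x + j x) \<partial>lborel)"
    unfolding En_def set_lebesgue_integral_def
    by (rule Bochner_Integration.integral_cong) (auto simp: indicator_def i_def j_def)
  then have "En UNIV \<le> C2 * exp ((2 * P + 1) * tau) * En U + 1 * En U" using 2 int J by simp
  also have "1 * En U \<le> exp ((2 * P + 1) * tau) * En U"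
  proof (rule mult_right_mono[OF _ En_nonneg])
    obtain x where "x \<in> Om" using ne by blast
    then have "0 \<le> P" using P[of x] order_trans[OF exp_ge_zero] by blast
    then show "1 \<le> exp ((2 * P + 1) * tau)" using tau0 by simp
  qed
  finally show ?thesis by (simp add: algebra_simps)
qed

theorem (in defined_domain) collar_propagation:
  "\<exists>C dl. C > 0 \<and> dl > 0 \<and> (\<forall>u G sig. data u G \<longrightarrow> sig \<ge> 0 \<longrightarrow>
     robin u G sig \<longrightarrow>
     energy u G UNIV \<le> exp (C * (1 + sig)) * energy u G {x \<in> closure Om. rho x \<le> - dl})"
proof -
  obtain K where K: "K \<ge> 1" "\<And>x. x \<in> closure Om ==> norm (gr rho x) \<le> K"
    "\<And>x h. x \<in> closure Om ==> norm (fd (gr rho) x h) \<le> K * norm h"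
    "\<And>x. x \<in> closure Om ==> \<bar>lap rho x\<bar> \<le> K" "\<And>x. x \<in> closure Om ==> \<bar>rho x\<bar> \<le> K" using rho_bounds by blast
  have "continuous_on (closure Om) (\<lambda>x. - \<bar>gr rho x \<bullet> gr rho x - 1\<bar>)" by (intro continuous_intros cont_grho)
  then obtain dl0 where d0: "dl0 > 0" "\<And>x. x \<in> closure Om ==> rho x > - dl0 ==> - \<bar>gr rho x \<bullet> gr rho x - 1\<bar> > - (1/10)"
    using collar_ge[of "\<lambda>x. - \<bar>gr rho x \<bullet> gr rho x - 1\<bar>" "- (1/10)"] unit by (auto simp: dot_square_norm)
  \<comment> \<open>The order of choices matters: \<open>mu\<close> depends on the geometry, then
    the depth \<open>dl\<close> is made small enough for \<open>gr rho\<close> to be nearly a unit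
    vector.\<close>
  define mu where "mu = 200 * K"
  define dl where "dl = min (dl0 / 2) (1 / mu)"
  define P where "P = exp (mu * K)"
  have mu: "mu > 0" using K by (simp add: mu_def)
  have delta: "dl > 0" "dl < dl0" "mu * dl \<le> 1"
    using d0 mu mult_left_mono[of dl "1 / mu" mu] by (auto simp: dl_def min_def field_simps)
  define C2 where "C2 = 68 * mu^4 * K^4 * P^3 + 12 * (mu * K)"
  have C2: "C2 \<ge> 0" "P > 0" using K(1) mu by (simp_all add: C2_def P_def)
  define C where "C = C2 + (2 * P + 1) * 20"
  have main: "energy u G UNIV \<le> exp (C * (1 + sig)) * energy u G {x \<in> closure Om. rho x \<le> - dl}"
    if h: "data u G" and s: "sig \<ge> 0" and b: "robin u G sig" for u G sig
  proof -
    interpret harmonic_data Om D rho u G by (rule h)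
    have xc: "x \<in> closure Om" if "x \<in> Om" for x using that closure_subset by auto
    \<comment> \<open>The smallest admissible Carleman parameter, linear in \<open>1 + sig\<close>;
      this is what makes the resulting exponent linear too.\<close>
    interpret C: collar Om D rho u G dl K P mu "20 * (1 + sig)" sig
    proof
      show "exp (- mu * rho x) \<le> P" if "x \<in> Om" for x
        using K(5)[OF xc[OF that]] mu mult_left_mono[of "- rho x" K mu] by (simp add: P_def abs_le_iff)
      show "\<bar>gr rho x \<bullet> gr rho x - 1\<bar> \<le> 1/10" if "x \<in> Om" "rho x \<ge> - dl" for x
        using d0(2)[OF xc[OF that(1)]] that(2) delta by linarith
    qed (use K xc delta s b in \<open>auto simp: mu_def\<close>)
    have "En UNIV \<le> (1 + C2) * exp ((2 * P + 1) * (20 * (1 + sig))) * En {x \<in> closure Om. rho x \<le> - dl}"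
      using C.En_split by (simp only: C.C2_def C2_def)
    also have "... \<le> exp (C * (1 + sig)) * En {x \<in> closure Om. rho x \<le> - dl}"
    proof (rule mult_right_mono[OF _ En_nonneg])
      have "1 + C2 \<le> exp (C2 * 1)" using exp_ge_add_one_self[of C2] by simp
      also have "... \<le> exp (C2 * (1 + sig))" using C2 s mult_left_mono[of 1 "1 + sig" C2] by simp
      finally have "(1 + C2) * exp ((2 * P + 1) * (20 * (1 + sig))) \<le> exp (C2 * (1 + sig)) * exp ((2 * P + 1) * (20 * (1 + sig)))"
        by (rule mult_right_mono) simp
      also have "... = exp (C * (1 + sig))" unfolding mult_exp_exp C_def by (simp add: algebra_simps)
      finally show "(1 + C2) * exp ((2 * P + 1) * (20 * (1 + sig))) \<le> exp (C * (1 + sig))" .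
    qed
    finally show ?thesis .
  qed
  show ?thesis
    by (rule exI[of _ C], rule exI[of _ dl]) (use C2 delta main in \<open>auto simp: C_def add_nonneg_pos\<close>)
qed

section \<open>Corrected squared distances\<close>

lemma mvt_ball:
  fixes f :: "'a::euclidean_space \<Rightarrow> real"
  assumes D: "open D" "ck 1 D f" and B: "cball x0 r \<subseteq> D" and x: "x \<in> cball x0 r"
    and g: "\<And>y. y \<in> cball x0 (dist x0 x) ==> norm (gr f y) \<le> L"
  shows "\<bar>f x - f x0\<bar> \<le> L * dist x0 x"
proof -
  have sub: "cball x0 (dist x0 x) \<subseteq> D" using B x by (auto simp: subset_eq)
  have "norm (f x - f x0) \<le> L * norm (x - x0)"
  proof (rule differentiable_bound[of "cball x0 (dist x0 x)" f "\<lambda>y h. gr f y \<bullet> h"])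
    fix y assume y: "y \<in> cball x0 (dist x0 x)"
    have "(f has_derivative (\<lambda>h. gr f y \<bullet> h)) (at y)" using D(2) sub y by (intro gr_deriv) auto
    then show "(f has_derivative (\<lambda>h. gr f y \<bullet> h)) (at y within cball x0 (dist x0 x))" by (rule has_derivative_at_withinI)
    show "onorm (\<lambda>h. gr f y \<bullet> h) \<le> L"
    proof (rule onorm_le)
      fix h have "norm (gr f y \<bullet> h) \<le> norm (gr f y) * norm h" using Cauchy_Schwarz_ineq2 by simp
      also have "... \<le> L * norm h" using g[OF y] by (intro mult_right_mono) auto
      finally show "norm (gr f y \<bullet> h) \<le> L * norm h" .
    qed
  qed auto
  then show ?thesis by (simp add: dist_norm norm_minus_commute)
qed

lemma root4_bounds:
  fixes q d M1 M2 M n :: real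
  assumes q: "d^2 / 2 \<le> q" "q \<le> 2 * d^2" and d: "d > 0"
  shows "d \<le> 2 * (q powr (1/4))^2" "q powr (1/4) \<le> 2 * sqrt d"
proof -
  have "d^2 / 2 > 0" using d by simp
  then have q0: "q > 0" using q by linarith
  have r: "q powr (1/4) = sqrt (sqrt q)" using q0 by (simp add: powr_half_sqrt[symmetric] powr_powr)
  then have r2: "(q powr (1/4))^2 = sqrt q" using q0 by simp
  have "sqrt (d^2 / 4) \<le> sqrt q" using q zero_le_power2[of d] by (intro real_sqrt_le_mono) linarith
  then show "d \<le> 2 * (q powr (1/4))^2" unfolding r2 using d by (simp add: real_sqrt_divide)
  have "sqrt q \<le> sqrt (4 * d^2)" using q zero_le_power2[of d] by (intro real_sqrt_le_mono) linarith
  also have "... = 2 * d" using d by (simp add: real_sqrt_mult)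
  also have "... \<le> 4 * d" using d by simp
  finally have "sqrt (sqrt q) \<le> sqrt (4 * d)" by (rule real_sqrt_le_mono)
  then show "q powr (1/4) \<le> 2 * sqrt d" unfolding r by (simp add: real_sqrt_mult)
qed

context defined_domain begin

text \<open>\<open>q\<close> replaces the squared distance to \<open>x0\<close> as the variable of
  the weight. \<open>R\<close> and \<open>M\<close> are separate arguments so that they can be
  chosen uniformly in \<open>x0\<close>.\<close>

definition good_centre :: "'a \<Rightarrow> real \<Rightarrow> real \<Rightarrow> ('a \<Rightarrow> real) \<Rightarrow> bool" where
  "good_centre x0 R M q \<longleftrightarrow> ball x0 R \<subseteq> D \<and>
     (\<forall>tau\<ge>16 * real DIM('a). radial_weight (ball x0 R - {x0}) q M tau (real DIM('a))) \<and>
     (\<forall>x\<in>ball x0 R. (dist x0 x)^2 / 2 \<le> q x \<and> q x \<le> 2 * (dist x0 x)^2) \<and>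
     (\<forall>x\<in>frontier Om \<inter> ball x0 R. gr q x \<bullet> gr rho x = 0)"

text \<open>Relative errors of first order in \<open>dist x0 x\<close> are admissible, because the
  distance is at most twice the square of the fourth root of \<open>q\<close>. The bound on
  \<open>R\<close> makes that root as small as \<open>radial_weight\<close> demands.\<close>

lemma good_centreI:
  assumes D: "ball x0 R \<subseteq> D" and M: "M \<ge> 1" and R: "R \<le> (1 / (200 * (real DIM('a) + 1) * M))^2"
    and ck: "ck 2 (ball x0 R) q" and b: "\<And>x. x \<in> ball x0 R ==> (dist x0 x)^2 / 2 \<le> q x \<and> q x \<le> 2 * (dist x0 x)^2"
    and c1: "\<And>x. x \<in> ball x0 R ==> \<bar>gr q x \<bullet> gr q x - 4 * q x\<bar> \<le> M * (dist x0 x)^3"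
    and c2: "\<And>x h. x \<in> ball x0 R ==> norm (fd (gr q) x h - 2 *\<^sub>R h) \<le> M / 2 * dist x0 x * norm h"
    and bc: "\<And>x. x \<in> frontier Om \<inter> ball x0 R ==> gr q x \<bullet> gr rho x = 0"
  shows "good_centre x0 R M q"
proof -
  define n where "n = real DIM('a)"
  have n: "n \<ge> 1" unfolding n_def by (simp add: Suc_leI)
  have "radial_weight (ball x0 R - {x0}) q M tau n" if t: "tau \<ge> 16 * n" for tau
  proof
    fix x assume x: "x \<in> ball x0 R - {x0}"
    define d where "d = dist x0 x"
    have xb: "x \<in> ball x0 R" and d: "d > 0" "d \<le> R" using x by (auto simp: d_def)
    have qd: "d^2 / 2 \<le> q x" "q x \<le> 2 * d^2" using b[OF xb] by (auto simp: d_def)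
    note rb = root4_bounds[OF qd d(1)]
    have d2: "d^2 / 2 > 0" using d by simp
    show qp: "q x > 0" using qd d2 by linarith
    show "100 * (n + 1) * M * q x powr (1/4) \<le> 1"
    proof -
      have "sqrt d \<le> sqrt ((1 / (200 * (n + 1) * M))^2)" using d R by (intro real_sqrt_le_mono) (simp add: n_def)
      also have "... = 1 / (200 * (n + 1) * M)" using n M by simp
      finally have "q x powr (1/4) \<le> 2 * (1 / (200 * (n + 1) * M))" using rb(2) by linarith
      then have "(100 * (n + 1) * M) * q x powr (1/4) \<le> (100 * (n + 1) * M) * (2 * (1 / (200 * (n + 1) * M)))"
        using n M by (intro mult_left_mono) auto
      also have "... = 1" using n M by simp
      finally show ?thesis .
    qed
    show "\<bar>gr q x \<bullet> gr q x - 4 * q x\<bar> \<le> 4 * M * (q x powr (1/4))^2 * q x"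
    proof -
      have "\<bar>gr q x \<bullet> gr q x - 4 * q x\<bar> \<le> M * (d * d^2)" using c1[OF xb] by (simp add: d_def power2_eq_square power3_eq_cube)
      also have "... \<le> M * ((2 * (q x powr (1/4))^2) * (2 * q x))"
        using rb(1) qd M d by (intro mult_left_mono mult_mono) auto
      finally show ?thesis by (simp add: mult_ac)
    qed
    show "norm (fd (gr q) x h - 2 *\<^sub>R h) \<le> M * (q x powr (1/4))^2 * norm h" for h
    proof -
      have "norm (fd (gr q) x h - 2 *\<^sub>R h) \<le> M / 2 * d * norm h" using c2[OF xb] by (simp add: d_def)
      also have "... \<le> M / 2 * (2 * (q x powr (1/4))^2) * norm h" using rb(1) M by (intro mult_right_mono mult_left_mono) auto
      finally show ?thesis by simp
    qed
  qed (use t M ck_subset[OF ck] n in \<open>auto simp: n_def intro!: open_Diff\<close>)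
  then show ?thesis unfolding good_centre_def n_def[symmetric] using D b bc by blast
qed

lemma interior_centre:
  assumes "ball y R \<subseteq> Om" "R > 0" "R \<le> (1 / (200 * (real DIM('a) + 1)))^2"
  shows "good_centre y R 1 (\<lambda>x. (x - y) \<bullet> (x - y))"
proof -
  define q where "q x = (x - y) \<bullet> (x - y)" for x
  have gq: "gr q x = 2 *\<^sub>R (x - y)" for x
  proof (rule gr_eqI)
    have "((\<lambda>x. (x - y) \<bullet> (x - y)) has_derivative (\<lambda>h. (x - y) \<bullet> h + h \<bullet> (x - y))) (at x)"
      by (auto intro!: derivative_eq_intros)
    then show "(q has_derivative (\<lambda>h. 2 *\<^sub>R (x - y) \<bullet> h)) (at x)"
      unfolding q_def[abs_def] by (rule has_derivative_eq_rhs) (auto simp: fun_eq_iff inner_commute)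
  qed
  have "gr q = (\<lambda>x. 2 *\<^sub>R (x - y))" using gq by auto
  moreover have "((\<lambda>x. 2 *\<^sub>R (x - y)) has_derivative (\<lambda>h. 2 *\<^sub>R h)) (at x)" for x
    by (auto intro!: derivative_eq_intros)
  ultimately have fq: "fd (gr q) x h = 2 *\<^sub>R h" for x h using fd_eqI by metis
  have qd: "q x = (dist y x)^2" for x by (simp add: q_def dist_norm dot_square_norm norm_minus_commute)
  have "good_centre y R 1 q"
  proof (rule good_centreI)
    show "ck 2 (ball y R) q" unfolding q_def[abs_def]
      by (intro ck_inner ck_diff' ck_ident ck_const open_ball)
  qed (use assms frontier_notin subD in \<open>auto simp: fq qd gq q_def[symmetric] inner_commute\<close>)
  then show ?thesis unfolding q_def[abs_def] .
qed

text \<open>Room around the closure in which the derivatives of \<open>rho\<close> are bounded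
  uniformly, so that boundary centres can be treated with common constants.\<close>

lemma compact_collar: "\<exists>r>0. compact {x + y | x y. x \<in> closure Om \<and> y \<in> cball 0 r} \<and> {x + y | x y. x \<in> closure Om \<and> y \<in> cball 0 r} \<subseteq> D"
proof -
  have "\<exists>r>0. \<forall>x\<in>closure Om. \<forall>y\<in>- D. r \<le> dist x y"
    by (rule separate_compact_closed) (use compact_cl opD clD in auto)
  then obtain r where r: "r > 0" "\<And>x y. x \<in> closure Om ==> y \<notin> D ==> r \<le> dist x y" by blast
  have "{x + y | x y. x \<in> closure Om \<and> y \<in> cball 0 (r/2)} \<subseteq> D"
  proof safe
    fix x y :: 'a assume xy: "x \<in> closure Om" "y \<in> cball 0 (r/2)"
    show "x + y \<in> D"
    proof (rule ccontr)
      assume "x + y \<notin> D"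
      then have "r \<le> dist x (x + y)" using r(2) xy by blast
      moreover have "dist x (x + y) = norm y" by (simp add: dist_norm)
      ultimately show False using xy r by simp
    qed
  qed
  moreover have "compact {x + y | x y. x \<in> closure Om \<and> y \<in> cball 0 (r/2)}"
    using compact_sums[OF compact_cl compact_cball[of 0 "r/2"]] by simp
  ultimately show ?thesis using r(1) by (intro exI[of _ "r/2"]) auto
qed

text \<open>Near a boundary point the squared distance is corrected by a cubic term, so that its normal derivative vanishes
  on the boundary.\<close>

lemma boundary_centre:
  "\<exists>M R0. M \<ge> 1 \<and> R0 > 0 \<and> (\<forall>x0\<in>frontier Om. \<exists>q. good_centre x0 R0 M q)"
proof -
  define n where "n = real DIM('a)"
  have n: "n \<ge> 1" unfolding n_def by (simp add: Suc_leI)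
  obtain r0 where r0: "r0 > 0" "compact {x + y | x y. x \<in> closure Om \<and> y \<in> cball 0 r0}"
    "{x + y | x y. x \<in> closure Om \<and> y \<in> cball 0 r0} \<subseteq> D" using compact_collar by blast
  define T where "T = {x + y | x y. x \<in> closure Om \<and> y \<in> cball 0 r0}"
  have T: "compact T" "T \<subseteq> D" using r0 by (simp_all add: T_def)
  obtain K1 where K1: "K1 \<ge> 1" "\<And>x h. x \<in> T ==> norm (fd (gr rho) x h) \<le> K1 * norm h"
    using fd_bound_compact[OF ck_grho[of 1] T] by auto
  have "continuous_on T (gr rho)" by (rule continuous_on_subset[OF ck_cont[OF ck_grho[of 0]] T(2)]) simp
  then have "bounded (gr rho ` T)" by (intro compact_imp_bounded compact_continuous_image T)
  then obtain K2 where K2: "K2 > 0" "\<And>x. x \<in> T ==> norm (gr rho x) \<le> K2" unfolding bounded_pos by auto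
  have H1: "ck 1 D (\<lambda>x. fd (gr rho) x c)" for c
    by (rule ck_dir[OF opD]) (use ck_grho[of 2] in \<open>simp_all add: numeral_2_eq_2\<close>)
  have "\<exists>k. \<forall>c\<in>(Basis::'a set). 1 \<le> k c \<and> (\<forall>x\<in>T. \<forall>h. norm (fd (\<lambda>x. fd (gr rho) x c) x h) \<le> k c * norm h)"
    by (rule bchoice) (use fd_bound_compact[OF H1 T] in blast)
  then obtain k where k: "\<And>c. c \<in> Basis ==> 1 \<le> k c" "\<And>c x h. c \<in> Basis ==> x \<in> T ==> norm (fd (\<lambda>x. fd (gr rho) x c) x h) \<le> k c * norm h" by blast
  define K3 where "K3 = (\<Sum>c\<in>(Basis::'a set). k c)"
  have K3: "K3 \<ge> 0" unfolding K3_def by (rule sum_nonneg) (use k(1) in fastforce)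
  define K where "K = K1 + K2"
  have K: "K \<ge> 1" "\<And>x. x \<in> T ==> norm (gr rho x) \<le> K" "\<And>x h. x \<in> T ==> norm (fd (gr rho) x h) \<le> K * norm h"
  proof -
    show "K \<ge> 1" using K1 K2 by (simp add: K_def)
    show "norm (gr rho x) \<le> K" if "x \<in> T" for x using K1(1) K2(2)[OF that] by (simp add: K_def)
    show "norm (fd (gr rho) x h) \<le> K * norm h" if "x \<in> T" for x h
      using K1(2)[OF that, of h] mult_right_mono[of K1 K "norm h"] K2 by (simp add: K_def)
  qed
  define M1 where "M1 = 2 * (2 * (K * K) + K * K * r0 + K * (n * K + r0 * K3))"
  define M2 where "M2 = 24 * K^2 + 16 * K^4"
  define M where "M = 1 + 2 * M1 + M2"
  have M0: "M1 \<ge> 0" "M2 \<ge> 0" using K K3 n r0 by (auto simp: M1_def M2_def)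
  have M1M: "M \<ge> 1" using M0 by (simp add: M_def)
  define R where "R = min (min r0 1) (min (1 / (4 * K^2)) ((1 / (200 * (n + 1) * M))^2))"
  have R: "R > 0" "R \<le> r0" "R \<le> 1" "4 * K^2 * R \<le> 1" "R \<le> (1 / (200 * (n + 1) * M))^2"
  proof -
    have p: "K^2 > 0" "M > 0" using K M1M by auto
    show "R > 0" using r0 p n by (simp add: R_def)
    show "R \<le> r0" "R \<le> 1" "R \<le> (1 / (200 * (n + 1) * M))^2" by (auto simp: R_def)
    have "R \<le> 1 / (4 * K^2)" by (auto simp: R_def)
    then show "4 * K^2 * R \<le> 1" using p by (simp add: field_simps)
  qed
  have "\<exists>q. good_centre x0 R M q" if x0: "x0 \<in> frontier Om" for x0
  proof -
    have rx0: "rho x0 = 0" by (rule zer[OF x0])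
    have sub: "cball x0 r0 \<subseteq> T"
    proof
      fix x assume "x \<in> cball x0 r0"
      then have "x = x0 + (x - x0)" "x - x0 \<in> cball 0 r0" by (auto simp: dist_norm norm_minus_commute)
      then show "x \<in> T" using frontier_cl[OF x0] unfolding T_def by blast
    qed
    have subD': "cball x0 r0 \<subseteq> D" using sub T by auto
    define p where "p x = fd (gr rho) x (x - x0)" for x
    \<comment> \<open>On the frontier, \<open>gr q\<close> is orthogonal to \<open>gr rho\<close>
      exactly if \<open>h0 x = gr rho x \<bullet> (x - x0)\<close>. Subtracting \<open>rho x\<close>
      changes nothing there and turns the gradient of \<open>h0\<close> into \<open>p\<close>, which
      vanishes at \<open>x0\<close>. So \<open>h0\<close> is quadratically small and the correction
      \<open>rho * h0\<close> is cubic.\<close>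
    define h0 where "h0 x = gr rho x \<bullet> (x - x0) - rho x" for x
    define q where "q x = (x - x0) \<bullet> (x - x0) - 2 * (rho x * h0 x)" for x
    have dg: "(gr rho has_derivative fd (gr rho) x) (at x)" if "x \<in> D" for x
      using ck_diff[of 0 D "gr rho" x] ck_grho[of 1] that by simp
    have dr: "(rho has_derivative (\<lambda>h. gr rho x \<bullet> h)) (at x)" if "x \<in> D" for x using gr_deriv[OF rho_diff[OF that]] .
    have dh0: "(h0 has_derivative (\<lambda>h. p x \<bullet> h)) (at x)" if x: "x \<in> D" for x
    proof -
      have "((\<lambda>x. gr rho x \<bullet> (x - x0)) has_derivative (\<lambda>h. gr rho x \<bullet> h + fd (gr rho) x h \<bullet> (x - x0))) (at x)"
        by (rule has_derivative_eq_rhs[OF has_derivative_inner[OF dg[OF x] has_derivative_diff[OF has_derivative_ident has_derivative_const]]]) simp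
      from has_derivative_diff[OF this dr[OF x]]
      have "(h0 has_derivative (\<lambda>h. gr rho x \<bullet> h + fd (gr rho) x h \<bullet> (x - x0) - gr rho x \<bullet> h)) (at x)"
        unfolding h0_def[abs_def] .
      then show ?thesis
        by (rule has_derivative_eq_rhs) (use hess_sym[OF opD ck_rho[of 2] x] in \<open>simp add: fun_eq_iff p_def inner_commute\<close>)
    qed
    have gh0: "gr h0 x = p x" if "x \<in> D" for x by (rule gr_eqI[OF dh0[OF that]])
    have p_sum: "p x = (\<Sum>c\<in>Basis. ((x - x0) \<bullet> c) *\<^sub>R fd (gr rho) x c)" if "x \<in> D" for x
      unfolding p_def by (rule fd_Basis_sum) (use ck_grho[of 1] that in auto)
    have p1: "ck 1 D p" unfolding p_def[abs_def]
    proof (rule ck_dir[OF opD])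
      show "ck (Suc 1) D (gr rho)" using ck_grho[of 2] by (simp add: numeral_2_eq_2)
      show "ck 1 D (\<lambda>x. x - x0)" by (intro ck_diff' ck_ident ck_const opD)
    qed
    \<comment> \<open>Differentiating \<open>p\<close> brings in the third derivatives of
      \<open>rho\<close>, bounded on \<open>T\<close> by the constants \<open>k c\<close>.\<close>
    have fp: "norm (fd p x h) \<le> (n * K + r0 * K3) * norm h" if x: "x \<in> cball x0 r0" for x h
    proof -
      have xD: "x \<in> D" "x \<in> T" using x sub subD' by auto
      define S where "S = (\<lambda>h. \<Sum>c\<in>Basis. ((x - x0) \<bullet> c) *\<^sub>R fd (\<lambda>x. fd (gr rho) x c) x h + (h \<bullet> c) *\<^sub>R fd (gr rho) x c)"
      have "((\<lambda>x. \<Sum>c\<in>Basis. ((x - x0) \<bullet> c) *\<^sub>R fd (gr rho) x c) has_derivative S) (at x)"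
        unfolding S_def
      proof (rule has_derivative_sum)
        fix c :: 'a assume "c \<in> Basis"
        have 1: "((\<lambda>x. (x - x0) \<bullet> c) has_derivative (\<lambda>h. h \<bullet> c)) (at x)" by (auto intro!: derivative_eq_intros)
        have 2: "((\<lambda>x. fd (gr rho) x c) has_derivative fd (\<lambda>x. fd (gr rho) x c) x) (at x)"
          by (rule ck_diff[of 0, OF _ xD(1)]) (use H1[of c] in simp)
        show "((\<lambda>x. ((x - x0) \<bullet> c) *\<^sub>R fd (gr rho) x c) has_derivative
            (\<lambda>h. ((x - x0) \<bullet> c) *\<^sub>R fd (\<lambda>x. fd (gr rho) x c) x h + (h \<bullet> c) *\<^sub>R fd (gr rho) x c)) (at x)"
          by (rule has_derivative_scaleR[OF 1 2])
      qed
      then have "(p has_derivative S) (at x)"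
        by (rule has_derivative_transform_within_open[OF _ opD xD(1)]) (simp add: p_sum)
      then have "fd p x h = S h" by (simp add: fd_eqI)
      also have "norm (S h) \<le> (\<Sum>c\<in>(Basis::'a set). (r0 * k c + K) * norm h)"
        unfolding S_def
      proof (rule order_trans[OF norm_sum sum_mono])
        fix c :: 'a assume c: "c \<in> Basis"
        have "norm (((x - x0) \<bullet> c) *\<^sub>R fd (\<lambda>x. fd (gr rho) x c) x h) \<le> r0 * (k c * norm h)"
          unfolding norm_scaleR
          using Basis_le_norm[OF c, of "x - x0"] x k(2)[OF c xD(2), of h] r0
          by (intro mult_mono) (auto simp: dist_norm norm_minus_commute)
        moreover have "norm ((h \<bullet> c) *\<^sub>R fd (gr rho) x c) \<le> norm h * K"
          unfolding norm_scaleR using Basis_le_norm[OF c, of h] K(3)[OF xD(2), of c] c by (intro mult_mono) auto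
        ultimately show "norm (((x - x0) \<bullet> c) *\<^sub>R fd (\<lambda>x. fd (gr rho) x c) x h + (h \<bullet> c) *\<^sub>R fd (gr rho) x c) \<le> (r0 * k c + K) * norm h"
          using norm_triangle_ineq[of "((x - x0) \<bullet> c) *\<^sub>R fd (\<lambda>x. fd (gr rho) x c) x h" "(h \<bullet> c) *\<^sub>R fd (gr rho) x c"]
          by (simp add: algebra_simps)
      qed
      also have "... = (n * K + r0 * K3) * norm h"
        by (simp add: sum_distrib_right[symmetric] sum.distrib K3_def sum_distrib_left n_def algebra_simps)
      finally show ?thesis .
    qed
    have q2: "ck 2 D q" unfolding q_def[abs_def] h0_def[abs_def]
      by (intro ck_inner ck_diff' ck_mult ck_ident ck_const opD ck_rho ck_grho) auto
    have gq: "gr q x = 2 *\<^sub>R (x - x0) - 2 *\<^sub>R (h0 x *\<^sub>R gr rho x + rho x *\<^sub>R p x)" if x: "x \<in> D" for x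
    proof (rule gr_eqI)
      have 1: "((\<lambda>x. (x - x0) \<bullet> (x - x0)) has_derivative (\<lambda>h. (x - x0) \<bullet> h + h \<bullet> (x - x0))) (at x)"
        by (auto intro!: derivative_eq_intros)
      have "(q has_derivative (\<lambda>h. ((x - x0) \<bullet> h + h \<bullet> (x - x0)) - 2 * (rho x * (p x \<bullet> h) + (gr rho x \<bullet> h) * h0 x))) (at x)"
        unfolding q_def[abs_def]
        by (intro has_derivative_diff 1 has_derivative_mult_right has_derivative_mult dr dh0 x)
      then show "(q has_derivative (\<lambda>h. (2 *\<^sub>R (x - x0) - 2 *\<^sub>R (h0 x *\<^sub>R gr rho x + rho x *\<^sub>R p x)) \<bullet> h)) (at x)"
        by (rule has_derivative_eq_rhs) (auto simp: fun_eq_iff inner_diff_left inner_diff_right inner_add_left inner_commute algebra_simps)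
    qed
    have fgq: "fd (gr q) x h = 2 *\<^sub>R h - 2 *\<^sub>R ((h0 x *\<^sub>R fd (gr rho) x h + (p x \<bullet> h) *\<^sub>R gr rho x) + (rho x *\<^sub>R fd p x h + (gr rho x \<bullet> h) *\<^sub>R p x))" if x: "x \<in> D" for x h
    proof -
      have dp: "(p has_derivative fd p x) (at x)" using ck_diff[of 0 D p x] p1 x by simp
      have "((\<lambda>x. 2 *\<^sub>R (x - x0) - 2 *\<^sub>R (h0 x *\<^sub>R gr rho x + rho x *\<^sub>R p x)) has_derivative
        (\<lambda>h. 2 *\<^sub>R (h - 0) - 2 *\<^sub>R ((h0 x *\<^sub>R fd (gr rho) x h + (p x \<bullet> h) *\<^sub>R gr rho x) + (rho x *\<^sub>R fd p x h + (gr rho x \<bullet> h) *\<^sub>R p x)))) (at x)"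
        by (intro has_derivative_diff has_derivative_add has_derivative_scaleR_right has_derivative_scaleR has_derivative_ident
            has_derivative_const dg dr dh0 dp x)
      then have "(gr q has_derivative
        (\<lambda>h. 2 *\<^sub>R (h - 0) - 2 *\<^sub>R ((h0 x *\<^sub>R fd (gr rho) x h + (p x \<bullet> h) *\<^sub>R gr rho x) + (rho x *\<^sub>R fd p x h + (gr rho x \<bullet> h) *\<^sub>R p x)))) (at x)"
        by (rule has_derivative_transform_within_open[OF _ opD x]) (simp add: gq)
      then show ?thesis by (simp add: fd_eqI)
    qed
    have e: "norm (p x) \<le> K * dist x0 x" "\<bar>rho x\<bar> \<le> K * dist x0 x" "\<bar>h0 x\<bar> \<le> K * (dist x0 x)^2" if x: "x \<in> cball x0 r0" for x
    proof -
      have pp: "norm (p y) \<le> K * dist x0 y" if "y \<in> cball x0 r0" for y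
        using K(3)[of y "y - x0"] that sub by (auto simp: p_def dist_norm norm_minus_commute)
      show "norm (p x) \<le> K * dist x0 x" by (rule pp[OF x])
      have "\<bar>rho x - rho x0\<bar> \<le> K * dist x0 x"
        by (rule mvt_ball[OF opD ck_rho subD' x]) (use K(2) sub x in \<open>auto simp: subset_eq\<close>)
      then show "\<bar>rho x\<bar> \<le> K * dist x0 x" by (simp add: rx0)
      have h01: "ck 1 D h0" unfolding h0_def[abs_def] by (intro ck_inner ck_diff' ck_ident ck_const opD ck_rho ck_grho) auto
      have "\<bar>h0 x - h0 x0\<bar> \<le> (K * dist x0 x) * dist x0 x"
      proof (rule mvt_ball[OF opD h01 subD' x])
        fix y assume y: "y \<in> cball x0 (dist x0 x)"
        then have y': "y \<in> cball x0 r0" using x by auto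
        have "norm (gr h0 y) \<le> K * dist x0 y" using gh0[of y] pp[OF y'] y' subD' by auto
        also have "... \<le> K * dist x0 x" using y K by (intro mult_left_mono) auto
        finally show "norm (gr h0 y) \<le> K * dist x0 x" .
      qed
      moreover have "h0 x0 = 0" by (simp add: h0_def rx0)
      ultimately show "\<bar>h0 x\<bar> \<le> K * (dist x0 x)^2" by (simp add: power2_eq_square mult.assoc)
    qed
    have xA: "x \<in> cball x0 r0" "x \<in> D" "x \<in> T" "dist x0 x \<le> R" "dist x0 x \<le> r0" if "x \<in> ball x0 R" for x
    proof -
      show 1: "x \<in> cball x0 r0" "dist x0 x \<le> R" "dist x0 x \<le> r0" using that R by auto
      show "x \<in> D" "x \<in> T" using 1 sub subD' by auto
    qed
    have rh: "\<bar>rho x * h0 x\<bar> \<le> K^2 * (dist x0 x)^3" if "x \<in> cball x0 r0" for x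
    proof -
      have "\<bar>rho x * h0 x\<bar> \<le> (K * dist x0 x) * (K * (dist x0 x)^2)" unfolding abs_mult using e(2,3)[OF that] K by (intro mult_mono) auto
      then show ?thesis by (simp add: power2_eq_square power3_eq_cube mult_ac)
    qed
    have qb: "(dist x0 x)^2 / 2 \<le> q x \<and> q x \<le> 2 * (dist x0 x)^2" if x: "x \<in> ball x0 R" for x
    proof -
      define d where "d = dist x0 x"
      have "K^2 * d^3 = (K^2 * d) * d^2" by (simp add: power2_eq_square power3_eq_cube)
      also have "... \<le> 1/4 * d^2"
      proof (rule mult_right_mono)
        have "K^2 * d \<le> K^2 * R" using xA(4)[OF x] by (intro mult_left_mono) (auto simp: d_def)
        then show "K^2 * d \<le> 1/4" using R(4) by linarith
      qed simp
      finally have "\<bar>rho x * h0 x\<bar> \<le> 1/4 * d^2" using rh[OF xA(1)[OF x]] by (simp add: d_def)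
      moreover have "q x = d^2 - 2 * (rho x * h0 x)"
        by (simp add: q_def d_def dist_norm dot_square_norm norm_minus_commute)
      ultimately show ?thesis using zero_le_power2[of d] unfolding d_def[symmetric] by linarith
    qed
    have c2: "norm (fd (gr q) x h - 2 *\<^sub>R h) \<le> M1 * dist x0 x * norm h" if x: "x \<in> ball x0 R" for x h
    proof -
      note x' = xA[OF x]
      define d where "d = dist x0 x"
      have d: "0 \<le> d" "d \<le> r0" using x' by (auto simp: d_def)
      have a1: "norm (h0 x *\<^sub>R fd (gr rho) x h) \<le> (K * r0 * d) * (K * norm h)"
      proof -
        have "\<bar>h0 x\<bar> \<le> K * d^2" using e(3)[OF x'(1)] by (simp add: d_def)
        also have "... \<le> K * r0 * d" using d K by (simp add: power2_eq_square mult_right_mono)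
        finally show ?thesis unfolding norm_scaleR using K(3)[OF x'(3)] K d r0 by (intro mult_mono) auto
      qed
      have a2: "norm ((p x \<bullet> h) *\<^sub>R gr rho x) \<le> (K * d * norm h) * K"
      proof -
        have "\<bar>p x \<bullet> h\<bar> \<le> K * d * norm h" using Cauchy_Schwarz_ineq2[of "p x" h] mult_right_mono[OF e(1)[OF x'(1)] norm_ge_zero[of h]]
          by (simp add: d_def)
        then show ?thesis unfolding norm_scaleR using K(2)[OF x'(3)] K d by (intro mult_mono) auto
      qed
      have a3: "norm (rho x *\<^sub>R fd p x h) \<le> (K * d) * ((n * K + r0 * K3) * norm h)"
        unfolding norm_scaleR using e(2)[OF x'(1)] fp[OF x'(1)] K d by (intro mult_mono) (auto simp: d_def)
      have a4: "norm ((gr rho x \<bullet> h) *\<^sub>R p x) \<le> (K * norm h) * (K * d)"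
      proof -
        have "\<bar>gr rho x \<bullet> h\<bar> \<le> K * norm h" using Cauchy_Schwarz_ineq2[of "gr rho x" h] mult_right_mono[OF K(2)[OF x'(3)] norm_ge_zero[of h]]
          by simp
        then show ?thesis unfolding norm_scaleR using e(1)[OF x'(1)] K d by (intro mult_mono) (auto simp: d_def)
      qed
      have "norm (fd (gr q) x h - 2 *\<^sub>R h) = 2 * norm ((h0 x *\<^sub>R fd (gr rho) x h + (p x \<bullet> h) *\<^sub>R gr rho x) + (rho x *\<^sub>R fd p x h + (gr rho x \<bullet> h) *\<^sub>R p x))"
        unfolding fgq[OF x'(2)] by simp
      also have "... \<le> 2 * ((norm (h0 x *\<^sub>R fd (gr rho) x h) + norm ((p x \<bullet> h) *\<^sub>R gr rho x)) + (norm (rho x *\<^sub>R fd p x h) + norm ((gr rho x \<bullet> h) *\<^sub>R p x)))"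
        by (intro mult_left_mono order_trans[OF norm_triangle_ineq] add_mono norm_triangle_ineq order_refl) auto
      also have "... \<le> 2 * (((K * r0 * d) * (K * norm h) + (K * d * norm h) * K) + ((K * d) * ((n * K + r0 * K3) * norm h) + (K * norm h) * (K * d)))"
        using a1 a2 a3 a4 by (intro mult_left_mono add_mono) auto
      also have "... = M1 * d * norm h" by (simp add: M1_def algebra_simps)
      finally show ?thesis by (simp add: d_def)
    qed
    have c1: "\<bar>gr q x \<bullet> gr q x - 4 * q x\<bar> \<le> M2 * (dist x0 x)^3" if x: "x \<in> ball x0 R" for x
    proof -
      note x' = xA[OF x]
      define d where "d = dist x0 x"
      have d: "0 \<le> d" "d \<le> 1" using x' R by (auto simp: d_def)
      define y where "y = x - x0"
      have ny: "norm y = d" by (simp add: y_def d_def dist_norm norm_minus_commute)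
      define E where "E = - 2 *\<^sub>R (h0 x *\<^sub>R gr rho x + rho x *\<^sub>R p x)"
      have nE: "norm E \<le> 4 * K^2 * d^2"
      proof -
        have "norm (h0 x *\<^sub>R gr rho x) \<le> (K * d^2) * K" unfolding norm_scaleR
          using e(3)[OF x'(1)] K(1) K(2)[OF x'(3)] by (intro mult_mono) (auto simp: d_def)
        moreover have "norm (rho x *\<^sub>R p x) \<le> (K * d) * (K * d)" unfolding norm_scaleR
          using e(1,2)[OF x'(1)] K(1) by (intro mult_mono) (auto simp: d_def)
        ultimately have "norm (h0 x *\<^sub>R gr rho x + rho x *\<^sub>R p x) \<le> (K * d^2) * K + (K * d) * (K * d)"
          using norm_triangle_ineq[of "h0 x *\<^sub>R gr rho x" "rho x *\<^sub>R p x"] by linarith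
        then show ?thesis by (simp add: E_def power2_eq_square mult_ac)
      qed
      have g: "gr q x = 2 *\<^sub>R y + E" unfolding gq[OF x'(2)] by (simp add: y_def E_def)
      have qx: "q x = y \<bullet> y - 2 * (rho x * h0 x)" by (simp add: q_def y_def)
      have "gr q x \<bullet> gr q x - 4 * q x = 4 * (y \<bullet> E) + E \<bullet> E + 8 * (rho x * h0 x)"
        unfolding g qx by (simp add: inner_add_left inner_add_right inner_commute algebra_simps)
      moreover have "\<bar>y \<bullet> E\<bar> \<le> d * (4 * K^2 * d^2)" using Cauchy_Schwarz_ineq2[of y E] ny mult_left_mono[OF nE d(1)] by simp
      moreover have "E \<bullet> E \<le> (4 * K^2 * d^2)^2" using power_mono[OF nE, of 2] by (simp add: dot_square_norm)
      moreover have "(4 * K^2 * d^2)^2 \<le> 16 * K^4 * d^3"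
      proof -
        have "d^4 \<le> d^3" using d by (intro power_decreasing) auto
        then have "16 * K^4 * d^4 \<le> 16 * K^4 * d^3" by (intro mult_left_mono) auto
        then show ?thesis by (simp add: power_mult_distrib power_mult[symmetric])
      qed
      moreover have "d * (4 * K^2 * d^2) = 4 * (K^2 * d^3)" by (simp add: power2_eq_square power3_eq_cube)
      moreover have "\<bar>rho x * h0 x\<bar> \<le> K^2 * d^3" using rh[OF x'(1)] by (simp add: d_def)
      moreover have "M2 * d^3 = 24 * (K^2 * d^3) + 16 * K^4 * d^3" by (simp add: M2_def algebra_simps)
      moreover have "E \<bullet> E \<ge> 0" by simp
      ultimately show ?thesis unfolding d_def[symmetric] by linarith
    qed
    have "good_centre x0 R M q"
    proof (rule good_centreI[OF _ M1M _ _ qb])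
      show "ball x0 R \<subseteq> D" using xA by auto
      then show "ck 2 (ball x0 R) q" by (rule ck_subset[OF q2])
      fix x
      show "\<bar>gr q x \<bullet> gr q x - 4 * q x\<bar> \<le> M * (dist x0 x)^3" if "x \<in> ball x0 R"
        using order_trans[OF c1[OF that] mult_right_mono[of M2 M "(dist x0 x)^3"]] M0 by (simp add: M_def)
      show "norm (fd (gr q) x h - 2 *\<^sub>R h) \<le> M / 2 * dist x0 x * norm h" if "x \<in> ball x0 R" for h
        using order_trans[OF c2[OF that, of h] mult_right_mono[OF mult_right_mono[of M1 "M / 2" "dist x0 x"]]] M0 by (simp add: M_def)
      show "gr q x \<bullet> gr rho x = 0" if x: "x \<in> frontier Om \<inter> ball x0 R"
      proof -
        have 1: "rho x = 0" "gr rho x \<bullet> gr rho x = 1" using zer[of x] unit[of x] x by (auto simp: dot_square_norm)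
        have "x \<in> D" using x xA by auto
        then show ?thesis using gq[of x] 1 by (simp add: h0_def inner_diff_left inner_diff_right inner_commute)
      qed
    qed (use R(5) in \<open>simp add: n_def\<close>)
    then show ?thesis by blast
  qed
  then show ?thesis using M1M R(1) by blast
qed

end

lemma (in harmonic_data) set_integral_mono_closure:
  fixes f g :: "'a \<Rightarrow> real"
  assumes "continuous_on (closure Om) f" "continuous_on (closure Om) g"
    and "U \<in> sets borel" "V \<in> sets borel" "U \<subseteq> V" "V \<subseteq> Om"
    and "\<And>x. x \<in> U ==> f x \<le> g x" "\<And>x. x \<in> V ==> 0 \<le> g x"
  shows "(LINT x:U|lborel. f x) \<le> (LINT x:V|lborel. g x)"
  unfolding set_lebesgue_integral_def
proof (rule Bochner_Integration.integral_mono)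
  have "set_integrable lborel U f" using assms by (intro si_closure) auto
  then show "integrable lborel (\<lambda>x. indicat_real U x *\<^sub>R f x)" by (simp add: set_integrable_def)
  have "set_integrable lborel V g" using assms by (intro si_closure) auto
  then show "integrable lborel (\<lambda>x. indicat_real V x *\<^sub>R g x)" by (simp add: set_integrable_def)
qed (use assms in \<open>auto simp: indicator_def\<close>)

definition annulus :: "'a::euclidean_space \<Rightarrow> real \<Rightarrow> real \<Rightarrow> 'a set" where
  "annulus x0 s t = {x. s \<le> (dist x0 x)^2 \<and> (dist x0 x)^2 \<le> t}"

lemma in_annulus [simp]: "x \<in> annulus x0 s t \<longleftrightarrow> s \<le> (dist x0 x)^2 \<and> (dist x0 x)^2 \<le> t"
  by (simp add: annulus_def)

lemma annulus_meas: "closed (annulus x0 s t)" "annulus x0 s t \<in> sets borel"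
  "open U ==> U \<inter> annulus x0 s t \<in> sets borel"
proof -
  show "closed (annulus x0 s t)" unfolding annulus_def
    by (intro closed_Collect_conj closed_Collect_le continuous_intros)
  then show 1: "annulus x0 s t \<in> sets borel" by (rule borel_closed)
  show "open U ==> U \<inter> annulus x0 s t \<in> sets borel" by (rule sets.Int[OF borel_open 1])
qed

text \<open>The shells of \<open>shell_estimate\<close> are cut out by \<open>q\<close>. Since
  \<open>q\<close> lies between half and twice the squared distance, they can be compared with
  annuli at the price of these factors, and the outer shell is bounded by the total energy.\<close>

lemma (in defined_domain) annulus_estimate:
  assumes hd: "data u G" and gc: "good_centre x0 R M q" and R: "R > 0"
    and K: "K \<ge> 1" "\<And>x. x \<in> closure Om ==> norm (gr rho x) \<le> K"
      "\<And>x h. x \<in> closure Om ==> norm (fd (gr rho) x h) \<le> K * norm h"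
    and sigma: "sig \<ge> 0" and tau: "tau \<ge> 640 * (real DIM('a))^2 * K * (1 + sig)"
    and bc: "\<And>x. x \<in> frontier Om \<inter> ball x0 R ==> G x \<bullet> gr rho x = sig * u x"
    and a: "0 < a" "2 * a \<le> tht1" "tht1 \<le> tht2" "tht2 \<le> b" "8 * b < R^2" "b \<le> 1"
  shows "tau * tht1 powr (1/4) / 128 * exp (2 * tau * wt tht2) * energy u G (annulus x0 (2 * tht1) (tht2 / 2))
     \<le> 1152 * (real DIM('a))^2 * Mb^2 * exp (2 * tau * wt a) * (LINT x:Om \<inter> annulus x0 (a / 2) (4 * a)|lborel. G x \<bullet> G x + (u x)\<^sup>2 / a)
      + 1152 * (real DIM('a))^2 * Mb^2 / b * exp (2 * tau * wt b) * energy u G UNIV"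
proof -
  interpret harmonic_data Om D rho u G by (rule hd)
  define n where "n = real DIM('a)"
  define A where "A = ball x0 R - {x0}"
  define C where "C = annulus x0 (a / 4) (8 * b)"
  have n: "n \<ge> 1" unfolding n_def by (simp add: Suc_leI)
  have t16: "tau \<ge> 16 * n"
  proof -
    have "16 * n \<le> 640 * n^2 * 1 * 1" using n mult_mono[of 1 n 1 n] by (simp add: power2_eq_square)
    also have "... \<le> 640 * n^2 * K * (1 + sig)" using n K sigma by (intro mult_mono) auto
    finally show ?thesis using tau unfolding n_def by linarith
  qed
  have g: "ball x0 R \<subseteq> D" "radial_weight A q M tau n" 
    "\<And>x. x \<in> ball x0 R ==> (dist x0 x)^2 / 2 \<le> q x \<and> q x \<le> 2 * (dist x0 x)^2"
    "\<And>x. x \<in> frontier Om \<inter> ball x0 R ==> gr q x \<bullet> gr rho x = 0"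
    using gc t16 by (auto simp: good_centre_def n_def A_def)
  have CA: "C \<subseteq> A"
  proof
    fix x assume x: "x \<in> C"
    then have "(dist x0 x)^2 < R^2" "(dist x0 x)^2 > 0" using a by (auto simp: C_def)
    then show "x \<in> A" using R by (auto simp: A_def intro: power_less_imp_less_base)
  qed
  have clO: "x \<in> closure Om" if "x \<in> Om" for x using that closure_subset by auto
  have "centred Om D rho u G A C q M tau n sig K a b"
  proof (intro centred.intro centred_axioms.intro hd)
    show "open A" "A \<subseteq> D" using g(1) by (auto simp: A_def)
    show "closed C" unfolding C_def by (rule annulus_meas)
    show "q x < a \<or> 2 * b < q x" if x: "x \<in> A - C" for x
    proof -
      have "(dist x0 x)^2 / 2 \<le> q x \<and> q x \<le> 2 * (dist x0 x)^2" using g(3) x by (auto simp: A_def)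
      moreover have "(dist x0 x)^2 < a / 4 \<or> (dist x0 x)^2 > 8 * b" using x by (auto simp: C_def)
      ultimately show ?thesis using a by linarith
    qed
    show "norm (gr rho x) \<le> K" if "x \<in> Om \<inter> A" for x using K(2)[of x] that clO by auto
    show "norm (fd (gr rho) x h) \<le> K * norm h" if "x \<in> Om \<inter> A" for x h using K(3)[of x h] that clO by auto
    show "G x \<bullet> gr rho x = sig * u x" if "x \<in> frontier Om \<inter> A" for x using bc[of x] that by (auto simp: A_def)
    show "gr q x \<bullet> gr rho x = 0" if "x \<in> frontier Om \<inter> A" for x using g(4)[of x] that by (auto simp: A_def)
    show "2 * a \<le> b" using a by linarith
  qed (use g CA K sigma tau a in \<open>auto simp: n_def\<close>)
  then interpret Z: centred Om D rho u G A C q M tau n sig K a b .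
  have b0: "b > 0" using a by linarith
  have f: "continuous_on (closure Om) (\<lambda>x. G x \<bullet> G x + (u x)\<^sup>2 / s)" if "s > 0" for s
    using that by (intro continuous_intros Gc uc) auto
  have t0: "tau > 0" using t16 n by linarith
  have 1: "En (annulus x0 (2 * tht1) (tht2 / 2)) \<le> (LINT x:Z.shell tht1 tht2|lborel. en x)"
    unfolding En_def
  proof (rule set_integral_mono_closure[OF en_cont en_cont _ Z.shell_meas])
    show "Om \<inter> annulus x0 (2 * tht1) (tht2 / 2) \<subseteq> Z.shell tht1 tht2"
    proof
      fix x assume x: "x \<in> Om \<inter> annulus x0 (2 * tht1) (tht2 / 2)"
      then have "x \<in> C" using a by (auto simp: C_def)
      then have "x \<in> A" using CA by auto
      moreover have "(dist x0 x)^2 / 2 \<le> q x \<and> q x \<le> 2 * (dist x0 x)^2" using g(3)[of x] \<open>x \<in> A\<close> by (auto simp: A_def)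
      ultimately show "x \<in> Z.shell tht1 tht2" using x by (auto simp: Z.shell_def)
    qed
    show "Om \<inter> annulus x0 (2 * tht1) (tht2 / 2) \<in> sets borel" by (rule annulus_meas(3)[OF op])
  qed (auto simp: Z.shell_def en_nonneg)
  have 2: "(LINT x:Z.shell a (2 * a)|lborel. G x \<bullet> G x + (u x)\<^sup>2 / a)
     \<le> (LINT x:Om \<inter> annulus x0 (a / 2) (4 * a)|lborel. G x \<bullet> G x + (u x)\<^sup>2 / a)"
  proof (rule set_integral_mono_closure[OF f[OF a(1)] f[OF a(1)] Z.shell_meas])
    show "Z.shell a (2 * a) \<subseteq> Om \<inter> annulus x0 (a / 2) (4 * a)"
    proof
      fix x assume x: "x \<in> Z.shell a (2 * a)"
      then have "x \<in> A" by (simp add: Z.shell_def)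
      then have "(dist x0 x)^2 / 2 \<le> q x \<and> q x \<le> 2 * (dist x0 x)^2" using g(3)[of x] by (auto simp: A_def)
      then show "x \<in> Om \<inter> annulus x0 (a / 2) (4 * a)" using x by (auto simp: Z.shell_def)
    qed
    show "Om \<inter> annulus x0 (a / 2) (4 * a) \<in> sets borel" by (rule annulus_meas(3)[OF op])
  qed (use a in auto)
  have 3: "(LINT x:Z.shell b (2 * b)|lborel. G x \<bullet> G x + (u x)\<^sup>2 / b) \<le> (LINT x:Om|lborel. en x / b)"
  proof (rule set_integral_mono_closure[OF f[OF b0] _ Z.shell_meas])
    show "continuous_on (closure Om) (\<lambda>x. en x / b)" using b0 by (intro continuous_intros en_cont) auto
    fix x show "G x \<bullet> G x + (u x)\<^sup>2 / b \<le> en x / b"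
    proof -
      have "G x \<bullet> G x \<le> (G x \<bullet> G x) / b" using b0 a mult_left_mono[of b 1 "G x \<bullet> G x"] by (simp add: field_simps)
      then show ?thesis by (simp add: en_def add_divide_distrib)
    qed
  qed (use op b0 en_nonneg in \<open>auto simp: Z.shell_def\<close>)
  have 3: "(LINT x:Z.shell b (2 * b)|lborel. G x \<bullet> G x + (u x)\<^sup>2 / b) \<le> En UNIV / b"
    using 3 by (simp add: En_def set_integral_divide_zero)
  have C1: "Z.C1 = 1152 * (real DIM('a))^2 * Mb^2" unfolding Z.C1_def by (simp add: n_def)
  have "tau * tht1 powr (1/4) / 128 * exp (2 * tau * wt tht2) * En (annulus x0 (2 * tht1) (tht2 / 2))
    \<le> tau * tht1 powr (1/4) / 128 * exp (2 * tau * wt tht2) * (LINT x:Z.shell tht1 tht2|lborel. en x)"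
    using 1 t0 by (intro mult_left_mono) auto
  also have "... \<le> Z.C1 * exp (2 * tau * wt a) * (LINT x:Z.shell a (2 * a)|lborel. G x \<bullet> G x + (u x)\<^sup>2 / a)
      + Z.C1 * exp (2 * tau * wt b) * (LINT x:Z.shell b (2 * b)|lborel. G x \<bullet> G x + (u x)\<^sup>2 / b)"
    by (rule Z.shell_estimate) (use a in auto)
  also have "... \<le> Z.C1 * exp (2 * tau * wt a) * (LINT x:Om \<inter> annulus x0 (a / 2) (4 * a)|lborel. G x \<bullet> G x + (u x)\<^sup>2 / a)
      + Z.C1 * exp (2 * tau * wt b) * (En UNIV / b)"
    using 2 3 by (intro add_mono mult_left_mono) (auto simp: C1)
  finally show ?thesis by (simp add: C1 mult_ac)
qed

section \<open>Observability\<close>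

lemma (in harmonic_data) En_Un:
  assumes "U \<in> sets borel" "V \<in> sets borel" shows "En (U \<union> V) \<le> En U + En V"
proof -
  have i: "integrable lborel (\<lambda>x. indicat_real (Om \<inter> U) x *\<^sub>R en x)" if "U \<in> sets borel" for U
    using si_closure[OF en_cont, of "Om \<inter> U"] op that by (auto simp: set_integrable_def)
  have "En U + En V = (LINT x|lborel. indicat_real (Om \<inter> U) x *\<^sub>R en x + indicat_real (Om \<inter> V) x *\<^sub>R en x)"
    unfolding En_def set_lebesgue_integral_def by (rule Bochner_Integration.integral_add[symmetric]) (intro i assms)+
  moreover have "En (U \<union> V) \<le> ..." unfolding En_def set_lebesgue_integral_def
    by (rule Bochner_Integration.integral_mono[OF i[OF sets.Un[OF assms]] Bochner_Integration.integrable_add[OF i[OF assms(1)] i[OF assms(2)]]])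
       (use en_nonneg in \<open>auto simp: indicator_def\<close>)
  ultimately show ?thesis by simp
qed

context defined_domain begin

text \<open>Hoelder-type propagation of smallness, uniform in the harmonic function and free of
  boundary conditions. Measuring smallness by an exponent above a threshold makes the relation
  transitive and lets the threshold absorb multiplicative constants.\<close>

definition controls :: "'a set \<Rightarrow> 'a set \<Rightarrow> bool" where
  "controls S T \<longleftrightarrow> (\<exists>tht>0. \<exists>kap0. \<forall>u G kap. data u G \<longrightarrow> kap \<ge> kap0 \<longrightarrow>
     energy u G S \<le> exp (- kap) * energy u G UNIV \<longrightarrow>
     energy u G T \<le> exp (- (tht * kap)) * energy u G UNIV)"

lemma controls_trans:
  assumes "controls S T" "controls T V" shows "controls S V"
proof -
  obtain tht1 kap1 where 1: "tht1 > 0" "\<And>u G kap. data u G ==> kap \<ge> kap1 ==>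
     energy u G S \<le> exp (- kap) * energy u G UNIV ==>
     energy u G T \<le> exp (- (tht1 * kap)) * energy u G UNIV"
    using assms(1) unfolding controls_def by blast
  obtain tht2 kap2 where 2: "tht2 > 0" "\<And>u G kap. data u G ==> kap \<ge> kap2 ==>
     energy u G T \<le> exp (- kap) * energy u G UNIV ==>
     energy u G V \<le> exp (- (tht2 * kap)) * energy u G UNIV"
    using assms(2) unfolding controls_def by blast
  have "energy u G V \<le> exp (- (tht2 * tht1 * kap)) * energy u G UNIV"
    if h: "data u G" "kap \<ge> max kap1 (kap2 / tht1)"
      "energy u G S \<le> exp (- kap) * energy u G UNIV" for u G kap
  proof -
    have "tht1 * kap \<ge> kap2" using h(2) 1(1) by (simp add: field_simps)
    then show ?thesis using 2(2)[OF h(1) _ 1(2)[OF h(1) _ h(3)]] h(2) by (simp add: mult.assoc)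
  qed
  moreover have "tht2 * tht1 > 0" using 1(1) 2(1) by simp
  ultimately show ?thesis unfolding controls_def by blast
qed

lemma controls_mono:
  assumes "controls S T" "Om \<inter> V \<subseteq> T" "V \<in> sets borel" "T \<in> sets borel" shows "controls S V"
proof -
  have "energy u G V \<le> energy u G T" if "data u G" for u G
    using harmonic_data.En_mono[OF that assms(3,4,2)] .
  then show ?thesis using assms(1) unfolding controls_def by (meson order_trans)
qed

lemma controls_Un:
  assumes "controls S T" "controls S V" "T \<in> sets borel" "V \<in> sets borel" shows "controls S (T \<union> V)"
proof -
  obtain tht1 kap1 where 1: "tht1 > 0" "\<And>u G kap. data u G ==> kap \<ge> kap1 ==>
     energy u G S \<le> exp (- kap) * energy u G UNIV ==>
     energy u G T \<le> exp (- (tht1 * kap)) * energy u G UNIV"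
    using assms(1) unfolding controls_def by blast
  obtain tht2 kap2 where 2: "tht2 > 0" "\<And>u G kap. data u G ==> kap \<ge> kap2 ==>
     energy u G S \<le> exp (- kap) * energy u G UNIV ==>
     energy u G V \<le> exp (- (tht2 * kap)) * energy u G UNIV"
    using assms(2) unfolding controls_def by blast
  \<comment> \<open>Half of the smaller exponent is kept. The other half, with
    \<open>tht * kap \<ge> 1\<close>, pays for the factor 2 in the sum of two energies.\<close>
  define tht where "tht = min tht1 tht2 / 2"
  have th: "tht > 0" "2 * tht \<le> tht1" "2 * tht \<le> tht2" using 1(1) 2(1) by (auto simp: tht_def)
  have "energy u G (T \<union> V) \<le> exp (- (tht * kap)) * energy u G UNIV"
    if h: "data u G" "kap \<ge> max (max kap1 kap2) (1 / tht)"
      "energy u G S \<le> exp (- kap) * energy u G UNIV" for u G kap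
  proof -
    interpret harmonic_data Om D rho u G by (rule h)
    have "kap \<ge> 1 / tht" "1 / tht > 0" using h(2) th by auto
    then have k: "kap > 0" "tht * kap \<ge> 1" using th by (linarith, simp add: field_simps)
    have e: "exp (- (tht' * kap)) \<le> exp (- (2 * tht * kap))" if "2 * tht \<le> tht'" for tht'
      using mult_right_mono[OF that, of kap] k by simp
    have "En T \<le> exp (- (tht1 * kap)) * En UNIV" "En V \<le> exp (- (tht2 * kap)) * En UNIV"
      using 1(2)[OF h(1) _ h(3)] 2(2)[OF h(1) _ h(3)] h(2) by auto
    moreover have "exp (- (tht1 * kap)) * En UNIV \<le> exp (- (2 * tht * kap)) * En UNIV"
      "exp (- (tht2 * kap)) * En UNIV \<le> exp (- (2 * tht * kap)) * En UNIV"
      by (intro mult_right_mono e th En_nonneg)+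
    ultimately have "En (T \<union> V) \<le> 2 * (exp (- (2 * tht * kap)) * En UNIV)"
      using En_Un[OF assms(3,4)] by linarith
    also have "... = (2 * exp (- (tht * kap))) * (exp (- (tht * kap)) * En UNIV)" by (simp add: mult_exp_exp)
    also have "... \<le> 1 * (exp (- (tht * kap)) * En UNIV)"
    proof (rule mult_right_mono)
      have "2 \<le> exp (tht * kap)" using exp_ge_add_one_self[of "tht * kap"] k by linarith
      then show "2 * exp (- (tht * kap)) \<le> 1" by (simp add: exp_minus field_simps)
    qed (simp add: En_nonneg)
    finally show ?thesis by simp
  qed
  then show ?thesis unfolding controls_def using th(1) by blast
qed

text \<open>A three-ball inequality around an interior point. There is no frontier in the ball, so
  the estimate is applied with \<open>sig = 0\<close> and \<open>tau\<close> is free to grow with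
  \<open>kap\<close>.\<close>

lemma interior_step:
  assumes B: "ball y R \<subseteq> Om" and R: "R > 0" "R \<le> (1 / (200 * (real DIM('a) + 1)))^2" and s: "0 < s" "s \<le> R / 7"
  shows "controls (cball y s) (cball y (R / 7))"
proof -
  obtain K where K: "K \<ge> 1" "\<And>x. x \<in> closure Om ==> norm (gr rho x) \<le> K"
      "\<And>x h. x \<in> closure Om ==> norm (fd (gr rho) x h) \<le> K * norm h" by (rule rho_bounds) (rule that)
  note gc = interior_centre[OF B R]
  \<comment> \<open>These are squared radii. The inner transition annulus ends at
    \<open>4 * a = s^2\<close>, where the middle one begins since \<open>2 * tht1 = s^2\<close>; the
    middle one reaches \<open>R^2 / 40\<close>, beyond \<open>(R / 7)^2\<close>.\<close>
  define a tht1 tht2 b where "a = s^2 / 4" and "tht1 = s^2 / 2" and "tht2 = R^2 / 20" and "b = R^2 / 10"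
  have sR: "s^2 \<le> R^2 / 49" using power_mono[OF s(2), of 2] s by (simp add: power_divide)
  have R1: "R \<le> 1"
  proof -
    have "1 / (200 * (real DIM('a) + 1)) \<le> 1" by (simp add: field_simps)
    then have "(1 / (200 * (real DIM('a) + 1)))^2 \<le> 1" by (intro power_le_one) auto
    then show ?thesis using R by linarith
  qed
  have p: "s^2 > 0" "R^2 > 0" "R^2 \<le> 1" using s R R1 by (auto intro: power_le_one)
  have a: "0 < a" "2 * a \<le> tht1" "tht1 \<le> tht2" "tht2 \<le> b" "8 * b < R^2" "b \<le> 1" "a < tht2" "tht2 < b" "b < 1" "tht2 < 1" "0 < tht2"
    unfolding a_def tht1_def tht2_def b_def using sR p by linarith+
  define n where "n = real DIM('a)"
  define T0 where "T0 = 640 * n^2 * K * (1 + 0)"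
  define C1 where "C1 = 1152 * n^2 * Mb^2"
  define alp where "alp = wt a - wt tht2"
  define gam where "gam = wt tht2 - wt b"
  have al: "alp > 0" "gam > 0" using wt_strict[of a tht2] wt_strict[of tht2 b] a by (auto simp: alp_def gam_def)
  define c where "c = tht1 powr (1/4) / 128"
  have c: "c > 0" using p by (simp add: c_def tht1_def)
  have C1: "C1 \<ge> 0" by (simp add: C1_def)
  \<comment> \<open>For \<open>tau = kap / (4 * alp)\<close> the inner term decays like
    \<open>exp (- (kap / 2))\<close> and the outer one like
    \<open>exp (- (gam / (2 * alp) * kap))\<close>; \<open>eta\<close> is the smaller rate.\<close>
  define eta where "eta = min (1/2) (gam / (2 * alp))"
  have eta: "eta > 0" "eta \<le> 1/2" "eta \<le> gam / (2 * alp)" using al unfolding eta_def by auto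
  define A0 where "A0 = (C1 / a + C1 / b) / c"
  have A0: "A0 \<ge> 0" using C1 a c by (simp add: A0_def)
  have "energy u G (cball y (R / 7)) \<le> exp (- (eta / 2 * kap)) * energy u G UNIV"
    if h: "data u G" "kap \<ge> max (4 * alp * max T0 1) (2 * A0 / eta)"
      "energy u G (cball y s) \<le> exp (- kap) * energy u G UNIV" for u G kap
  proof -
    interpret harmonic_data Om D rho u G by (rule h)
    \<comment> \<open>Passing from the middle to the inner annulus, the weight costs
      \<open>exp (2 * tau * alp) = exp (kap / 2)\<close>, so half of the assumed smallness
      survives.\<close>
    define tau where "tau = kap / (4 * alp)"
    define U where "U = En UNIV"
    define P where "P = En (annulus y (2 * tht1) (tht2 / 2))"
    have U0: "U \<ge> 0" and P0: "P \<ge> 0" by (simp_all add: U_def P_def En_nonneg)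
    have "kap \<ge> max T0 1 * (4 * alp)" using h(2) by (simp add: mult_ac)
    then have "tau \<ge> max T0 1" using al unfolding tau_def by (simp only: pos_le_divide_eq)
    then have tau: "tau \<ge> T0" "tau \<ge> 1" by auto
    have kt: "kap = 4 * alp * tau" using al by (simp add: tau_def)
    then have k0: "kap > 0" using al tau by simp
    have fr: "frontier Om \<inter> ball y R = {}" using B frontier_notin by auto
    have b0: "b > 0" using p by (simp add: b_def)
    have "(LINT x:Om \<inter> annulus y (a / 2) (4 * a)|lborel. G x \<bullet> G x + (u x)\<^sup>2 / a)
       \<le> (LINT x:Om \<inter> cball y s|lborel. en x / a)"
    proof (rule set_integral_mono_closure)
      show "continuous_on (closure Om) (\<lambda>x. G x \<bullet> G x + (u x)\<^sup>2 / a)" "continuous_on (closure Om) (\<lambda>x. en x / a)"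
        using a by (intro continuous_intros Gc uc en_cont; simp)+
      show "Om \<inter> annulus y (a / 2) (4 * a) \<in> sets borel" by (rule annulus_meas(3)[OF op])
      show "Om \<inter> annulus y (a / 2) (4 * a) \<subseteq> Om \<inter> cball y s"
        using s by (auto simp: a_def intro: power2_le_imp_le)
      show "G x \<bullet> G x + (u x)\<^sup>2 / a \<le> en x / a" for x
      proof -
        have "G x \<bullet> G x \<le> (G x \<bullet> G x) / a" using a mult_left_mono[of a 1 "G x \<bullet> G x"] by (simp add: field_simps)
        then show ?thesis by (simp add: en_def add_divide_distrib)
      qed
    qed (use op a en_nonneg in auto)
    also have "... = En (cball y s) / a" by (simp add: En_def set_integral_divide_zero)
    also have "... \<le> exp (- kap) * U / a" using h(3) a by (intro divide_right_mono) (auto simp: U_def)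
    finally have I: "(LINT x:Om \<inter> annulus y (a / 2) (4 * a)|lborel. G x \<bullet> G x + (u x)\<^sup>2 / a) \<le> exp (- kap) * U / a" .
    have "tau * tht1 powr (1/4) / 128 * exp (2 * tau * wt tht2) * P \<le> C1 * exp (2 * tau * wt a) *
         (LINT x:Om \<inter> annulus y (a / 2) (4 * a)|lborel. G x \<bullet> G x + (u x)\<^sup>2 / a)
      + C1 / b * exp (2 * tau * wt b) * U" unfolding P_def C1_def n_def U_def
      by (rule annulus_estimate[OF h(1) gc R(1) K, where sig = 0]) (use tau a fr in \<open>auto simp: T0_def n_def\<close>)
    also have "... \<le> C1 * exp (2 * tau * wt a) * (exp (- kap) * U / a) + C1 / b * exp (2 * tau * wt b) * U"
      using I C1 by (intro add_right_mono mult_left_mono) auto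
    also have "... = exp (2 * tau * wt tht2) * ((C1 / a * exp (- (kap / 2)) + C1 / b * exp (- (2 * tau * gam))) * U)"
    proof -
      have e1: "exp (2 * tau * wt tht2) * exp (- (kap / 2)) = exp (2 * tau * wt a) * exp (- kap)"
      proof -
        have "kap = 2 * (2 * tau * wt a) - 2 * (2 * tau * wt tht2)" unfolding kt alp_def by (simp add: algebra_simps)
        then have "2 * tau * wt tht2 + - (kap / 2) = 2 * tau * wt a + - kap" by linarith
        then show ?thesis unfolding mult_exp_exp by simp
      qed
      have e2: "exp (2 * tau * wt tht2) * exp (- (2 * tau * gam)) = exp (2 * tau * wt b)"
        unfolding mult_exp_exp gam_def by (simp add: algebra_simps)
      have "exp (2 * tau * wt tht2) * ((C1 / a * exp (- (kap / 2)) + C1 / b * exp (- (2 * tau * gam))) * U)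
         = C1 / a * (exp (2 * tau * wt tht2) * exp (- (kap / 2))) * U + C1 / b * (exp (2 * tau * wt tht2) * exp (- (2 * tau * gam))) * U"
        by (simp add: distrib_left distrib_right mult_ac)
      then show ?thesis unfolding e1 e2 by (simp add: mult_ac)
    qed
    also have "tau * tht1 powr (1/4) / 128 * exp (2 * tau * wt tht2) * P = exp (2 * tau * wt tht2) * (tau * (c * P))"
      by (simp add: c_def mult_ac)
    finally have "tau * (c * P) \<le> (C1 / a * exp (- (kap / 2)) + C1 / b * exp (- (2 * tau * gam))) * U" by simp
    moreover have "c * P \<le> tau * (c * P)" using tau c P0 mult_right_mono[of 1 tau "c * P"] by simp
    moreover have "(C1 / a * exp (- (kap / 2)) + C1 / b * exp (- (2 * tau * gam))) * U \<le> (C1 / a * exp (- (eta * kap)) + C1 / b * exp (- (eta * kap))) * U"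
    proof -
      have 1: "eta * kap \<le> kap / 2" using mult_right_mono[OF eta(2), of kap] k0 by simp
      have "eta * kap \<le> gam / (2 * alp) * kap" using mult_right_mono[OF eta(3), of kap] k0 by simp
      also have "... = 2 * tau * gam" unfolding kt using al by simp
      finally have 2: "eta * kap \<le> 2 * tau * gam" .
      show ?thesis using 1 2 C1 a b0 U0 by (intro mult_right_mono add_mono mult_left_mono) auto
    qed
    moreover have "(C1 / a * exp (- (eta * kap)) + C1 / b * exp (- (eta * kap))) * U = c * (A0 * exp (- (eta * kap)) * U)"
    proof -
      have "c * A0 = C1 / a + C1 / b" using c by (simp add: A0_def)
      then have "c * (A0 * exp (- (eta * kap)) * U) = (C1 / a + C1 / b) * exp (- (eta * kap)) * U" by (metis mult.assoc)
      then show ?thesis by (simp add: distrib_right)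
    qed
    ultimately have "c * P \<le> c * (A0 * exp (- (eta * kap)) * U)" by linarith
    then have P: "P \<le> A0 * exp (- (eta * kap)) * U" using c by simp
    have "En (cball y (R / 7)) \<le> En (cball y s \<union> annulus y (2 * tht1) (tht2 / 2))"
    proof (rule En_mono)
      show "Om \<inter> cball y (R / 7) \<subseteq> cball y s \<union> annulus y (2 * tht1) (tht2 / 2)"
      proof
        fix x assume "x \<in> Om \<inter> cball y (R / 7)"
        then have "(dist y x)^2 \<le> (R / 7)^2" by (intro power_mono) auto
        then have "(dist y x)^2 \<le> R^2 / 49" by (simp add: power_divide)
        then have "(dist y x)^2 \<le> tht2 / 2" using p unfolding tht2_def by linarith
        moreover have "2 * tht1 \<le> (dist y x)^2" if "\<not> dist y x \<le> s" using that s power_mono[of s "dist y x" 2] by (simp add: tht1_def)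
        ultimately show "x \<in> cball y s \<union> annulus y (2 * tht1) (tht2 / 2)" by auto
      qed
    qed (use annulus_meas(2) in \<open>auto intro!: sets.Un\<close>)
    also have "... \<le> En (cball y s) + P" unfolding P_def by (rule En_Un) (use annulus_meas(2) in auto)
    also have "... \<le> exp (- (eta * kap)) * U + A0 * exp (- (eta * kap)) * U"
    proof (rule add_mono[OF _ P])
      have "eta * kap \<le> kap" using mult_right_mono[OF eta(2), of kap] k0 by simp
      then have "exp (- kap) * U \<le> exp (- (eta * kap)) * U" using U0 by (intro mult_right_mono) auto
      then show "En (cball y s) \<le> exp (- (eta * kap)) * U" using h(3) unfolding U_def by linarith
    qed
    also have "... = ((1 + A0) * exp (- (eta / 2 * kap))) * (exp (- (eta / 2 * kap)) * U)"
    proof -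
      have "exp (- (eta / 2 * kap)) * exp (- (eta / 2 * kap)) = exp (- (eta * kap))" unfolding mult_exp_exp by simp
      then have "((1 + A0) * exp (- (eta / 2 * kap))) * (exp (- (eta / 2 * kap)) * U) = (1 + A0) * exp (- (eta * kap)) * U"
        by (metis (no_types) mult.assoc)
      then show ?thesis by (simp add: distrib_right)
    qed
    also have "... \<le> 1 * (exp (- (eta / 2 * kap)) * U)"
    proof (rule mult_right_mono)
      have "A0 \<le> eta / 2 * kap" using h(2) eta by (simp add: field_simps)
      then have "1 + A0 \<le> exp (eta / 2 * kap)" using exp_ge_add_one_self[of "eta / 2 * kap"] by linarith
      then have "(1 + A0) * exp (- (eta / 2 * kap)) \<le> exp (eta / 2 * kap) * exp (- (eta / 2 * kap))" by (intro mult_right_mono) auto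
      then show "(1 + A0) * exp (- (eta / 2 * kap)) \<le> 1" by (simp add: mult_exp_exp)
    qed (simp add: U0)
    finally show ?thesis by (simp add: U_def)
  qed
  then show ?thesis unfolding controls_def using eta(1)
    by (intro exI[of _ "eta / 2"] conjI exI[of _ "max (4 * alp * max T0 1) (2 * A0 / eta)"]) auto
qed

end

context defined_domain begin

lemma controls_mono_self:
  assumes "Om \<inter> V \<subseteq> S" "V \<in> sets borel" "S \<in> sets borel" shows "controls S V"
proof -
  have "controls S S" unfolding controls_def by (rule exI[of _ 1]) simp
  then show ?thesis by (rule controls_mono) (use assms in auto)
qed

text \<open>The connectedness argument for an abstract property of sets, since it serves both
  energies and oscillations. The centres of good balls form an open set. Its complement in
  \<open>Om\<close> is open as well: a good ball around a point near \<open>y\<close> grows by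
  \<open>step\<close> until it contains \<open>y\<close>. A finite cover then passes from balls to
  \<open>T\<close>.\<close>

lemma chain_of_balls:
  assumes S: "cball x0 s \<subseteq> Om" "s > 0" and T: "compact T" "T \<subseteq> Om"
    and base: "Q (cball x0 s)" "Q {}"
    and mono: "\<And>T V. Q T ==> V \<subseteq> T ==> V \<in> sets borel ==> T \<in> sets borel ==> Q V"
    and Un: "\<And>T V. Q T ==> Q V ==> T \<in> sets borel ==> V \<in> sets borel ==> Q (T \<union> V)"
    and step: "\<And>y R s. ball y R \<subseteq> Om ==> R > 0 ==> R \<le> (1 / (200 * (real DIM('a) + 1)))^2 ==> 0 < s ==> s \<le> R / 7 ==>
      Q (cball y s) ==> Q (cball y (R / 7))"
  shows "Q T"
proof -
  define P where "P = {y \<in> Om. \<exists>r>0. cball y r \<subseteq> Om \<and> Q (cball y r)}"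
  have x0: "x0 \<in> P" using S base by (auto simp: P_def)
  have sub: "ball y r \<subseteq> P" if y: "cball y r \<subseteq> Om" "Q (cball y r)" for y r
  proof
    fix z assume z: "z \<in> ball y r"
    define r' where "r' = r - dist y z"
    have r': "r' > 0" using z by (simp add: r'_def)
    have r'2: "cball z r' \<subseteq> cball y r"
    proof
      fix w assume "w \<in> cball z r'"
      then show "w \<in> cball y r" using dist_triangle[of y w z] by (simp add: r'_def)
    qed
    have "Q (cball z r')" by (rule mono[OF y(2)]) (use r'2 in auto)
    moreover have "z \<in> Om" using z y(1) by (auto simp: subset_eq)
    ultimately show "z \<in> P" unfolding P_def using r' r'2 y by auto
  qed
  have "open P"
  proof (rule openI)
    fix y assume "y \<in> P"
    then obtain r where "r > 0" "cball y r \<subseteq> Om" "Q (cball y r)" by (auto simp: P_def)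
    then show "\<exists>e>0. ball y e \<subseteq> P" using sub by blast
  qed
  moreover have "open (Om - P)"
  proof (rule openI)
    fix y assume y: "y \<in> Om - P"
    then obtain R0 where R0: "R0 > 0" "ball y R0 \<subseteq> Om" using op open_contains_ball by blast
    define R where "R = min (R0 / 2) ((1 / (200 * (real DIM('a) + 1)))^2)"
    have R: "R > 0" "R \<le> R0 / 2" "R \<le> (1 / (200 * (real DIM('a) + 1)))^2" using R0 by (auto simp: R_def)
    have "z \<notin> P" if z: "z \<in> ball y (R / 7)" for z
    proof
      assume "z \<in> P"
      then obtain r where r: "r > 0" "cball z r \<subseteq> Om" "Q (cball z r)" by (auto simp: P_def)
      \<comment> \<open>The good ball may be larger than \<open>step\<close> admits, so it is shrunk
        beforehand.\<close>
      define r' where "r' = min r (R / 7)"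
      have bz: "ball z R \<subseteq> ball y R0"
      proof
        fix w assume "w \<in> ball z R"
        then show "w \<in> ball y R0" using z R dist_triangle[of y w z] by auto
      qed
      have "Q (cball z r')" by (rule mono[OF r(3)]) (auto simp: r'_def)
      then have "Q (cball z (R / 7))"
        by (rule step[rotated -1]) (use bz R0 R r in \<open>auto simp: r'_def\<close>)
      moreover have "cball z (R / 7) \<subseteq> Om" using bz R0 R by (auto simp: subset_eq)
      ultimately have "ball z (R / 7) \<subseteq> P" using sub by blast
      moreover have "y \<in> ball z (R / 7)" using z by (simp add: dist_commute)
      ultimately show False using y by auto
    qed
    moreover have "ball y (R / 7) \<subseteq> Om" using R0 R by (auto simp: subset_eq)
    ultimately show "\<exists>e>0. ball y e \<subseteq> Om - P" using R by (intro exI[of _ "R / 7"]) auto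
  qed
  ultimately have "P \<inter> Om = {} \<or> (Om - P) \<inter> Om = {}" by (intro connectedD[OF conn]) auto
  moreover have "x0 \<in> P \<inter> Om" using x0 by (auto simp: P_def)
  ultimately have all: "Om \<subseteq> P" by auto
  then have "\<forall>y\<in>T. \<exists>r>0. Q (cball y r)" using T by (auto simp: P_def)
  then obtain r where r: "\<And>y. y \<in> T ==> r y > 0 \<and> Q (cball y (r y))" by metis
  obtain F where F: "F \<subseteq> T" "finite F" "T \<subseteq> (\<Union>y\<in>F. ball y (r y))"
  proof (rule compactE_image[OF T(1), of T "\<lambda>y. ball y (r y)"])
    show "T \<subseteq> (\<Union>y\<in>T. ball y (r y))" using r by (meson UN_I centre_in_ball subsetI)
  qed auto
  have cF: "Q (\<Union>y\<in>F. cball y (r y))" using F(2,1)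
  proof (induction F rule: finite_induct)
    case empty
    then show ?case using base by simp
  next
    case (insert y F)
    have "Q (cball y (r y) \<union> (\<Union>y\<in>F. cball y (r y)))"
      by (rule Un) (use insert r in \<open>auto intro!: borel_closed closed_UN\<close>)
    then show ?case by simp
  qed
  show ?thesis
  proof (rule mono[OF cF])
    show "(\<Union>y\<in>F. cball y (r y)) \<in> sets borel" using F(2) by (intro borel_closed closed_UN) auto
    show "T \<subseteq> (\<Union>y\<in>F. cball y (r y))"
    proof
      fix x assume "x \<in> T"
      then obtain y where "y \<in> F" "x \<in> ball y (r y)" using F(3) by blast
      then have "y \<in> F" "x \<in> cball y (r y)" using ball_subset_cball[of y "r y"] by auto
      then show "x \<in> (\<Union>y\<in>F. cball y (r y))" by (rule UN_I)
    qed
    show "T \<in> sets borel" by (intro borel_closed compact_imp_closed T)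
  qed
qed

lemma controls_compact:
  assumes S: "cball x0 s \<subseteq> Om" "s > 0" and T: "compact T" "T \<subseteq> Om"
  shows "controls (cball x0 s) T"
proof (rule chain_of_balls[OF assms, where Q="controls (cball x0 s)"])
  show "controls (cball x0 s) (cball x0 s)" "controls (cball x0 s) {}" by (rule controls_mono_self; simp)+
  show "controls (cball x0 s) V" if "controls (cball x0 s) T" "V \<subseteq> T" "V \<in> sets borel" "T \<in> sets borel" for T V
    by (rule controls_mono[OF that(1) _ that(3,4)]) (use that in auto)
qed (rule controls_Un, assumption+, rule controls_trans, assumption, rule interior_step, assumption+)

text \<open>By \<open>collar_propagation\<close> a fixed compact set carries the fraction
  \<open>exp (- (C1 * (1 + sig)))\<close> of the energy. If the ball carried too little,
  \<open>controls_compact\<close> would force that set below this fraction; \<open>C\<close> is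
  chosen so that \<open>tht * C\<close> exceeds \<open>C1\<close> by at least 1.\<close>

lemma observability:
  assumes S: "cball x0 s \<subseteq> Om" "s > 0"
  shows "\<exists>C>0. \<forall>u G sig. data u G \<longrightarrow> sig \<ge> 0 \<longrightarrow>
     robin u G sig \<longrightarrow> energy u G UNIV > 0 \<longrightarrow>
     exp (- (C * (1 + sig))) * energy u G UNIV < energy u G (cball x0 s)"
proof -
  obtain C1 dl where C1: "C1 > 0" "dl > 0" "\<And>u G sig. data u G ==> sig \<ge> 0 ==>
     robin u G sig ==>
     energy u G UNIV \<le> exp (C1 * (1 + sig)) * energy u G {x \<in> closure Om. rho x \<le> - dl}"
    using collar_propagation by blast
  define T where "T = {x \<in> closure Om. rho x \<le> - dl}"
  from controls_compact[OF S inner_set[OF C1(2)]]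
  obtain tht kap0 where c: "tht > 0" "\<And>u G kap. data u G ==> kap \<ge> kap0 ==>
     energy u G (cball x0 s) \<le> exp (- kap) * energy u G UNIV ==>
     energy u G T \<le> exp (- (tht * kap)) * energy u G UNIV"
    unfolding controls_def T_def by blast
  define C where "C = max kap0 ((C1 + 1) / tht)"
  have C: "C \<ge> kap0" "C \<ge> (C1 + 1) / tht" by (auto simp: C_def)
  then have C0: "C > 0" "tht * C \<ge> C1 + 1" using C1(1) c(1) divide_pos_pos[of "C1 + 1" tht] by (linarith, simp add: field_simps)
  have "exp (- (C * (1 + sig))) * energy u G UNIV < energy u G (cball x0 s)"
    if h: "data u G" "sig \<ge> 0" "robin u G sig"
      "energy u G UNIV > 0" for u G sig
  proof (rule ccontr)
    interpret harmonic_data Om D rho u G by (rule h)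
    assume "\<not> exp (- (C * (1 + sig))) * En UNIV < En (cball x0 s)"
    then have "En (cball x0 s) \<le> exp (- (C * (1 + sig))) * En UNIV" by simp
    moreover have "C * (1 + sig) \<ge> kap0" using C(1) C0(1) h(2) mult_left_mono[of 1 "1 + sig" C] by linarith
    ultimately have "En T \<le> exp (- (tht * (C * (1 + sig)))) * En UNIV" by (intro c(2) h(1))
    then have "exp (C1 * (1 + sig)) * En T \<le> exp (C1 * (1 + sig)) * (exp (- (tht * (C * (1 + sig)))) * En UNIV)"
      by (rule mult_left_mono) simp
    then have "En UNIV \<le> exp (C1 * (1 + sig) + - (tht * (C * (1 + sig)))) * En UNIV"
      using C1(3)[OF h(1,2,3)] unfolding T_def[symmetric] exp_add by linarith
    then have "1 \<le> exp (C1 * (1 + sig) + - (tht * (C * (1 + sig))))" using h(4) by simp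
    then have "C1 * (1 + sig) - tht * C * (1 + sig) \<ge> 0" by (simp add: mult.assoc)
    moreover have "tht * C * (1 + sig) \<ge> (C1 + 1) * (1 + sig)" using C0 h(2) by (intro mult_right_mono) auto
    moreover have "(C1 + 1) * (1 + sig) = C1 * (1 + sig) + (1 + sig)" by (simp add: algebra_simps)
    ultimately show False using h(2) by linarith
  qed
  then show ?thesis using C0 by blast
qed

end

section \<open>The vanishing order at the boundary\<close>

context defined_domain begin

text \<open>Vanishing on the boundary enters the estimates as this growth condition from inside,
  with \<open>c\<close> and \<open>r\<close> depending on the function. The single extra power for
  \<open>u\<close> compensates the division by \<open>a\<close> in the inner term of
  \<open>annulus_estimate\<close>.\<close>

definition boundary_zero :: "('a \<Rightarrow> real) \<Rightarrow> ('a \<Rightarrow> 'a) \<Rightarrow> real \<Rightarrow> 'a \<Rightarrow> nat \<Rightarrow> bool" where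
  "boundary_zero u G sig x0 l \<longleftrightarrow> data u G \<and> sig \<ge> 0 \<and> robin u G sig \<and>
     energy u G UNIV > 0 \<and> x0 \<in> frontier Om \<and>
     (\<exists>c r. r > 0 \<and> (\<forall>x\<in>Om \<inter> ball x0 r. \<bar>u x\<bar> \<le> c * dist x0 x ^ (l + 1) \<and> norm (G x) \<le> c * dist x0 x ^ l))"

text \<open>The weight grows like \<open>a powr (- tau)\<close> while the energy of a small annulus
  decays at least like \<open>a ^ l\<close>. The offset one half in \<open>tau\<close> leaves a
  factor \<open>sqrt a\<close>, which disappears in the limit.\<close>

lemma weight_power_bound:
  fixes tau a :: real
  assumes a: "0 < a" "a \<le> 1" and t: "tau = real l - 1/2" "tau > 0"
  shows "exp (2 * tau * wt a) * a ^ l \<le> exp (4 * tau) * sqrt a"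
proof -
  have "2 * tau * wt a = 4 * tau * a powr (1/4) - tau * ln a" by (simp add: wt_def algebra_simps)
  also have "... \<le> 4 * tau - tau * ln a" using powr_mono_both[of 0 "1/4" a 1] a t powr_le_one_le[of a "1/4"]
    by (simp add: powr_le1)
  finally have "exp (2 * tau * wt a) \<le> exp (4 * tau - tau * ln a)" by simp
  then have "exp (2 * tau * wt a) * a ^ l \<le> exp (4 * tau - tau * ln a) * exp (real l * ln a)"
    using a by (simp add: exp_of_nat_mult)
  also have "... = exp (4 * tau + ln a / 2)" unfolding mult_exp_exp t by (simp add: algebra_simps)
  also have "... = exp (4 * tau) * sqrt a" using a by (simp add: exp_add powr_half_sqrt[symmetric] powr_def)
  finally show ?thesis .
qed

text \<open>A fixed interior ball near \<open>p\<close> lies in an annulus around every frontier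
  point close to \<open>p\<close>. Once the inner term is gone, the energy of that annulus is at
  most of size \<open>exp (- (2 * tau * gam))\<close>; observability bounds it below by
  \<open>exp (- (Co * (1 + sig)))\<close>. Comparing exponents bounds \<open>tau\<close>.\<close>

lemma local_vanishing_bound:
  assumes p: "p \<in> frontier Om"
  shows "\<exists>e>0. \<exists>C>0. \<forall>u G sig x0 l. x0 \<in> ball p e \<longrightarrow> boundary_zero u G sig x0 l \<longrightarrow> real l \<le> C * (1 + sig)"
proof -
  obtain K where K: "K \<ge> 1" "\<And>x. x \<in> closure Om ==> norm (gr rho x) \<le> K"
      "\<And>x h. x \<in> closure Om ==> norm (fd (gr rho) x h) \<le> K * norm h" by (rule rho_bounds) (rule that)
  obtain M R where MR: "M \<ge> 1" "R > 0" "\<And>x0. x0 \<in> frontier Om ==> \<exists>q. good_centre x0 R M q" using boundary_centre by blast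
  define b where "b = min (R^2 / 10) (1/2)"
  define tht2 where "tht2 = b / 2"
  have "R^2 > 0" using MR by simp
  then have b: "0 < b" "b < 1" "8 * b < R^2" "tht2 < b" "0 < tht2" unfolding tht2_def b_def min_def by auto
  have "sqrt (tht2 / 8) > 0" using b by simp
  then obtain z where z: "z \<in> Om" "dist z p < sqrt (tht2 / 8)" using frontier_cl[OF p] closure_approachable by blast
  define d where "d = dist p z"
  have d: "d > 0" using z frontier_notin[OF p] by (auto simp: d_def)
  have d2: "d^2 < tht2 / 8"
  proof -
    have "d^2 < (sqrt (tht2 / 8))^2" using z(2) d by (intro power_strict_mono) (auto simp: d_def dist_commute)
    then show ?thesis using b by simp
  qed
  obtain s0 where s0: "s0 > 0" "cball z s0 \<subseteq> Om" using op z(1) open_contains_cball by blast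
  define s where "s = min s0 (d / 4)"
  have s: "s > 0" "s \<le> d / 4" "cball z s \<subseteq> Om" using s0 d by (auto simp: s_def subset_eq)
  \<comment> \<open>If \<open>x0\<close> is within \<open>d / 4\<close> of \<open>p\<close>, points
    of the ball around \<open>z\<close> have distance between \<open>d / 2\<close> and
    \<open>2 * d\<close> from \<open>x0\<close>. The annulus begins at
    \<open>2 * tht1 = (d / 2)^2\<close>, and \<open>d2\<close> puts \<open>(2 * d)^2\<close> below
    its outer bound \<open>tht2 / 2\<close>.\<close>
  define tht1 where "tht1 = d^2 / 8"
  have th: "0 < tht1" "tht1 \<le> tht2" using d d2 b by (auto simp: tht1_def)
  obtain Co where Co: "Co > 0" "\<And>u G sig. data u G ==> sig \<ge> 0 ==>
     robin u G sig ==> energy u G UNIV > 0 ==>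
     exp (- (Co * (1 + sig))) * energy u G UNIV < energy u G (cball z s)"
    using observability[OF s(3,1)] by blast
  define n where "n = real DIM('a)"
  define T0 where "T0 = 640 * n^2 * K"
  define C1 where "C1 = 1152 * n^2 * Mb^2"
  define gam where "gam = wt tht2 - wt b"
  have gam: "gam > 0" using wt_strict[of tht2 b] b by (auto simp: gam_def)
  define c where "c = tht1 powr (1/4) / 128"
  have c: "c > 0" using th by (simp add: c_def)
  have C1: "C1 \<ge> 0" by (simp add: C1_def)
  define B where "B = C1 / b / c"
  have B: "B \<ge> 0" using C1 b c by (simp add: B_def)
  have T0: "T0 \<ge> 1"
  proof -
    have "1 \<le> n" unfolding n_def by (simp add: Suc_leI)
    then have "1 \<le> n^2" by (simp add: one_le_power)
    then show ?thesis using K(1) mult_mono[of 1 "n^2" 1 K] unfolding T0_def by simp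
  qed
  define CC where "CC = T0 + 1 + (Co + B) / (2 * gam)"
  have CC: "CC > 0" using T0 Co(1) B gam by (simp add: CC_def add_pos_nonneg)
  have "real l \<le> CC * (1 + sig)" if x0: "x0 \<in> ball p (d / 4)" and bz: "boundary_zero u G sig x0 l" for u G sig x0 l
  proof -
    have h: "data u G" "sig \<ge> 0" "robin u G sig"
      "energy u G UNIV > 0" "x0 \<in> frontier Om" using bz by (auto simp: boundary_zero_def)
    obtain cv r where r: "r > 0" "\<And>x. x \<in> Om \<inter> ball x0 r ==> \<bar>u x\<bar> \<le> cv * dist x0 x ^ (l + 1) \<and> norm (G x) \<le> cv * dist x0 x ^ l"
      using bz unfolding boundary_zero_def by blast
    interpret harmonic_data Om D rho u G by (rule h)
    obtain q where gc: "good_centre x0 R M q" using MR(3)[OF h(5)] by blast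
    define tau where "tau = real l - 1/2"
    have pos: "(Co + B) / (2 * gam) * (1 + sig) \<ge> 0" using Co(1) B gam h(2) by simp
    have ex: "CC * (1 + sig) = T0 * (1 + sig) + (1 + sig) + (Co + B) / (2 * gam) * (1 + sig)" by (simp add: CC_def distrib_right)
    show ?thesis
    proof (cases "tau \<ge> T0 * (1 + sig)")
      \<comment> \<open>If \<open>tau\<close> is too small for the Carleman estimate, then
        \<open>l\<close> already satisfies a linear bound.\<close>
      case False
      then show ?thesis using pos h(2) unfolding ex tau_def by linarith
    next
      case True
      have t1: "tau \<ge> 1" using True T0 h(2) mult_mono[of 1 T0 1 "1 + sig"] by linarith
      define P where "P = En (annulus x0 (2 * tht1) (tht2 / 2))"
      define I1 where "I1 = (LINT x:Om|lborel. (1::real))"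
      define Z where "Z = C1 * (exp (4 * tau) * (5 * cv^2 * 4 ^ l * I1))"
      define RHS where "RHS = C1 / b * exp (2 * tau * wt b) * En UNIV"
      define LHS where "LHS = tau * tht1 powr (1/4) / 128 * exp (2 * tau * wt tht2) * P"
      have I1: "I1 \<ge> 0" unfolding I1_def set_lebesgue_integral_def by (rule Bochner_Integration.integral_nonneg) simp
      define a0 where "a0 = min (tht1 / 2) (r^2 / 8)"
      have a0: "a0 > 0" using th r by (simp add: a0_def)
      have est: "LHS \<le> Z * sqrt a + RHS" if a: "0 < a" "a < a0" for a
      proof -
        have a': "2 * a \<le> tht1" "4 * a < r^2" "a \<le> 1" using a th b by (auto simp: a0_def)
        have "(LINT x:Om \<inter> annulus x0 (a / 2) (4 * a)|lborel. G x \<bullet> G x + (u x)\<^sup>2 / a)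
          \<le> (LINT x:Om|lborel. 5 * cv^2 * 4 ^ l * a ^ l)"
        proof (rule set_integral_mono_closure)
          show "continuous_on (closure Om) (\<lambda>x. G x \<bullet> G x + (u x)\<^sup>2 / a)" using a by (intro continuous_intros Gc uc) auto
          show "Om \<inter> annulus x0 (a / 2) (4 * a) \<in> sets borel" by (rule annulus_meas(3)[OF op])
          fix x assume x: "x \<in> Om \<inter> annulus x0 (a / 2) (4 * a)"
          define D0 where "D0 = (dist x0 x)^2"
          have D0: "0 \<le> D0" "D0 \<le> 4 * a" using x by (auto simp: D0_def)
          have "(dist x0 x)^2 < r^2" using D0 a' unfolding D0_def by linarith
          then have "dist x0 x < r" using r(1) by (meson less_imp_le power_less_imp_less_base)
          then have rr: "\<bar>u x\<bar> \<le> cv * dist x0 x ^ (l + 1)" "norm (G x) \<le> cv * dist x0 x ^ l" using r(2)[of x] x by auto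
          have pw: "(dist x0 x ^ k)^2 \<le> (4 * a)^k" for k
            using power_mono[OF D0(2,1), of k] by (simp add: D0_def power_mult[symmetric] mult.commute)
          have "G x \<bullet> G x = (norm (G x))^2" by (simp add: dot_square_norm)
          also have "... \<le> (cv * dist x0 x ^ l)^2" by (rule power_mono[OF rr(2) norm_ge_zero])
          also have "... \<le> cv^2 * (4 * a)^l" unfolding power_mult_distrib[of cv] by (intro mult_left_mono pw) auto
          finally have g: "G x \<bullet> G x \<le> cv^2 * (4 * a)^l" .
          have "(u x)^2 = \<bar>u x\<bar>^2" by simp
          also have "... \<le> (cv * dist x0 x ^ (l + 1))^2" by (rule power_mono[OF rr(1) abs_ge_zero])
          also have "... \<le> cv^2 * (4 * a)^(l + 1)" unfolding power_mult_distrib[of cv] by (intro mult_left_mono pw) auto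
          finally have "(u x)^2 / a \<le> cv^2 * (4 * a)^(l + 1) / a" using a by (intro divide_right_mono) auto
          also have "... = 4 * (cv^2 * (4 * a)^l)" using a by simp
          finally have "G x \<bullet> G x + (u x)^2 / a \<le> 5 * (cv^2 * (4 * a)^l)" using g by linarith
          then show "G x \<bullet> G x + (u x)\<^sup>2 / a \<le> 5 * cv^2 * 4 ^ l * a ^ l" by (simp add: power_mult_distrib mult_ac)
        qed (use op a in auto)
        also have "... = 5 * cv^2 * 4 ^ l * a ^ l * I1" unfolding I1_def set_integral_mult_right[symmetric] by simp
        finally have I: "(LINT x:Om \<inter> annulus x0 (a / 2) (4 * a)|lborel. G x \<bullet> G x + (u x)\<^sup>2 / a)
          \<le> 5 * cv^2 * 4 ^ l * a ^ l * I1" .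
        have "LHS \<le> C1 * exp (2 * tau * wt a) * (LINT x:Om \<inter> annulus x0 (a / 2) (4 * a)|lborel. G x \<bullet> G x + (u x)\<^sup>2 / a) + RHS"
          unfolding LHS_def RHS_def P_def C1_def n_def
          by (rule annulus_estimate[OF h(1) gc MR(2) K h(2)]) (use True h(3) a a' th b in \<open>auto simp: T0_def n_def\<close>)
        also have "... \<le> C1 * exp (2 * tau * wt a) * (5 * cv^2 * 4 ^ l * a ^ l * I1) + RHS"
          using C1 I by (intro add_right_mono mult_left_mono) auto
        also have "... = C1 * ((exp (2 * tau * wt a) * a ^ l) * (5 * cv^2 * 4 ^ l * I1)) + RHS" by simp
        also have "... \<le> C1 * ((exp (4 * tau) * sqrt a) * (5 * cv^2 * 4 ^ l * I1)) + RHS"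
          using C1 I1 t1 a a' by (intro add_right_mono mult_left_mono mult_right_mono weight_power_bound) (auto simp: tau_def)
        also have "... = Z * sqrt a + RHS" by (simp add: Z_def)
        finally show ?thesis .
      qed
      \<comment> \<open>\<open>LHS\<close>, \<open>RHS\<close> and \<open>Z\<close> do not depend on
        the inner radius, so \<open>a\<close> may tend to 0.\<close>
      have "LHS \<le> RHS"
      proof (rule tendsto_lowerbound)
        have "((\<lambda>a. Z * sqrt a + RHS) \<longlongrightarrow> Z * sqrt 0 + RHS) (at_right 0)" by (intro tendsto_intros)
        then show "((\<lambda>a. Z * sqrt a + RHS) \<longlongrightarrow> RHS) (at_right 0)" by simp
        show "\<forall>\<^sub>F a in at_right 0. LHS \<le> Z * sqrt a + RHS"
          unfolding eventually_at_right_field using est a0 by blast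
      qed simp
      have "En (cball z s) \<le> P" unfolding P_def
      proof (rule En_mono)
        show "Om \<inter> cball z s \<subseteq> annulus x0 (2 * tht1) (tht2 / 2)"
        proof
          fix x assume x: "x \<in> Om \<inter> cball z s"
          have "d \<le> dist p x0 + dist x0 x + dist x z" using dist_triangle[of p z x0] dist_triangle[of x0 z x] unfolding d_def by linarith
          then have 1: "d / 2 \<le> dist x0 x" using x x0 s by (auto simp: dist_commute)
          have "dist x0 x \<le> dist x0 p + dist p z + dist z x" using dist_triangle[of x0 x p] dist_triangle[of p x z] by linarith
          then have 2: "dist x0 x \<le> 2 * d" using x x0 s d by (auto simp: dist_commute d_def)
          have "(d / 2)^2 \<le> (dist x0 x)^2" by (rule power_mono[OF 1]) (use d in simp)
          moreover have "(dist x0 x)^2 \<le> (2 * d)^2" by (rule power_mono[OF 2]) simp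
          ultimately show "x \<in> annulus x0 (2 * tht1) (tht2 / 2)" using d2 by (simp add: tht1_def power_divide)
        qed
      qed (use annulus_meas(2) in auto)
      then have "exp (- (Co * (1 + sig))) * En UNIV \<le> P" using Co(2)[OF h(1-4)] by linarith
      moreover have "0 < exp (- (Co * (1 + sig))) * En UNIV" using h(4) by simp
      ultimately have P: "exp (- (Co * (1 + sig))) * En UNIV \<le> tau * P" using mult_right_mono[OF t1, of P] by linarith
      have "exp (2 * tau * wt tht2) * (c * (exp (- (Co * (1 + sig))) * En UNIV)) \<le> exp (2 * tau * wt tht2) * (c * (tau * P))"
        using P c by (intro mult_left_mono) auto
      also have "... = LHS" by (simp add: LHS_def c_def mult_ac)
      also have "... \<le> RHS" by fact
      finally have "(exp (2 * tau * wt tht2) * (c * exp (- (Co * (1 + sig))))) * En UNIV \<le> (C1 / b * exp (2 * tau * wt b)) * En UNIV"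
        by (simp add: RHS_def mult.assoc)
      then have "exp (2 * tau * wt tht2) * (c * exp (- (Co * (1 + sig)))) \<le> C1 / b * exp (2 * tau * wt b)"
        by (rule mult_right_le_imp_le) (rule h(4))
      also have "C1 / b = c * B" using c by (simp add: B_def)
      finally have "exp (2 * tau * wt tht2) * exp (- (Co * (1 + sig))) \<le> B * exp (2 * tau * wt b)" using c by (simp add: mult_ac)
      then have "exp (2 * tau * wt tht2) * exp (- (Co * (1 + sig))) * exp (- (2 * tau * wt b)) \<le> B * exp (2 * tau * wt b) * exp (- (2 * tau * wt b))"
        by (rule mult_right_mono) simp
      then have "exp (2 * tau * wt tht2 + - (Co * (1 + sig)) + - (2 * tau * wt b)) \<le> B" by (simp add: mult.assoc mult_exp_exp add.assoc)
      then have "2 * tau * wt tht2 + - (Co * (1 + sig)) + - (2 * tau * wt b) \<le> B"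
        using exp_ge_add_one_self[of "2 * tau * wt tht2 + - (Co * (1 + sig)) + - (2 * tau * wt b)"] by linarith
      then have "tau * (2 * gam) \<le> Co * (1 + sig) + B" by (simp add: gam_def algebra_simps)
      also have "... \<le> (Co + B) * (1 + sig)" using B h(2) by (simp add: distrib_right distrib_left)
      finally have "tau \<le> (Co + B) * (1 + sig) / (2 * gam)" using gam by (simp add: pos_le_divide_eq)
      then have "tau \<le> (Co + B) / (2 * gam) * (1 + sig)" by simp
      moreover have "T0 * (1 + sig) \<ge> 0" using T0 h(2) by simp
      ultimately show ?thesis using h(2) unfolding ex tau_def by linarith
    qed
  qed
  then show ?thesis using d CC by (intro exI[of _ "d / 4"] conjI exI[of _ CC]) auto
qed

text \<open>Compactness of the frontier makes the local constants uniform.\<close>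

theorem vanishing_bound:
  "\<exists>C>0. \<forall>u G sig x0 l. boundary_zero u G sig x0 l \<longrightarrow> real l \<le> C * (1 + sig)"
proof -
  obtain e C where eC: "\<And>p. p \<in> frontier Om ==> e p > 0 \<and> C p > 0 \<and>
     (\<forall>u G sig x0 l. x0 \<in> ball p (e p) \<longrightarrow> boundary_zero u G sig x0 l \<longrightarrow> real l \<le> C p * (1 + sig))"
    using local_vanishing_bound by metis
  have cf: "compact (frontier Om)" using bd by (simp add: compact_frontier_bounded)
  obtain F where F: "F \<subseteq> frontier Om" "finite F" "frontier Om \<subseteq> (\<Union>p\<in>F. ball p (e p))"
  proof (rule compactE_image[OF cf, of "frontier Om" "\<lambda>p. ball p (e p)"])
    show "frontier Om \<subseteq> (\<Union>p\<in>frontier Om. ball p (e p))" using eC by (meson UN_I centre_in_ball subsetI)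
  qed auto
  define Z where "Z = 1 + (\<Sum>p\<in>F. C p)"
  have Cp: "C p \<ge> 0" if "p \<in> F" for p using eC[of p] F(1) that by (meson less_imp_le subsetD)
  have "real l \<le> Z * (1 + sig)" if bz: "boundary_zero u G sig x0 l" for u G sig x0 l
  proof -
    have x0: "x0 \<in> frontier Om" "sig \<ge> 0" using bz by (auto simp: boundary_zero_def)
    then obtain p where p: "p \<in> F" "x0 \<in> ball p (e p)" using F(3) by blast
    have "real l \<le> C p * (1 + sig)" using eC[of p] p F(1) bz by blast
    also have "C p \<le> (\<Sum>p\<in>F. C p)" by (rule member_le_sum) (use p F Cp in auto)
    then have "C p * (1 + sig) \<le> Z * (1 + sig)" using x0 by (intro mult_right_mono) (auto simp: Z_def)
    finally show ?thesis .
  qed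
  moreover have "Z > 0" using sum_nonneg[of F C] Cp by (simp add: Z_def add_pos_nonneg)
  ultimately show ?thesis by blast
qed

end

section \<open>A lower bound for the eigenvalues\<close>

text \<open>Chosen because \<open>gr (bump 4) x = (- 8 * bump 3 x) *\<^sub>R x\<close>: a mean value
  with weight \<open>bump 3\<close> can be differentiated in the radius and integrated by parts
  against \<open>bump 4\<close>, all within volume integrals.\<close>

definition bump :: "nat \<Rightarrow> 'a::euclidean_space \<Rightarrow> real" where "bump k x = (max 0 (1 - x \<bullet> x)) ^ k"

lemma bump_props: "0 \<le> bump k x" "bump k x \<le> 1" "norm x \<ge> 1 ==> k > 0 ==> bump k x = 0" "norm x < 1 ==> bump k x > 0"
  "continuous_on S (bump k)"
proof -
  show "0 \<le> bump k x" "bump k x \<le> 1" by (auto simp: bump_def intro!: power_le_one)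
  show "bump k x = 0" if "norm x \<ge> 1" "k > 0"
  proof -
    have "1 - x \<bullet> x \<le> 0" using that(1) power_mono[of 1 "norm x" 2] by (simp add: dot_square_norm)
    then show ?thesis using that(2) by (simp add: bump_def max_absorb1)
  qed
  show "bump k x > 0" if "norm x < 1"
    using that power_strict_mono[of "norm x" 1 2] by (simp add: bump_def dot_square_norm)
  show "continuous_on S (bump k)" unfolding bump_def[abs_def] by (intro continuous_intros)
qed

lemma bump4_deriv: "(bump 4 has_derivative (\<lambda>h. ((- 8 * bump 3 x) *\<^sub>R x) \<bullet> h)) (at x)"
proof -
  have "((\<lambda>x. 1 - x \<bullet> x) has_derivative (\<lambda>h. - (2 *\<^sub>R x) \<bullet> h)) (at x)"
    by (rule has_derivative_eq_rhs[OF has_derivative_diff[OF has_derivative_const has_derivative_inner[OF has_derivative_ident has_derivative_ident]]])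
       (auto simp: inner_commute fun_eq_iff)
  from DERIV_compose_FDERIV[OF DERIV_power[OF pos2_deriv, of 2] this]
  have "((\<lambda>x. (pos2 (1 - x \<bullet> x))^2) has_derivative (\<lambda>h. ((- 8 * bump 3 x) *\<^sub>R x) \<bullet> h)) (at x)"
    by (rule has_derivative_eq_rhs) (auto simp: fun_eq_iff bump_def pos2_def power2_eq_square power3_eq_cube)
  then show ?thesis by (simp add: bump_def[abs_def] pos2_def)
qed

lemma ck_bump:
  assumes "k < m" shows "ck k S (bump m :: 'a::euclidean_space \<Rightarrow> real)"
proof -
  define H where "H i s = (\<Prod>j<i. real m - real j) * (max 0 s) ^ (m - i)" for i and s :: real
  have u: "ck k UNIV (\<lambda>x::'a. 1 - x \<bullet> x)" by (intro ck_diff' ck_inner ck_ident) auto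
  have d: "((\<lambda>s::real. (max 0 s) ^ Suc (Suc n)) has_real_derivative (real n + 2) * (max 0 s) ^ Suc n) (at s)" for n s
  proof -
    have p: "(\<lambda>s::real. (max 0 s) ^ Suc (Suc n)) = (\<lambda>s. s ^ n * pos2 s)"
      by (auto simp: fun_eq_iff pos2_def max_def power2_eq_square)
    show ?thesis unfolding p
      by (rule DERIV_cong[OF DERIV_mult[OF DERIV_power[OF DERIV_ident] pos2_deriv]])
        (cases n; auto simp: pos2_def max_def power2_eq_square algebra_simps)
  qed
  have "ck k UNIV (\<lambda>x::'a. H 0 (1 - x \<bullet> x))"
  proof (rule ck_compose_real[OF open_UNIV _ _ u])
    show "(H i has_real_derivative H (Suc i) s) (at s)" if "i < k" for i s
    proof -
      have "m - i = Suc (Suc (m - i - 2))" using that assms by linarith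
      then obtain j where j: "m - i = Suc (Suc j)" by blast
      then have "m - Suc i = Suc j" "real m - real i = real j + 2" by (simp, linarith)
      then show ?thesis unfolding H_def[abs_def] using DERIV_cmult[OF d[of j s], of "\<Prod>j<i. real m - real j"]
        by (simp only: j prod.lessThan_Suc mult.assoc)
    qed
    show "continuous_on UNIV (H k)" unfolding H_def[abs_def] by (intro continuous_intros)
  qed auto
  then have "ck k UNIV (bump m :: 'a \<Rightarrow> real)" by (simp add: H_def bump_def[abs_def])
  then show ?thesis by (rule ck_subset) auto
qed

lemma norm_unit_cube: "x \<in> cbox (-One) (One::'a::euclidean_space) ==> norm x \<le> real DIM('a)"
proof -
  assume x: "x \<in> cbox (-One) One"
  have "norm x \<le> (\<Sum>b\<in>Basis. \<bar>x \<bullet> b\<bar>)" by (rule norm_le_l1)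
  also have "... \<le> (\<Sum>b\<in>(Basis::'a set). 1)" using x by (intro sum_mono) (auto simp: mem_box abs_le_iff)
  finally show ?thesis by simp
qed

abbreviation bump_mass :: "'a::euclidean_space itself \<Rightarrow> real" where
  "bump_mass _ \<equiv> integral (cbox (-One) One) (bump 3 :: 'a \<Rightarrow> real)"

text \<open>The weighted mean increases with the radius \<open>r\<close>: up to the factor 1/8, its
  derivative is the integral of \<open>bump 4\<close> times \<open>r * lap v\<close>, by
  \<open>integral_dv_zero\<close> for the field \<open>F\<close>. The integrals run over a cube, on
  which differentiation under the integral sign is available; the weight confines them to the unit
  ball. The cube has norm at most \<open>real DIM('a)\<close>.\<close>

lemma mean_value_inequality:
  fixes v :: "'a::euclidean_space \<Rightarrow> real"
  assumes W: "open W" and v: "ck 2 W v" and h: "\<And>x. x \<in> W ==> 0 \<le> lap v x"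
    and R: "R > 0" "cball z (R * real DIM('a)) \<subseteq> W"
  shows "v z * bump_mass TYPE('a) \<le> integral (cbox (-One) One) (\<lambda>x. v (z + R *\<^sub>R x) * bump 3 x)"
proof -
  define cb where "cb = cbox (-One) (One::'a)"
  have cbc: "compact cb" by (simp add: cb_def)
  have inW: "z + r *\<^sub>R x \<in> W" if "r \<in> {0..R}" "x \<in> cb" for r x
  proof -
    have "norm (r *\<^sub>R x) \<le> R * real DIM('a)" using that norm_unit_cube[of x] R unfolding norm_scaleR cb_def by (intro mult_mono) auto
    then show ?thesis using R(2) by (auto simp: subset_eq dist_norm)
  qed
  have ball1: "norm x \<le> 1 ==> x \<in> cb" for x
    unfolding cb_def mem_box using Basis_le_norm[of _ x] by (force simp: abs_le_iff)
  have v1: "ck 1 W v" "ck 1 W (gr v)" using ck_mono[OF v, of 1] ck_gr[OF W, of 1 v] v by (simp_all add: numeral_2_eq_2)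
  have vc: "continuous_on W v" "continuous_on W (gr v)" by (rule ck_cont[OF v1(1)], rule ck_cont[OF v1(2)])
  define f where "f r x = v (z + r *\<^sub>R x) * bump 3 x" for r x
  define f' where "f' r x = (gr v (z + r *\<^sub>R x) \<bullet> x) * bump 3 x" for r x
  define I where "I r = integral cb (f r)" for r
  have contf: "continuous_on cb (f r)" if "r \<in> {0..R}" for r
    unfolding f_def by (intro continuous_intros bump_props continuous_on_compose2[OF vc(1)]) (use inW that in auto)
  have contf': "continuous_on cb (f' r)" if "r \<in> {0..R}" for r
    unfolding f'_def by (intro continuous_intros bump_props continuous_on_compose2[OF vc(2)]) (use inW that in auto)
  have D: "(I has_field_derivative integral cb (f' r)) (at r within {0..R})" if r: "r \<in> {0..R}" for r
    unfolding I_def[abs_def] cb_def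
  proof (rule leibniz_rule_field_derivative[where U="{0..R}"])
    show "((\<lambda>r. f r x) has_field_derivative f' r x) (at r within {0..R})" if "r \<in> {0..R}" "x \<in> cbox (-One) One" for r x
    proof -
      have W: "z + r *\<^sub>R x \<in> W" using inW that by (simp add: cb_def)
      have 1: "((\<lambda>r. z + r *\<^sub>R x) has_derivative (\<lambda>t. t *\<^sub>R x)) (at r within {0..R})" by (auto intro!: derivative_eq_intros)
      have "((\<lambda>r. v (z + r *\<^sub>R x)) has_derivative (\<lambda>t. gr v (z + r *\<^sub>R x) \<bullet> (t *\<^sub>R x))) (at r within {0..R})"
        by (rule has_derivative_compose[OF 1 gr_deriv]) (use v1(1) W in auto)
      then have "((\<lambda>r. v (z + r *\<^sub>R x)) has_field_derivative (gr v (z + r *\<^sub>R x) \<bullet> x)) (at r within {0..R})"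
        unfolding has_field_derivative_def by (rule has_derivative_eq_rhs) (auto simp: fun_eq_iff)
      then show ?thesis unfolding f_def f'_def by (rule DERIV_cmult_right)
    qed
    show "f r integrable_on cbox (-One) One" if "r \<in> {0..R}" for r
      using contf[OF that] integrable_continuous unfolding cb_def by blast
    show "continuous_on ({0..R} \<times> cbox (-One) One) (\<lambda>(r, x). f' r x)"
      unfolding f'_def split_beta
    proof (intro continuous_intros continuous_on_compose2[OF vc(2)] continuous_on_compose2[OF bump_props(5)[of UNIV 3]])
      show "(\<lambda>x. z + fst x *\<^sub>R snd x) ` ({0..R} \<times> cbox (-One) One) \<subseteq> W" using inW by (auto simp: cb_def)
    qed auto
  qed (use r in auto)
  have Z: "0 \<le> integral cb (f' r)" if r: "r \<in> {0..R}" for r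
  proof -
    define S where "S = {x. z + r *\<^sub>R x \<in> W}"
    have "open ((\<lambda>x. z + r *\<^sub>R x) -` W)" by (intro open_vimage W continuous_intros)
    then have S: "open S" by (simp add: S_def vimage_def)
    have phi: "ck k S (\<lambda>x. z + r *\<^sub>R x)" for k by (intro ck_add ck_scaleR ck_ident ck_const S)
    have gS: "ck 1 S (\<lambda>x. gr v (z + r *\<^sub>R x))" by (rule ck_compose[OF S W v1(2) phi]) (auto simp: S_def)
    define F where "F x = bump 4 x *\<^sub>R gr v (z + r *\<^sub>R x)" for x
    have F1: "ck 1 S F" unfolding F_def[abs_def] by (intro ck_scaleR S gS ck_bump) simp
    have dF: "- 8 * f' r x \<le> dv F x" if x: "x \<in> S" for x
    proof -
      have W: "z + r *\<^sub>R x \<in> W" using x by (simp add: S_def)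
      have d: "(gr v has_derivative fd (gr v) (z + r *\<^sub>R x)) (at (z + r *\<^sub>R x))" using ck_diff[of 0 W "gr v"] v1(2) W by simp
      have 1: "((\<lambda>x. z + r *\<^sub>R x) has_derivative (\<lambda>h. r *\<^sub>R h)) (at x)" by (auto intro!: derivative_eq_intros)
      have "((\<lambda>x. gr v (z + r *\<^sub>R x)) has_derivative (\<lambda>h. fd (gr v) (z + r *\<^sub>R x) (r *\<^sub>R h))) (at x)"
        by (rule has_derivative_compose[OF 1 d])
      from dv_eqI[OF this] have "dv (\<lambda>x. gr v (z + r *\<^sub>R x)) x = (\<Sum>b\<in>Basis. fd (gr v) (z + r *\<^sub>R x) (r *\<^sub>R b) \<bullet> b)" .
      also have "... = (\<Sum>b\<in>Basis. r * (fd (gr v) (z + r *\<^sub>R x) b \<bullet> b))"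
      proof -
        have "linear (fd (gr v) (z + r *\<^sub>R x))" using fd_linear d differentiable_def by blast
        then show ?thesis by (simp add: linear_scale)
      qed
      also have "... = r * lap v (z + r *\<^sub>R x)" by (simp add: dv_def sum_distrib_left)
      finally have dd: "0 \<le> dv (\<lambda>x. gr v (z + r *\<^sub>R x)) x" using h[OF W] r by simp
      have "dv F x = gr (bump 4) x \<bullet> gr v (z + r *\<^sub>R x) + bump 4 x * dv (\<lambda>x. gr v (z + r *\<^sub>R x)) x"
        unfolding F_def[abs_def] by (rule dv_scaleR) (use gS ck_bump[of 1 4 UNIV] x in auto)
      then show ?thesis using mult_nonneg_nonneg[OF bump_props(1) dd, of 4] unfolding gr_eqI[OF bump4_deriv]
        by (simp add: f'_def inner_commute)
    qed
    have sub: "cball 0 1 \<subseteq> S" "cb \<subseteq> S" using inW[OF r] ball1 by (auto simp: S_def)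
    have I: "set_integrable lborel S (dv F)" "(LINT x:S|lborel. dv F x) = 0"
      by (rule integral_dv_zero[OF S F1, of "cball 0 1"]; use sub in \<open>auto simp: F_def bump_props\<close>)+
    have Fi: "set_integrable lborel cb (f' r)" unfolding set_integrable_def
      by (rule borel_integrable_compact[OF cbc contf'[OF r]])
    have "- 8 * (LINT x:cb|lborel. f' r x) = (LINT x:cb|lborel. - 8 * f' r x)" by (rule set_integral_mult_right[symmetric])
    also have "... \<le> (LINT x:S|lborel. dv F x)" unfolding set_lebesgue_integral_def
    proof (rule integral_mono)
      show "integrable lborel (\<lambda>x. indicat_real cb x *\<^sub>R (- 8 * f' r x))"
        using set_integrable_mult_right[of "- 8", OF Fi] by (simp add: set_integrable_def)
      show "integrable lborel (\<lambda>x. indicat_real S x *\<^sub>R dv F x)" using I(1) by (simp add: set_integrable_def)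
      fix x show "indicat_real cb x *\<^sub>R (- 8 * f' r x) \<le> indicat_real S x *\<^sub>R dv F x"
      proof (cases "x \<in> cb")
        case True then show ?thesis using sub dF by auto
      next
        case False
        then have "norm x \<ge> 1" using ball1[of x] by force
        then have "f' r x = 0" by (simp add: f'_def bump_props)
        then show ?thesis using False dF[of x] by (auto simp: indicator_def)
      qed
    qed
    finally show ?thesis using I(2) set_borel_integral_eq_integral(2)[OF Fi] by simp
  qed
  have "I 0 \<le> I R"
  proof (rule DERIV_nonneg_imp_increasing_open[of 0 R I])
    show "\<exists>y. (I has_real_derivative y) (at r) \<and> 0 \<le> y" if "0 < r" "r < R" for r
      using D[of r] Z[of r] that at_within_Icc_at[of 0 r R] by auto
    show "continuous_on {0..R} I" by (rule DERIV_continuous_on[OF D])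
  qed (use R in simp)
  then show ?thesis by (simp add: I_def f_def[abs_def] cb_def)
qed

lemma lap_alt:
  fixes u :: "'a::euclidean_space \<Rightarrow> real"
  assumes "open S" "ck 2 S u" "x \<in> S"
  shows "lap u x = (\<Sum>c\<in>Basis. fd (\<lambda>y. fd u y c) x c)"
proof -
  have S2: "ck (Suc (Suc 0)) S u" using assms(2) by (simp add: numeral_2_eq_2)
  have g: "ck (Suc 0) S (gr u)" by (rule ck_gr[OF assms(1) S2])
  have "fd (gr u) x c \<bullet> c = fd (\<lambda>y. fd u y c) x c" for c
  proof -
    have "(gr u has_derivative fd (gr u) x) (at x)" by (rule ck_diff[OF g assms(3)])
    then have "((\<lambda>y. gr u y \<bullet> c) has_derivative (\<lambda>h. fd (gr u) x h \<bullet> c)) (at x)" by (intro derivative_eq_intros) auto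
    then have "fd (\<lambda>y. gr u y \<bullet> c) x c = fd (gr u) x c \<bullet> c" by (simp add: fd_eqI)
    moreover have "fd (\<lambda>y. gr u y \<bullet> c) x = fd (\<lambda>y. fd u y c) x"
      by (rule fd_cong_open[OF assms(1,3)]) (use S2 gr_inner[of u] in auto)
    ultimately show ?thesis by simp
  qed
  then show ?thesis by (simp add: dv_def)
qed

lemma lap_fd:
  fixes u :: "'a::euclidean_space \<Rightarrow> real"
  assumes S: "open S" "ck 3 S u" "x \<in> S" and h: "\<And>x. x \<in> S ==> lap u x = 0" and b: "b \<in> Basis"
  shows "lap (\<lambda>y. fd u y b) x = 0"
proof -
  have u3: "ck (Suc (Suc (Suc 0))) S u" using S(2) by (simp only: numeral_3_eq_3)
  then have u2: "ck 2 S u" using ck_Suc_imp by (simp only: numeral_2_eq_2)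
  have c2: "ck 2 S (\<lambda>y. fd u y c)" if "c \<in> Basis" for c using u3 that by (simp add: numeral_2_eq_2)
  have d1: "(\<lambda>y. fd (\<lambda>z. fd u z c) y c') differentiable (at x)" if "c \<in> Basis" "c' \<in> Basis" for c c'
    using u3 that S(3) by auto
  have "lap (\<lambda>y. fd u y b) x = (\<Sum>c\<in>Basis. fd (\<lambda>y. fd (\<lambda>z. fd u z b) y c) x c)" by (rule lap_alt[OF S(1) c2[OF b] S(3)])
  also have "... = (\<Sum>c\<in>Basis. fd (\<lambda>y. fd (\<lambda>z. fd u z c) y c) x b)"
  proof (rule sum.cong[OF refl])
    fix c :: 'a assume c: "c \<in> Basis"
    have "fd (\<lambda>y. fd (\<lambda>z. fd u z b) y c) x = fd (\<lambda>y. fd (\<lambda>z. fd u z c) y b) x"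
      by (rule fd_cong_open[OF S(1,3)]) (rule fd_commute[OF S(1) u2])
    then show "fd (\<lambda>y. fd (\<lambda>z. fd u z b) y c) x c = fd (\<lambda>y. fd (\<lambda>z. fd u z c) y c) x b"
      using fd_commute[OF S(1) c2[OF c] S(3), of b c] by simp
  qed
  also have "... = fd (\<lambda>y. \<Sum>c\<in>Basis. fd (\<lambda>z. fd u z c) y c) x b"
  proof -
    have "((\<lambda>y. \<Sum>c\<in>Basis. fd (\<lambda>z. fd u z c) y c) has_derivative (\<lambda>h. \<Sum>c\<in>Basis. fd (\<lambda>y. fd (\<lambda>z. fd u z c) y c) x h)) (at x)"
      by (intro has_derivative_sum differentiable_fd d1)
    then show ?thesis by (simp add: fd_eqI)
  qed
  also have "fd (\<lambda>y. \<Sum>c\<in>Basis. fd (\<lambda>z. fd u z c) y c) x = fd (\<lambda>_. 0) x"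
    by (rule fd_cong_open[OF S(1,3)]) (use lap_alt[OF S(1) u2] h in simp)
  finally show ?thesis by (simp add: fd_eqI)
qed


lemma bump_mass_pos: "0 < bump_mass TYPE('a::euclidean_space)"
proof -
  have "bump_mass TYPE('a) \<noteq> 0"
  proof
    assume z: "bump_mass TYPE('a) = 0"
    have "\<forall>x\<in>cbox (-One) (One::'a). bump 3 x = 0"
      by (rule integral_cbox_eq_0_iff[THEN iffD1, OF _ _ _ z]) (auto simp: bump_props mem_box content_pos_lt_eq box_ne_empty)
    moreover have "(0::'a) \<in> cbox (-One) One" by (simp add: mem_box)
    ultimately show False using bump_props(4)[of "0::'a" 3] by force
  qed
  moreover have "bump_mass TYPE('a) \<ge> 0"
    by (rule integral_nonneg) (auto intro!: integrable_continuous bump_props)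
  ultimately show ?thesis by linarith
qed

context harmonic_data begin

text \<open>The square of a harmonic function is subharmonic, so the mean value inequality applies
  to it; an affine substitution then returns to \<open>Om\<close>. The continuous version
  \<open>w\<close> on the closure provides integrability.\<close>

lemma sup_bound:
  assumes v: "ck 2 Om v" "\<And>x. x \<in> Om ==> lap v x = 0" and w: "continuous_on (closure Om) w" "\<And>x. x \<in> Om ==> v x = w x"
    and R: "R > 0" "cball z (R * real DIM('a)) \<subseteq> Om"
  shows "(v z)^2 * (bump_mass TYPE('a) * R ^ DIM('a)) \<le> (LINT x:Om|lborel. (w x)^2)"
proof -
  define cb where "cb = cbox (-One) (One::'a)"
  have inO: "z + R *\<^sub>R x \<in> Om" if "x \<in> cb" for x
  proof -
    have "norm (R *\<^sub>R x) \<le> R * real DIM('a)" using that norm_unit_cube[of x] R unfolding norm_scaleR cb_def by (intro mult_mono) auto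
    then show ?thesis using R(2) by (auto simp: subset_eq dist_norm)
  qed
  have vc: "continuous_on Om v" by (rule ck_cont[OF v(1)])
  have vz: "continuous_on cb (\<lambda>x. v (z + R *\<^sub>R x))"
    by (rule continuous_on_compose2[OF vc]) (use inO in \<open>auto intro!: continuous_intros\<close>)
  have int: "f integrable_on cb" if "continuous_on cb f" for f :: "'a \<Rightarrow> real"
    using that integrable_continuous unfolding cb_def by blast
  have "(v z)^2 * bump_mass TYPE('a) \<le> integral cb (\<lambda>x. (v (z + R *\<^sub>R x))^2 * bump 3 x)"
    unfolding cb_def power2_eq_square
  proof (rule mean_value_inequality[OF op _ _ R])
    show "ck 2 Om (\<lambda>x. v x * v x)" by (intro ck_mult op v)
    show "0 \<le> lap (\<lambda>x. v x * v x) x" if "x \<in> Om" for x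
      using lap_mult[OF op v(1) v(1) that] v(2)[OF that] by simp
  qed
  also have "... \<le> integral cb (\<lambda>x. (v (z + R *\<^sub>R x))^2)"
    by (rule integral_le) (auto intro!: int continuous_intros vz bump_props mult_left_le)
  also have "... = (LINT x:cb|lborel. (v (z + R *\<^sub>R x))^2)"
    by (rule set_borel_integral_eq_integral(2)[symmetric], unfold set_integrable_def, rule borel_integrable_compact)
       (auto simp: cb_def intro!: continuous_intros vz[unfolded cb_def])
  finally have 1: "(v z)^2 * bump_mass TYPE('a) \<le> (LINT x:cb|lborel. (v (z + R *\<^sub>R x))^2)" .
  define f where "f y = indicat_real Om y *\<^sub>R (w y)^2" for y
  have fi: "integrable lborel f"
    using si_closure[of "\<lambda>x. (w x)^2" Om] op unfolding f_def[abs_def] set_integrable_def by (auto intro: continuous_intros w(1))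
  then have fm: "f \<in> borel_measurable borel" by auto
  have "(LINT x:cb|lborel. (v (z + R *\<^sub>R x))^2) \<le> integral\<^sup>L lborel (\<lambda>x. f (z + R *\<^sub>R x))"
    unfolding set_lebesgue_integral_def
  proof (rule integral_mono[OF _ lborel_integral_affine(2)[OF fm R(1) fi]])
    show "integrable lborel (\<lambda>x. indicat_real cb x *\<^sub>R (v (z + R *\<^sub>R x))^2)"
      by (rule borel_integrable_compact) (auto simp: cb_def intro!: continuous_intros vz[unfolded cb_def])
  qed (use inO w(2) in \<open>auto simp: f_def indicator_def\<close>)
  with 1 have "(v z)^2 * bump_mass TYPE('a) \<le> integral\<^sup>L lborel (\<lambda>x. f (z + R *\<^sub>R x))" by linarith
  then have "R ^ DIM('a) * ((v z)^2 * bump_mass TYPE('a)) \<le> integral\<^sup>L lborel f"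
    unfolding lborel_integral_affine(1)[OF fm R(1), of z] using R by (intro mult_left_mono) auto
  then show ?thesis by (simp add: f_def[abs_def] set_lebesgue_integral_def mult_ac)
qed

definition "Dir = (LINT x:Om|lborel. G x \<bullet> G x)"

text \<open>Each partial derivative is harmonic, so \<open>sup_bound\<close> applies to it, and the
  components are added.\<close>

lemma gradient_bound:
  assumes u3: "ck 3 Om u" and R: "R > 0" "cball z (R * real DIM('a)) \<subseteq> Om"
  shows "G z \<bullet> G z \<le> real DIM('a) / (bump_mass TYPE('a) * R ^ DIM('a)) * Dir"
proof -
  define k where "k = bump_mass TYPE('a) * R ^ DIM('a)"
  have k: "k > 0" using bump_mass_pos[where 'a='a] R by (simp add: k_def)
  have z: "z \<in> Om" using R by (auto simp: subset_eq)
  have ub: "u differentiable (at x)" if "x \<in> Om" for x using ck_mono[OF u2, of 1] that by simp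
  have "(G z \<bullet> b)^2 \<le> Dir / k" if b: "b \<in> Basis" for b
  proof -
    have fG: "fd u x b = G x \<bullet> b" if "x \<in> Om" for x using gr_inner[OF ub[OF that], of b] GG[OF that] by simp
    have c2: "ck 2 Om (\<lambda>y. fd u y b)" using u3 b by (simp add: numeral_3_eq_3 numeral_2_eq_2)
    have "(fd u z b)^2 * k \<le> (LINT x:Om|lborel. (G x \<bullet> b)^2)" unfolding k_def
      by (rule sup_bound[OF c2 lap_fd[OF op u3 _ harm b] _ fG R]) (auto intro!: continuous_intros Gc)
    then have "(fd u z b)^2 \<le> (LINT x:Om|lborel. (G x \<bullet> b)^2) / k" using k by (simp add: pos_le_divide_eq)
    also have "... \<le> Dir / k" unfolding Dir_def
    proof (rule divide_right_mono[OF set_integral_mono_closure])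
      show "(G x \<bullet> b)^2 \<le> G x \<bullet> G x" for x
      proof -
        have "\<bar>G x \<bullet> b\<bar>^2 \<le> (norm (G x))^2" by (rule power_mono[OF Basis_le_norm[OF b] abs_ge_zero])
        then show ?thesis by (simp add: dot_square_norm)
      qed
      show "continuous_on (closure Om) (\<lambda>x. (G x \<bullet> b)^2)" "continuous_on (closure Om) (\<lambda>x. G x \<bullet> G x)"
        by (intro continuous_intros Gc)+
    qed (use op k in auto)
    finally show ?thesis unfolding fG[OF z] .
  qed
  then have "(\<Sum>b\<in>Basis. (G z \<bullet> b)^2) \<le> (\<Sum>b\<in>(Basis::'a set). Dir / k)" by (rule sum_mono)
  moreover have "G z \<bullet> G z = (\<Sum>b\<in>Basis. (G z \<bullet> b)^2)" unfolding power2_eq_square by (rule euclidean_inner)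
  ultimately have "G z \<bullet> G z \<le> real DIM('a) * (Dir / k)" by simp
  then show ?thesis by (simp add: k_def)
qed

end

context defined_domain begin

abbreviation "dirichlet \<equiv> harmonic_data.Dir Om"

lemma oscillation:
  assumes B: "ball y R \<subseteq> Om" "R > 0"
  shows "\<exists>C\<ge>0. \<forall>u G. data u G \<longrightarrow> ck 3 Om u \<longrightarrow>
     (\<forall>x\<in>cball y (R / 7). (u x - u y)^2 \<le> C * dirichlet G)"
proof -
  define n where "n = real DIM('a)"
  have n: "n \<ge> 1" unfolding n_def by (simp add: Suc_leI)
  \<comment> \<open>Balls of radius \<open>r * n = R / 2\<close> about points of
    \<open>cball y (R / 7)\<close> stay inside \<open>ball y R\<close>.\<close>
  define r where "r = R / (2 * n)"
  have r: "r > 0" "r * n = R / 2" using B n by (auto simp: r_def)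
  define k where "k = n / (bump_mass TYPE('a) * r ^ DIM('a))"
  have k: "k \<ge> 0" using bump_mass_pos[where 'a='a] r n by (simp add: k_def)
  have "(u x - u y)^2 \<le> k * (R / 7)^2 * dirichlet G"
    if h: "data u G" "ck 3 Om u" and x: "x \<in> cball y (R / 7)" for u G x
  proof -
    interpret harmonic_data Om D rho u G by (rule h)
    have D0: "Dir \<ge> 0" unfolding Dir_def set_lebesgue_integral_def by (rule Bochner_Integration.integral_nonneg) simp
    define L where "L = sqrt (k * Dir)"
    have g: "norm (gr u w) \<le> L" if w: "w \<in> cball y (R / 7)" for w
    proof -
      have "cball w (r * n) \<subseteq> ball y R"
      proof
        fix v assume "v \<in> cball w (r * n)"
        then show "v \<in> ball y R" using w r B(2) dist_triangle[of y v w] by auto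
      qed
      then have "cball w (r * real DIM('a)) \<subseteq> Om" using B by (auto simp: n_def)
      from gradient_bound[OF h(2) r(1) this] have "G w \<bullet> G w \<le> k * Dir" by (simp add: k_def n_def)
      then have "(norm (G w))^2 \<le> k * Dir" by (simp add: dot_square_norm)
      then have "norm (G w) \<le> L" unfolding L_def by (rule real_le_rsqrt)
      moreover have "w \<in> Om" using w B by (auto simp: subset_eq)
      ultimately show ?thesis using GG by simp
    qed
    have "cball y (R / 7) \<subseteq> Om" using B by (auto simp: subset_eq)
    from mvt_ball[OF op ck_mono[OF u2, of 1] this x, of L] g x
    have "\<bar>u x - u y\<bar> \<le> L * dist y x" by (auto simp: subset_eq)
    also have "... \<le> L * (R / 7)" using x k D0 by (intro mult_left_mono) (auto simp: L_def)
    finally have "\<bar>u x - u y\<bar>^2 \<le> (L * (R / 7))^2" by (rule power_mono) simp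
    also have "... = L^2 * (R / 7)^2" by (rule power_mult_distrib)
    also have "L^2 = k * Dir" using k D0 by (simp add: L_def)
    finally show ?thesis by (simp add: mult_ac)
  qed
  then show ?thesis using k by (intro exI[of _ "k * (R / 7)^2"]) auto
qed

text \<open>A pointwise substitute for the Poincare inequality, with a reference point common to all
  harmonic functions. Oscillations add up along chains of balls, which is what
  \<open>chain_of_balls\<close> organises.\<close>

lemma interior_oscillation:
  "\<exists>z0\<in>Om. \<forall>T. compact T \<longrightarrow> T \<subseteq> Om \<longrightarrow> (\<exists>C\<ge>0. \<forall>u G. data u G \<longrightarrow> ck 3 Om u \<longrightarrow>
     (\<forall>x\<in>T. (u x - u z0)^2 \<le> C * dirichlet G))"
proof -
  have D0: "dirichlet G \<ge> 0" if "data u G" for u G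
    unfolding harmonic_data.Dir_def[OF that] set_lebesgue_integral_def by (rule Bochner_Integration.integral_nonneg) simp
  obtain z0 where z0: "z0 \<in> Om" using ne by auto
  then obtain R where R: "R > 0" "ball z0 R \<subseteq> Om" using op open_contains_ball by blast
  define Q where "Q T \<longleftrightarrow> (\<exists>C\<ge>0. \<forall>u G. data u G \<longrightarrow> ck 3 Om u \<longrightarrow>
     (\<forall>x\<in>T. (u x - u z0)^2 \<le> C * dirichlet G))" for T
  have "Q T" if T: "compact T" "T \<subseteq> Om" for T
  proof (rule chain_of_balls[OF _ _ T, where Q=Q])
    show "cball z0 (R / 7) \<subseteq> Om" "R / 7 > 0" using R by (auto simp: subset_eq)
    show "Q (cball z0 (R / 7))" unfolding Q_def by (rule oscillation[OF R(2,1)])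
    show "Q {}" unfolding Q_def by (rule exI[of _ 0]) auto
    show "Q V" if "Q T" "V \<subseteq> T" for T V using that unfolding Q_def by (meson subsetD)
    show "Q (T \<union> V)" if "Q T" "Q V" for T V
    proof -
      obtain C1 where C1: "C1 \<ge> 0" "\<And>u G x. data u G ==> ck 3 Om u ==> x \<in> T ==> (u x - u z0)^2 \<le> C1 * dirichlet G"
        using \<open>Q T\<close> unfolding Q_def by blast
      obtain C2 where C2: "C2 \<ge> 0" "\<And>u G x. data u G ==> ck 3 Om u ==> x \<in> V ==> (u x - u z0)^2 \<le> C2 * dirichlet G"
        using \<open>Q V\<close> unfolding Q_def by blast
      have "(u x - u z0)^2 \<le> (C1 + C2) * dirichlet G"
        if h: "data u G" "ck 3 Om u" "x \<in> T \<union> V" for u G x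
        using C1(1) C2(1) C1(2)[OF h(1,2)] C2(2)[OF h(1,2)] h(3) D0[OF h(1)]
          mult_right_mono[of C1 "C1 + C2" "dirichlet G"] mult_right_mono[of C2 "C1 + C2" "dirichlet G"]
        by fastforce
      then show ?thesis unfolding Q_def using C1(1) C2(1) by (intro exI[of _ "C1 + C2"]) auto
    qed
    show "Q (cball y (R / 7))" if st: "ball y R \<subseteq> Om" "R > 0" "0 < s" "Q (cball y s)" for y R s
    proof -
      obtain C1 where C1: "C1 \<ge> 0" "\<And>u G x. data u G ==> ck 3 Om u ==> x \<in> cball y (R / 7) ==> (u x - u y)^2 \<le> C1 * dirichlet G"
        using oscillation[OF st(1,2)] by blast
      obtain C2 where C2: "C2 \<ge> 0" "\<And>u G x. data u G ==> ck 3 Om u ==> x \<in> cball y s ==> (u x - u z0)^2 \<le> C2 * dirichlet G"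
        using st(4) unfolding Q_def by blast
      have "(u x - u z0)^2 \<le> (2 * C1 + 2 * C2) * dirichlet G"
        if h: "data u G" "ck 3 Om u" "x \<in> cball y (R / 7)" for u G x
      proof -
        have "(u x - u z0)^2 \<le> 2 * (u x - u y)^2 + 2 * (u y - u z0)^2"
          using sum_squares_bound[of "u x - u y" "u y - u z0"] by (simp add: power2_eq_square algebra_simps)
        moreover have "y \<in> cball y s" using \<open>0 < s\<close> by simp
        ultimately show ?thesis using C1(2)[OF h] C2(2)[OF h(1,2), of y] by (simp add: distrib_right)
      qed
      then show ?thesis unfolding Q_def using C1(1) C2(1) by (intro exI[of _ "2 * C1 + 2 * C2"]) auto
    qed
  qed
  then show ?thesis using z0 unfolding Q_def by blast
qed

text \<open>On the boundary the field \<open>(u - 2 * c) *\<^sub>R G + (sig * (u - c)\<^sup>2) *\<^sub>R Y\<close> has the normal component \<open>- sig * c\<^sup>2\<close>,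
  because \<open>Y\<close> is the inner normal there; near the boundary the divergence of \<open>Y\<close> is at least 1.\<close>

theorem eigenvalue_lower_bound:
  "\<exists>s>0. \<forall>u G sig. data u G \<longrightarrow> ck 3 Om u \<longrightarrow> sig \<ge> 0 \<longrightarrow>
     robin u G sig \<longrightarrow> dirichlet G > 0 \<longrightarrow> s \<le> sig"
proof -
  obtain z0 where z0: "z0 \<in> Om" "\<And>T. compact T ==> T \<subseteq> Om ==> \<exists>C\<ge>0. \<forall>u G. data u G \<longrightarrow> ck 3 Om u \<longrightarrow>
     (\<forall>x\<in>T. (u x - u z0)^2 \<le> C * dirichlet G)" using interior_oscillation by blast
  obtain K where K: "K \<ge> 1" "\<And>x. x \<in> closure Om ==> norm (gr rho x) \<le> K"
    "\<And>x. x \<in> closure Om ==> \<bar>lap rho x\<bar> \<le> K" "\<And>x. x \<in> closure Om ==> \<bar>rho x\<bar> \<le> K" by (rule rho_bounds) (rule that)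
  have "continuous_on (closure Om) (\<lambda>x. gr rho x \<bullet> gr rho x)" by (intro continuous_intros cont_grho)
  then obtain dl where d: "dl > 0" "\<And>x. x \<in> closure Om ==> rho x > - dl ==> gr rho x \<bullet> gr rho x > 1/2"
    using collar_ge[of "\<lambda>x. gr rho x \<bullet> gr rho x" "1/2"] unit by (auto simp: dot_square_norm)
  \<comment> \<open>In the collar, \<open>gr rho \<bullet> gr rho\<close> exceeds 1/2 and
    \<open>lap rho\<close> is at most \<open>K\<close>, so \<open>k / 2 - K = 1\<close> is a lower
    bound for the divergence of \<open>Y\<close>.\<close>
  define k where "k = 2 * (K + 1)"
  have k0: "k > 0" using K by (simp add: k_def)
  define e where "e x = exp (- k * rho x)" for x
  define Y where "Y x = (- e x) *\<^sub>R gr rho x" for x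
  define E1 where "E1 = exp (k * K)"
  have E1: "E1 \<ge> 1" using k0 K by (simp add: E1_def)
  have eb: "0 < e x" "e x \<le> E1" if "x \<in> closure Om" for x
    using K(4)[OF that] k0 mult_left_mono[of "- rho x" K k] by (auto simp: e_def E1_def abs_le_iff)
  have ck_e: "ck 1 D e" unfolding e_def[abs_def] by (intro ck_exp ck_mult ck_const opD ck_rho) auto
  have Y1: "ck 1 D Y" unfolding Y_def[abs_def] by (intro ck_scaleR ck_minus ck_e opD ck_grho) auto
  have dY: "dv Y x = e x * (k * (gr rho x \<bullet> gr rho x) - lap rho x)" if x: "x \<in> D" for x
  proof -
    have de: "((\<lambda>s. - exp (- k * s)) has_real_derivative k * exp (- k * s)) (at s)" for s
      by (auto intro!: derivative_eq_intros)
    have g: "gr (\<lambda>x. - e x) x = (k * e x) *\<^sub>R gr rho x"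
      unfolding e_def[abs_def] by (rule gr_compose[OF de rho_diff[OF x]])
    have "dv Y x = gr (\<lambda>x. - e x) x \<bullet> gr rho x + (- e x) * lap rho x" unfolding Y_def[abs_def]
      by (rule dv_scaleR) (use ck_minus[OF opD ck_e] ck_grho[of 1] x in auto)
    then show ?thesis unfolding g by (simp add: algebra_simps)
  qed
  have nY: "norm (Y x) \<le> E1 * K" if "x \<in> closure Om" for x
    unfolding Y_def norm_scaleR using eb[OF that] K(2)[OF that] E1 by (intro mult_mono) auto
  define T where "T = {x \<in> closure Om. rho x \<le> - dl}"
  obtain C1 where C1: "C1 \<ge> 0" "\<And>u G x. data u G ==> ck 3 Om u ==> x \<in> T ==> (u x - u z0)^2 \<le> C1 * dirichlet G"
    using z0(2)[OF inner_set[OF d(1)]] unfolding T_def by blast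
  define C2 where "C2 = E1 * (k * (K * K) + K)"
  have C2: "C2 \<ge> 0" using E1 k0 K by (simp add: C2_def)
  define C3 where "C3 = (E1 * K)^2"
  define V where "V = (LINT x:Om|lborel. (1::real))"
  have V: "V \<ge> 0" unfolding V_def set_lebesgue_integral_def by (rule Bochner_Integration.integral_nonneg) simp
  define CC where "CC = C3 + (C2 + 1) * C1 * V + 1"
  have CC: "CC > 0" using C1 C2 V by (simp add: CC_def C3_def add_nonneg_pos)
  have "1 / CC \<le> sig"
    if h: "data u G" "ck 3 Om u" "sig \<ge> 0" "robin u G sig"
      "dirichlet G > 0" for u G sig
  proof -
    interpret harmonic_data Om D rho u G by (rule h)
    define c where "c = u z0"
    define w where "w x = u x - c" for x
    define F where "F x = (u x - 2 * c) *\<^sub>R G x + (sig * (w x)^2) *\<^sub>R Y x" for x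
    define m where "m x = (1 - sig * C3) * (G x \<bullet> G x) - sig * ((C2 + 1) * C1 * Dir) * 1" for x
    have wc: "continuous_on (closure Om) w" unfolding w_def[abs_def] by (intro continuous_intros uc)
    have Yc: "continuous_on (closure Om) Y" by (rule continuous_on_subset[OF ck_cont[OF Y1] clD])
    have u1: "ck 1 Om u" by (rule ck_mono[OF u2]) simp
    have w1: "ck 1 Om w" unfolding w_def[abs_def] by (intro ck_diff' op u1 ck_const)
    have G1: "ck 1 Om (gr u)" by (rule ck_gr[OF op]) (use u2 in \<open>simp only: numeral_2_eq_2 One_nat_def\<close>)
    have YO: "ck 1 Om Y" by (rule ck_subset[OF Y1 subD])
    define F1 where "F1 x = (u x - 2 * c) *\<^sub>R gr u x" for x
    define F2 where "F2 x = (sig * (w x)^2) *\<^sub>R Y x" for x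
    have ckF: "ck 1 Om F1" "ck 1 Om F2" unfolding F1_def[abs_def] F2_def[abs_def]
      by (intro ck_scaleR ck_diff' ck_mult ck_power ck_const op u1 w1 G1 YO)+
    have ckF': "ck 1 Om (\<lambda>x. F1 x + F2 x)" by (intro ck_add op ckF)
    have FF: "F x = F1 x + F2 x" if "x \<in> Om" for x using GG[OF that] by (simp add: F_def F1_def F2_def)
    have si: "set_integrable lborel Om f" if "continuous_on (closure Om) f" for f :: "'a \<Rightarrow> real"
      by (rule si_closure[OF that]) (use op in auto)
    have i: "set_integrable lborel Om (\<lambda>x. (1 - sig * C3) * (G x \<bullet> G x))" "set_integrable lborel Om (\<lambda>x. sig * ((C2 + 1) * C1 * Dir) * 1)"
      by (intro si continuous_intros Gc; simp)+
    have "(LINT x:Om \<inter> UNIV|lborel. m x) \<le> 0"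
    proof (rule divergence_bound[where C=UNIV and F=F])
      show "ck 1 (Om \<inter> UNIV) F" unfolding Int_UNIV_right by (rule ck_cong[OF op _ ckF']) (simp add: FF)
      show "continuous_on (closure Om \<inter> UNIV) F" unfolding F_def[abs_def] Int_UNIV_right
        by (intro continuous_intros wc uc Gc Yc)
      show "set_integrable lborel (Om \<inter> UNIV) m" unfolding m_def[abs_def] Int_UNIV_right by (intro set_integral_diff(1) i)
      show "F x \<bullet> gr rho x \<le> 0" if "x \<in> frontier Om \<inter> UNIV" for x
      proof -
        have 1: "G x \<bullet> gr rho x = sig * u x" "gr rho x \<bullet> gr rho x = 1" "e x = 1"
          using h(4) unit[of x] zer[of x] that by (auto simp: dot_square_norm e_def)
        have "F x \<bullet> gr rho x = (u x - 2 * c) * (sig * u x) - sig * (w x)^2" by (simp add: F_def Y_def inner_add_left inner_diff_left 1)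
        also have "... = - (sig * c^2)" by (simp add: w_def power2_eq_square algebra_simps)
        finally show ?thesis using h(3) by simp
      qed
      show "m x \<le> dv F x" if "x \<in> Om \<inter> UNIV" for x
      proof -
        have x: "x \<in> Om" and xc: "x \<in> closure Om" and xD: "x \<in> D" using that closure_subset subD by auto
        have du: "u differentiable (at x)" and dw: "w differentiable (at x)" using u1 w1 x by auto
        have g: "gr (\<lambda>x. u x - k) x = G x" for k
        proof -
          from has_derivative_diff[OF gr_deriv[OF du] has_derivative_const[of k]]
          have "((\<lambda>x. u x - k) has_derivative (\<lambda>h. gr u x \<bullet> h)) (at x)" by simp
          then show ?thesis using gr_eqI GG[OF x] by metis
        qed
        have gw: "gr w x = G x" unfolding w_def[abs_def] by (rule g)
        have d2: "((\<lambda>s. sig * s^2) has_real_derivative 2 * sig * w x) (at (w x))" by (auto intro!: derivative_eq_intros)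
        have g2: "gr (\<lambda>x. sig * (w x)^2) x = (2 * sig * w x) *\<^sub>R G x" using gr_compose[OF d2 dw] by (simp add: gw)
        have "dv F x = dv (\<lambda>x. F1 x + F2 x) x" by (rule dv_cong_open[OF op x]) (simp add: FF)
        also have "... = dv F1 x + dv F2 x" by (rule dv_add) (use ckF x in auto)
        also have "dv F1 x = gr (\<lambda>x. u x - 2 * c) x \<bullet> gr u x + (u x - 2 * c) * lap u x" unfolding F1_def[abs_def]
          by (rule dv_scaleR) (use du G1 x in auto)
        also have "dv F2 x = gr (\<lambda>x. sig * (w x)^2) x \<bullet> Y x + sig * (w x)^2 * dv Y x" unfolding F2_def[abs_def]
          by (rule dv_scaleR) (use dw YO x in \<open>auto intro!: differentiable_power differentiable_mult\<close>)
        finally have dF: "dv F x = G x \<bullet> G x + sig * (2 * w x * (G x \<bullet> Y x) + (w x)^2 * dv Y x)"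
          unfolding g g2 using harm[OF x] GG[OF x] by (simp add: algebra_simps)
        have 1: "- ((w x)^2 + C3 * (G x \<bullet> G x)) \<le> 2 * w x * (G x \<bullet> Y x)"
        proof -
          have "\<bar>G x \<bullet> Y x\<bar> \<le> norm (G x) * (E1 * K)"
            using Cauchy_Schwarz_ineq2[of "G x" "Y x"] mult_left_mono[OF nY[OF xc], of "norm (G x)"] by simp
          then have "\<bar>2 * w x * (G x \<bullet> Y x)\<bar> \<le> 2 * \<bar>w x\<bar> * (norm (G x) * (E1 * K))"
            unfolding abs_mult by (intro mult_mono) auto
          also have "... \<le> (w x)^2 + (norm (G x) * (E1 * K))^2"
            using sum_squares_bound[of "\<bar>w x\<bar>" "norm (G x) * (E1 * K)"] by simp
          also have "(norm (G x) * (E1 * K))^2 = C3 * (G x \<bullet> G x)" by (simp add: C3_def power_mult_distrib dot_square_norm)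
          finally show ?thesis by linarith
        qed
        \<comment> \<open>In the collar the divergence of \<open>Y\<close> pays for the square of
          \<open>w\<close>. At greater depth \<open>w\<close>, the deviation from the value at
          \<open>z0\<close>, is bounded by the Dirichlet energy.\<close>
        have "- (C3 * (G x \<bullet> G x)) - (C2 + 1) * C1 * Dir \<le> 2 * w x * (G x \<bullet> Y x) + (w x)^2 * dv Y x"
        proof (cases "rho x > - dl")
          case True
          have "e x \<ge> 1" using neg[OF x] k0 by (simp add: e_def mult_nonneg_nonpos)
          moreover have "k * (gr rho x \<bullet> gr rho x) \<ge> k * (1/2)" using d(2)[OF xc True] k0 by (intro mult_left_mono) auto
          then have "k * (gr rho x \<bullet> gr rho x) - lap rho x \<ge> 1" using K(3)[OF xc] k_def by argo
          ultimately have "1 * 1 \<le> dv Y x" unfolding dY[OF xD] by (intro mult_mono) auto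
          then have "(w x)^2 * 1 \<le> (w x)^2 * dv Y x" by (intro mult_left_mono) auto
          moreover have "(C2 + 1) * C1 * Dir \<ge> 0" using C1 C2 h(5) by simp
          ultimately show ?thesis using 1 by linarith
        next
          case False
          have "\<bar>dv Y x\<bar> \<le> C2" unfolding dY[OF xD] abs_mult C2_def
          proof (rule mult_mono)
            have "k * (gr rho x \<bullet> gr rho x) \<le> k * (K * K)" "0 \<le> k * (gr rho x \<bullet> gr rho x)"
              using K(1) power_mono[OF K(2)[OF xc], of 2] k0 by (auto intro!: mult_left_mono simp: dot_square_norm power2_eq_square)
            then show "\<bar>k * (gr rho x \<bullet> gr rho x) - lap rho x\<bar> \<le> k * (K * K) + K" using K(3)[OF xc] by linarith
          qed (use eb[OF xc] E1 in auto)
          then have "(w x)^2 * (- C2) \<le> (w x)^2 * dv Y x" by (intro mult_left_mono) auto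
          moreover have "(C2 + 1) * (w x)^2 \<le> (C2 + 1) * (C1 * Dir)"
            using C1(2)[OF h(1,2), of x] False xc C2 by (intro mult_left_mono) (auto simp: w_def c_def T_def)
          moreover have "(C2 + 1) * (w x)^2 = (w x)^2 - (w x)^2 * (- C2)" by (simp add: algebra_simps)
          ultimately show ?thesis using 1 by (simp add: mult.assoc)
        qed
        from mult_left_mono[OF this h(3)] show ?thesis unfolding dF m_def by (simp add: algebra_simps)
      qed
    qed auto
    also have "(LINT x:Om \<inter> UNIV|lborel. m x) = (1 - sig * C3) * Dir - sig * ((C2 + 1) * C1 * Dir) * V"
      unfolding m_def[abs_def] Int_UNIV_right set_integral_diff(2)[OF i] by (simp only: Dir_def V_def set_integral_mult_right)
    \<comment> \<open>The integrated inequality bounds the Dirichlet energy by a constant times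
      \<open>sig\<close> times itself, and a positive energy cancels.\<close>
    finally have "1 * Dir \<le> (sig * (CC - 1)) * Dir" by (simp add: CC_def algebra_simps)
    then have "1 \<le> sig * (CC - 1)" by (rule mult_right_le_imp_le) (rule h(5))
    also have "... \<le> sig * CC" using h(3) by (intro mult_left_mono) auto
    finally show ?thesis using CC by (simp add: field_simps)
  qed
  then show ?thesis using CC by (intro exI[of _ "1 / CC"]) auto
qed

end

section \<open>Global defining functions\<close>

lemma smooth_on_iter_deriv:
  fixes f :: "'a::euclidean_space \<Rightarrow> 'b::real_normed_vector"
  assumes "smooth_on S f" "vs \<in> lists Basis"
  shows "ck k S (iter_deriv vs f)"
  using assms(2)
proof (induction k arbitrary: vs)
  case 0
  then have "iter_deriv vs f differentiable_on S"
    using assms(1) by (auto simp: smooth_on_def differentiable_on_def intro: differentiable_at_withinI)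
  then show ?case by (simp add: differentiable_imp_continuous_on)
next
  case (Suc k)
  have "ck k S (\<lambda>x. fd (iter_deriv vs f) x b)" if "b \<in> Basis" for b
    using Suc.IH[of "b # vs"] Suc.prems that by simp
  then show ?case using assms(1) Suc.prems by (simp add: smooth_on_def)
qed

lemma smooth_on_ck: "smooth_on S f ==> ck k S f"
  using smooth_on_iter_deriv[of S f "[]" k] by simp

text \<open>Otherwise some direction entering \<open>{f < 0}\<close>, hence \<open>Om\<close>, would increase \<open>f'\<close>.\<close>

lemma gradients_parallel:
  fixes f f' :: "'a::euclidean_space \<Rightarrow> real"
  assumes f: "f differentiable (at x)" "f x = 0" "gr f x \<noteq> 0" and f': "f' differentiable (at x)" "f' x = 0" "gr f' x \<noteq> 0"
    and U: "open U" "x \<in> U" "\<And>y. y \<in> U ==> f y < 0 ==> y \<in> Om"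
    and U': "open U'" "x \<in> U'" "\<And>y. y \<in> U' ==> y \<in> Om ==> f' y \<le> 0"
  shows "gr f' x /\<^sub>R norm (gr f' x) = gr f x /\<^sub>R norm (gr f x)"
proof (rule ccontr)
  define n n' where "n = gr f x /\<^sub>R norm (gr f x)" and "n' = gr f' x /\<^sub>R norm (gr f' x)"
  assume "\<not> ?thesis"
  then have ne: "n' - n \<noteq> 0" by (simp add: n_def n'_def)
  have nn: "n \<bullet> n = 1" "n' \<bullet> n' = 1" using f f' by (simp_all add: n_def n'_def dot_square_norm)
  define h where "h = n' - n"
  have "(n' - n) \<bullet> (n' - n) > 0" using ne by simp
  then have lt: "n \<bullet> n' < 1" by (simp add: inner_diff_left inner_diff_right nn inner_commute)
  have g: "gr f x = norm (gr f x) *\<^sub>R n" "gr f' x = norm (gr f' x) *\<^sub>R n'" using f f' by (simp_all add: n_def n'_def)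
  have "n \<bullet> h < 0" "n' \<bullet> h > 0" using lt by (simp_all add: h_def inner_diff_right nn inner_commute)
  then have neg: "gr f x \<bullet> h < 0" "gr f' x \<bullet> h > 0"
    using f f' by (subst g; simp add: mult_pos_neg)+
  have line: "((\<lambda>t. k (x + t *\<^sub>R h)) has_real_derivative gr k x \<bullet> h) (at 0)" if "k differentiable (at x)" for k
  proof -
    have 1: "((\<lambda>t. x + t *\<^sub>R h) has_derivative (\<lambda>t. t *\<^sub>R h)) (at 0)" by (auto intro!: derivative_eq_intros)
    have 2: "(k has_derivative (\<lambda>h. gr k x \<bullet> h)) (at (x + 0 *\<^sub>R h))" using gr_deriv[OF that] by simp
    show ?thesis unfolding has_field_derivative_def
      by (rule has_derivative_eq_rhs[OF has_derivative_compose[OF 1 2]]) (auto simp: fun_eq_iff)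
  qed
  obtain d1 where d1: "d1 > 0" "\<And>t. 0 < t ==> t < d1 ==> f (x + t *\<^sub>R h) < 0"
    using DERIV_neg_dec_right[OF line[OF f(1)] neg(1)] f(2) by auto
  obtain d2 where d2: "d2 > 0" "\<And>t. 0 < t ==> t < d2 ==> f' (x + t *\<^sub>R h) > 0"
    using DERIV_pos_inc_right[OF line[OF f'(1)] neg(2)] f'(2) by auto
  have "open ((\<lambda>t. x + t *\<^sub>R h) -` (U \<inter> U'))" by (intro open_vimage open_Int U U' continuous_intros)
  moreover have "0 \<in> (\<lambda>t::real. x + t *\<^sub>R h) -` (U \<inter> U')" using U U' by simp
  ultimately obtain d3 where d3: "d3 > 0" "ball 0 d3 \<subseteq> (\<lambda>t. x + t *\<^sub>R h) -` (U \<inter> U')" using open_contains_ball by blast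
  define t where "t = min d1 (min d2 d3) / 2"
  have t: "0 < t" "t < d1" "t < d2" "t < d3" using d1 d2 d3 by (auto simp: t_def)
  then have "t \<in> ball 0 d3" by simp
  then have "x + t *\<^sub>R h \<in> U \<inter> U'" using d3(2) by auto
  then have "f' (x + t *\<^sub>R h) \<le> 0" using U(3) U'(3) d1(2)[OF t(1,2)] by auto
  then show False using d2(2)[OF t(1,3)] by simp
qed

text \<open>For the last claim: a frontier point lies outside the open set \<open>Om\<close>, so
  \<open>rho \<ge> 0\<close> there; a positive value would persist in a neighbourhood disjoint from
  \<open>Om\<close>, against membership in the closure.\<close>

lemma local_defining_function_props:
  assumes "local_defining_function Om U rho" and op: "open Om"
  shows "open U" "ck k U rho" "\<And>x. x \<in> U ==> gr rho x \<noteq> 0" "\<And>x. x \<in> U ==> rho x < 0 \<longleftrightarrow> x \<in> Om"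
    "\<And>x. x \<in> U ==> x \<in> frontier Om ==> rho x = 0"
proof -
  show U: "open U" and c: "ck k U rho" for k using assms by (auto simp: local_defining_function_def smooth_on_ck)
  have d: "rho differentiable (at x)" if "x \<in> U" for x using c[of 1] that by simp
  show "gr rho x \<noteq> 0" if "x \<in> U" for x
  proof
    assume "gr rho x = 0"
    then have "GDERIV rho x :> 0" using gr_deriv[OF d[OF that]] by (simp add: gderiv_def)
    then show False using assms(1) that by (auto simp: local_defining_function_def)
  qed
  show iff: "rho x < 0 \<longleftrightarrow> x \<in> Om" if "x \<in> U" for x using assms(1) that by (auto simp: local_defining_function_def)
  show "rho x = 0" if x: "x \<in> U" "x \<in> frontier Om" for x
  proof -
    have "x \<notin> Om" "x \<in> closure Om" using x(2) op by (auto simp: frontier_def interior_open)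
    then have ge: "rho x \<ge> 0" using iff[OF x(1)] by simp
    have "\<not> rho x > 0"
    proof
      assume p: "rho x > 0"
      have "continuous_on U rho" using c[of 0] by simp
      then have "open (U \<inter> rho -` {0<..})" by (intro continuous_open_preimage U) auto
      moreover have "x \<in> U \<inter> rho -` {0<..}" using x p by simp
      ultimately have "(U \<inter> rho -` {0<..}) \<inter> Om \<noteq> {}" using \<open>x \<in> closure Om\<close> open_Int_closure_eq_empty by blast
      then show False using iff by force
    qed
    then show ?thesis using ge by simp
  qed
qed

text \<open>\<open>rho\<close> has class 3 and may fail to be a local defining function in the
  smooth sense. The one-sided comparison in \<open>gradients_parallel\<close> still applies to
  it.\<close>

theorem (in defined_domain) exterior_unit_normal_eq:
  assumes "exterior_unit_normal Om x nv" "x \<in> frontier Om"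
  shows "nv = gr rho x"
proof -
  obtain U r g where U: "x \<in> U" "local_defining_function Om U r" "GDERIV r x :> g" "nv = g /\<^sub>R norm g"
    using assms(1) unfolding exterior_unit_normal_def by blast
  note p = local_defining_function_props[OF U(2) op]
  have g: "gr r x = g" by (rule gr_eqI) (use U(3) in \<open>simp add: gderiv_def inner_commute\<close>)
  have xD: "x \<in> D" using frontier_cl[OF assms(2)] clD by auto
  have "gr rho x /\<^sub>R norm (gr rho x) = gr r x /\<^sub>R norm (gr r x)"
  proof (rule gradients_parallel[where U=U and U'=D and Om=Om])
    show "r differentiable (at x)" using p(2)[of 1] U(1) by simp
    show "rho y \<le> 0" if "y \<in> Om" for y using neg[OF that] by simp
    show "gr rho x \<noteq> 0" using unit[OF assms(2)] by auto
  qed (use p U assms(2) zer xD rho_diff opD in auto)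
  then show ?thesis using unit[OF assms(2)] g U(4) by simp
qed

text \<open>Local defining functions are added with cutoff weights. On the frontier all of them
  vanish and their gradients are positive multiples of one normal, so the sum keeps a nonzero
  gradient. Dividing by the square root of \<open>k0\<close> normalises it; the summand
  \<open>(rho0 x)^2\<close> keeps \<open>k0\<close> positive inside, where the gradient may
  vanish.\<close>

theorem bounded_smooth_domain_defined:
  fixes Om :: "'a::euclidean_space set"
  assumes "bounded_smooth_domain Om"
  shows "\<exists>D rho. defined_domain Om D rho"
proof -
  have op: "open Om" and conn: "connected Om" and ne: "Om \<noteq> {}" and bd: "bounded Om"
    and loc: "\<And>x. x \<in> frontier Om ==> \<exists>U rho. x \<in> U \<and> local_defining_function Om U rho"
    using assms unfolding bounded_smooth_domain_def by auto
  define P where "P p U f R \<longleftrightarrow> open U \<and> R > 0 \<and> cball p R \<subseteq> U \<and> ck 4 U f \<and> (\<forall>y\<in>U. f y < 0 \<longleftrightarrow> y \<in> Om) \<and>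
     (\<forall>x\<in>U \<inter> frontier Om. f x = 0 \<and> gr f x \<noteq> 0)" for p :: 'a and U :: "'a set" and f :: "'a \<Rightarrow> real" and R
  have ex: "\<exists>U f R. P p U f R" if p: "p \<in> closure Om" for p
  proof (cases "p \<in> Om")
    case True
    then obtain R where "R > 0" "cball p R \<subseteq> Om" using op open_contains_cball by blast
    \<comment> \<open>An interior point gets the constant function -1 on \<open>Om\<close>; the
      condition on frontier points is void there because \<open>Om\<close> is open.\<close>
    then have "P p Om (\<lambda>_. -1) R" using op by (auto simp: P_def frontier_def interior_open)
    then show ?thesis by blast
  next
    case False
    then have "p \<in> frontier Om" using p op by (simp add: frontier_def interior_open)
    then obtain U f where U: "p \<in> U" "local_defining_function Om U f" using loc by blast
    note q = local_defining_function_props[OF U(2) op]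
    obtain R where "R > 0" "cball p R \<subseteq> U" using q(1) U(1) open_contains_cball by blast
    then have "P p U f R" using q unfolding P_def by blast
    then show ?thesis by blast
  qed
  then obtain U f R where UfR: "\<And>p. p \<in> closure Om ==> P p (U p) (f p) (R p)" by metis
  have compact: "compact (closure Om)" using bd by simp
  obtain F where F: "F \<subseteq> closure Om" "finite F" "closure Om \<subseteq> (\<Union>p\<in>F. ball p (R p))"
  proof (rule compactE_image[OF compact, of "closure Om" "\<lambda>p. ball p (R p)"])
    show "closure Om \<subseteq> (\<Union>p\<in>closure Om. ball p (R p))" using UfR unfolding P_def by (meson UN_I centre_in_ball subsetI)
  qed auto
  have PF: "open (U p)" "R p > 0" "cball p (R p) \<subseteq> U p" "ck 4 (U p) (f p)" "\<And>y. y \<in> U p ==> f p y < 0 \<longleftrightarrow> y \<in> Om"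
    "\<And>x. x \<in> U p ==> x \<in> frontier Om ==> f p x = 0 \<and> gr (f p) x \<noteq> 0" if "p \<in> F" for p
    using UfR[of p] F(1) that unfolding P_def by auto
  \<comment> \<open>\<open>bump 5\<close> is of class 4. One derivative is lost in the normalising
    factor, which contains \<open>gr rho0\<close>, so that \<open>rho\<close> ends up in class
    3.\<close>
  define eta where "eta p x = bump 5 ((1 / R p) *\<^sub>R (x - p))" for p x
  have eta0: "eta p x \<ge> 0" for p x by (simp add: eta_def bump_props)
  have eta_pos: "eta p x > 0" if "x \<in> ball p (R p)" "p \<in> F" for p x
    unfolding eta_def by (rule bump_props(4)) (use that PF(2)[OF that(2)] in \<open>simp add: dist_norm norm_minus_commute\<close>)
  have eta_out: "eta p x = 0" if "x \<notin> ball p (R p)" "p \<in> F" for p x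
    unfolding eta_def by (rule bump_props(3)) (use that PF(2)[OF that(2)] in \<open>simp_all add: dist_norm norm_minus_commute\<close>)
  have eta_ck: "ck 4 S (eta p)" if "open S" for S p unfolding eta_def[abs_def]
    by (rule ck_compose[OF that open_UNIV, of 4 "bump 5"]) (auto intro!: ck_bump ck_scaleR ck_diff' ck_ident that)
  define t where "t p x = eta p x * f p x" for p x
  have t_out: "t p x = 0" if "x \<in> - cball p (R p)" "p \<in> F" for p x using eta_out[of x p] that by (auto simp: t_def)
  have t_ck: "ck 4 UNIV (t p)" if p: "p \<in> F" for p
  proof (rule ck_local)
    fix x :: 'a
    show "\<exists>T. open T \<and> x \<in> T \<and> ck 4 T (t p)"
    proof (cases "x \<in> U p")
      case True
      have "ck 4 (U p) (t p)" unfolding t_def[abs_def] by (intro ck_mult PF[OF p] eta_ck)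
      then show ?thesis using PF[OF p] True by blast
    next
      case False
      then have "x \<in> - cball p (R p)" using PF(3)[OF p] by blast
      moreover have "ck 4 (- cball p (R p)) (t p)"
        by (rule ck_cong[OF _ _ ck_const[of 4 _ 0]]) (use t_out p in \<open>auto simp: open_Compl\<close>)
      ultimately show ?thesis by (intro exI[of _ "- cball p (R p)"]) (auto simp: open_Compl)
    qed
  qed
  define rho0 where "rho0 x = (\<Sum>p\<in>F. t p x)" for x
  have r4: "ck 4 UNIV rho0" unfolding rho0_def[abs_def] by (intro ck_sum open_UNIV t_ck)
  have r1: "ck 1 UNIV rho0" by (rule ck_mono[OF r4]) simp
  have neg: "rho0 x < 0" if x: "x \<in> Om" for x
  proof -
    have le: "t p x \<le> 0" if p: "p \<in> F" for p
    proof (cases "x \<in> ball p (R p)")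
      case True
      then have "x \<in> U p" using PF(3)[OF p] ball_subset_cball by blast
      then have "f p x < 0" using PF(5)[OF p] x by simp
      then show ?thesis unfolding t_def using eta0[of p x] by (simp add: mult_nonneg_nonpos)
    qed (simp add: t_def eta_out p)
    obtain p where p: "p \<in> F" "x \<in> ball p (R p)" using F(3) x closure_subset by blast
    then have "x \<in> U p" using PF(3)[OF p(1)] ball_subset_cball by blast
    then have "t p x < 0" unfolding t_def using PF(5)[OF p(1)] x eta_pos[OF p(2,1)] by (simp add: mult_pos_neg)
    then have "(\<Sum>p\<in>F. t p x) < (\<Sum>p\<in>F. 0)" by (intro sum_strict_mono_ex1 F(2)) (use le p in auto)
    then show ?thesis by (simp add: rho0_def)
  qed
  have zer: "rho0 x = 0" if x: "x \<in> frontier Om" for x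
    unfolding rho0_def
  proof (rule sum.neutral, rule ballI)
    fix p assume p: "p \<in> F"
    show "t p x = 0"
    proof (cases "x \<in> cball p (R p)")
      case True
      then have "x \<in> U p" using PF(3)[OF p] by blast
      then show ?thesis using PF(6)[OF p _ x] by (simp add: t_def)
    qed (use t_out[of x p] p in auto)
  qed
  have gt: "gr (t p) x = eta p x *\<^sub>R gr (f p) x" if p: "p \<in> F" and x: "x \<in> frontier Om" for p x
  proof (cases "x \<in> U p")
    case True
    have "f p differentiable (at x)" "eta p differentiable (at x)"
      using ck_mono[OF PF(4)[OF p], of 1] ck_mono[OF eta_ck[OF open_UNIV], of 1] True by auto
    then have "gr (t p) x = eta p x *\<^sub>R gr (f p) x + f p x *\<^sub>R gr (eta p) x" unfolding t_def[abs_def] by (intro gr_mult)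
    then show ?thesis using PF(6)[OF p True x] by simp
  next
    case False
    then have xo: "x \<in> - cball p (R p)" using PF(3)[OF p] by blast
    have d0: "((\<lambda>_. 0) has_derivative (\<lambda>h. 0 \<bullet> h)) (at x)" by simp
    have "(t p has_derivative (\<lambda>h. 0 \<bullet> h)) (at x)"
      by (rule has_derivative_transform_within_open[OF d0 _ xo]) (use t_out p in \<open>auto simp: open_Compl\<close>)
    then have "gr (t p) x = 0" by (rule gr_eqI)
    moreover have "eta p x = 0" using xo eta_out[of x p] p by auto
    ultimately show ?thesis by simp
  qed
  have g0: "gr rho0 x \<noteq> 0" if x: "x \<in> frontier Om" for x
  proof -
    have "x \<in> closure Om" using x by (simp add: frontier_def)
    then obtain p0 where p0: "p0 \<in> F" "x \<in> ball p0 (R p0)" using F(3) by blast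
    then have xU: "x \<in> U p0" using PF(3)[OF p0(1)] ball_subset_cball by blast
    define n where "n = gr (f p0) x /\<^sub>R norm (gr (f p0) x)"
    have n1: "n \<bullet> n = 1" using PF(6)[OF p0(1) xU x] by (simp add: n_def dot_square_norm)
    have par: "gr (f p) x \<bullet> n = norm (gr (f p) x)" if p: "p \<in> F" "x \<in> U p" for p
    proof -
      have fd: "f q differentiable (at x)" if "q \<in> F" "x \<in> U q" for q using ck_mono[OF PF(4)[OF that(1)], of 1] that by auto
      have "gr (f p) x /\<^sub>R norm (gr (f p) x) = n" unfolding n_def
      proof (rule gradients_parallel[where U="U p0" and U'="U p" and Om=Om])
        show "f p y \<le> 0" if "y \<in> U p" "y \<in> Om" for y using PF(5)[OF p(1) that(1)] that(2) by simp
      qed (use fd p p0 xU x PF in auto)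
      then have "gr (f p) x = norm (gr (f p) x) *\<^sub>R n" using PF(6)[OF p(1,2) x] by auto
      then have "gr (f p) x \<bullet> n = (norm (gr (f p) x) *\<^sub>R n) \<bullet> n" by simp
      then show ?thesis by (simp add: n1)
    qed
    have d: "(t p has_derivative (\<lambda>h. gr (t p) x \<bullet> h)) (at x)" if "p \<in> F" for p
      using gr_deriv[of "t p" x] ck_mono[OF t_ck[OF that], of 1] by simp
    have "(rho0 has_derivative (\<lambda>h. \<Sum>p\<in>F. gr (t p) x \<bullet> h)) (at x)" unfolding rho0_def[abs_def] by (rule has_derivative_sum[OF d])
    then have "gr rho0 x = (\<Sum>p\<in>F. gr (t p) x)" by (intro gr_eqI) (simp add: inner_sum_left)
    then have "gr rho0 x \<bullet> n = (\<Sum>p\<in>F. eta p x * (gr (f p) x \<bullet> n))" by (simp add: inner_sum_left gt x)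
    also have "... > (\<Sum>p\<in>F. 0)"
    proof (rule sum_strict_mono_ex1[OF F(2)])
      show "\<forall>p\<in>F. 0 \<le> eta p x * (gr (f p) x \<bullet> n)"
      proof
        fix p assume p: "p \<in> F"
        show "0 \<le> eta p x * (gr (f p) x \<bullet> n)"
        proof (cases "x \<in> U p")
          case True then show ?thesis using par[OF p] eta0 by simp
        next
          case False
          then have "x \<notin> ball p (R p)" using PF(3)[OF p] ball_subset_cball by blast
          then show ?thesis using eta_out p by simp
        qed
      qed
      show "\<exists>p\<in>F. 0 < eta p x * (gr (f p) x \<bullet> n)"
        using p0 xU par[OF p0(1) xU] eta_pos[OF p0(2,1)] PF(6)[OF p0(1) xU x] by (intro bexI[of _ p0]) auto
    qed
    finally show ?thesis by auto
  qed
  define k0 where "k0 x = gr rho0 x \<bullet> gr rho0 x + (rho0 x)^2" for x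
  define D where "D = {x. k0 x > 0}"
  have g3: "ck 3 UNIV (gr rho0)" by (rule ck_gr[OF open_UNIV]) (use r4 in \<open>simp add: eval_nat_numeral del: ck.simps\<close>)
  have r3: "ck 3 UNIV rho0" by (rule ck_mono[OF r4]) simp
  have k3: "ck 3 UNIV k0" unfolding k0_def[abs_def] by (intro ck_add ck_inner ck_power open_UNIV g3 r3)
  have "open D" unfolding D_def using ck_cont[OF k3] by (intro open_Collect_less continuous_intros) auto
  define rho where "rho x = rho0 x * k0 x powr (- 1/2)" for x
  have kp: "ck 3 D (\<lambda>x. k0 x powr (- 1/2))"
    by (rule ck_powr[OF \<open>open D\<close> ck_subset[OF k3]]) (auto simp: D_def)
  have rho3: "ck 3 D rho" unfolding rho_def[abs_def] by (intro ck_mult \<open>open D\<close> kp ck_subset[OF r3]) auto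
  have inD: "x \<in> D" if "x \<in> closure Om" for x
  proof (cases "x \<in> Om")
    case True
    then have "(rho0 x)^2 > 0" using neg by force
    then show ?thesis by (simp add: D_def k0_def add_nonneg_pos)
  next
    case False
    then have "x \<in> frontier Om" using that op by (simp add: frontier_def interior_open)
    then show ?thesis using g0 by (simp add: D_def k0_def add_pos_nonneg)
  qed
  have "defined_domain Om D rho"
  proof
    show "rho x < 0" if "x \<in> Om" for x
    proof -
      have "k0 x > 0" using inD[of x] that closure_subset by (auto simp: D_def)
      then show ?thesis unfolding rho_def using neg[OF that] by (simp add: mult_neg_pos)
    qed
    show "norm (gr rho x) = 1" if x: "x \<in> frontier Om" for x
    proof -
      have xD: "x \<in> D" using inD x by (simp add: frontier_def)
      have "gr rho x = rho0 x *\<^sub>R gr (\<lambda>x. k0 x powr (- 1/2)) x + (k0 x powr (- 1/2)) *\<^sub>R gr rho0 x"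
        unfolding rho_def[abs_def]
        by (rule gr_mult) (use r1 ck_mono[OF kp, of 1] xD in auto)
      also have "... = (k0 x powr (- 1/2)) *\<^sub>R gr rho0 x" by (simp add: zer[OF x])
      also have "k0 x = (norm (gr rho0 x))^2" by (simp add: k0_def zer[OF x] dot_square_norm)
      also have "... powr (- 1/2) = 1 / norm (gr rho0 x)"
        using g0[OF x] by (simp add: powr_minus_divide powr_half_sqrt)
      finally show ?thesis using g0[OF x] by simp
    qed
  qed (use op bd conn ne \<open>open D\<close> inD rho3 zer in \<open>auto simp: rho_def[symmetric] simp del: ck.simps\<close>, simp add: rho_def zer)
  then show ?thesis by blast
qed

section \<open>Vanishing jets\<close>

lemma iter_deriv_append: "iter_deriv (vs @ ws) f = iter_deriv vs (iter_deriv ws f)"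
  by (induction vs) auto

text \<open>Vanishing of a jet, unfolded from the innermost derivative, whereas
  \<open>iter_deriv\<close> unfolds from the outermost. This suits inductions that generalise over
  the function.\<close>

primrec van :: "'a::euclidean_space \<Rightarrow> nat \<Rightarrow> ('a \<Rightarrow> real) \<Rightarrow> bool" where
  "van y 0 h \<longleftrightarrow> h y = 0"
| "van y (Suc k) h \<longleftrightarrow> h y = 0 \<and> (\<forall>b\<in>Basis. van y k (\<lambda>z. fd h z b))"

lemma vanishes_to_order_van: "vanishes_to_order k h y ==> van y k h"
proof (induction k arbitrary: h)
  case 0
  then show ?case by (auto simp: vanishes_to_order_def)
next
  case (Suc k)
  have "h y = 0" using Suc.prems[unfolded vanishes_to_order_def, rule_format, of "[]"] by simp
  moreover have "vanishes_to_order k (\<lambda>z. fd h z b) y" if b: "b \<in> Basis" for b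
    unfolding vanishes_to_order_def
  proof (intro ballI impI)
    fix vs :: "'a list" assume "vs \<in> lists Basis" "length vs \<le> k"
    then have "iter_deriv (vs @ [b]) h y = 0" using Suc.prems b unfolding vanishes_to_order_def by auto
    then show "iter_deriv vs (\<lambda>z. fd h z b) y = 0" by (simp add: iter_deriv_append)
  qed
  ultimately show ?case using Suc.IH by simp
qed

lemma van_zero: "van y k h ==> h y = 0" by (cases k) auto

lemma van_Suc_imp: "van y (Suc k) h ==> van y k h"
proof (induction k arbitrary: h)
  case (Suc k)
  then show ?case by (metis van.simps(2))
qed simp

lemma van_cong_open:
  assumes "open S" "y \<in> S" "\<And>z. z \<in> S ==> h z = h' z" "van y k h" shows "van y k h'"
  using assms(3,4)
proof (induction k arbitrary: h h')
  case 0
  then show ?case using assms(2) by simp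
next
  case (Suc k)
  have eq: "fd h z = fd h' z" if "z \<in> S" for z by (rule fd_cong_open[OF assms(1) that Suc.prems(1)])
  have "van y k (\<lambda>z. fd h' z b)" if b: "b \<in> Basis" for b
  proof (rule Suc.IH)
    show "van y k (\<lambda>z. fd h z b)" using Suc.prems(2) b by simp
    show "fd h z b = fd h' z b" if "z \<in> S" for z by (simp only: eq[OF that])
  qed
  moreover have "h' y = 0" using Suc.prems assms(2) by simp
  ultimately show ?case by simp
qed

lemma van_const0: "van y k (\<lambda>_. 0)"
proof (induction k)
  case (Suc k)
  have "fd (\<lambda>_::'a. 0::real) z b = 0" for z b by (simp add: fd_eqI)
  then show ?case using Suc by simp
qed simp

context
  fixes S :: "'a::euclidean_space set" and y :: 'a
  assumes S: "open S" "y \<in> S"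
begin

lemma van_add:
  assumes "ck k S h" "ck k S h'" "van y k h" "van y k h'" shows "van y k (\<lambda>z. h z + h' z)"
  using assms
proof (induction k arbitrary: h h')
  case (Suc k)
  have "van y k (\<lambda>z. fd (\<lambda>z. h z + h' z) z b)" if b: "b \<in> Basis" for b
  proof (rule van_cong_open[OF S])
    show "van y k (\<lambda>z. fd h z b + fd h' z b)" using Suc.prems b by (intro Suc.IH) auto
    show "fd h z b + fd h' z b = fd (\<lambda>z. h z + h' z) z b" if z: "z \<in> S" for z
      using fd_eqI[OF has_derivative_add[OF ck_diff[OF Suc.prems(1) z] ck_diff[OF Suc.prems(2) z]]] by simp
  qed
  then show ?case using Suc.prems by simp
qed simp

lemma van_mult:
  assumes "ck k S a" "ck k S h" "van y k h" shows "van y k (\<lambda>z. a z * h z)"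
  using assms
proof (induction k arbitrary: a h)
  case (Suc k)
  have "van y k (\<lambda>z. fd (\<lambda>z. a z * h z) z b)" if b: "b \<in> Basis" for b
  proof (rule van_cong_open[OF S])
    have a: "ck k S a" "ck k S h" "van y k h" using ck_Suc_imp Suc.prems(1,2) van_Suc_imp[OF Suc.prems(3)] by blast+
    have fa: "ck k S (\<lambda>z. fd a z b)" "ck k S (\<lambda>z. fd h z b)" "van y k (\<lambda>z. fd h z b)" using Suc.prems b by auto
    show "van y k (\<lambda>z. a z * fd h z b + fd a z b * h z)"
      by (intro van_add ck_mult S Suc.IH a fa)
    show "a z * fd h z b + fd a z b * h z = fd (\<lambda>z. a z * h z) z b" if z: "z \<in> S" for z
      using fd_eqI[OF has_derivative_mult[OF ck_diff[OF Suc.prems(1) z] ck_diff[OF Suc.prems(2) z]]] by simp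
  qed
  then show ?case using Suc.prems by simp
qed simp

lemma van_minus: "ck k S h ==> van y k h ==> van y k (\<lambda>z. - h z)"
  using van_mult[of k "\<lambda>_. -1" h] by simp

lemma van_sum:
  assumes "finite J" "\<And>j. j \<in> J ==> ck k S (h j)" "\<And>j. j \<in> J ==> van y k (h j)"
  shows "van y k (\<lambda>z. \<Sum>j\<in>J. h j z)"
  using assms
proof (induction J rule: finite_induct)
  case empty
  then show ?case using van_const0 by simp
next
  case (insert j J)
  then show ?case by (auto intro!: van_add ck_sum S)
qed

text \<open>The derivatives of the unknowns solve the same system modulo terms that already vanish; no inverse matrix is needed.\<close>

lemma van_solve:
  assumes fin: "finite J"
    and M: "\<And>i j. i \<in> I ==> j \<in> J ==> ck k S (M i j)" and x: "\<And>j. j \<in> J ==> ck k S (x j)"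
    and rows: "\<And>i. i \<in> I ==> van y k (\<lambda>z. \<Sum>j\<in>J. M i j z * x j z)"
    and inj: "\<And>xi j. (\<And>i. i \<in> I ==> (\<Sum>j\<in>J. M i j y * xi j) = 0) ==> j \<in> J ==> xi j = (0::real)"
    and j: "j \<in> J"
  shows "van y k (x j)"
  using M x rows j
proof (induction k arbitrary: x j)
  case 0
  then show ?case using inj[of "\<lambda>j. x j y" j] by simp
next
  case (Suc k)
  have M': "ck k S (M i j)" if "i \<in> I" "j \<in> J" for i j using ck_Suc_imp[OF Suc.prems(1)] that by blast
  have x': "ck k S (x j)" if "j \<in> J" for j using ck_Suc_imp[OF Suc.prems(2)] that by blast
  have xk: "van y k (x j)" if "j \<in> J" for j
    by (rule Suc.IH[OF M' x' _ that]) (use van_Suc_imp[OF Suc.prems(3)] in auto)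
  have "van y k (\<lambda>z. fd (x j) z b)" if b: "b \<in> Basis" for b
  proof (rule Suc.IH[where x="\<lambda>j z. fd (x j) z b", OF M' _ _ Suc.prems(4)])
    show "ck k S (\<lambda>z. fd (x j) z b)" if "j \<in> J" for j using Suc.prems(2)[OF that] b by simp
    fix i assume i: "i \<in> I"
    have c1: "ck k S (\<lambda>z. fd (M i j) z b)" if "j \<in> J" for j using Suc.prems(1)[OF i that] b by simp
    have c2: "ck k S (\<lambda>z. fd (x j) z b)" if "j \<in> J" for j using Suc.prems(2)[OF that] b by simp
    have 1: "van y k (\<lambda>z. fd (\<lambda>z. \<Sum>j\<in>J. M i j z * x j z) z b)" using Suc.prems(3)[OF i] b by simp
    have eq: "fd (\<lambda>z. \<Sum>j\<in>J. M i j z * x j z) z b = (\<Sum>j\<in>J. M i j z * fd (x j) z b + fd (M i j) z b * x j z)" if z: "z \<in> S" for z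
    proof -
      have "((\<lambda>z. \<Sum>j\<in>J. M i j z * x j z) has_derivative (\<lambda>h. \<Sum>j\<in>J. M i j z * fd (x j) z h + fd (M i j) z h * x j z)) (at z)"
        by (intro has_derivative_sum has_derivative_mult ck_diff[OF Suc.prems(1)[OF i] z] ck_diff[OF Suc.prems(2) z])
      then show ?thesis by (simp add: fd_eqI)
    qed
    have cs: "ck k S (\<lambda>z. \<Sum>j\<in>J. M i j z * fd (x j) z b + fd (M i j) z b * x j z)"
      by (intro ck_sum ck_add ck_mult S M'[OF i] x' c1 c2)
    have cn: "ck k S (\<lambda>z. \<Sum>j\<in>J. - (fd (M i j) z b * x j z))"
      by (intro ck_sum ck_minus ck_mult S x' c1)
    have 2: "van y k (\<lambda>z. \<Sum>j\<in>J. M i j z * fd (x j) z b + fd (M i j) z b * x j z)"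
      by (rule van_cong_open[OF S _ 1]) (rule eq)
    have 3: "van y k (\<lambda>z. \<Sum>j\<in>J. - (fd (M i j) z b * x j z))"
      by (intro van_sum fin ck_minus ck_mult van_minus van_mult S x' c1 xk)
    show "van y k (\<lambda>z. \<Sum>j\<in>J. M i j z * fd (x j) z b)"
      by (rule van_cong_open[OF S _ van_add[OF cs cn 2 3]]) (simp add: sum.distrib[symmetric])
  qed
  then show ?case using xk[OF Suc.prems(4)] van_zero by auto
qed

end

section \<open>Functions that are continuously differentiable up to the boundary\<close>

lemma segment_mvt:
  fixes f :: "'a::euclidean_space \<Rightarrow> real"
  assumes c: "continuous_on (closed_segment p q) f"
    and d: "\<And>t. 0 < t ==> t < 1 ==> f differentiable (at (p + t *\<^sub>R (q - p)))"
  shows "\<exists>t. 0 < t \<and> t < 1 \<and> f q - f p = gr f (p + t *\<^sub>R (q - p)) \<bullet> (q - p)"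
proof -
  define k where "k t = f (p + t *\<^sub>R (q - p))" for t
  have kc: "continuous_on {0..1} k" unfolding k_def
  proof (rule continuous_on_compose2[OF c])
    show "continuous_on {0..1} (\<lambda>t. p + t *\<^sub>R (q - p))" by (intro continuous_intros)
    show "(\<lambda>t. p + t *\<^sub>R (q - p)) ` {0..1} \<subseteq> closed_segment p q"
    proof safe
      fix t :: real assume "t \<in> {0..1}"
      moreover have "p + t *\<^sub>R (q - p) = (1 - t) *\<^sub>R p + t *\<^sub>R q" by (simp add: algebra_simps)
      ultimately show "p + t *\<^sub>R (q - p) \<in> closed_segment p q" unfolding in_segment by (intro exI[of _ t]) auto
    qed
  qed
  obtain t where "0 < t" "t < 1" "k 1 - k 0 = (\<lambda>s. gr f (p + t *\<^sub>R (q - p)) \<bullet> (s *\<^sub>R (q - p))) (1 - 0)"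
  proof (rule mvt[OF zero_less_one kc])
    fix t :: real assume t: "0 < t" "t < 1"
    have 1: "((\<lambda>t. p + t *\<^sub>R (q - p)) has_derivative (\<lambda>s. s *\<^sub>R (q - p))) (at t)" by (auto intro!: derivative_eq_intros)
    show "(k has_derivative (\<lambda>s. gr f (p + t *\<^sub>R (q - p)) \<bullet> (s *\<^sub>R (q - p)))) (at t)" unfolding k_def
      by (rule has_derivative_compose[OF 1 gr_deriv[OF d[OF t]]])
  qed
  then show ?thesis by (intro exI[of _ t]) (simp add: k_def)
qed

definition c1_closure :: "'a::euclidean_space set \<Rightarrow> ('a \<Rightarrow> real) \<Rightarrow> ('a \<Rightarrow> 'a) \<Rightarrow> bool" where
  "c1_closure Om V W \<longleftrightarrow> ck 1 Om V \<and> continuous_on (closure Om) V \<and> continuous_on (closure Om) W \<and> (\<forall>x\<in>Om. gr V x = W x)"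

lemma segment_estimate:
  assumes V: "c1_closure Om V W" and pq: "p \<in> closure Om" "q \<in> closure Om"
    and seg: "\<And>t. 0 < t ==> t < 1 ==> p + t *\<^sub>R (q - p) \<in> Om"
    and B: "\<And>t. 0 < t ==> t < 1 ==> norm (W (p + t *\<^sub>R (q - p)) - g) \<le> B"
  shows "\<bar>V q - V p - g \<bullet> (q - p)\<bar> \<le> B * norm (q - p)"
proof -
  have "closed_segment p q \<subseteq> closure Om"
  proof
    fix x assume "x \<in> closed_segment p q"
    then obtain t where t: "0 \<le> t" "t \<le> 1" "x = p + t *\<^sub>R (q - p)" by (auto simp: in_segment algebra_simps)
    then consider "t = 0" | "t = 1" | "0 < t" "t < 1" by linarith
    then show "x \<in> closure Om" using t pq seg[of t] closure_subset by cases auto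
  qed
  then have "continuous_on (closed_segment p q) V" using V continuous_on_subset unfolding c1_closure_def by blast
  moreover have "V differentiable (at (p + t *\<^sub>R (q - p)))" if "0 < t" "t < 1" for t
    using V seg[OF that] by (simp add: c1_closure_def)
  ultimately obtain t where t: "0 < t" "t < 1" "V q - V p = gr V (p + t *\<^sub>R (q - p)) \<bullet> (q - p)"
    using segment_mvt[of p q V] by blast
  have "V q - V p - g \<bullet> (q - p) = (W (p + t *\<^sub>R (q - p)) - g) \<bullet> (q - p)"
    using t(3) V seg[OF t(1,2)] by (simp add: c1_closure_def inner_diff_left)
  also have "\<bar>...\<bar> \<le> norm (W (p + t *\<^sub>R (q - p)) - g) * norm (q - p)" by (rule Cauchy_Schwarz_ineq2)
  also have "... \<le> B * norm (q - p)" by (intro mult_right_mono B t) simp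
  finally show ?thesis .
qed

text \<open>A cone condition uniform near \<open>x0\<close>. The base point \<open>y\<close> may lie
  outside the closure, as happens for points of a segment between two closure points.\<close>

definition inner_cone :: "'a::euclidean_space set \<Rightarrow> 'a \<Rightarrow> 'a \<Rightarrow> real \<Rightarrow> bool" where
  "inner_cone Om x0 n R \<longleftrightarrow> norm n = 1 \<and> R > 0 \<and> (\<forall>x y t. x \<in> closure Om \<longrightarrow> x \<in> ball x0 R \<longrightarrow> y \<in> ball x0 R \<longrightarrow>
     4 * dist x y < t \<longrightarrow> t < R \<longrightarrow> y - t *\<^sub>R n \<in> Om)"

text \<open>Close to \<open>x0\<close> the function \<open>r\<close> falls along \<open>- n\<close>
  at a rate of at least \<open>m\<close> and has Lipschitz constant \<open>4 * m\<close>, whence the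
  ratio 4 between \<open>t\<close> and the distance.\<close>

lemma inner_cone_exists:
  assumes ld: "local_defining_function Om U r" and op: "open Om" and x0: "x0 \<in> U"
  shows "\<exists>n R. inner_cone Om x0 n R"
proof -
  note p = local_defining_function_props[OF ld op]
  have r1: "ck 1 U r" by (rule p)
  define m where "m = norm (gr r x0) / 2"
  have m: "m > 0" using p(3)[OF x0] by (simp add: m_def)
  define n where "n = gr r x0 /\<^sub>R norm (gr r x0)"
  have n1: "norm n = 1" using p(3)[OF x0] by (simp add: n_def)
  have gn: "gr r x0 \<bullet> n = 2 * m" using p(3)[OF x0] by (simp add: n_def m_def dot_square_norm power2_eq_square)
  have gc: "continuous_on U (gr r)" by (rule ck_cont[OF ck_gr[OF p(1), of 0]]) (use p(2)[of 1] in simp)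
  have "open (U \<inter> (\<lambda>x. gr r x - gr r x0) -` ball 0 m)"
    by (intro continuous_open_preimage p(1) continuous_intros gc) simp
  moreover have "x0 \<in> U \<inter> (\<lambda>x. gr r x - gr r x0) -` ball 0 m" using x0 m by simp
  ultimately obtain R where R: "R > 0" "ball x0 R \<subseteq> U \<inter> (\<lambda>x. gr r x - gr r x0) -` ball 0 m" using open_contains_ball by blast
  have gb: "gr r w \<bullet> n \<ge> m" "norm (gr r w) \<le> 4 * m" if "w \<in> ball x0 R" for w
  proof -
    have d: "norm (gr r w - gr r x0) < m" using R(2) that by auto
    have "\<bar>(gr r w - gr r x0) \<bullet> n\<bar> \<le> norm (gr r w - gr r x0) * norm n" by (rule Cauchy_Schwarz_ineq2)
    then show "gr r w \<bullet> n \<ge> m" using d gn n1 by (simp add: inner_diff_left)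
    have "norm (gr r w) \<le> norm (gr r x0) + norm (gr r w - gr r x0)" using norm_triangle_ineq[of "gr r x0" "gr r w - gr r x0"] by simp
    then show "norm (gr r w) \<le> 4 * m" using d m m_def by linarith
  qed
  have dif: "r differentiable (at w)" if "w \<in> ball x0 R" for w using r1 R(2) that by auto
  have rc: "continuous_on (ball x0 R) r" by (rule continuous_on_subset[OF ck_cont[OF r1]]) (use R(2) in auto)
  have mv: "\<exists>w\<in>ball x0 R. r b - r a = gr r w \<bullet> (b - a)" if ab: "a \<in> ball x0 R" "b \<in> ball x0 R" for a b
  proof -
    have s: "closed_segment a b \<subseteq> ball x0 R" using ab closed_segment_subset convex_ball by blast
    have in_s: "a + t *\<^sub>R (b - a) \<in> ball x0 R" if "0 < t" "t < 1" for t
    proof -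
      have "a + t *\<^sub>R (b - a) = (1 - t) *\<^sub>R a + t *\<^sub>R b" by (simp add: algebra_simps)
      then have "a + t *\<^sub>R (b - a) \<in> closed_segment a b" unfolding in_segment using that by (intro exI[of _ t]) auto
      then show ?thesis using s by blast
    qed
    obtain t where "0 < t" "t < 1" "r b - r a = gr r (a + t *\<^sub>R (b - a)) \<bullet> (b - a)"
      using segment_mvt[OF continuous_on_subset[OF rc s] dif[OF in_s]] by blast
    then show ?thesis using in_s by blast
  qed
  have "y - t *\<^sub>R n \<in> Om" if x: "x \<in> closure Om" "x \<in> ball x0 (R / 2)" and y: "y \<in> ball x0 (R / 2)" and t: "4 * dist x y < t" "t < R / 2" for x y t
  proof -
    have b: "x \<in> ball x0 R" "y \<in> ball x0 R" using x y R by auto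
    have "dist x0 (y - t *\<^sub>R n) \<le> dist x0 y + norm (t *\<^sub>R n)" using norm_triangle_ineq[of "x0 - y" "t *\<^sub>R n"] by (simp add: dist_norm algebra_simps)
    moreover have "t > 0" using t(1) zero_le_dist[of x y] by linarith
    ultimately have b3: "y - t *\<^sub>R n \<in> ball x0 R" using y t n1 by simp
    have "x \<in> U" using b R by auto
    have rx: "r x \<le> 0"
    proof (cases "x \<in> Om")
      case True then show ?thesis using p(4)[OF \<open>x \<in> U\<close>] by simp
    next
      case False
      then have "x \<in> frontier Om" using x op by (simp add: frontier_def interior_open)
      then show ?thesis using p(5)[OF \<open>x \<in> U\<close>] by simp
    qed
    obtain w where w: "w \<in> ball x0 R" "r y - r x = gr r w \<bullet> (y - x)" using mv[OF b] by blast
    have "\<bar>gr r w \<bullet> (y - x)\<bar> \<le> norm (gr r w) * norm (y - x)" by (rule Cauchy_Schwarz_ineq2)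
    also have "... \<le> 4 * m * norm (y - x)" using gb(2)[OF w(1)] by (intro mult_right_mono) auto
    finally have ry: "r y - r x \<le> m * (4 * dist x y)" using w(2) by (simp add: dist_norm norm_minus_commute mult_ac)
    obtain w' where w': "w' \<in> ball x0 R" "r (y - t *\<^sub>R n) - r y = gr r w' \<bullet> ((y - t *\<^sub>R n) - y)" using mv[OF b(2) b3] by blast
    have "t * m \<le> t * (gr r w' \<bullet> n)" using gb(1)[OF w'(1)] \<open>t > 0\<close> by (intro mult_left_mono) auto
    then have "r (y - t *\<^sub>R n) - r y \<le> - (m * t)" using w'(2) by (simp add: mult.commute)
    moreover have "m * (4 * dist x y) < m * t" using t m by simp
    ultimately have "r (y - t *\<^sub>R n) < 0" using rx ry by linarith
    then show ?thesis using p(4)[of "y - t *\<^sub>R n"] b3 R(2) by auto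
  qed
  then have "inner_cone Om x0 n (R / 2)" unfolding inner_cone_def using n1 R(1) by auto
  then show ?thesis by blast
qed

text \<open>The segment from \<open>x\<close> to \<open>z\<close> may leave \<open>Om\<close>. It is
  replaced by a path that moves inwards by \<open>5 * s\<close>, across by \<open>s\<close>, and
  back by \<open>5 * s\<close>, with \<open>s\<close> the distance: its length is
  \<open>11 * s\<close>, and it stays within \<open>12 * s\<close> of \<open>x\<close>.\<close>

lemma quasiconvex_estimate:
  assumes V: "c1_closure Om V W" and cone: "inner_cone Om x0 n R"
    and x: "x \<in> closure Om" "x \<in> ball x0 R" and z: "z \<in> closure Om" "z \<in> ball x0 R" and s: "5 * dist x z < R"
    and B: "\<And>w. w \<in> Om ==> dist x w \<le> 12 * dist x z ==> norm (W w - g) \<le> B"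
  shows "\<bar>V z - V x - g \<bullet> (z - x)\<bar> \<le> 11 * B * dist x z"
proof (cases "x = z")
  case False
  define s where "s = dist x z"
  define p1 p2 where "p1 = x - (5 * s) *\<^sub>R n" and "p2 = z - (5 * s) *\<^sub>R n"
  have s0: "s > 0" using False by (simp add: s_def)
  have n1: "norm n = 1" and C: "\<And>x y t. x \<in> closure Om ==> x \<in> ball x0 R ==> y \<in> ball x0 R ==> 4 * dist x y < t ==> t < R ==> y - t *\<^sub>R n \<in> Om"
    using cone unfolding inner_cone_def by blast+
  have sR: "5 * s < R" using s by (simp add: s_def)
  have down: "a + t *\<^sub>R ((a - (5 * s) *\<^sub>R n) - a) \<in> Om" "dist a (a + t *\<^sub>R ((a - (5 * s) *\<^sub>R n) - a)) \<le> 5 * s"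
    if a: "a \<in> closure Om" "a \<in> ball x0 R" and t: "0 < t" "t < 1" for a t
  proof -
    have e: "a + t *\<^sub>R ((a - (5 * s) *\<^sub>R n) - a) = a - (t * (5 * s)) *\<^sub>R n" by simp
    have le: "t * (5 * s) \<le> 5 * s" using t s0 by simp
    show "a + t *\<^sub>R ((a - (5 * s) *\<^sub>R n) - a) \<in> Om" unfolding e
    proof (rule C[OF a a(2)])
      show "4 * dist a a < t * (5 * s)" using t s0 by simp
      show "t * (5 * s) < R" using le sR by linarith
    qed
    show "dist a (a + t *\<^sub>R ((a - (5 * s) *\<^sub>R n) - a)) \<le> 5 * s" unfolding e using t s0 le by (simp add: dist_norm n1)
  qed
  have across: "(x + t *\<^sub>R (z - x)) - (5 * s) *\<^sub>R n \<in> Om" "dist x ((x + t *\<^sub>R (z - x)) - (5 * s) *\<^sub>R n) \<le> 6 * s"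
    if t: "0 \<le> t" "t \<le> 1" for t
  proof -
    have e: "x + t *\<^sub>R (z - x) = (1 - t) *\<^sub>R x + t *\<^sub>R z" by (simp add: algebra_simps)
    have "x + t *\<^sub>R (z - x) \<in> ball x0 R" unfolding e using t x(2) z(2) by (intro convexD convex_ball) auto
    moreover have d: "dist x (x + t *\<^sub>R (z - x)) = t * s" using t by (simp add: dist_norm s_def norm_minus_commute)
    moreover have ts: "t * s \<le> s" using t s0 by simp
    ultimately show "(x + t *\<^sub>R (z - x)) - (5 * s) *\<^sub>R n \<in> Om" using s0 sR by (intro C[OF x]) auto
    have "dist x ((x + t *\<^sub>R (z - x)) - (5 * s) *\<^sub>R n) \<le> dist x (x + t *\<^sub>R (z - x)) + norm ((5 * s) *\<^sub>R n)"
      using norm_triangle_ineq[of "x - (x + t *\<^sub>R (z - x))" "(5 * s) *\<^sub>R n"] by (simp add: dist_norm algebra_simps)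
    moreover have "norm ((5 * s) *\<^sub>R n) = 5 * s" using s0 n1 by simp
    ultimately show "dist x ((x + t *\<^sub>R (z - x)) - (5 * s) *\<^sub>R n) \<le> 6 * s" using d ts by linarith
  qed
  have p12: "p1 \<in> Om" "p2 \<in> Om" using across(1)[of 0] across(1)[of 1] by (simp_all add: p1_def p2_def)
  then have cl: "p1 \<in> closure Om" "p2 \<in> closure Om" using closure_subset by auto
  have B': "norm (W w - g) \<le> B" if "w \<in> Om" "dist x w \<le> 12 * s" for w using B[OF that(1)] that(2) by (simp add: s_def)
  have 1: "\<bar>V p1 - V x - g \<bullet> (p1 - x)\<bar> \<le> B * norm (p1 - x)"
  proof (rule segment_estimate[OF V x(1) cl(1)])
    fix t :: real assume t: "0 < t" "t < 1"
    show in1: "x + t *\<^sub>R (p1 - x) \<in> Om" unfolding p1_def by (rule down(1)[OF x t])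
    show "norm (W (x + t *\<^sub>R (p1 - x)) - g) \<le> B"
      by (rule B'[OF in1]) (use down(2)[OF x t] s0 in \<open>simp add: p1_def\<close>)
  qed
  have 3: "\<bar>V p2 - V z - g \<bullet> (p2 - z)\<bar> \<le> B * norm (p2 - z)"
  proof (rule segment_estimate[OF V z(1) cl(2)])
    fix t :: real assume t: "0 < t" "t < 1"
    show in1: "z + t *\<^sub>R (p2 - z) \<in> Om" unfolding p2_def by (rule down(1)[OF z t])
    have "dist z (z + t *\<^sub>R (p2 - z)) \<le> 5 * s" unfolding p2_def by (rule down(2)[OF z t])
    then have "dist x (z + t *\<^sub>R (p2 - z)) \<le> 12 * s" using dist_triangle[of x "z + t *\<^sub>R (p2 - z)" z] s0 unfolding s_def by linarith
    then show "norm (W (z + t *\<^sub>R (p2 - z)) - g) \<le> B" by (rule B'[OF in1])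
  qed
  have 2: "\<bar>V p2 - V p1 - g \<bullet> (p2 - p1)\<bar> \<le> B * norm (p2 - p1)"
  proof (rule segment_estimate[OF V cl])
    fix t :: real assume t: "0 < t" "t < 1"
    have e: "p1 + t *\<^sub>R (p2 - p1) = (x + t *\<^sub>R (z - x)) - (5 * s) *\<^sub>R n" by (simp add: p1_def p2_def algebra_simps)
    show in1: "p1 + t *\<^sub>R (p2 - p1) \<in> Om" unfolding e by (rule across(1)) (use t in auto)
    show "norm (W (p1 + t *\<^sub>R (p2 - p1)) - g) \<le> B"
      by (rule B'[OF in1]) (use across(2)[of t] t s0 in \<open>simp add: e\<close>)
  qed
  have nn: "norm (p1 - x) = 5 * s" "norm (p2 - z) = 5 * s" "norm (p2 - p1) = s"
    using s0 n1 by (simp_all add: p1_def p2_def s_def dist_norm norm_minus_commute)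
  have "V z - V x - g \<bullet> (z - x) = (V p1 - V x - g \<bullet> (p1 - x)) + (V p2 - V p1 - g \<bullet> (p2 - p1)) - (V p2 - V z - g \<bullet> (p2 - z))"
    by (simp add: inner_diff_right)
  then have "\<bar>V z - V x - g \<bullet> (z - x)\<bar> \<le> B * (5 * s) + B * s + B * (5 * s)" using 1 2 3 unfolding nn by linarith
  then show ?thesis by (simp add: s_def)
qed simp

text \<open>The extended gradient is a derivative relative to the closure. This gives a chain rule
  for charts of the frontier, along which two-sided derivatives of \<open>V\<close> make no
  sense.\<close>

lemma frontier_derivative:
  assumes V: "c1_closure Om V W" and cone: "inner_cone Om x n R" and x: "x \<in> closure Om"
  shows "(V has_derivative (\<lambda>h. W x \<bullet> h)) (at x within closure Om)"
  unfolding has_derivative_within_alt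
proof (intro conjI allI impI)
  show "bounded_linear (\<lambda>h. W x \<bullet> h)" by (rule bounded_linear_inner_right)
  fix e :: real assume e: "e > 0"
  have R: "R > 0" using cone by (simp add: inner_cone_def)
  have "continuous_on (closure Om) W" using V by (simp add: c1_closure_def)
  then obtain d where d: "d > 0" "\<And>w. w \<in> closure Om ==> dist w x < d ==> dist (W w) (W x) < e / 11"
    using x e unfolding continuous_on_iff by (metis zero_less_divide_iff zero_less_numeral)
  show "\<exists>d>0. \<forall>z\<in>closure Om. norm (z - x) < d \<longrightarrow> norm (V z - V x - W x \<bullet> (z - x)) \<le> e * norm (z - x)"
  proof (intro exI[of _ "min (d / 13) (R / 5)"] conjI ballI impI)
    show "min (d / 13) (R / 5) > 0" using d R by simp
    fix z assume z: "z \<in> closure Om" "norm (z - x) < min (d / 13) (R / 5)"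
    then have dz: "dist x z < d / 13" "dist x z < R / 5" by (auto simp: dist_norm norm_minus_commute)
    have "\<bar>V z - V x - W x \<bullet> (z - x)\<bar> \<le> 11 * (e / 11) * dist x z"
    proof (rule quasiconvex_estimate[OF V cone x _ z(1)])
      fix w assume w: "w \<in> Om" "dist x w \<le> 12 * dist x z"
      then have "dist w x < d" using dz d(1) by (simp add: dist_commute)
      then show "norm (W w - W x) \<le> e / 11" using d(2)[of w] w(1) closure_subset by (force simp: dist_norm)
    qed (use R dz in auto)
    then show "norm (V z - V x - W x \<bullet> (z - x)) \<le> e * norm (z - x)" by (simp add: dist_norm norm_minus_commute)
  qed
qed

text \<open>By counting dimensions, \<open>n\<close> and the image of \<open>L\<close> span the
  whole space; the difference of both sides is orthogonal to all of it.\<close>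

lemma normal_space:
  fixes L :: "'b::euclidean_space \<Rightarrow> 'a::euclidean_space"
  assumes L: "linear L" "inj L" and dim: "DIM('b) + 1 = DIM('a)" and n: "n \<bullet> n = 1" "\<And>h. n \<bullet> L h = 0"
    and v: "\<And>b. b \<in> Basis ==> v \<bullet> L b = 0"
  shows "v = (v \<bullet> n) *\<^sub>R n"
proof -
  define w where "w = v - (v \<bullet> n) *\<^sub>R n"
  have sub: "subspace (range L)" using L(1) linear_subspace_image subspace_UNIV by blast
  have "n \<notin> range L" using n by (metis imageE zero_neq_one)
  then have ns: "n \<notin> span (range L)" using sub by (metis span_eq_iff)
  have "dim (range L) = DIM('b)" using dim_image_eq[OF L(1), of UNIV] L(2) by simp
  then have "dim (insert n (range L)) = DIM('a)" using ns dim by (simp add: dim_insert)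
  then have full: "span (insert n (range L)) = UNIV" by (simp add: dim_eq_full)
  have vL: "v \<bullet> L h = 0" for h
  proof -
    have "L h = (\<Sum>b\<in>Basis. (h \<bullet> b) *\<^sub>R L b)" by (rule linear_Basis_sum[OF L(1)])
    then show ?thesis using v by (simp add: inner_sum_right)
  qed
  have "orthogonal w x" if "x \<in> insert n (range L)" for x
    using that n vL by (auto simp: orthogonal_def w_def inner_diff_left)
  then have "orthogonal w w" using orthogonal_to_span[of w "insert n (range L)" w] full by blast
  then show ?thesis by (simp add: orthogonal_def w_def)
qed

section \<open>From tangential derivatives to the full jet\<close>

lemma inner_Basis_combination:
  "(\<Sum>e\<in>Basis. f e *\<^sub>R e) \<bullet> v = (\<Sum>e\<in>Basis. (v \<bullet> e) * f e)" for v :: "'a::euclidean_space"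
  unfolding inner_sum_left by (rule sum.cong) (simp_all add: inner_commute mult.commute)

lemma continuous_eq_closure:
  fixes f g :: "'a::euclidean_space \<Rightarrow> real"
  assumes "continuous_on (closure S) f" "continuous_on (closure S) g" "\<And>x. x \<in> S ==> f x = g x" "x \<in> closure S"
  shows "f x = g x"
proof -
  have "continuous_on (closure S) (\<lambda>x. f x - g x)" by (intro continuous_intros assms)
  from continuous_constant_on_closure[OF this, of 0 x] show ?thesis using assms by simp
qed

text \<open>\<open>E vs\<close> extends the derivative \<open>iter_deriv vs u\<close> to the
  closure. The smooth local function \<open>r\<close> takes the place of \<open>rho\<close>, whose
  limited smoothness would bound the order of the jets.\<close>

locale boundary_jets =
  fixes Om U :: "'a::euclidean_space set" and r u :: "'a \<Rightarrow> real" and E :: "'a list \<Rightarrow> 'a \<Rightarrow> real" and sig :: real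
    and W :: "'b::euclidean_space set" and phi :: "'b \<Rightarrow> 'a" and y0 :: 'b and l :: nat
  assumes op: "open Om" and ld: "local_defining_function Om U r" and su: "smooth_on Om u"
    and Ec: "\<And>vs. vs \<in> lists Basis ==> continuous_on (closure Om) (E vs)"
    and EO: "\<And>vs x. vs \<in> lists Basis ==> x \<in> Om ==> E vs x = iter_deriv vs u x" and E0: "E [] = u"
    and harm: "\<And>x. x \<in> Om ==> lap u x = 0"
    and nb: "\<And>x. x \<in> frontier Om ==> x \<in> U ==> (\<Sum>e\<in>Basis. (gr r x \<bullet> e) * E [e] x) = sig * norm (gr r x) * u x"
    and par: "local_parametrization (frontier Om) W phi" and y0: "y0 \<in> W" "phi y0 \<in> U"
    and dim: "DIM('b) + 1 = DIM('a)" and zero: "vanishes_to_order l (u \<circ> phi) y0"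
begin

lemma par': "open W" "smooth_on W phi" "inj (fd phi y0)" "\<And>y. y \<in> W ==> phi y \<in> frontier Om"
  using par y0(1) openin_imp_subset unfolding local_parametrization_def by blast+

lemmas rp = local_defining_function_props[OF ld op]

definition "S = W \<inter> phi -` U"

lemma S: "open S" "y0 \<in> S" "S \<subseteq> W"
proof -
  have "continuous_on W phi" using smooth_on_ck[OF par'(2), of 0] by simp
  then show "open S" unfolding S_def by (intro continuous_open_preimage par' rp)
  show "y0 \<in> S" "S \<subseteq> W" using y0 by (auto simp: S_def)
qed

lemma phi_ck: "ck k S phi" using ck_subset[OF smooth_on_ck[OF par'(2)] S(3)] .

lemma phi_S: "y \<in> S ==> phi y \<in> frontier Om" "y \<in> S ==> phi y \<in> U" "y \<in> S ==> phi y \<in> closure Om"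
  using par'(4) by (auto simp: S_def frontier_def)

lemma iter_ck: "vs \<in> lists Basis ==> ck k Om (iter_deriv vs u)" by (rule smooth_on_iter_deriv[OF su])

lemma E_c1:
  assumes vs: "vs \<in> lists Basis"
  shows "c1_closure Om (E vs) (\<lambda>x. \<Sum>e\<in>Basis. E (e # vs) x *\<^sub>R e)"
  unfolding c1_closure_def
proof (intro conjI ballI)
  show "ck 1 Om (E vs)" by (rule ck_cong[OF op _ iter_ck[OF vs]]) (simp add: EO vs)
  show "continuous_on (closure Om) (\<lambda>x. \<Sum>e\<in>Basis. E (e # vs) x *\<^sub>R e)"
    by (intro continuous_intros Ec) (use vs in auto)
  fix x assume x: "x \<in> Om"
  have "fd (E vs) x = fd (iter_deriv vs u) x" by (rule fd_cong_open[OF op x]) (simp add: EO vs)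
  then have "fd (E vs) x e = E (e # vs) x" if "e \<in> Basis" for e using EO[of "e # vs" x] vs that x by simp
  then show "gr (E vs) x = (\<Sum>e\<in>Basis. E (e # vs) x *\<^sub>R e)" unfolding gr_def by simp
qed (rule Ec[OF vs])

definition "F vs y = E vs (phi y)"

text \<open>The chain rule through the chart: \<open>phi\<close> maps into the frontier, so the
  derivative of \<open>E vs\<close> relative to the closure is the one that matters.\<close>

lemma F_deriv:
  assumes vs: "vs \<in> lists Basis" and y: "y \<in> S"
  shows "(F vs has_derivative (\<lambda>h. \<Sum>e\<in>Basis. (fd phi y h \<bullet> e) * F (e # vs) y)) (at y)"
proof -
  obtain n R where cone: "inner_cone Om (phi y) n R" using inner_cone_exists[OF ld op phi_S(2)[OF y]] by blast
  have 1: "(E vs has_derivative (\<lambda>h. (\<Sum>e\<in>Basis. E (e # vs) (phi y) *\<^sub>R e) \<bullet> h)) (at (phi y) within closure Om)"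
    by (rule frontier_derivative[OF E_c1[OF vs] cone phi_S(3)[OF y]])
  have 2: "(E vs has_derivative (\<lambda>h. (\<Sum>e\<in>Basis. E (e # vs) (phi y) *\<^sub>R e) \<bullet> h)) (at (phi y) within phi ` S)"
    by (rule has_derivative_subset[OF 1]) (use phi_S(3) in auto)
  have 3: "(phi has_derivative fd phi y) (at y within S)"
    by (rule has_derivative_at_withinI) (rule ck_diff[OF phi_ck[of "Suc 0"] y])
  have "((\<lambda>y. E vs (phi y)) has_derivative (\<lambda>h. (\<Sum>e\<in>Basis. E (e # vs) (phi y) *\<^sub>R e) \<bullet> fd phi y h)) (at y within S)"
    by (rule has_derivative_in_compose[OF 3 2])
  then have "((\<lambda>y. E vs (phi y)) has_derivative (\<lambda>h. (\<Sum>e\<in>Basis. E (e # vs) (phi y) *\<^sub>R e) \<bullet> fd phi y h)) (at y)"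
    using at_within_open[OF y S(1)] by simp
  then show ?thesis unfolding F_def[abs_def]
    by (rule has_derivative_eq_rhs) (simp only: inner_Basis_combination F_def)
qed

lemma fd_phi_ck: "b \<in> Basis ==> ck k S (\<lambda>y. fd phi y b \<bullet> e)"
  by (intro ck_inner S ck_const) (use phi_ck[of "Suc k"] in simp)

lemma F_ck: "vs \<in> lists Basis ==> ck k S (F vs)"
proof (induction k arbitrary: vs)
  case 0
  have "isCont (F vs) y" if "y \<in> S" for y using has_derivative_continuous[OF F_deriv[OF 0 that]] .
  then show ?case by (auto intro: continuous_at_imp_continuous_on)
next
  case (Suc k)
  show ?case
  proof (rule ck_Suc_openI[OF S(1) F_deriv[OF Suc.prems]])
    fix b :: 'b assume b: "b \<in> Basis"
    show "ck k S (\<lambda>x. \<Sum>e\<in>Basis. fd phi x b \<bullet> e * F (e # vs) x)"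
      by (intro ck_sum ck_mult S fd_phi_ck[OF b] Suc.IH) (use Suc.prems in auto)
  qed
qed

lemma F_fd: "vs \<in> lists Basis ==> y \<in> S ==> fd (F vs) y b = (\<Sum>e\<in>Basis. (fd phi y b \<bullet> e) * F (e # vs) y)"
  using fd_eqI[OF F_deriv] by simp

lemma E_swap:
  assumes "vs \<in> lists Basis" "a \<in> Basis" "b \<in> Basis" "x \<in> closure Om"
  shows "E (a # b # vs) x = E (b # a # vs) x"
proof (rule continuous_eq_closure[OF Ec Ec _ assms(4)])
  fix x assume x: "x \<in> Om"
  have "fd (\<lambda>y. fd (iter_deriv vs u) y b) x a = fd (\<lambda>y. fd (iter_deriv vs u) y a) x b"
    by (rule fd_commute[OF op iter_ck[OF assms(1)] x])
  then show "E (a # b # vs) x = E (b # a # vs) x" using EO assms x by simp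
qed (use assms in auto)

lemma lap_iter: "vs \<in> lists Basis ==> x \<in> Om ==> lap (iter_deriv vs u) x = 0"
proof (induction vs arbitrary: x)
  case Nil
  then show ?case using harm by simp
next
  case (Cons b vs)
  have "lap (\<lambda>y. fd (iter_deriv vs u) y b) x = 0"
    by (rule lap_fd[OF op iter_ck Cons.prems(2) Cons.IH]) (use Cons.prems in auto)
  then show ?case by simp
qed

lemma E_trace:
  assumes "vs \<in> lists Basis" "x \<in> closure Om"
  shows "(\<Sum>e\<in>Basis. E (e # e # vs) x) = 0"
proof -
  have "(\<lambda>x. \<Sum>e\<in>Basis. E (e # e # vs) x) x = (\<lambda>_. 0) x"
  proof (rule continuous_eq_closure[OF _ _ _ assms(2)])
    show "continuous_on (closure Om) (\<lambda>x. \<Sum>e\<in>Basis. E (e # e # vs) x)" by (intro continuous_intros Ec) (use assms in auto)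
    fix x assume x: "x \<in> Om"
    have "(\<Sum>e\<in>Basis. E (e # e # vs) x) = (\<Sum>e\<in>Basis. fd (\<lambda>y. fd (iter_deriv vs u) y e) x e)"
      by (rule sum.cong[OF refl]) (use EO assms x in simp)
    also have "... = lap (iter_deriv vs u) x" by (rule lap_alt[OF op iter_ck[OF assms(1)] x, symmetric])
    finally show "(\<Sum>e\<in>Basis. E (e # e # vs) x) = 0" using lap_iter[OF assms(1) x] by simp
  qed simp
  then show ?thesis by simp
qed

abbreviation "x0 \<equiv> phi y0"
definition "nu = gr r x0 /\<^sub>R norm (gr r x0)"

lemma nu: "nu \<bullet> nu = 1" "nu \<bullet> fd phi y0 h = 0" "gr r x0 = norm (gr r x0) *\<^sub>R nu"
proof -
  have g: "gr r x0 \<noteq> 0" by (rule rp(3)[OF y0(2)])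
  then show "nu \<bullet> nu = 1" "gr r x0 = norm (gr r x0) *\<^sub>R nu" by (simp_all add: nu_def dot_square_norm)
  have "r differentiable (at x0)" using rp(2)[of 1] y0(2) by simp
  then have "((\<lambda>y. r (phi y)) has_derivative (\<lambda>h. gr r x0 \<bullet> fd phi y0 h)) (at y0)"
    by (intro has_derivative_compose[OF ck_diff[OF phi_ck[of "Suc 0"] S(2)]] gr_deriv)
  moreover have "((\<lambda>y. r (phi y)) has_derivative (\<lambda>h. 0)) (at y0)"
    by (rule has_derivative_transform_within_open[OF has_derivative_const[of 0] S(1,2)])
       (use rp(5) phi_S in auto)
  ultimately have "(\<lambda>h. gr r x0 \<bullet> fd phi y0 h) = (\<lambda>h. 0)" by (rule has_derivative_unique)
  then show "nu \<bullet> fd phi y0 h = 0" by (metis g nu_def inner_scaleR_left mult_zero_right)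
qed

lemma lin: "linear (fd phi y0)"
  using ck_diff[OF phi_ck[of "Suc 0"] S(2)] has_derivative_linear by blast

lemmas normal = normal_space[OF lin par'(3) dim nu(1,2)]

text \<open>The first derivatives solve a linear system: the rows \<open>Some b\<close> are the
  tangential derivatives of \<open>u\<close>, the row \<open>None\<close> is the Robin condition. At
  \<open>y0\<close> the tangent directions and the normal together admit the zero solution
  alone.\<close>

lemma jet_step1:
  assumes v: "van y0 (Suc k) (F [])" and e: "e \<in> Basis"
  shows "van y0 k (F [e])"
proof -
  define M where "M i e y = (case i of Some b \<Rightarrow> fd phi y b \<bullet> e | None \<Rightarrow> gr r (phi y) \<bullet> e)" for i e y
  have rc: "ck k S (\<lambda>y. gr r (phi y))"
    by (rule ck_compose[OF S(1) rp(1) ck_gr[OF rp(1) rp(2)] phi_ck]) (use phi_S in auto)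
  show ?thesis
  proof (rule van_solve[OF S(1,2), where I="Some ` Basis \<union> {None}" and J=Basis and M=M and x="\<lambda>e. F [e]"])
    show "ck k S (M i e)" if "i \<in> Some ` Basis \<union> {None}" "e \<in> Basis" for i e
      using that by (auto simp: M_def[abs_def] intro!: fd_phi_ck ck_inner rc S)
    show "ck k S (F [e])" if "e \<in> Basis" for e using that by (intro F_ck) auto
    show "van y0 k (\<lambda>y. \<Sum>e\<in>Basis. M i e y * F [e] y)" if i: "i \<in> Some ` Basis \<union> {None}" for i
    proof (cases i)
      case (Some b)
      then have b: "b \<in> Basis" using i by auto
      have "van y0 k (\<lambda>y. fd (F []) y b)" using v b by simp
      then show ?thesis by (rule van_cong_open[OF S(1,2), rotated]) (simp add: F_fd Some M_def)
    next
      case None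
      have fc: "ck k S (F [])" by (rule F_ck) simp
      \<comment> \<open>The norm is written as a power of the inner product, which makes it of class
        \<open>k\<close> because the gradient of \<open>r\<close> has no zero.\<close>
      have nc: "ck k S (\<lambda>y. sig * ((gr r (phi y) \<bullet> gr r (phi y)) powr (1/2)))"
        by (intro ck_mult ck_const ck_powr ck_inner rc S) (use rp(3) phi_S in auto)
      have "van y0 k (\<lambda>y. (sig * ((gr r (phi y) \<bullet> gr r (phi y)) powr (1/2))) * F [] y)"
        by (rule van_mult[OF S(1,2) nc fc van_Suc_imp[OF v]])
      then show ?thesis
      proof (rule van_cong_open[OF S(1,2), rotated])
        fix y assume y: "y \<in> S"
        have "(gr r (phi y) \<bullet> gr r (phi y)) powr (1/2) = norm (gr r (phi y))" by (simp add: powr_half_sqrt norm_eq_sqrt_inner)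
        then show "(sig * ((gr r (phi y) \<bullet> gr r (phi y)) powr (1/2))) * F [] y = (\<Sum>e\<in>Basis. M i e y * F [e] y)"
          using nb[OF phi_S(1)[OF y] phi_S(2)[OF y]] by (simp add: None M_def F_def E0)
      qed
    qed
    show "xi e = 0" if xi: "\<And>i. i \<in> Some ` Basis \<union> {None} ==> (\<Sum>e\<in>Basis. M i e y0 * xi e) = 0" and e: "e \<in> Basis" for xi :: "'a \<Rightarrow> real" and e
    proof -
      define w where "w = (\<Sum>e\<in>Basis. xi e *\<^sub>R e)"
      have wi: "w \<bullet> a = (\<Sum>e\<in>Basis. (a \<bullet> e) * xi e)" for a unfolding w_def by (rule inner_Basis_combination)
      have "w = (w \<bullet> nu) *\<^sub>R nu"
      proof (rule normal)
        fix b :: 'b assume "b \<in> Basis"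
        then show "w \<bullet> fd phi y0 b = 0" using xi[of "Some b"] by (simp add: M_def wi)
      qed
      moreover have "w \<bullet> gr r x0 = 0" using xi[of None] by (simp add: M_def wi)
      then have "w \<bullet> nu = 0" by (simp add: nu_def)
      ultimately have "w = 0" by simp
      moreover have "w \<bullet> e = xi e" unfolding w_def by (rule inner_sum_left_Basis[OF e])
      ultimately show "xi e = 0" by simp
    qed
  qed (use e in auto)
qed

text \<open>Each column is orthogonal to the tangent space, hence a multiple of \<open>nu\<close>.
  By symmetry the matrix is then \<open>s\<close> times the projection onto \<open>nu\<close>, and
  its trace is \<open>s\<close>.\<close>

lemma symmetric_traceless_zero:
  fixes a :: "'a \<times> 'a \<Rightarrow> real"
  assumes tan: "\<And>b c. b \<in> Basis ==> c \<in> Basis ==> (\<Sum>e\<in>Basis. (fd phi y0 b \<bullet> e) * a (e, c)) = 0"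
    and sym: "\<And>c d. c \<in> Basis ==> d \<in> Basis ==> a (c, d) = a (d, c)"
    and tr: "(\<Sum>e\<in>Basis. a (e, e)) = 0" and cd: "c \<in> Basis" "d \<in> Basis"
  shows "a (c, d) = 0"
proof -
  define w where "w c = (\<Sum>e\<in>Basis. a (e, c) *\<^sub>R e)" for c
  define alp where "alp c = w c \<bullet> nu" for c
  have wi: "w c \<bullet> v = (\<Sum>e\<in>Basis. (v \<bullet> e) * a (e, c))" for c v unfolding w_def by (rule inner_Basis_combination)
  have wa: "w c = alp c *\<^sub>R nu" if "c \<in> Basis" for c
    unfolding alp_def by (rule normal) (use tan that in \<open>simp add: wi\<close>)
  have aw: "a (e, c) = alp c * (nu \<bullet> e)" if "e \<in> Basis" "c \<in> Basis" for e c
  proof -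
    have "a (e, c) = w c \<bullet> e" unfolding w_def by (rule inner_sum_left_Basis[OF that(1), symmetric])
    then show ?thesis using wa[OF that(2)] by simp
  qed
  define s where "s = (\<Sum>c\<in>Basis. alp c * (nu \<bullet> c))"
  have "s = (\<Sum>e\<in>Basis. a (e, e))" unfolding s_def by (rule sum.cong) (auto simp: aw)
  then have s0: "s = 0" using tr by simp
  have "alp e = 0" if e: "e \<in> Basis" for e
  proof -
    have "alp e = (\<Sum>c\<in>Basis. (nu \<bullet> c) * (alp e * (nu \<bullet> c)))"
    proof -
      have "(\<Sum>c\<in>Basis. (nu \<bullet> c) * (nu \<bullet> c)) = 1" using nu(1) by (simp add: euclidean_inner[of nu nu])
      then have "alp e = alp e * (\<Sum>c\<in>Basis. (nu \<bullet> c) * (nu \<bullet> c))" by simp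
      then show ?thesis by (simp add: sum_distrib_left mult_ac)
    qed
    also have "... = (\<Sum>c\<in>Basis. (nu \<bullet> c) * (alp c * (nu \<bullet> e)))"
      by (rule sum.cong[OF refl]) (use sym e aw in metis)
    also have "... = s * (nu \<bullet> e)" unfolding s_def sum_distrib_right by (rule sum.cong) auto
    finally show ?thesis by (simp add: s0)
  qed
  then show ?thesis using aw[OF cd] cd by simp
qed

text \<open>The second derivatives of the function indexed by \<open>vs\<close> form an unknown
  matrix. Tangential derivatives of the previous level, symmetry and vanishing trace are linear
  equations that determine it. The boundary condition acts at first order, harmonicity from then
  on.\<close>

lemma jet_step:
  assumes vs: "vs \<in> lists Basis" and v: "\<And>e. e \<in> Basis ==> van y0 (Suc k) (F (e # vs))"
    and e: "e \<in> Basis" "e' \<in> Basis"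
  shows "van y0 k (F (e # e' # vs))"
proof -
  \<comment> \<open>Rows of the system: \<open>I1\<close> tangential derivatives, \<open>I2\<close>
    symmetry, \<open>I3\<close> trace. Each row is its own index, so \<open>van_solve\<close> is
    used with the identity for \<open>M\<close>.\<close>
  define I1 where "I1 = (\<lambda>(b, c) (e, e') y. (fd phi y b \<bullet> e) * of_bool (e' = c)) ` (Basis \<times> (Basis :: 'a set))"
  define I2 where "I2 = (\<lambda>(c, d) p (y::'b). of_bool (p = (c, d)) - of_bool (p = (d, c)) :: real) ` (Basis \<times> (Basis :: 'a set))"
  define I3 where "I3 = (\<lambda>(e, e'::'a) (y::'b). of_bool (e = e') :: real)"
  define x where "x = (\<lambda>(e, e'). F (e # e' # vs))"
  have fin: "finite ((Basis::'a set) \<times> (Basis::'a set))" by simp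
  have row1: "(\<Sum>j\<in>Basis \<times> Basis. (case j of (e, e') \<Rightarrow> k e * of_bool (e' = c)) * (z j :: real)) = (\<Sum>e\<in>Basis. k e * z (e, c))"
    if c: "c \<in> (Basis::'a set)" for k :: "'a \<Rightarrow> real" and c z
  proof -
    have "(\<Sum>j\<in>Basis \<times> Basis. (case j of (e, e') \<Rightarrow> k e * of_bool (e' = c)) * z j) = (\<Sum>e\<in>Basis. \<Sum>e'\<in>Basis. (k e * of_bool (e' = c)) * z (e, e'))"
      by (simp add: sum.cartesian_product split_beta)
    also have "... = (\<Sum>e\<in>Basis. k e * z (e, c))"
    proof (rule sum.cong[OF refl])
      fix e :: 'a
      have "(\<Sum>e'\<in>Basis. (k e * of_bool (e' = c)) * z (e, e')) = (\<Sum>e'\<in>Basis. if e' = c then k e * z (e, c) else 0)"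
        by (rule sum.cong) auto
      then show "(\<Sum>e'\<in>Basis. (k e * of_bool (e' = c)) * z (e, e')) = k e * z (e, c)" using c by simp
    qed
    finally show ?thesis .
  qed
  have pick: "(\<Sum>j\<in>Basis \<times> Basis. of_bool (j = p) * (z j :: real)) = z p" if p: "p \<in> (Basis::'a set) \<times> (Basis::'a set)" for p z
  proof -
    have "(\<Sum>j\<in>Basis \<times> Basis. of_bool (j = p) * z j) = (\<Sum>j\<in>Basis \<times> Basis. if j = p then z p else 0)" by (rule sum.cong) auto
    then show ?thesis using p fin by simp
  qed
  have row3: "(\<Sum>j\<in>Basis \<times> Basis. I3 j y * (z j :: real)) = (\<Sum>e\<in>Basis. z (e, e))" for y z
  proof -
    have "(\<Sum>j\<in>Basis \<times> Basis. I3 j y * z j) = (\<Sum>e\<in>Basis. \<Sum>e'\<in>Basis. of_bool (e = e') * z (e, e'))"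
      unfolding sum.cartesian_product I3_def by (rule sum.cong) auto
    also have "... = (\<Sum>e\<in>Basis. z (e, e))"
    proof (rule sum.cong[OF refl])
      fix e :: 'a assume "e \<in> Basis"
      moreover have "(\<Sum>e'\<in>Basis. of_bool (e = e') * z (e, e')) = (\<Sum>e'\<in>Basis. if e' = e then z (e, e) else 0)" by (rule sum.cong) auto
      ultimately show "(\<Sum>e'\<in>Basis. of_bool (e = e') * z (e, e')) = z (e, e)" by simp
    qed
    finally show ?thesis .
  qed
  have "van y0 k (x (e, e'))"
  proof (rule van_solve[OF S(1,2), where I="I1 \<union> I2 \<union> {I3}" and J="Basis \<times> Basis" and M="\<lambda>i. i" and x=x])
    show "ck k S (i j)" if "i \<in> I1 \<union> I2 \<union> {I3}" "j \<in> Basis \<times> Basis" for i j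
      using that unfolding I1_def I2_def I3_def by (auto intro!: ck_mult fd_phi_ck S ck_const split: prod.splits)
    show "ck k S (x j)" if "j \<in> Basis \<times> Basis" for j using that vs by (auto simp: x_def intro!: F_ck)
    show "van y0 k (\<lambda>y. \<Sum>j\<in>Basis \<times> Basis. i j y * x j y)" if i: "i \<in> I1 \<union> I2 \<union> {I3}" for i
    proof -
      consider b c where "b \<in> Basis" "c \<in> Basis" "i = (\<lambda>(e, e') y. (fd phi y b \<bullet> e) * of_bool (e' = c))"
        | c d where "c \<in> Basis" "d \<in> Basis" "i = (\<lambda>p y. of_bool (p = (c, d)) - of_bool (p = (d, c)))" | "i = I3"
        using i by (auto simp: I1_def I2_def)
      then show ?thesis
      proof cases
        case 1
        have "van y0 k (\<lambda>y. fd (F (c # vs)) y b)" using v[OF 1(2)] 1(1) by simp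
        then show ?thesis
        proof (rule van_cong_open[OF S(1,2), rotated])
          fix y assume y: "y \<in> S"
          have "(\<Sum>j\<in>Basis \<times> Basis. i j y * x j y) = (\<Sum>j\<in>Basis \<times> Basis. (case j of (e, e') \<Rightarrow> (fd phi y b \<bullet> e) * of_bool (e' = c)) * x j y)"
            by (rule sum.cong) (auto simp: 1(3))
          also have "... = (\<Sum>e\<in>Basis. (fd phi y b \<bullet> e) * x (e, c) y)" by (rule row1[OF 1(2)])
          finally show "fd (F (c # vs)) y b = (\<Sum>j\<in>Basis \<times> Basis. i j y * x j y)"
            using F_fd[of "c # vs" y b] vs 1(2) y by (simp add: x_def)
        qed
      next
        case 2
        show ?thesis
        proof (rule van_cong_open[OF S(1,2) _ van_const0])
          fix y assume y: "y \<in> S"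
          have "(\<Sum>j\<in>Basis \<times> Basis. i j y * x j y) = x (c, d) y - x (d, c) y"
            unfolding 2(3) left_diff_distrib sum_subtractf using pick 2(1,2) by simp
          also have "... = 0" using E_swap[OF vs 2(1,2) phi_S(3)[OF y]] by (simp add: x_def F_def)
          finally show "0 = (\<Sum>j\<in>Basis \<times> Basis. i j y * x j y)" by simp
        qed
      next
        case 3
        show ?thesis
        proof (rule van_cong_open[OF S(1,2) _ van_const0])
          fix y assume y: "y \<in> S"
          have "(\<Sum>j\<in>Basis \<times> Basis. i j y * x j y) = (\<Sum>e\<in>Basis. x (e, e) y)" unfolding 3 by (rule row3)
          also have "... = 0" using E_trace[OF vs phi_S(3)[OF y]] by (simp add: x_def F_def)
          finally show "0 = (\<Sum>j\<in>Basis \<times> Basis. i j y * x j y)" by simp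
        qed
      qed
    qed
    show "xi j = 0" if xi: "\<And>i. i \<in> I1 \<union> I2 \<union> {I3} ==> (\<Sum>j\<in>Basis \<times> Basis. i j y0 * xi j) = 0" and j: "j \<in> Basis \<times> Basis" for xi :: "'a \<times> 'a \<Rightarrow> real" and j
    proof -
      have "xi (c, d) = 0" if cd: "c \<in> Basis" "d \<in> Basis" for c d
      proof (rule symmetric_traceless_zero[OF _ _ _ cd])
        fix b :: 'b and c :: 'a assume bc: "b \<in> Basis" "c \<in> Basis"
        have "(\<lambda>(e, e') y. (fd phi y b \<bullet> e) * of_bool (e' = c)) \<in> I1" unfolding I1_def using bc by (intro image_eqI[of _ _ "(b, c)"]) auto
        from xi[OF UnI1[OF UnI1[OF this]]]
        have "(\<Sum>j\<in>Basis \<times> Basis. (case j of (e, e') \<Rightarrow> (fd phi y0 b \<bullet> e) * of_bool (e' = c)) * xi j) = 0"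
          by (simp add: split_beta)
        then show "(\<Sum>e\<in>Basis. (fd phi y0 b \<bullet> e) * xi (e, c)) = 0" using row1[OF bc(2)] by simp
      next
        fix c d :: 'a assume cd: "c \<in> Basis" "d \<in> Basis"
        have "(\<lambda>p y. of_bool (p = (c, d)) - of_bool (p = (d, c))) \<in> I2" unfolding I2_def using cd by (intro image_eqI[of _ _ "(c, d)"]) auto
        from xi[OF UnI1[OF UnI2[OF this]]] have "xi (c, d) - xi (d, c) = 0"
          unfolding left_diff_distrib sum_subtractf using pick cd by simp
        then show "xi (c, d) = xi (d, c)" by simp
      next
        show "(\<Sum>e\<in>Basis. xi (e, e)) = 0" using xi[of I3] row3[of y0 xi] by simp
      qed
      then show ?thesis using j by auto
    qed
  qed (use e in auto)
  then show ?thesis by (simp add: x_def)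
qed

lemma jets_vanish: "vs \<in> lists Basis ==> length vs \<le> l ==> van y0 (l - length vs) (F vs)"
proof (induction "length vs" arbitrary: vs)
  case 0
  have "van y0 l (u \<circ> phi)" by (rule vanishes_to_order_van[OF zero])
  moreover have "F [] = u \<circ> phi" by (auto simp: F_def[abs_def] E0)
  ultimately have "van y0 l (F [])" by (simp only:)
  then show ?case using 0 by simp
next
  case (Suc j)
  then obtain e vs' where vs: "vs = e # vs'" "e \<in> Basis" "vs' \<in> lists Basis" "length vs' = j" by (cases vs) auto
  have l: "l - j = Suc (l - length vs)" using Suc vs by simp
  show ?case
  proof (cases vs')
    case Nil
    have "van y0 (Suc (l - length vs)) (F [])" using Suc(1)[of "[]"] vs Nil l by simp
    from jet_step1[OF this vs(2)] show ?thesis using vs Nil by simp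
  next
    case (Cons e' ws)
    have "van y0 (Suc (l - length vs)) (F (d # ws))" if "d \<in> Basis" for d
      using Suc(1)[of "d # ws"] that vs Cons l Suc.prems by simp
    then have "van y0 (l - length vs) (F (e # e' # ws))" by (rule jet_step[rotated]) (use vs Cons in auto)
    then show ?thesis using vs Cons by simp
  qed
qed

text \<open>Taylor's estimate by induction on \<open>j\<close>. A derivative of order
  \<open>l + 1\<close> is merely bounded near \<open>x0\<close>; each lower order starts from the
  value 0 at \<open>x0\<close> and gains one power by \<open>quasiconvex_estimate\<close>.\<close>

lemma growth:
  assumes "vs \<in> lists Basis" "length vs + j = l + 1"
  shows "\<exists>C\<ge>0. \<exists>R>0. \<forall>z\<in>closure Om \<inter> ball x0 R. \<bar>E vs z\<bar> \<le> C * dist x0 z ^ j"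
  using assms
proof (induction j arbitrary: vs)
  case 0
  have "x0 \<in> closure Om" by (rule phi_S(3)[OF S(2)])
  then obtain d where d: "d > 0" "\<And>z. z \<in> closure Om ==> dist z x0 < d ==> dist (E vs z) (E vs x0) < 1"
    using Ec[OF 0(1)] unfolding continuous_on_iff by (metis zero_less_one)
  have "\<bar>E vs z\<bar> \<le> \<bar>E vs x0\<bar> + 1" if "z \<in> closure Om \<inter> ball x0 d" for z
    using d(2)[of z] that by (auto simp: dist_real_def dist_commute)
  then show ?case using d(1) by (intro exI[of _ "\<bar>E vs x0\<bar> + 1"] conjI exI[of _ d]) auto
next
  case (Suc j)
  have "\<forall>e\<in>Basis. \<exists>C R. C \<ge> 0 \<and> R > 0 \<and> (\<forall>z\<in>closure Om \<inter> ball x0 R. \<bar>E (e # vs) z\<bar> \<le> C * dist x0 z ^ j)"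
    using Suc.IH Suc.prems by (auto; meson)
  then obtain C R where CR: "\<And>e. e \<in> Basis ==> C e \<ge> 0 \<and> R e > 0 \<and> (\<forall>z\<in>closure Om \<inter> ball x0 (R e). \<bar>E (e # vs) z\<bar> \<le> C e * dist x0 z ^ j)"
    by metis
  define Rm where "Rm = Min (R ` (Basis::'a set))"
  have Rm: "Rm > 0" "\<And>e. e \<in> Basis ==> Rm \<le> R e" using CR by (auto simp: Rm_def)
  define Cs where "Cs = (\<Sum>e\<in>(Basis::'a set). C e)"
  have Cs: "Cs \<ge> 0" unfolding Cs_def by (rule sum_nonneg) (use CR in auto)
  obtain n R' where cone: "inner_cone Om x0 n R'" using inner_cone_exists[OF ld op y0(2)] by blast
  have R': "R' > 0" using cone by (simp add: inner_cone_def)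
  have x0: "x0 \<in> closure Om" by (rule phi_S(3)[OF S(2)])
  have z0: "E vs x0 = 0" using van_zero[OF jets_vanish[OF Suc.prems(1)]] Suc.prems(2) by (simp add: F_def)
  \<comment> \<open>The divisors 13 and 6 leave room for the factors 12 and 5 in
    \<open>quasiconvex_estimate\<close>.\<close>
  define R0 where "R0 = min (Rm / 13) (R' / 6)"
  have R0: "R0 > 0" using Rm R' by (simp add: R0_def)
  have "\<bar>E vs z\<bar> \<le> (11 * Cs * 12 ^ j) * dist x0 z ^ Suc j" if z: "z \<in> closure Om \<inter> ball x0 R0" for z
  proof -
    define s where "s = dist x0 z"
    have s: "0 \<le> s" "13 * s < Rm" "6 * s < R'" using z by (auto simp: s_def R0_def)
    have "\<bar>E vs z - E vs x0 - 0 \<bullet> (z - x0)\<bar> \<le> 11 * (Cs * (12 * s) ^ j) * dist x0 z"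
    proof (rule quasiconvex_estimate[OF E_c1[OF Suc.prems(1)] cone x0])
      fix w assume w: "w \<in> Om" "dist x0 w \<le> 12 * dist x0 z"
      have wR: "dist x0 w < R e" if "e \<in> Basis" for e using w(2) s Rm(2)[OF that] unfolding s_def[symmetric] by linarith
      have "norm ((\<Sum>e\<in>Basis. E (e # vs) w *\<^sub>R e) - 0) \<le> (\<Sum>e\<in>Basis. norm (E (e # vs) w *\<^sub>R e))"
        unfolding diff_zero by (rule norm_sum)
      also have "... \<le> (\<Sum>e\<in>(Basis::'a set). C e * (12 * s) ^ j)"
      proof (rule sum_mono)
        fix e :: 'a assume e: "e \<in> Basis"
        have "w \<in> closure Om" using w(1) closure_subset by auto
        then have "\<bar>E (e # vs) w\<bar> \<le> C e * dist x0 w ^ j" using CR[OF e] wR[OF e] by auto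
        also have "... \<le> C e * (12 * s) ^ j" using CR[OF e] w(2) by (intro mult_left_mono power_mono) (auto simp: s_def)
        finally show "norm (E (e # vs) w *\<^sub>R e) \<le> C e * (12 * s) ^ j" using e by simp
      qed
      also have "... = Cs * (12 * s) ^ j" by (simp add: Cs_def sum_distrib_right)
      finally show "norm ((\<Sum>e\<in>Basis. E (e # vs) w *\<^sub>R e) - 0) \<le> Cs * (12 * s) ^ j" .
    qed (use z s R' in \<open>auto simp: s_def\<close>)
    then show ?thesis by (simp add: z0 s_def power_mult_distrib mult_ac)
  qed
  then show ?case using R0 Cs by (intro exI[of _ "11 * Cs * 12 ^ j"] conjI exI[of _ R0]) auto
qed

theorem boundary_growth:
  "\<exists>c R. R > 0 \<and> (\<forall>x\<in>Om \<inter> ball x0 R. \<bar>u x\<bar> \<le> c * dist x0 x ^ (l + 1) \<and> norm (\<Sum>e\<in>Basis. E [e] x *\<^sub>R e) \<le> c * dist x0 x ^ l)"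
proof -
  obtain C0 R0 where 0: "C0 \<ge> 0" "R0 > 0" "\<And>z. z \<in> closure Om \<inter> ball x0 R0 ==> \<bar>u z\<bar> \<le> C0 * dist x0 z ^ (l + 1)"
    using growth[of "[]" "l + 1"] by (auto simp: E0)
  have "\<forall>e\<in>Basis. \<exists>C R. C \<ge> 0 \<and> R > 0 \<and> (\<forall>z\<in>closure Om \<inter> ball x0 R. \<bar>E [e] z\<bar> \<le> C * dist x0 z ^ l)"
    using growth[of "[_]" l] by (auto; meson)
  then obtain C R where CR: "\<And>e. e \<in> Basis ==> C e \<ge> 0 \<and> R e > 0 \<and> (\<forall>z\<in>closure Om \<inter> ball x0 (R e). \<bar>E [e] z\<bar> \<le> C e * dist x0 z ^ l)"
    by metis
  define Rm where "Rm = Min (R ` (Basis::'a set))"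
  have Rm: "Rm > 0" "\<And>e. e \<in> Basis ==> Rm \<le> R e" using CR by (auto simp: Rm_def)
  define Cs where "Cs = (\<Sum>e\<in>(Basis::'a set). C e)"
  have Cs: "Cs \<ge> 0" unfolding Cs_def by (rule sum_nonneg) (use CR in auto)
  have "\<bar>u x\<bar> \<le> (C0 + Cs) * dist x0 x ^ (l + 1) \<and> norm (\<Sum>e\<in>Basis. E [e] x *\<^sub>R e) \<le> (C0 + Cs) * dist x0 x ^ l"
    if x: "x \<in> Om \<inter> ball x0 (min R0 Rm)" for x
  proof
    have xc: "x \<in> closure Om" using x closure_subset by auto
    have "\<bar>u x\<bar> \<le> C0 * dist x0 x ^ (l + 1)" using 0(3)[of x] xc x by auto
    also have "... \<le> (C0 + Cs) * dist x0 x ^ (l + 1)" using Cs by (intro mult_right_mono) auto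
    finally show "\<bar>u x\<bar> \<le> (C0 + Cs) * dist x0 x ^ (l + 1)" .
    have "norm (\<Sum>e\<in>Basis. E [e] x *\<^sub>R e) \<le> (\<Sum>e\<in>Basis. norm (E [e] x *\<^sub>R e))" by (rule norm_sum)
    also have "... \<le> (\<Sum>e\<in>(Basis::'a set). C e * dist x0 x ^ l)"
    proof (rule sum_mono)
      fix e :: 'a assume e: "e \<in> Basis"
      have "dist x0 x < R e" using x Rm(2)[OF e] by auto
      then have "\<bar>E [e] x\<bar> \<le> C e * dist x0 x ^ l" using CR[OF e] xc by auto
      then show "norm (E [e] x *\<^sub>R e) \<le> C e * dist x0 x ^ l" using e by simp
    qed
    also have "... = Cs * dist x0 x ^ l" by (simp add: Cs_def sum_distrib_right)
    also have "... \<le> (C0 + Cs) * dist x0 x ^ l" using 0(1) by (intro mult_right_mono) auto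
    finally show "norm (\<Sum>e\<in>Basis. E [e] x *\<^sub>R e) \<le> (C0 + Cs) * dist x0 x ^ l" .
  qed
  then show ?thesis using 0(2) Rm(1) by (intro exI[of _ "C0 + Cs"] exI[of _ "min R0 Rm"]) auto
qed

end

section \<open>Steklov eigenfunctions\<close>

lemma (in harmonic_data) set_integral_pos:
  assumes f: "continuous_on (closure Om) f" "\<And>x. x \<in> Om ==> f x \<ge> (0::real)" and x: "x \<in> Om" "f x > 0"
  shows "(LINT x:Om|lborel. f x) > 0"
proof -
  have fO: "continuous_on Om f" by (rule continuous_on_subset[OF f(1) closure_subset])
  have "open (Om \<inter> f -` {f x / 2<..})" by (rule continuous_open_preimage[OF fO op]) simp
  moreover have "x \<in> Om \<inter> f -` {f x / 2<..}" using x by simp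
  ultimately obtain r where r: "r > 0" "ball x r \<subseteq> Om \<inter> f -` {f x / 2<..}" using open_contains_ball by blast
  have "0 < f x / 2 * measure lborel (ball x r)" using x content_ball_pos[OF r(1)] by simp
  also have "f x / 2 * measure lborel (ball x r) = (LINT y:ball x r|lborel. f x / 2)"
    by (simp add: set_lebesgue_integral_def)
  also have "... \<le> (LINT y:Om|lborel. f y)"
    by (rule set_integral_mono_closure) (use f op r in \<open>auto intro: less_imp_le\<close>)
  finally show ?thesis .
qed

locale steklov = defined_domain Om D rho for Om D :: "'a::euclidean_space set" and rho +
  fixes sig :: real and u :: "'a \<Rightarrow> real"
  assumes bsd: "bounded_smooth_domain Om" and sigma: "sig > 0" and ef: "steklov_eigenfunction Om sig u"
begin

lemma su: "smooth_on Om u" and uc: "continuous_on (closure Om) u" and u_ne: "\<exists>x\<in>Om. u x \<noteq> 0"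
  and harm': "\<And>x. x \<in> Om ==> lap u x = 0"
proof -
  show s: "smooth_on Om u" "continuous_on (closure Om) u" "\<exists>x\<in>Om. u x \<noteq> 0"
    using ef by (auto simp: steklov_eigenfunction_def smooth_up_to_boundary_def)
  show "lap u x = 0" if "x \<in> Om" for x
    using ef lap_alt[OF op smooth_on_ck[OF s(1)] that] that by (simp add: steklov_eigenfunction_def laplacian_def)
qed

text \<open>The empty list is treated apart so that \<open>E []\<close> is \<open>u\<close> itself
  everywhere, as \<open>boundary_jets\<close> asks.\<close>

definition "E vs = (if vs = [] then u else SOME g. continuous_on (closure Om) g \<and> (\<forall>x\<in>Om. g x = iter_deriv vs u x))"

lemma E: "E [] = u" "vs \<in> lists Basis ==> continuous_on (closure Om) (E vs)"
  "vs \<in> lists Basis ==> x \<in> Om ==> E vs x = iter_deriv vs u x"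
proof -
  show "E [] = u" by (simp add: E_def)
  have *: "continuous_on (closure Om) (E vs) \<and> (\<forall>x\<in>Om. E vs x = iter_deriv vs u x)" if vs: "vs \<in> lists Basis"
  proof (cases "vs = []")
    case True
    then show ?thesis using uc by (simp add: E_def)
  next
    case False
    have "\<exists>g. continuous_on (closure Om) g \<and> (\<forall>x\<in>Om. g x = iter_deriv vs u x)"
      using ef vs by (simp add: steklov_eigenfunction_def smooth_up_to_boundary_def)
    from someI_ex[OF this] show ?thesis using False by (simp add: E_def)
  qed
  show "vs \<in> lists Basis ==> continuous_on (closure Om) (E vs)"
    "vs \<in> lists Basis ==> x \<in> Om ==> E vs x = iter_deriv vs u x" using * by blast+
qed

definition "G x = (\<Sum>e\<in>Basis. E [e] x *\<^sub>R e)"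

lemma c1: "c1_closure Om u G"
  unfolding c1_closure_def
proof (intro conjI ballI)
  show "continuous_on (closure Om) G" unfolding G_def[abs_def] by (intro continuous_intros E) auto
  show "gr u x = G x" if "x \<in> Om" for x
    unfolding gr_def G_def by (rule sum.cong[OF refl]) (use E(3)[of "[_]", OF _ that] in simp)
qed (use smooth_on_ck[OF su, of 1] uc in auto)

sublocale harmonic_data Om D rho u G
  by unfold_locales (use c1 smooth_on_ck[OF su] harm' in \<open>auto simp: c1_closure_def\<close>)

lemma local_function:
  assumes "x \<in> frontier Om"
  shows "\<exists>U r. x \<in> U \<and> local_defining_function Om U r"
  using bsd assms by (simp add: bounded_smooth_domain_def)

lemma gr_local:
  assumes "local_defining_function Om U r" "x \<in> U" "x \<in> frontier Om"
  shows "gr r x = norm (gr r x) *\<^sub>R gr rho x"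
proof -
  note p = local_defining_function_props[OF assms(1) op]
  have "r differentiable (at x)" using p(2)[of 1] assms(2) by simp
  then have "GDERIV r x :> gr r x" using gr_deriv by (simp add: gderiv_def inner_commute)
  then have "exterior_unit_normal Om x (gr r x /\<^sub>R norm (gr r x))"
    unfolding exterior_unit_normal_def using assms by blast
  from exterior_unit_normal_eq[OF this assms(3)]
  have "norm (gr r x) *\<^sub>R (gr r x /\<^sub>R norm (gr r x)) = norm (gr r x) *\<^sub>R gr rho x" by (rule arg_cong)
  then show ?thesis using p(3)[OF assms(2)] by simp
qed

text \<open>The eigenfunction condition is a one-sided derivative along the normal ray. For small
  negative parameters the ray runs inside \<open>Om\<close>, so the derivative of \<open>u\<close>
  relative to the closure computes the same limit as \<open>G x \<bullet> gr rho x\<close>.\<close>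

lemma normal_derivative:
  assumes x: "x \<in> frontier Om"
  shows "G x \<bullet> gr rho x = sig * u x"
proof -
  obtain nv where nu: "exterior_unit_normal Om x nv" "((\<lambda>t. u (x + t *\<^sub>R nv)) has_real_derivative sig * u x) (at_left 0)"
    using ef x unfolding steklov_eigenfunction_def by blast
  have nr: "nv = gr rho x" by (rule exterior_unit_normal_eq[OF nu(1) x])
  obtain U r where Ur: "x \<in> U" "local_defining_function Om U r" using local_function[OF x] by blast
  note p = local_defining_function_props[OF Ur(2) op]
  have r1: "r differentiable (at x)" using p(2)[of 1] Ur(1) by simp
  obtain n R where cone: "inner_cone Om x n R" using inner_cone_exists[OF Ur(2) op Ur(1)] by blast
  have xc: "x \<in> closure Om" by (rule frontier_cl[OF x])
  have path: "((\<lambda>t. x + t *\<^sub>R nv) has_derivative (\<lambda>t. t *\<^sub>R nv)) (at 0 within A)" for A by (auto intro!: derivative_eq_intros)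
  have "((\<lambda>t. r (x + t *\<^sub>R nv)) has_real_derivative gr r x \<bullet> nv) (at 0)"
  proof -
    have 2: "(r has_derivative (\<lambda>h. gr r x \<bullet> h)) (at (x + 0 *\<^sub>R nv))" using gr_deriv[OF r1] by simp
    show ?thesis unfolding has_field_derivative_def
      by (rule has_derivative_eq_rhs[OF has_derivative_compose[OF path 2]]) (auto simp: fun_eq_iff)
  qed
  moreover have "gr r x \<bullet> nv > 0"
  proof -
    have "gr r x \<bullet> nv = norm (gr r x) * (nv \<bullet> nv)" by (subst gr_local[OF Ur(2,1) x]) (simp add: nr)
    moreover have "nv \<bullet> nv = 1" using unit[OF x] by (simp add: nr dot_square_norm)
    ultimately show ?thesis using p(3)[OF Ur(1)] by simp
  qed
  ultimately obtain d1 where d1: "d1 > 0" "\<And>h. 0 < h ==> h < d1 ==> r (x + (0 - h) *\<^sub>R nv) < 0"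
    using DERIV_pos_inc_left[of "\<lambda>t. r (x + t *\<^sub>R nv)" "gr r x \<bullet> nv" 0] p(5)[OF Ur(1) x] by auto
  have "open ((\<lambda>t. x + t *\<^sub>R nv) -` U)" by (intro open_vimage p(1) continuous_intros)
  moreover have "0 \<in> (\<lambda>t::real. x + t *\<^sub>R nv) -` U" using Ur by simp
  ultimately obtain d2 where d2: "d2 > 0" "ball 0 d2 \<subseteq> (\<lambda>t. x + t *\<^sub>R nv) -` U" using open_contains_ball by blast
  define d where "d = min d1 d2 / 2"
  have d: "d > 0" "d < d1" "d < d2" using d1 d2 by (auto simp: d_def)
  have sub: "(\<lambda>t. x + t *\<^sub>R nv) ` {-d..0} \<subseteq> closure Om"
  proof safe
    fix t :: real assume t: "t \<in> {-d..0}"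
    show "x + t *\<^sub>R nv \<in> closure Om"
    proof (cases "t = 0")
      case False
      then have "r (x + (0 - (- t)) *\<^sub>R nv) < 0" using t d by (intro d1(2)) auto
      moreover have "t \<in> ball 0 d2" using t d by (simp add: dist_real_def)
      then have "x + t *\<^sub>R nv \<in> U" using d2(2) by auto
      ultimately have "x + t *\<^sub>R nv \<in> Om" using p(4) by simp
      then show ?thesis using closure_subset by auto
    qed (use xc in simp)
  qed
  have "(u has_derivative (\<lambda>h. G x \<bullet> h)) (at (x + 0 *\<^sub>R nv) within (\<lambda>t. x + t *\<^sub>R nv) ` {-d..0})"
    using has_derivative_subset[OF frontier_derivative[OF c1 cone xc] sub] by simp
  from has_derivative_in_compose[OF path this]
  have "((\<lambda>t. u (x + t *\<^sub>R nv)) has_real_derivative G x \<bullet> nv) (at 0 within {-d..0})"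
    unfolding has_field_derivative_def by (rule has_derivative_eq_rhs) (auto simp: fun_eq_iff)
  then have "((\<lambda>t. u (x + t *\<^sub>R nv)) has_real_derivative G x \<bullet> nv) (at_left 0)"
    using at_within_Icc_at_left[of "-d" 0] d by simp
  then have "G x \<bullet> nv = sig * u x"
    using nu(2) unfolding has_field_derivative_iff by (rule tendsto_unique[OF trivial_limit_at_left_real])
  then show ?thesis by (simp add: nr)
qed

lemma energy_pos: "En UNIV > 0"
proof -
  obtain x where "x \<in> Om" "u x \<noteq> 0" using u_ne by blast
  then have "(LINT x:Om|lborel. en x) > 0"
    by (intro set_integral_pos[OF en_cont]) (auto simp: en_def add_nonneg_pos)
  then show ?thesis by (simp add: En_def)
qed

text \<open>Without Dirichlet energy \<open>u\<close> would be a nonzero constant on the closure.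
  Its normal derivative would vanish, contrary to \<open>sig > 0\<close> at a frontier point; one
  exists because \<open>Om\<close> is bounded.\<close>

lemma Dir_pos: "Dir > 0"
proof (rule ccontr)
  assume n: "\<not> Dir > 0"
  have "G x = 0" if "x \<in> Om" for x
  proof (rule ccontr)
    assume "G x \<noteq> 0"
    then have "(LINT x:Om|lborel. G x \<bullet> G x) > 0" by (intro set_integral_pos[OF _ _ that] continuous_intros Gc) auto
    then show False using n by (simp add: Dir_def)
  qed
  then have G0: "G x = 0" if "x \<in> closure Om" for x
    using continuous_constant_on_closure[OF Gc, of 0 x] that by blast
  obtain z where z: "z \<in> Om" "u z \<noteq> 0" using u_ne by blast
  have "(u has_derivative (\<lambda>h. 0)) (at x)" if "x \<in> Om" for x
  proof -
    have "u differentiable (at x)" using smooth_on_ck[OF su, of 1] that by simp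
    moreover have "gr u x = 0" using GG[OF that] G0[of x] that closure_subset by auto
    ultimately show ?thesis by (intro has_derivative_eq_rhs[OF gr_deriv]) (simp_all add: fun_eq_iff)
  qed
  then have "u x = u z" if "x \<in> Om" for x by (rule has_derivative_zero_unique_connected[OF op conn _ that z(1)])
  then have uz: "u x = u z" if "x \<in> closure Om" for x
    using continuous_constant_on_closure[OF uc _ that] by blast
  have "Om \<noteq> UNIV" using bd not_bounded_UNIV by metis
  then obtain x where x: "x \<in> frontier Om" using ne frontier_eq_empty[of Om] by blast
  have "sig * u x = 0" using normal_derivative[OF x] G0[OF frontier_cl[OF x]] by simp
  then show False using sigma uz[OF frontier_cl[OF x]] z(2) by simp
qed

lemma boundary_zero:
  fixes W :: "'b::euclidean_space set"
  assumes dim: "DIM('b) + 1 = DIM('a)" and x: "x \<in> frontier Om"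
    and par: "local_parametrization (frontier Om) W phi" "y0 \<in> W" "phi y0 = x" and zero: "vanishes_to_order l (u \<circ> phi) y0"
  shows "boundary_zero u G sig x l"
proof -
  obtain U r where Ur: "x \<in> U" "local_defining_function Om U r" using local_function[OF x] by blast
  interpret J: boundary_jets Om U r u E sig W phi y0 l
  proof
    show "(\<Sum>e\<in>Basis. (gr r z \<bullet> e) * E [e] z) = sig * norm (gr r z) * u z" if z: "z \<in> frontier Om" "z \<in> U" for z
    proof -
      have "(\<Sum>e\<in>Basis. (gr r z \<bullet> e) * E [e] z) = G z \<bullet> gr r z" unfolding G_def by (rule inner_Basis_combination[symmetric])
      also have "... = norm (gr r z) * (G z \<bullet> gr rho z)" by (subst gr_local[OF Ur(2) z(2,1)]) simp
      finally show ?thesis using normal_derivative[OF z(1)] by simp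
    qed
  qed (use op Ur su E harm par dim zero in auto)
  have "\<exists>c R. R > 0 \<and> (\<forall>z\<in>Om \<inter> ball x R. \<bar>u z\<bar> \<le> c * dist x z ^ (l + 1) \<and> norm (G z) \<le> c * dist x z ^ l)"
    using J.boundary_growth unfolding par(3) G_def .
  then show ?thesis unfolding boundary_zero_def
    using normal_derivative energy_pos x sigma harmonic_data_axioms by auto
qed

end

theorem vanishing_order_bound:
  fixes Om :: "'a::euclidean_space set"
  assumes bsd: "bounded_smooth_domain Om" and dim: "DIM('b::euclidean_space) + 1 = DIM('a)"
  shows "\<exists>C>0. \<forall>sig>0. \<forall>u. steklov_eigenfunction Om sig u \<longrightarrow>
      (\<forall>x\<in>frontier Om. \<forall>W (phi :: 'b \<Rightarrow> 'a). \<forall>y\<in>W. local_parametrization (frontier Om) W phi \<and> phi y = x \<longrightarrow>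
        (\<forall>l. vanishes_to_order l (u \<circ> phi) y \<longrightarrow> real l < C * sig))"
proof -
  obtain D rho where "defined_domain Om D rho" using bounded_smooth_domain_defined[OF bsd] by blast
  then interpret defined_domain Om D rho .
  obtain C where C: "C > 0" "\<And>u G sig x0 l. boundary_zero u G sig x0 l ==> real l \<le> C * (1 + sig)"
    using vanishing_bound by blast
  obtain s where s: "s > 0" "\<And>u G sig. harmonic_data Om D rho u G ==> ck 3 Om u ==> sig \<ge> 0 ==>
     (\<forall>x\<in>frontier Om. G x \<bullet> gr rho x = sig * u x) ==> harmonic_data.Dir Om G > 0 ==> s \<le> sig"
    using eigenvalue_lower_bound by blast
  \<comment> \<open>The part \<open>1 / s\<close> absorbs the 1 of \<open>1 + sig\<close> through
    \<open>1 \<le> 1 / s * sig\<close>; the last summand makes the inequality strict.\<close>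
  define C' where "C' = C * (1 / s + 1) + 1"
  have C': "C' > 0" using C s by (simp add: C'_def add_pos_pos)
  have "real l < C' * sig"
    if sg: "sig > 0" and ef: "steklov_eigenfunction Om sig u" and x: "x \<in> frontier Om"
      and par: "local_parametrization (frontier Om) W phi" "y \<in> W" "phi y = x" and v: "vanishes_to_order l (u \<circ> phi) y"
    for sig u x W and phi :: "'b \<Rightarrow> 'a" and y l
  proof -
    interpret steklov Om D rho sig u by unfold_locales (use bsd sg ef in auto)
    have "s \<le> sig" by (rule s(2)[OF harmonic_data_axioms smooth_on_ck[OF su]]) (use sg normal_derivative Dir_pos in auto)
    then have "1 \<le> 1 / s * sig" using s(1) by (simp add: field_simps)
    then have "C * (1 + sig) \<le> C * (1 / s * sig + sig)" using C(1) by (intro mult_left_mono) auto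
    moreover have "real l \<le> C * (1 + sig)" by (rule C(2)[OF boundary_zero[OF dim x par v]])
    moreover have "C' * sig = C * (1 / s * sig + sig) + sig" by (simp add: C'_def algebra_simps)
    ultimately show ?thesis using sg by linarith
  qed
  then show ?thesis using C' by blast
qed

theorem theorem2:
  fixes \<Omega> :: "(real ^ 'n) set"
  assumes "CARD('n) \<ge> 2"
    and "CARD('m::finite) + 1 = CARD('n)"
    and "bounded_smooth_domain \<Omega>"
  shows "\<exists>C>0. \<forall>\<sigma>>0. steklov_eigenvalue \<Omega> \<sigma> \<longrightarrow>
    (\<forall>u. steklov_eigenfunction \<Omega> \<sigma> u \<longrightarrow>
      (\<forall>x\<^sub>0\<in>frontier \<Omega>. \<forall>W (\<phi> :: real ^ 'm \<Rightarrow> real ^ 'n). \<forall>y\<^sub>0\<in>W.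
        local_parametrization (frontier \<Omega>) W \<phi> \<and> \<phi> y\<^sub>0 = x\<^sub>0 \<longrightarrow>
        (\<forall>l::nat. vanishes_to_order l (u \<circ> \<phi>) y\<^sub>0 \<longrightarrow> real l < C * \<sigma>)))"
proof -
  have "DIM(real ^ 'm) + 1 = DIM(real ^ 'n)" using assms(2) by simp
  from vanishing_order_bound[OF assms(3) this] show ?thesis
  proof (rule ex_forward)
    fix C
    assume C: "C > 0 \<and> (\<forall>\<sigma>>0. \<forall>u. steklov_eigenfunction \<Omega> \<sigma> u \<longrightarrow>
      (\<forall>x\<in>frontier \<Omega>. \<forall>W (\<phi> :: real ^ 'm \<Rightarrow> real ^ 'n). \<forall>y\<in>W. local_parametrization (frontier \<Omega>) W \<phi> \<and> \<phi> y = x \<longrightarrow>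
        (\<forall>l. vanishes_to_order l (u \<circ> \<phi>) y \<longrightarrow> real l < C * \<sigma>)))"
    show "C > 0 \<and> (\<forall>\<sigma>>0. steklov_eigenvalue \<Omega> \<sigma> \<longrightarrow> (\<forall>u. steklov_eigenfunction \<Omega> \<sigma> u \<longrightarrow>
      (\<forall>x\<in>frontier \<Omega>. \<forall>W (\<phi> :: real ^ 'm \<Rightarrow> real ^ 'n). \<forall>y\<in>W. local_parametrization (frontier \<Omega>) W \<phi> \<and> \<phi> y = x \<longrightarrow>
        (\<forall>l. vanishes_to_order l (u \<circ> \<phi>) y \<longrightarrow> real l < C * \<sigma>))))"
      by (intro conjI allI impI, rule conjunct1[OF C], rule conjunct2[OF C, THEN spec, THEN mp, THEN spec, THEN mp]) assumption+
  qed
qed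

end
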